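(* Let $S=R[\theta;\alpha]$ be as in the context. The irreducible elements of $S$ can be divided into the 3 disjoint sets $\mathbf{(A)}$, $\mathbf{(B)}$ and $\mathbf{(C)}$ defined in the context, with the following properties. Let $\mathbf{(F)}=\{f\in k[\theta] : f \text{ monic irreducible}\}$. (1) There are bijective correspondences between these sets, together with $\mathbf{(F)}$, and the equivalence classes of finitely generated critical torsion right $S$-modules as follows: $\mathbf{(F)} \longleftrightarrow \{V : V \text{ simple},\ \dim_k(V)<\infty\}/\sim$; $\mathbf{(A)} \longleftrightarrow \{V : V \text{ unfaithful finitely generated 1-critical}\}/\sim$; $\mathbf{(B)} \longleftrightarrow \{V : V \text{ simple},\ \dim_k(V)=\infty\}/\sim$; $\mathbf{(C)} \longleftrightarrow \{V : V \text{ faithful finitely generated 1-critical}\}/\sim$. (2) The equivalence relation $\sim$ is isomorphism for $\mathbf{(F)}$, $\mathbf{(A)}$ and $\mathbf{(B)}$, and hull similarity for $\mathbf{(C)}$. (3) In cases $\mathbf{(A)}$, $\mathbf{(B)}$ and $\mathbf{(C)}$ the map from left to right takes the irreducible element $c$ to the module $S/cS$. In case $\mathbf{(F)}$ the element $f$ of $\mathbf{(F)}$ is sent to the module $S/(XS+fS)$.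
   Context: Setting: $k$ is an arbitrary field; $R$ is a discrete valuation ring which is a $k$-algebra, with maximal ideal $M=XR$ and residue field $R/M=k$; $\alpha$ is a $k$-algebra automorphism of $R$ of infinite order, so $\alpha(X)=qX$ for some unit $q$ of $R$. $S=R[\theta;\alpha]$ is the skew polynomial ring, with $\theta r=\alpha(r)\theta$ for $r\in R$. An irreducible element of a ring is a non-zero non-unit $s$ such that whenever $s=ab$ with $a,b$ in the ring, either $a$ or $b$ is a unit. Since $S/XS\cong k[\theta]$, an irreducible element $z$ of $S$ can be uniquely written in the form $z=f+Xs$ with $f\in k[\theta]$ and $s\in S$. After normalising by multiplying $z$ by a suitable unit of $S$ (that is, by a suitable element of $R\setminus XR$), there are the following three mutually exclusive possibilities for the irreducible element $z$, which define the sets: $\mathbf{(A)}$: $z=X$ or $z=\theta$ (that is, $f=0$, $s=1$, or $f=\theta$, $s=0$); $\mathbf{(B)}$: $z=1+Xs$ with $s\in S\setminus R$; $\mathbf{(C)}$: $z=f+Xs$ with $f\in k[\theta]\setminus k$ monic, $s\in S$, and $z\neq\theta$. $\mathrm{Kdim}$ denotes (Gabriel–Rentschler) Krull dimension. A nonzero module $M$ with Krull dimension is critical if $\mathrm{Kdim}(N)<\mathrm{Kdim}(M)$ for all proper factors $N$ of $M$; it is $n$-critical if moreover $\mathrm{Kdim}(M)=n$. Two critical $S$-modules are hull similar if they contain a nonzero isomorphic submodule. Modules are right modules.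
   Formalization: Elements of (B) and (C) are taken up to similarity (c, d similar if S/cS ~ S/dS), as S/cS = S/cuS for units u in 1+XR makes the literal map non-injective; in (C), z ≠ θ means z is not θ times a unit; irreducibles are sorted into the sets up to right multiplication by a unit. *)

theory Defs
  imports "HOL-Algebra.UnivPoly" "HOL-Algebra.QuotRing" "HOL-Algebra.Ring_Divisibility"
begin

section \<open>Rings\<close>

definition discrete_valuation_ring :: "('a, 'm) ring_scheme \<Rightarrow> bool" where
  "discrete_valuation_ring R \<longleftrightarrow>
     principal_domain R \<and> \<not> field R \<and> (\<exists>!M. maximalideal M R)"

text \<open>The ring need not be commutative, so neither \<^const>\<open>ring_irreducible\<close> nor
  \<^const>\<open>irreducible\<close>, whose notion of divisor is one-sided, is used here.\<close>

definition irreducible_elements :: "('a, 'm) ring_scheme \<Rightarrow> 'a set" where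
  "irreducible_elements S =
     {z \<in> carrier S. z \<noteq> \<zero>\<^bsub>S\<^esub> \<and> z \<notin> Units S \<and>
        (\<forall>a\<in>carrier S. \<forall>b\<in>carrier S. z = a \<otimes>\<^bsub>S\<^esub> b \<longrightarrow> a \<in> Units S \<or> b \<in> Units S)}"

text \<open>The skew polynomial ring \<open>R[\<theta>;\<alpha>]\<close>: as for \<^const>\<open>UP\<close>, \<open>p\<close> stands for
  \<open>\<Sum>i. p i \<theta>^i\<close> (coefficients on the left), and
  \<open>(a \<theta>^i) (b \<theta>^j) = a \<alpha>^i(b) \<theta>^(i+j)\<close>, in particular \<open>\<theta> r = \<alpha>(r) \<theta>\<close>.\<close>

definition skew_poly_ring :: "('a, 'm) ring_scheme \<Rightarrow> ('a \<Rightarrow> 'a) \<Rightarrow> (nat \<Rightarrow> 'a) ring" where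
  "skew_poly_ring R \<alpha> = \<lparr>
     carrier = up R,
     mult = (\<lambda>p\<in>up R. \<lambda>q\<in>up R. \<lambda>n. \<Oplus>\<^bsub>R\<^esub>i \<in> {..n}. p i \<otimes>\<^bsub>R\<^esub> (\<alpha> ^^ i) (q (n - i))),
     one = (\<lambda>i. if i = 0 then \<one>\<^bsub>R\<^esub> else \<zero>\<^bsub>R\<^esub>),
     zero = (\<lambda>i. \<zero>\<^bsub>R\<^esub>),
     add = (\<lambda>p\<in>up R. \<lambda>q\<in>up R. \<lambda>i. p i \<oplus>\<^bsub>R\<^esub> q i)\<rparr>"

definition skew_const :: "('a, 'm) ring_scheme \<Rightarrow> 'a \<Rightarrow> nat \<Rightarrow> 'a" where
  "skew_const R r = (\<lambda>i. if i = 0 then r else \<zero>\<^bsub>R\<^esub>)"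

definition skew_var :: "('a, 'm) ring_scheme \<Rightarrow> nat \<Rightarrow> 'a" where
  "skew_var R = (\<lambda>i. if i = 1 then \<one>\<^bsub>R\<^esub> else \<zero>\<^bsub>R\<^esub>)"

text \<open>For a \<open>k\<close>-algebra \<open>R\<close>, \<open>k[\<theta>]\<close> (the ring \<open>UP k\<close>) is regarded as a subring of \<open>R[\<theta>;\<alpha>]\<close>.\<close>

definition emb_poly ::
  "('k, 'n) ring_scheme \<Rightarrow> ('k, 'a, 'm) module_scheme \<Rightarrow> (nat \<Rightarrow> 'k) \<Rightarrow> nat \<Rightarrow> 'a" where
  "emb_poly k R f = (\<lambda>i. coeff (UP k) f i \<odot>\<^bsub>R\<^esub> \<one>\<^bsub>R\<^esub>)"

definition monic_polys :: "('k, 'n) ring_scheme \<Rightarrow> (nat \<Rightarrow> 'k) set" where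
  "monic_polys k = {f \<in> carrier (UP k). coeff (UP k) f (deg k f) = \<one>\<^bsub>k\<^esub>}"


section \<open>Right modules\<close>

record ('s, 'v) right_mod = "'v ring" +
  ract :: "['v, 's] \<Rightarrow> 'v" (infixl \<open>\<cdot>\<index>\<close> 70)

locale right_module = S?: ring S + V?: abelian_group V
  for S :: "('s, 'm) ring_scheme" and V :: "('s, 'v, 'n) right_mod_scheme" +
  assumes ract_closed:
      "\<lbrakk>v \<in> carrier V; s \<in> carrier S\<rbrakk> \<Longrightarrow> v \<cdot>\<^bsub>V\<^esub> s \<in> carrier V"
    and ract_l_distr:
      "\<lbrakk>v \<in> carrier V; w \<in> carrier V; s \<in> carrier S\<rbrakk> \<Longrightarrow>
        (v \<oplus>\<^bsub>V\<^esub> w) \<cdot>\<^bsub>V\<^esub> s = v \<cdot>\<^bsub>V\<^esub> s \<oplus>\<^bsub>V\<^esub> w \<cdot>\<^bsub>V\<^esub> s"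
    and ract_r_distr:
      "\<lbrakk>v \<in> carrier V; s \<in> carrier S; t \<in> carrier S\<rbrakk> \<Longrightarrow>
        v \<cdot>\<^bsub>V\<^esub> (s \<oplus>\<^bsub>S\<^esub> t) = v \<cdot>\<^bsub>V\<^esub> s \<oplus>\<^bsub>V\<^esub> v \<cdot>\<^bsub>V\<^esub> t"
    and ract_assoc:
      "\<lbrakk>v \<in> carrier V; s \<in> carrier S; t \<in> carrier S\<rbrakk> \<Longrightarrow>
        v \<cdot>\<^bsub>V\<^esub> (s \<otimes>\<^bsub>S\<^esub> t) = (v \<cdot>\<^bsub>V\<^esub> s) \<cdot>\<^bsub>V\<^esub> t"
    and ract_one:
      "v \<in> carrier V \<Longrightarrow> v \<cdot>\<^bsub>V\<^esub> \<one>\<^bsub>S\<^esub> = v"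

definition right_submodule ::
  "('s, 'm) ring_scheme \<Rightarrow> ('s, 'v, 'n) right_mod_scheme \<Rightarrow> 'v set \<Rightarrow> bool" where
  "right_submodule S V N \<longleftrightarrow>
     additive_subgroup N V \<and> (\<forall>v\<in>N. \<forall>s\<in>carrier S. v \<cdot>\<^bsub>V\<^esub> s \<in> N)"

text \<open>The right module \<open>S/I\<close>, for a right ideal \<open>I\<close> of \<open>S\<close>. The fields \<^const>\<open>mult\<close> and \<^const>\<open>one\<close>
  of the record play no role in a module.\<close>

definition cyclic_module ::
  "('s, 'm) ring_scheme \<Rightarrow> 's set \<Rightarrow> ('s, 's set) right_mod" where
  "cyclic_module S I = \<lparr>
     carrier = a_rcosets\<^bsub>S\<^esub> I,
     mult = undefined,
     one = undefined,
     zero = I,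
     add = set_add S,
     ract = (\<lambda>C s. \<Union>x\<in>C. I +>\<^bsub>S\<^esub> (x \<otimes>\<^bsub>S\<^esub> s))\<rparr>"

definition right_ideal_gen :: "('s, 'm) ring_scheme \<Rightarrow> 's \<Rightarrow> 's set" where
  "right_ideal_gen S c = c <#\<^bsub>S\<^esub> carrier S"

definition mod_iso ::
  "('s, 'm) ring_scheme \<Rightarrow> ('s, 'v, 'n) right_mod_scheme \<Rightarrow> ('s, 'w, 'l) right_mod_scheme \<Rightarrow> bool"
  where
  "mod_iso S V W \<longleftrightarrow>
     (\<exists>h. bij_betw h (carrier V) (carrier W) \<and>
        (\<forall>v\<in>carrier V. \<forall>w\<in>carrier V. h (v \<oplus>\<^bsub>V\<^esub> w) = h v \<oplus>\<^bsub>W\<^esub> h w) \<and>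
        (\<forall>v\<in>carrier V. \<forall>s\<in>carrier S. h (v \<cdot>\<^bsub>V\<^esub> s) = h v \<cdot>\<^bsub>W\<^esub> s))"

definition hull_similar ::
  "('s, 'm) ring_scheme \<Rightarrow> ('s, 'v, 'n) right_mod_scheme \<Rightarrow> ('s, 'w, 'l) right_mod_scheme \<Rightarrow> bool"
  where
  "hull_similar S V W \<longleftrightarrow>
     (\<exists>N N'. right_submodule S V N \<and> N \<noteq> {\<zero>\<^bsub>V\<^esub>} \<and>
             right_submodule S W N' \<and> N' \<noteq> {\<zero>\<^bsub>W\<^esub>} \<and>
             mod_iso S (V\<lparr>carrier := N\<rparr>) (W\<lparr>carrier := N'\<rparr>))"

definition finitely_spanned_over :: "'s set \<Rightarrow> ('s, 'v, 'n) right_mod_scheme \<Rightarrow> bool" where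
  "finitely_spanned_over A V \<longleftrightarrow>
     (\<exists>B. finite B \<and> B \<subseteq> carrier V \<and>
        (\<forall>v\<in>carrier V. \<exists>a\<in>B \<rightarrow> A. v = (\<Oplus>\<^bsub>V\<^esub>b\<in>B. b \<cdot>\<^bsub>V\<^esub> a b)))"

definition finitely_generated ::
  "('s, 'm) ring_scheme \<Rightarrow> ('s, 'v, 'n) right_mod_scheme \<Rightarrow> bool" where
  "finitely_generated S V \<longleftrightarrow> finitely_spanned_over (carrier S) V"

text \<open>\<open>dim\<^sub>k V < \<infinity>\<close> for a right module \<open>V\<close> over \<open>R[\<theta>;\<alpha>]\<close>; here \<open>k\<close> acts through
  \<open>k \<rightarrow> R \<rightarrow> R[\<theta>;\<alpha>]\<close>.\<close>

definition finite_dim ::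
  "('k, 'n) ring_scheme \<Rightarrow> ('k, 'a, 'm) module_scheme \<Rightarrow> (nat \<Rightarrow> 'a, 'v, 'l) right_mod_scheme \<Rightarrow> bool"
  where
  "finite_dim k R V \<longleftrightarrow>
     finitely_spanned_over ((\<lambda>c. skew_const R (c \<odot>\<^bsub>R\<^esub> \<one>\<^bsub>R\<^esub>)) ` carrier k) V"

definition faithful ::
  "('s, 'm) ring_scheme \<Rightarrow> ('s, 'v, 'n) right_mod_scheme \<Rightarrow> bool" where
  "faithful S V \<longleftrightarrow>
     (\<forall>s\<in>carrier S. (\<forall>v\<in>carrier V. v \<cdot>\<^bsub>V\<^esub> s = \<zero>\<^bsub>V\<^esub>) \<longrightarrow> s = \<zero>\<^bsub>S\<^esub>)"

text \<open>The usual notion for modules over an Ore domain.\<close>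

definition torsion ::
  "('s, 'm) ring_scheme \<Rightarrow> ('s, 'v, 'n) right_mod_scheme \<Rightarrow> bool" where
  "torsion S V \<longleftrightarrow>
     (\<forall>v\<in>carrier V. \<exists>s\<in>carrier S. s \<noteq> \<zero>\<^bsub>S\<^esub> \<and> v \<cdot>\<^bsub>V\<^esub> s = \<zero>\<^bsub>V\<^esub>)"

definition simple_module ::
  "('s, 'm) ring_scheme \<Rightarrow> ('s, 'v, 'n) right_mod_scheme \<Rightarrow> bool" where
  "simple_module S V \<longleftrightarrow>
     right_module S V \<and> carrier V \<noteq> {\<zero>\<^bsub>V\<^esub>} \<and>
     (\<forall>N. right_submodule S V N \<longrightarrow> N = {\<zero>\<^bsub>V\<^esub>} \<or> N = carrier V)"


section \<open>Krull dimension\<close>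

text \<open>The subfactor \<open>A/B\<close> of \<open>V\<close>, for submodules \<open>B \<subseteq> A\<close> of \<open>V\<close>, is represented by the pair \<open>(A, B)\<close>;
  its Krull dimension is the deviation of the interval from \<open>B\<close> to \<open>A\<close> in the lattice of submodules
  of \<open>V\<close>. Ordinals are avoided by working with the classes
  \<open>K \<beta> = {(A, B). Kdim (A/B) < \<beta>}\<close>. These are generated by transfinite iteration:
  \<open>K 0\<close> consists of the zero subfactors; \<open>K (\<beta> + 1)\<close> consists of the subfactors \<open>A/B\<close> such
  that in every descending chain between \<open>A\<close> and \<open>B\<close> all but finitely many factors lie in
  \<open>K \<beta>\<close>; and at limits one takes unions.\<close>

definition kdim_zero ::
  "('s, 'm) ring_scheme \<Rightarrow> ('s, 'v, 'n) right_mod_scheme \<Rightarrow> ('v set \<times> 'v set) set" where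
  "kdim_zero S V = {(N, N) | N. right_submodule S V N}"

definition kdim_step ::
  "('s, 'm) ring_scheme \<Rightarrow> ('s, 'v, 'n) right_mod_scheme \<Rightarrow>
     ('v set \<times> 'v set) set \<Rightarrow> ('v set \<times> 'v set) set" where
  "kdim_step S V K =
     {(A, B). right_submodule S V A \<and> right_submodule S V B \<and> B \<subseteq> A \<and>
        (\<forall>C :: nat \<Rightarrow> 'v set.
           (\<forall>i. right_submodule S V (C i) \<and> B \<subseteq> C i \<and> C i \<subseteq> A \<and> C (Suc i) \<subseteq> C i) \<longrightarrow>
           (\<exists>n. \<forall>i\<ge>n. (C i, C (Suc i)) \<in> K))}"

inductive_set kdim_classes ::
  "('s, 'm) ring_scheme \<Rightarrow> ('s, 'v, 'n) right_mod_scheme \<Rightarrow> ('v set \<times> 'v set) set set"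
  for S V where
  zero: "kdim_zero S V \<in> kdim_classes S V"
| step: "K \<in> kdim_classes S V \<Longrightarrow> kdim_step S V K \<in> kdim_classes S V"
| limit: "\<K> \<noteq> {} \<Longrightarrow> (\<And>K. K \<in> \<K> \<Longrightarrow> K \<in> kdim_classes S V) \<Longrightarrow> \<Union>\<K> \<in> kdim_classes S V"

definition has_kdim ::
  "('s, 'm) ring_scheme \<Rightarrow> ('s, 'v, 'n) right_mod_scheme \<Rightarrow> bool" where
  "has_kdim S V \<longleftrightarrow> (\<exists>K\<in>kdim_classes S V. (carrier V, {\<zero>\<^bsub>V\<^esub>}) \<in> K)"

definition kdim_less ::
  "('s, 'm) ring_scheme \<Rightarrow> ('s, 'v, 'n) right_mod_scheme \<Rightarrow>
     'v set \<times> 'v set \<Rightarrow> 'v set \<times> 'v set \<Rightarrow> bool" where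
  "kdim_less S V P Q \<longleftrightarrow> (\<exists>K\<in>kdim_classes S V. P \<in> K \<and> Q \<notin> K)"

definition kdim_equals ::
  "('s, 'm) ring_scheme \<Rightarrow> ('s, 'v, 'n) right_mod_scheme \<Rightarrow> nat \<Rightarrow> bool" where
  "kdim_equals S V n \<longleftrightarrow>
     (carrier V, {\<zero>\<^bsub>V\<^esub>}) \<in> (kdim_step S V ^^ Suc n) (kdim_zero S V) \<and>
     (carrier V, {\<zero>\<^bsub>V\<^esub>}) \<notin> (kdim_step S V ^^ n) (kdim_zero S V)"

definition critical ::
  "('s, 'm) ring_scheme \<Rightarrow> ('s, 'v, 'n) right_mod_scheme \<Rightarrow> bool" where
  "critical S V \<longleftrightarrow>
     right_module S V \<and> carrier V \<noteq> {\<zero>\<^bsub>V\<^esub>} \<and> has_kdim S V \<and>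
     (\<forall>N. right_submodule S V N \<and> N \<noteq> {\<zero>\<^bsub>V\<^esub>} \<longrightarrow>
        kdim_less S V (carrier V, N) (carrier V, {\<zero>\<^bsub>V\<^esub>}))"

definition n_critical ::
  "nat \<Rightarrow> ('s, 'm) ring_scheme \<Rightarrow> ('s, 'v, 'n) right_mod_scheme \<Rightarrow> bool" where
  "n_critical n S V \<longleftrightarrow> critical S V \<and> kdim_equals S V n"


section \<open>The sets of irreducible elements\<close>

definition set_F :: "('k, 'n) ring_scheme \<Rightarrow> (nat \<Rightarrow> 'k) set" where
  "set_F k = monic_polys k \<inter> irreducible_elements (UP k)"

definition set_A :: "('a, 'm) ring_scheme \<Rightarrow> 'a \<Rightarrow> (nat \<Rightarrow> 'a) set" where
  "set_A R X = {skew_const R X, skew_var R}"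

definition set_B :: "('a, 'm) ring_scheme \<Rightarrow> ('a \<Rightarrow> 'a) \<Rightarrow> 'a \<Rightarrow> (nat \<Rightarrow> 'a) set" where
  "set_B R \<alpha> X = (let S = skew_poly_ring R \<alpha> in
     {z \<in> irreducible_elements S.
        \<exists>s\<in>carrier S - skew_const R ` carrier R.
          z = \<one>\<^bsub>S\<^esub> \<oplus>\<^bsub>S\<^esub> skew_const R X \<otimes>\<^bsub>S\<^esub> s})"

text \<open>The condition \<open>z \<noteq> \<theta>\<close> has to be read up to associates: for \<open>1 \<noteq> u \<in> 1 + XR\<close> the
  element \<open>\<theta>u\<close> has the form \<open>\<theta> + Xs\<close> as well, but its normalisation is \<open>\<theta>\<close>, which is in
  \<^const>\<open>set_A\<close>.\<close>

definition set_C ::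
  "('k, 'n) ring_scheme \<Rightarrow> ('k, 'a, 'm) module_scheme \<Rightarrow> ('a \<Rightarrow> 'a) \<Rightarrow> 'a \<Rightarrow> (nat \<Rightarrow> 'a) set" where
  "set_C k R \<alpha> X = (let S = skew_poly_ring R \<alpha> in
     {z \<in> irreducible_elements S.
        (\<exists>f\<in>monic_polys k. deg k f > 0 \<and>
           (\<exists>s\<in>carrier S. z = emb_poly k R f \<oplus>\<^bsub>S\<^esub> skew_const R X \<otimes>\<^bsub>S\<^esub> s)) \<and>
        (\<forall>u\<in>Units S. z \<noteq> skew_var R \<otimes>\<^bsub>S\<^esub> u)})"


section \<open>The classes of modules\<close>

definition simple_finite_dim ::
  "('k, 'n) ring_scheme \<Rightarrow> ('k, 'a, 'm) module_scheme \<Rightarrow> (nat \<Rightarrow> 'a) ring \<Rightarrow>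
     (nat \<Rightarrow> 'a, 'v) right_mod set" where
  "simple_finite_dim k R S = {V. simple_module S V \<and> finite_dim k R V}"

definition simple_infinite_dim ::
  "('k, 'n) ring_scheme \<Rightarrow> ('k, 'a, 'm) module_scheme \<Rightarrow> (nat \<Rightarrow> 'a) ring \<Rightarrow>
     (nat \<Rightarrow> 'a, 'v) right_mod set" where
  "simple_infinite_dim k R S = {V. simple_module S V \<and> \<not> finite_dim k R V}"

definition unfaithful_fg_1_critical :: "('s, 'm) ring_scheme \<Rightarrow> ('s, 'v) right_mod set" where
  "unfaithful_fg_1_critical S =
     {V. n_critical 1 S V \<and> finitely_generated S V \<and> \<not> faithful S V}"

definition faithful_fg_1_critical :: "('s, 'm) ring_scheme \<Rightarrow> ('s, 'v) right_mod set" where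
  "faithful_fg_1_critical S =
     {V. n_critical 1 S V \<and> finitely_generated S V \<and> faithful S V}"


section \<open>Correspondences\<close>

definition rel_on :: "'x set \<Rightarrow> ('x \<Rightarrow> 'x \<Rightarrow> bool) \<Rightarrow> ('x \<times> 'x) set" where
  "rel_on M E = {(x, y). x \<in> M \<and> y \<in> M \<and> E x y}"

definition bijection_onto_classes ::
  "'c set \<Rightarrow> ('c \<Rightarrow> 'x) \<Rightarrow> 'x set \<Rightarrow> ('x \<Rightarrow> 'x \<Rightarrow> bool) \<Rightarrow> bool" where
  "bijection_onto_classes L \<phi> M E \<longleftrightarrow>
     equiv M (rel_on M E) \<and> \<phi> ` L \<subseteq> M \<and>
     bij_betw (\<lambda>c. rel_on M E `` {\<phi> c}) L (M // rel_on M E)"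

text \<open>The same, with the elements of \<open>L\<close> taken up to similarity, where \<open>c\<close> and \<open>d\<close> are similar
  if \<open>E (\<phi> c) (\<phi> d)\<close>. For \<open>\<phi> c = S/cS\<close> and \<open>E\<close> isomorphism, this is the classical
  similarity of elements of a ring. Similarity cannot be replaced by equality: \<open>zS = zuS\<close> for
  each unit \<open>u \<in> 1 + XR\<close>. Nor is it enough, in general, to work up to associates: for \<open>z = 1 - X\<theta>\<close> and
  \<open>z' = 1 - qX\<theta>\<close>, where \<open>\<alpha>(X) = qX\<close>, one has \<open>Xz' = zX\<close> and \<open>S/zS \<cong> S/z'S\<close>.\<close>

definition bijection_onto_classes_up_to_similarity ::
  "'c set \<Rightarrow> ('c \<Rightarrow> 'x) \<Rightarrow> 'x set \<Rightarrow> ('x \<Rightarrow> 'x \<Rightarrow> bool) \<Rightarrow> bool" where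
  "bijection_onto_classes_up_to_similarity L \<phi> M E \<longleftrightarrow>
     equiv M (rel_on M E) \<and> \<phi> ` L \<subseteq> M \<and>
     bij_betw (\<lambda>Q. \<Union>c\<in>Q. rel_on M E `` {\<phi> c})
       (L // rel_on L (\<lambda>c d. E (\<phi> c) (\<phi> d))) (M // rel_on M E)"

end

theory Submission
  imports Defs
begin

text \<open>
  Both \<open>X\<close> and \<open>\<theta>\<close> are normal elements of \<open>S\<close>, and \<open>S/XS = k[\<theta>]\<close> and \<open>S/\<theta>S = R\<close> are principal ideal
  domains. The modules killed by \<open>X\<close> or by \<open>\<theta>\<close> are therefore modules over a principal ideal domain;
  all other modules in question are torsionfree over \<open>X\<close>, and for them \<open>S\<close> itself behaves almost like
  a principal ideal domain.

  Krull dimension enters only through the artinian subfactors. Each of the transfinitely generated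
  classes is closed under extensions and compatible with the second isomorphism theorem
  (\<open>kdim_class_serre\<close>), and a class with a member that is not artinian contains every
  subfactor of Krull dimension at most one (\<open>kdim_class_cases\<close>). So a critical module with a nonzero submodule
  of Krull dimension at most one is simple or 1-critical (\<open>critical_simple_or_1_critical\<close>), and a module
  is 1-critical if and only if it is not artinian but all its proper factors are (\<open>one_critical_iff\<close>).
  On a 1-critical module a normal element acts as zero or injectively
  (\<open>one_critical_normal_dichotomy\<close>).

  Modules killed by a normal element. The simple modules killed by \<open>X\<close> are the modules \<open>k[\<theta>]/(f)\<close>,
  which gives \<open>(F)\<close>: finite-dimensional simple modules are killed by \<open>X\<close>, for otherwise \<open>X\<close> would act
  bijectively on a finitely generated \<open>R\<close>-module, against Nakayama's lemma. A finitely generated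
  1-critical module killed by \<open>X\<close> or \<open>\<theta>\<close> is free of rank one over \<open>k[\<theta>]\<close> or \<open>R\<close>
  (\<open>killed_one_critical_cyclic\<close>). As \<open>\<alpha>\<close> has infinite order, a nonzero two-sided ideal of \<open>S\<close> contains
  a monomial (\<open>two_sided_ideal_contains_monomial\<close>), hence a product \<open>X^n\<theta>^m\<close>; so an unfaithful 1-critical
  module is killed by \<open>X\<close> or \<open>\<theta>\<close>, and the two cases are \<open>(A)\<close>.

  Modules on which \<open>X\<close> acts injectively. Division with remainder works in \<open>S\<close> up to powers of \<open>X\<close>, so
  a right ideal \<open>I\<close> such that \<open>wX \<in> I\<close> implies \<open>w \<in> I\<close> is principal (\<open>principal_of_saturated\<close>, a form of
  Gauss' lemma). Annihilators of elements have this property; for a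
  suitable element the generator \<open>z\<close> of the annihilator is irreducible
  (\<open>irreducible_annihilator_exists\<close>). A right ideal strictly above \<open>zS\<close> contains a power of \<open>X\<close>
  (\<open>power_mem_of_irreducible\<close>), so the proper factors of \<open>S/zS\<close> are artinian. What happens to \<open>S/zS\<close>
  itself is decided by the residue \<open>f \<noteq> 0\<close> of \<open>z\<close> in \<open>k[\<theta>]\<close>. If \<open>f\<close> is a unit, then \<open>zS + XS = S\<close> and no power of \<open>X\<close>
  can lie in a proper right ideal above \<open>zS\<close>; the module is simple, and infinite-dimensional because
  \<open>X\<close> does not kill it. This is \<open>(B)\<close>. If \<open>f\<close> is not a unit, then the images of the powers of \<open>X\<close> form a
  strictly descending chain and the module is 1-critical; it is faithful unless \<open>z\<close> is an associate
  of \<open>\<theta>\<close>. This is \<open>(C)\<close>, where a faithful 1-critical module is reached only through its submodule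
  \<open>S/zS\<close>, and hull similarity is the relation that remains.
\<close>


section \<open>Right modules and their submodules\<close>

lemma right_submoduleD:
  assumes "right_submodule S V N"
  shows "N \<subseteq> carrier V" "\<zero>\<^bsub>V\<^esub> \<in> N"
    "\<And>v w. v \<in> N \<Longrightarrow> w \<in> N \<Longrightarrow> v \<oplus>\<^bsub>V\<^esub> w \<in> N"
    "\<And>v. v \<in> N \<Longrightarrow> \<ominus>\<^bsub>V\<^esub> v \<in> N"
    "\<And>v s. v \<in> N \<Longrightarrow> s \<in> carrier S \<Longrightarrow> v \<cdot>\<^bsub>V\<^esub> s \<in> N"
  using assms additive_subgroup.a_subset[of N V] additive_subgroup.zero_closed[of N V]
    additive_subgroup.a_closed[of N V] additive_subgroup.a_inv_closed[of N V]
  unfolding right_submodule_def by auto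

lemma (in abelian_group) minus_eq_zero_iff:
  assumes "a \<in> carrier G" "b \<in> carrier G"
  shows "a \<ominus> b = \<zero> \<longleftrightarrow> a = b"
proof
  assume "a \<ominus> b = \<zero>"
  moreover have "(a \<ominus> b) \<oplus> b = a" using assms by (simp add: a_minus_def a_assoc l_neg)
  ultimately show "a = b" using assms by simp
qed (use assms in \<open>simp add: a_minus_def r_neg\<close>)

context right_module
begin

lemma zero_ract [simp]:
  assumes "s \<in> carrier S" shows "\<zero>\<^bsub>V\<^esub> \<cdot>\<^bsub>V\<^esub> s = \<zero>\<^bsub>V\<^esub>"
proof -
  have "\<zero>\<^bsub>V\<^esub> \<cdot>\<^bsub>V\<^esub> s \<oplus>\<^bsub>V\<^esub> \<zero>\<^bsub>V\<^esub> \<cdot>\<^bsub>V\<^esub> s = \<zero>\<^bsub>V\<^esub> \<cdot>\<^bsub>V\<^esub> s \<oplus>\<^bsub>V\<^esub> \<zero>\<^bsub>V\<^esub>"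
    using assms ract_l_distr[of "\<zero>\<^bsub>V\<^esub>" "\<zero>\<^bsub>V\<^esub>" s] by (simp add: ract_closed)
  thus ?thesis using assms V.add.l_cancel ract_closed V.zero_closed by metis
qed

lemma ract_zero [simp]:
  assumes "v \<in> carrier V" shows "v \<cdot>\<^bsub>V\<^esub> \<zero>\<^bsub>S\<^esub> = \<zero>\<^bsub>V\<^esub>"
proof -
  have "v \<cdot>\<^bsub>V\<^esub> \<zero>\<^bsub>S\<^esub> \<oplus>\<^bsub>V\<^esub> v \<cdot>\<^bsub>V\<^esub> \<zero>\<^bsub>S\<^esub> = v \<cdot>\<^bsub>V\<^esub> \<zero>\<^bsub>S\<^esub> \<oplus>\<^bsub>V\<^esub> \<zero>\<^bsub>V\<^esub>"
    using assms ract_r_distr[of v "\<zero>\<^bsub>S\<^esub>" "\<zero>\<^bsub>S\<^esub>"] by (simp add: ract_closed)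
  thus ?thesis using assms V.add.l_cancel ract_closed V.zero_closed S.zero_closed by metis
qed

lemma ract_minus:
  assumes "v \<in> carrier V" "s \<in> carrier S"
  shows "v \<cdot>\<^bsub>V\<^esub> (\<ominus>\<^bsub>S\<^esub> s) = \<ominus>\<^bsub>V\<^esub> (v \<cdot>\<^bsub>V\<^esub> s)"
proof -
  have "v \<cdot>\<^bsub>V\<^esub> (\<ominus>\<^bsub>S\<^esub> s) \<oplus>\<^bsub>V\<^esub> v \<cdot>\<^bsub>V\<^esub> s = \<zero>\<^bsub>V\<^esub>"
    using assms ract_r_distr[of v "\<ominus>\<^bsub>S\<^esub> s" s] by (simp add: S.l_neg)
  thus ?thesis using assms by (metis V.minus_equality ract_closed S.a_inv_closed)
qed

lemma minus_ract:
  assumes "v \<in> carrier V" "s \<in> carrier S"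
  shows "(\<ominus>\<^bsub>V\<^esub> v) \<cdot>\<^bsub>V\<^esub> s = \<ominus>\<^bsub>V\<^esub> (v \<cdot>\<^bsub>V\<^esub> s)"
proof -
  have "(\<ominus>\<^bsub>V\<^esub> v) \<cdot>\<^bsub>V\<^esub> s \<oplus>\<^bsub>V\<^esub> v \<cdot>\<^bsub>V\<^esub> s = \<zero>\<^bsub>V\<^esub>"
    using assms ract_l_distr[of "\<ominus>\<^bsub>V\<^esub> v" v s] by (simp add: V.l_neg)
  thus ?thesis using assms by (metis V.minus_equality ract_closed V.a_inv_closed)
qed

lemma finsum_ract:
  assumes "finite B" "f \<in> B \<rightarrow> carrier V" "s \<in> carrier S"
  shows "(\<Oplus>\<^bsub>V\<^esub>b\<in>B. f b) \<cdot>\<^bsub>V\<^esub> s = (\<Oplus>\<^bsub>V\<^esub>b\<in>B. f b \<cdot>\<^bsub>V\<^esub> s)"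
  using assms by (induction B rule: finite_induct)
    (simp_all add: Pi_def ract_l_distr ract_closed V.finsum_insert)

lemma right_submoduleI:
  assumes "N \<subseteq> carrier V" "\<zero>\<^bsub>V\<^esub> \<in> N"
    and "\<And>v w. v \<in> N \<Longrightarrow> w \<in> N \<Longrightarrow> v \<oplus>\<^bsub>V\<^esub> w \<in> N"
    and act: "\<And>v s. v \<in> N \<Longrightarrow> s \<in> carrier S \<Longrightarrow> v \<cdot>\<^bsub>V\<^esub> s \<in> N"
  shows "right_submodule S V N"
proof -
  have "\<ominus>\<^bsub>V\<^esub> v \<in> N" if "v \<in> N" for v
    using that act[of v "\<ominus>\<^bsub>S\<^esub> \<one>\<^bsub>S\<^esub>"] assms(1) by (auto simp: ract_minus ract_one)
  hence "additive_subgroup N V"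
    using assms by (intro additive_subgroup.intro V.add.subgroupI)
      (auto simp: a_inv_def[symmetric])
  thus ?thesis using act by (auto simp: right_submodule_def)
qed

lemma submodule_zero: "right_submodule S V {\<zero>\<^bsub>V\<^esub>}"
  by (rule right_submoduleI) auto

lemma submodule_carrier: "right_submodule S V (carrier V)"
  by (rule right_submoduleI) (auto simp: ract_closed)

lemma submodule_Int:
  assumes "right_submodule S V A" "right_submodule S V B"
  shows "right_submodule S V (A \<inter> B)"
  using right_submoduleD[OF assms(1)] right_submoduleD[OF assms(2)]
  by (intro right_submoduleI) auto

lemma submodule_sum:
  assumes "right_submodule S V A" "right_submodule S V B"
  shows "right_submodule S V (A <+>\<^bsub>V\<^esub> B)"
proof (rule right_submoduleI)
  note A = right_submoduleD[OF assms(1)] and B = right_submoduleD[OF assms(2)]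
  show "A <+>\<^bsub>V\<^esub> B \<subseteq> carrier V" using A(1) B(1) by (auto simp: set_add_def')
  have "\<zero>\<^bsub>V\<^esub> \<oplus>\<^bsub>V\<^esub> \<zero>\<^bsub>V\<^esub> \<in> A <+>\<^bsub>V\<^esub> B"
    using A(2) B(2) by (auto simp: set_add_def' simp del: V.l_zero V.r_zero)
  thus "\<zero>\<^bsub>V\<^esub> \<in> A <+>\<^bsub>V\<^esub> B" by simp
next
  note A = right_submoduleD[OF assms(1)] and B = right_submoduleD[OF assms(2)]
  fix v w assume "v \<in> A <+>\<^bsub>V\<^esub> B" "w \<in> A <+>\<^bsub>V\<^esub> B"
  then obtain a b c d where
    *: "a \<in> A" "b \<in> B" "c \<in> A" "d \<in> B" "v = a \<oplus>\<^bsub>V\<^esub> b" "w = c \<oplus>\<^bsub>V\<^esub> d"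
    by (auto simp: set_add_def')
  hence cl: "a \<in> carrier V" "b \<in> carrier V" "c \<in> carrier V" "d \<in> carrier V" using A(1) B(1) by auto
  have "v \<oplus>\<^bsub>V\<^esub> w = (a \<oplus>\<^bsub>V\<^esub> c) \<oplus>\<^bsub>V\<^esub> (b \<oplus>\<^bsub>V\<^esub> d)" using * cl by (simp add: V.a_ac)
  moreover have "a \<oplus>\<^bsub>V\<^esub> c \<in> A" "b \<oplus>\<^bsub>V\<^esub> d \<in> B" using * A(3) B(3) by auto
  ultimately show "v \<oplus>\<^bsub>V\<^esub> w \<in> A <+>\<^bsub>V\<^esub> B" unfolding set_add_def' by blast
next
  note A = right_submoduleD[OF assms(1)] and B = right_submoduleD[OF assms(2)]
  fix v s assume "v \<in> A <+>\<^bsub>V\<^esub> B" and s: "s \<in> carrier S"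
  then obtain a b where *: "a \<in> A" "b \<in> B" "v = a \<oplus>\<^bsub>V\<^esub> b" by (auto simp: set_add_def')
  moreover from this A(1) B(1) have "a \<in> carrier V" "b \<in> carrier V" by auto
  ultimately have "v \<cdot>\<^bsub>V\<^esub> s = a \<cdot>\<^bsub>V\<^esub> s \<oplus>\<^bsub>V\<^esub> b \<cdot>\<^bsub>V\<^esub> s" using s by (simp add: ract_l_distr)
  moreover have "a \<cdot>\<^bsub>V\<^esub> s \<in> A" "b \<cdot>\<^bsub>V\<^esub> s \<in> B" using * s A(5) B(5) by auto
  ultimately show "v \<cdot>\<^bsub>V\<^esub> s \<in> A <+>\<^bsub>V\<^esub> B" unfolding set_add_def' by blast
qed

lemma submodule_sum_upper:
  assumes "right_submodule S V A" "right_submodule S V B"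
  shows "A \<subseteq> A <+>\<^bsub>V\<^esub> B" "B \<subseteq> A <+>\<^bsub>V\<^esub> B"
proof -
  note A = right_submoduleD[OF assms(1)] and B = right_submoduleD[OF assms(2)]
  show "A \<subseteq> A <+>\<^bsub>V\<^esub> B"
  proof
    fix a assume a: "a \<in> A"
    hence "a \<oplus>\<^bsub>V\<^esub> \<zero>\<^bsub>V\<^esub> \<in> A <+>\<^bsub>V\<^esub> B" using B(2) unfolding set_add_def' by blast
    thus "a \<in> A <+>\<^bsub>V\<^esub> B" using a A(1) by (simp add: subsetD)
  qed
  show "B \<subseteq> A <+>\<^bsub>V\<^esub> B"
  proof
    fix b assume b: "b \<in> B"
    hence "\<zero>\<^bsub>V\<^esub> \<oplus>\<^bsub>V\<^esub> b \<in> A <+>\<^bsub>V\<^esub> B" using A(2) unfolding set_add_def' by blast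
    thus "b \<in> A <+>\<^bsub>V\<^esub> B" using b B(1) by (simp add: subsetD)
  qed
qed

lemma submodule_sum_least:
  assumes "right_submodule S V C" "A \<subseteq> C" "B \<subseteq> C"
  shows "A <+>\<^bsub>V\<^esub> B \<subseteq> C"
  using assms right_submoduleD(3)[OF assms(1)] by (auto simp: set_add_def')

lemma submodule_modular_law:
  assumes "right_submodule S V A" "right_submodule S V B" "right_submodule S V C" "A \<subseteq> C"
  shows "(A <+>\<^bsub>V\<^esub> B) \<inter> C = A <+>\<^bsub>V\<^esub> (B \<inter> C)"
proof
  note A = right_submoduleD[OF assms(1)] and B = right_submoduleD[OF assms(2)]
    and C = right_submoduleD[OF assms(3)]
  show "A <+>\<^bsub>V\<^esub> (B \<inter> C) \<subseteq> (A <+>\<^bsub>V\<^esub> B) \<inter> C"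
    using assms(4) C(3) by (fastforce simp: set_add_def')
  show "(A <+>\<^bsub>V\<^esub> B) \<inter> C \<subseteq> A <+>\<^bsub>V\<^esub> (B \<inter> C)"
  proof
    fix x assume "x \<in> (A <+>\<^bsub>V\<^esub> B) \<inter> C"
    then obtain a b where *: "a \<in> A" "b \<in> B" "x = a \<oplus>\<^bsub>V\<^esub> b" "x \<in> C" by (auto simp: set_add_def')
    moreover have cl: "a \<in> carrier V" "b \<in> carrier V" using * A(1) B(1) by auto
    have "\<ominus>\<^bsub>V\<^esub> a \<oplus>\<^bsub>V\<^esub> x \<in> C" using * assms(4) C(3,4) by auto
    hence "b \<in> C" using * cl by (simp add: V.a_assoc[symmetric] V.l_neg)
    thus "x \<in> A <+>\<^bsub>V\<^esub> (B \<inter> C)" using * by (auto simp: set_add_def')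
  qed
qed

lemma module_of_submodule:
  assumes "right_submodule S V N"
  shows "right_module S (V\<lparr>carrier := N\<rparr>)"
proof -
  note N = right_submoduleD[OF assms]
  have "abelian_group (V\<lparr>carrier := N\<rparr>)"
  proof (rule abelian_groupI)
    fix v assume "v \<in> carrier (V\<lparr>carrier := N\<rparr>)"
    thus "\<exists>w\<in>carrier (V\<lparr>carrier := N\<rparr>). w \<oplus>\<^bsub>V\<lparr>carrier := N\<rparr>\<^esub> v = \<zero>\<^bsub>V\<lparr>carrier := N\<rparr>\<^esub>"
      using N V.l_neg by (auto simp: subset_iff intro!: bexI[of _ "\<ominus>\<^bsub>V\<^esub> v"])
  qed (use N in \<open>auto simp: subset_iff V.a_ac\<close>)
  moreover have "right_module_axioms S (V\<lparr>carrier := N\<rparr>)"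
    using N by unfold_locales
      (auto simp: subset_iff ract_l_distr ract_r_distr ract_assoc ract_one)
  ultimately show ?thesis
    by (intro right_module.intro) (auto simp: S.ring_axioms)
qed

definition cyclic_submodule :: "'v \<Rightarrow> 'v set" where
  "cyclic_submodule v = {v \<cdot>\<^bsub>V\<^esub> s | s. s \<in> carrier S}"

lemma cyclic_submodule_submodule:
  assumes "v \<in> carrier V"
  shows "right_submodule S V (cyclic_submodule v)"
proof (rule right_submoduleI)
  show "cyclic_submodule v \<subseteq> carrier V" using assms by (auto simp: cyclic_submodule_def ract_closed)
  show "\<zero>\<^bsub>V\<^esub> \<in> cyclic_submodule v" using ract_zero[OF assms] by (force simp: cyclic_submodule_def)
next
  fix a b assume "a \<in> cyclic_submodule v" "b \<in> cyclic_submodule v"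
  then obtain s t where "s \<in> carrier S" "t \<in> carrier S" "a = v \<cdot>\<^bsub>V\<^esub> s" "b = v \<cdot>\<^bsub>V\<^esub> t"
    by (auto simp: cyclic_submodule_def)
  thus "a \<oplus>\<^bsub>V\<^esub> b \<in> cyclic_submodule v"
    using assms ract_r_distr[of v s t] by (auto simp: cyclic_submodule_def intro!: exI[of _ "s \<oplus>\<^bsub>S\<^esub> t"])
next
  fix a s assume "a \<in> cyclic_submodule v" "s \<in> carrier S"
  then obtain t where "t \<in> carrier S" "a = v \<cdot>\<^bsub>V\<^esub> t" by (auto simp: cyclic_submodule_def)
  thus "a \<cdot>\<^bsub>V\<^esub> s \<in> cyclic_submodule v"
    using assms \<open>s \<in> carrier S\<close> ract_assoc[of v t s]
    by (auto simp: cyclic_submodule_def intro!: exI[of _ "t \<otimes>\<^bsub>S\<^esub> s"])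
qed

lemma self_in_cyclic_submodule: "v \<in> carrier V \<Longrightarrow> v \<in> cyclic_submodule v"
  using ract_one[of v] by (force simp: cyclic_submodule_def)

lemma cyclic_submodule_nonzero:
  "v \<in> carrier V \<Longrightarrow> v \<noteq> \<zero>\<^bsub>V\<^esub> \<Longrightarrow> cyclic_submodule v \<noteq> {\<zero>\<^bsub>V\<^esub>}"
  using self_in_cyclic_submodule by blast

lemma cyclic_submodule_least:
  "right_submodule S V N \<Longrightarrow> v \<in> N \<Longrightarrow> cyclic_submodule v \<subseteq> N"
  using right_submoduleD(5) by (fastforce simp: cyclic_submodule_def)

lemma finitely_generated_cyclic:
  assumes "v \<in> carrier V" "carrier V = cyclic_submodule v"
  shows "finitely_generated S V"
  unfolding finitely_generated_def finitely_spanned_over_def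
proof (intro exI[of _ "{v}"] conjI ballI)
  fix w assume "w \<in> carrier V"
  then obtain s where s: "s \<in> carrier S" "w = v \<cdot>\<^bsub>V\<^esub> s" using assms by (auto simp: cyclic_submodule_def)
  thus "\<exists>a\<in>{v} \<rightarrow> carrier S. w = (\<Oplus>\<^bsub>V\<^esub>b\<in>{v}. b \<cdot>\<^bsub>V\<^esub> a b)"
    using assms(1) by (intro bexI[of _ "\<lambda>_. s"]) (auto simp: ract_closed V.finsum_insert)
qed (use assms in auto)

lemma simple_cyclic:
  assumes "simple_module S V" "v \<in> carrier V" "v \<noteq> \<zero>\<^bsub>V\<^esub>"
  shows "carrier V = cyclic_submodule v"
  using assms cyclic_submodule_submodule[of v] cyclic_submodule_nonzero[of v]
  unfolding simple_module_def by blast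

lemma nonzero_submodule_obtains:
  assumes "right_submodule S V N" "N \<noteq> {\<zero>\<^bsub>V\<^esub>}"
  obtains w where "w \<in> N" "w \<noteq> \<zero>\<^bsub>V\<^esub>"
  using assms right_submoduleD(2)[OF assms(1)] by blast

section \<open>Krull dimension zero and one\<close>

abbreviation artinian :: "('v set \<times> 'v set) set" where
  "artinian \<equiv> kdim_step S V (kdim_zero S V)"

lemma kdim_step_mono: "K \<subseteq> L \<Longrightarrow> kdim_step S V K \<subseteq> kdim_step S V L"
  unfolding kdim_step_def by (clarsimp, meson subsetD)

lemma kdim_stepD:
  "(A, B) \<in> kdim_step S V K \<Longrightarrow> right_submodule S V A \<and> right_submodule S V B \<and> B \<subseteq> A"
  by (simp add: kdim_step_def)

lemma kdim_stepE:
  assumes "(A, B) \<in> kdim_step S V K"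
    and "\<And>i. right_submodule S V (C i)" "\<And>i. B \<subseteq> C i" "\<And>i. C i \<subseteq> A" "\<And>i. C (Suc i) \<subseteq> C i"
  obtains n where "\<And>i. i \<ge> n \<Longrightarrow> (C i, C (Suc i)) \<in> K"
  using assms unfolding kdim_step_def by blast

lemma kdim_stepI:
  assumes "right_submodule S V A" "right_submodule S V B" "B \<subseteq> A"
    and "\<And>C :: nat \<Rightarrow> 'v set. (\<And>i. right_submodule S V (C i)) \<Longrightarrow> (\<And>i. B \<subseteq> C i) \<Longrightarrow>
      (\<And>i. C i \<subseteq> A) \<Longrightarrow> (\<And>i. C (Suc i) \<subseteq> C i) \<Longrightarrow> \<exists>n. \<forall>i\<ge>n. (C i, C (Suc i)) \<in> K"
  shows "(A, B) \<in> kdim_step S V K"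
  using assms unfolding kdim_step_def by simp

lemma kdim_zero_subset_step:
  assumes "kdim_zero S V \<subseteq> K"
  shows "kdim_zero S V \<subseteq> kdim_step S V K"
proof -
  have "kdim_zero S V \<subseteq> kdim_step S V (kdim_zero S V)"
    unfolding kdim_step_def kdim_zero_def by clarsimp (meson subset_antisym subset_trans)
  thus ?thesis using kdim_step_mono[OF assms] by blast
qed

text \<open>The classes are among the iterates of the monotone map \<open>K \<mapsto> K\<^sub>0 \<union> step K\<close>, with \<open>K\<^sub>0\<close> the class of the
  zero subfactors, and the iterates of a monotone map form a chain.\<close>

lemma kdim_classes_chain:
  assumes "K \<in> kdim_classes S V" "L \<in> kdim_classes S V"
  shows "K \<subseteq> L \<or> L \<subseteq> K"
proof -
  define f where "f K = kdim_zero S V \<union> kdim_step S V K" for K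
  have mono: "monotone (\<le>) (\<le>) f"
    unfolding f_def by (rule monotoneI) (meson Un_mono kdim_step_mono subset_refl)
  note chain = ccpo_class.chain_iterates[OF mono]
  have "K \<in> ccpo_class.iterates f \<and> kdim_zero S V \<subseteq> K" if "K \<in> kdim_classes S V" for K
    using that
  proof induction
    case zero
    \<comment> \<open>The iteration starts at the empty set, which the map sends to the class of zero subfactors.\<close>
    have "(A, B) \<notin> kdim_step S V {}" for A B
    proof
      assume *: "(A, B) \<in> kdim_step S V {}"
      show False by (rule kdim_stepE[OF *, of "\<lambda>_. A"]) (use kdim_stepD[OF *] in auto)
    qed
    hence "kdim_step S V {} = {}" by auto
    hence "f (Sup {}) = kdim_zero S V" by (simp add: f_def)
    moreover have "f (Sup {}) \<in> ccpo_class.iterates f"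
      by (rule ccpo_class.iterates.step[OF ccpo_class.bot_in_iterates])
    ultimately show ?case by simp
  next
    case (step K)
    hence "f K = kdim_step S V K" using kdim_zero_subset_step[of K] by (auto simp: f_def)
    thus ?case using ccpo_class.iterates.step[of K f] step kdim_zero_subset_step[of K] by simp
  next
    case (limit \<K>)
    hence "\<K> \<subseteq> ccpo_class.iterates f" by blast
    hence "Complete_Partial_Order.chain (\<le>) \<K>" using chain_subset[OF chain] by blast
    hence "\<Union>\<K> \<in> ccpo_class.iterates f" using limit by (intro ccpo_class.iterates.Sup) auto
    thus ?case using limit by blast
  qed
  thus ?thesis using assms chain by (auto simp: chain_def)
qed

text \<open>A union of classes that only consist of artinian subfactors is again one of the two smallest classes,
  so nothing lies between these and the class of Krull dimension at most one. This turns the order of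
  Krull dimensions, which is given by separating classes, into statements on artinian subfactors.\<close>

lemma kdim_class_cases:
  assumes "K \<in> kdim_classes S V"
  shows "K = kdim_zero S V \<or> K = artinian \<or> kdim_step S V artinian \<subseteq> K"
  using assms
proof induction
  have 01: "kdim_zero S V \<subseteq> artinian" using kdim_zero_subset_step by blast
  hence 12: "artinian \<subseteq> kdim_step S V artinian" by (rule kdim_step_mono)
  {
    case (step K)
    then show ?case
      using kdim_step_mono[of "kdim_step S V artinian" K] kdim_step_mono[OF 12] by (elim disjE) auto
  next
    case (limit \<K>)
    show ?case
    proof (cases "\<exists>K\<in>\<K>. kdim_step S V artinian \<subseteq> K")
      case False
      hence "\<forall>K\<in>\<K>. K = kdim_zero S V \<or> K = artinian" using limit by blast
      thus ?thesis using 01 limit(1) by (cases "artinian \<in> \<K>") auto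
    qed auto
  }
qed simp

text \<open>Each class is closed under extensions and invariant under the second isomorphism theorem;
  the two properties have to be propagated together through the transfinite iteration.\<close>

definition serre_class :: "('v set \<times> 'v set) set \<Rightarrow> bool" where
  "serre_class K \<longleftrightarrow>
    (\<forall>A B. right_submodule S V A \<longrightarrow> right_submodule S V B \<longrightarrow>
        (A <+>\<^bsub>V\<^esub> B, B) \<in> K \<longleftrightarrow> (A, A \<inter> B) \<in> K) \<and>
    (\<forall>A B C. (A, B) \<in> K \<longrightarrow> (B, C) \<in> K \<longrightarrow> (A, C) \<in> K)"

lemma submodule_sum_absorb:
  assumes "right_submodule S V A" "right_submodule S V B" "A \<subseteq> B"
  shows "A <+>\<^bsub>V\<^esub> B = B" "B <+>\<^bsub>V\<^esub> A = B"
  using submodule_sum_upper[OF assms(1,2)] submodule_sum_upper[OF assms(2,1)]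
    submodule_sum_least[OF assms(2) assms(3) subset_refl] submodule_sum_least[OF assms(2) subset_refl assms(3)]
  by auto

lemma submodule_sum_commute:
  assumes "right_submodule S V A" "right_submodule S V B"
  shows "A <+>\<^bsub>V\<^esub> B = B <+>\<^bsub>V\<^esub> A"
  using submodule_sum_upper[OF assms] submodule_sum_upper[OF assms(2,1)]
    submodule_sum_least[OF submodule_sum[OF assms]] submodule_sum_least[OF submodule_sum[OF assms(2,1)]]
  by (meson subset_antisym)

lemma serre_class_zero: "serre_class (kdim_zero S V)"
proof -
  have "A <+>\<^bsub>V\<^esub> B = B \<longleftrightarrow> A = A \<inter> B" if "right_submodule S V A" "right_submodule S V B" for A B
    using submodule_sum_upper[OF that] submodule_sum_absorb[OF that] by blast
  thus ?thesis by (auto simp: serre_class_def kdim_zero_def submodule_Int submodule_sum)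
qed

text \<open>Chains are carried from one interval to the other by adding \<open>B\<close> and by intersecting with \<open>A\<close>. By
  the modular law, successive members of the two chains again form transposed intervals, so their
  factors lie in \<open>K\<close> simultaneously.\<close>

lemma serre_class_step_transpose:
  assumes K: "serre_class K" and A: "right_submodule S V A" and B: "right_submodule S V B"
  shows "(A <+>\<^bsub>V\<^esub> B, B) \<in> kdim_step S V K \<longleftrightarrow> (A, A \<inter> B) \<in> kdim_step S V K"
proof
  assume AB: "(A <+>\<^bsub>V\<^esub> B, B) \<in> kdim_step S V K"
  show "(A, A \<inter> B) \<in> kdim_step S V K"
  proof (rule kdim_stepI)
    fix C :: "nat \<Rightarrow> 'v set"
    assume C: "\<And>i. right_submodule S V (C i)" "\<And>i. A \<inter> B \<subseteq> C i" "\<And>i. C i \<subseteq> A" "\<And>i. C (Suc i) \<subseteq> C i"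
    define D where "D i = C i <+>\<^bsub>V\<^esub> B" for i
    have D: "right_submodule S V (D i)" for i unfolding D_def using C B by (intro submodule_sum)
    obtain n where n: "\<And>i. i \<ge> n \<Longrightarrow> (D i, D (Suc i)) \<in> K"
    proof (rule kdim_stepE[OF AB])
      show "right_submodule S V (D i)" "B \<subseteq> D i" "D i \<subseteq> A <+>\<^bsub>V\<^esub> B" "D (Suc i) \<subseteq> D i" for i
        using D submodule_sum_upper[OF C(1)[of i] B] submodule_sum_upper[OF A B] C(3)[of i] C(4)[of i]
          submodule_sum_least[OF submodule_sum[OF A B], of "C i" B]
          submodule_sum_least[OF D[of i], of "C (Suc i)" B]
        by (auto simp: D_def)
    qed blast
    have "(C i, C (Suc i)) \<in> K" if "i \<ge> n" for i
    proof -
      have "C i <+>\<^bsub>V\<^esub> D (Suc i) = D i"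
        using submodule_sum_upper[OF C(1)[of i] D[of "Suc i"]] submodule_sum_upper[OF C(1)[of "Suc i"] B]
           submodule_sum_upper[OF C(1)[of i] B]
           submodule_sum_least[OF submodule_sum[OF C(1)[of i] D[of "Suc i"]], of "C i" B]
           submodule_sum_least[OF D[of i], of "C i" "D (Suc i)"]
           submodule_sum_least[OF D[of i], of "C (Suc i)" B] C(4)[of i]
        unfolding D_def by blast
      moreover have "C i \<inter> D (Suc i) = C (Suc i)"
      proof -
        have "D (Suc i) \<inter> C i = C (Suc i) <+>\<^bsub>V\<^esub> (B \<inter> C i)"
          unfolding D_def by (rule submodule_modular_law[OF C(1) B C(1) C(4)])
        also have "\<dots> = C (Suc i)"
          using C(2)[of "Suc i"] C(3)[of i] by (intro submodule_sum_absorb submodule_Int C B) auto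
        finally show ?thesis by blast
      qed
      ultimately show ?thesis using n[OF that] K C(1) D unfolding serre_class_def by metis
    qed
    thus "\<exists>n. \<forall>i\<ge>n. (C i, C (Suc i)) \<in> K" by blast
  qed (use A B submodule_Int in auto)
next
  assume AB: "(A, A \<inter> B) \<in> kdim_step S V K"
  show "(A <+>\<^bsub>V\<^esub> B, B) \<in> kdim_step S V K"
  proof (rule kdim_stepI)
    fix C :: "nat \<Rightarrow> 'v set"
    assume C: "\<And>i. right_submodule S V (C i)" "\<And>i. B \<subseteq> C i" "\<And>i. C i \<subseteq> A <+>\<^bsub>V\<^esub> B" "\<And>i. C (Suc i) \<subseteq> C i"
    define D where "D i = C i \<inter> A" for i
    have D: "right_submodule S V (D i)" for i unfolding D_def using C A by (intro submodule_Int)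
    obtain n where n: "\<And>i. i \<ge> n \<Longrightarrow> (D i, D (Suc i)) \<in> K"
      by (rule kdim_stepE[OF AB, of D]) (use D C(2) subsetD[OF C(4)] in \<open>auto simp: D_def\<close>)
    have "(C i, C (Suc i)) \<in> K" if "i \<ge> n" for i
    proof -
      have "D i <+>\<^bsub>V\<^esub> C (Suc i) = C i"
      proof -
        have "D i <+>\<^bsub>V\<^esub> C (Suc i) = C (Suc i) <+>\<^bsub>V\<^esub> (A \<inter> C i)"
          using submodule_sum_commute[OF D C(1)] by (simp add: D_def Int_commute)
        also have "\<dots> = (C (Suc i) <+>\<^bsub>V\<^esub> A) \<inter> C i"
          by (rule submodule_modular_law[symmetric]) (use C A in auto)
        also have "C (Suc i) <+>\<^bsub>V\<^esub> A = A <+>\<^bsub>V\<^esub> C (Suc i)"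
          using submodule_sum_commute C A by blast
        also have "\<dots> \<inter> C i = C i"
          using submodule_sum_upper[OF A C(1)[of "Suc i"]] C(2)[of "Suc i"] C(3)[of i]
            submodule_sum_least[OF submodule_sum[OF A C(1)[of "Suc i"]], of A B] by blast
        finally show ?thesis .
      qed
      moreover have "D i \<inter> C (Suc i) = D (Suc i)" unfolding D_def using C(4)[of i] by blast
      ultimately show ?thesis using n[OF that] K C(1) D unfolding serre_class_def by metis
    qed
    thus "\<exists>n. \<forall>i\<ge>n. (C i, C (Suc i)) \<in> K" by blast
  qed (use A B submodule_sum submodule_sum_upper in auto)
qed

text \<open>A chain \<open>D\<close> between \<open>C\<close> and \<open>A\<close> has the trace \<open>D i + B\<close> on \<open>A/B\<close> and the trace \<open>D i \<inter> B\<close> on \<open>B/C\<close>;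
  the factors of \<open>D\<close> are extensions of factors of the two traces.\<close>

lemma serre_class_step_extension:
  assumes K: "serre_class K" and AB: "(A, B) \<in> kdim_step S V K" and BC: "(B, C) \<in> kdim_step S V K"
  shows "(A, C) \<in> kdim_step S V K"
proof (rule kdim_stepI)
  have B: "right_submodule S V B" using kdim_stepD[OF AB] by blast
  fix D :: "nat \<Rightarrow> 'v set"
  assume D: "\<And>i. right_submodule S V (D i)" "\<And>i. C \<subseteq> D i" "\<And>i. D i \<subseteq> A" "\<And>i. D (Suc i) \<subseteq> D i"
  obtain m where m: "\<And>i. i \<ge> m \<Longrightarrow> (D i <+>\<^bsub>V\<^esub> B, D (Suc i) <+>\<^bsub>V\<^esub> B) \<in> K"
  proof (rule kdim_stepE[OF AB, of "\<lambda>i. D i <+>\<^bsub>V\<^esub> B"])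
    show "right_submodule S V (D i <+>\<^bsub>V\<^esub> B)" "B \<subseteq> D i <+>\<^bsub>V\<^esub> B" "D i <+>\<^bsub>V\<^esub> B \<subseteq> A"
      "D (Suc i) <+>\<^bsub>V\<^esub> B \<subseteq> D i <+>\<^bsub>V\<^esub> B" for i
      using D B kdim_stepD[OF AB] submodule_sum_upper[OF D(1)[of i] B] submodule_sum
        submodule_sum_least[of A "D i" B]
        submodule_sum_least[OF submodule_sum[OF D(1)[of i] B], of "D (Suc i)" B]
      by (auto; blast)+
  qed blast
  obtain n where n: "\<And>i. i \<ge> n \<Longrightarrow> (D i \<inter> B, D (Suc i) \<inter> B) \<in> K"
  proof (rule kdim_stepE[OF BC, of "\<lambda>i. D i \<inter> B"])
    show "right_submodule S V (D i \<inter> B)" "C \<subseteq> D i \<inter> B" "D i \<inter> B \<subseteq> B" "D (Suc i) \<inter> B \<subseteq> D i \<inter> B" for i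
      using D B kdim_stepD[OF BC] submodule_Int by (auto; blast)+
  qed blast
  have "(D i, D (Suc i)) \<in> K" if "i \<ge> max m n" for i
  proof -
    \<comment> \<open>\<open>E\<close> splits the factor at \<open>i\<close> into a factor of the trace on \<open>A/B\<close> and one of the trace on \<open>B/C\<close>.\<close>
    define E where "E = D (Suc i) <+>\<^bsub>V\<^esub> (B \<inter> D i)"
    have sub: "right_submodule S V (D (Suc i) <+>\<^bsub>V\<^esub> B)" "right_submodule S V (D i \<inter> B)"
      using D B submodule_sum submodule_Int by auto
    have E: "E = (D (Suc i) <+>\<^bsub>V\<^esub> B) \<inter> D i"
      unfolding E_def using submodule_modular_law[OF D(1) B D(1) D(4)] by simp
    have "D i <+>\<^bsub>V\<^esub> (D (Suc i) <+>\<^bsub>V\<^esub> B) = D i <+>\<^bsub>V\<^esub> B"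
    proof
      have s: "right_submodule S V (D i <+>\<^bsub>V\<^esub> B)" by (rule submodule_sum[OF D(1) B])
      show "D i <+>\<^bsub>V\<^esub> (D (Suc i) <+>\<^bsub>V\<^esub> B) \<subseteq> D i <+>\<^bsub>V\<^esub> B"
        using submodule_sum_upper[OF D(1)[of i] B] D(4)[of i]
        by (intro submodule_sum_least[OF s]) auto
      show "D i <+>\<^bsub>V\<^esub> B \<subseteq> D i <+>\<^bsub>V\<^esub> (D (Suc i) <+>\<^bsub>V\<^esub> B)"
        using submodule_sum_upper[OF D(1)[of i] sub(1)] submodule_sum_upper[OF D(1)[of "Suc i"] B]
        by (intro submodule_sum_least submodule_sum D sub) auto
    qed
    hence "(D i, D i \<inter> (D (Suc i) <+>\<^bsub>V\<^esub> B)) \<in> K"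
      using K m[of i] that D(1) sub unfolding serre_class_def by (metis max.boundedE)
    hence DE: "(D i, E) \<in> K" by (simp add: E Int_commute)
    have "(D i \<inter> B) \<inter> D (Suc i) = D (Suc i) \<inter> B" using D(4)[of i] by blast
    hence "((D i \<inter> B) <+>\<^bsub>V\<^esub> D (Suc i), D (Suc i)) \<in> K"
      using K n[of i] that D(1) sub unfolding serre_class_def by (metis max.boundedE)
    moreover have "(D i \<inter> B) <+>\<^bsub>V\<^esub> D (Suc i) = E"
      unfolding E_def using submodule_sum_commute[OF sub(2) D(1)] by (simp add: Int_commute)
    ultimately show ?thesis using DE K unfolding serre_class_def by blast
  qed
  thus "\<exists>n. \<forall>i\<ge>n. (D i, D (Suc i)) \<in> K" by blast
qed (use kdim_stepD[OF AB] kdim_stepD[OF BC] in auto)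

lemma serre_class_step: "serre_class K \<Longrightarrow> serre_class (kdim_step S V K)"
  using serre_class_step_transpose serre_class_step_extension
  unfolding serre_class_def[of "kdim_step S V K"] by blast

text \<open>At a limit, the two ends of an extension may lie in different classes; as the classes form a chain,
  one of them contains both.\<close>

lemma kdim_class_serre:
  assumes "K \<in> kdim_classes S V"
  shows "serre_class K"
  using assms
proof induction
  case (limit \<K>)
  have "(A, C) \<in> \<Union>\<K>" if AB: "(A, B) \<in> \<Union>\<K>" and BC: "(B, C) \<in> \<Union>\<K>" for A B C
  proof -
    obtain K L where KL: "(A, B) \<in> K" "K \<in> \<K>" "(B, C) \<in> L" "L \<in> \<K>" using AB BC by (elim UnionE)
    moreover have "K \<subseteq> L \<or> L \<subseteq> K" using limit KL by (intro kdim_classes_chain) auto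
    ultimately obtain M where "M \<in> \<K>" "(A, B) \<in> M" "(B, C) \<in> M" by blast
    thus ?thesis using limit(3)[of M] unfolding serre_class_def by blast
  qed
  moreover have "(A <+>\<^bsub>V\<^esub> B, B) \<in> \<Union>\<K> \<longleftrightarrow> (A, A \<inter> B) \<in> \<Union>\<K>"
    if "right_submodule S V A" "right_submodule S V B" for A B
    using limit(3) that unfolding serre_class_def Union_iff by (intro bex_cong refl) blast
  ultimately show ?case unfolding serre_class_def by blast
qed (simp_all add: serre_class_zero serre_class_step)

lemma artinian_class: "artinian \<in> kdim_classes S V"
  by (intro kdim_classes.intros)

lemma artinian_extension:
  "(A, B) \<in> artinian \<Longrightarrow> (B, C) \<in> artinian \<Longrightarrow> (A, C) \<in> artinian"
  using kdim_class_serre[OF artinian_class] unfolding serre_class_def by blast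

lemma artinian_transpose:
  "right_submodule S V A \<Longrightarrow> right_submodule S V B \<Longrightarrow>
    (A <+>\<^bsub>V\<^esub> B, B) \<in> artinian \<longleftrightarrow> (A, A \<inter> B) \<in> artinian"
  using kdim_class_serre[OF artinian_class] unfolding serre_class_def by blast

lemma artinianI:
  assumes "right_submodule S V A" "right_submodule S V B" "B \<subseteq> A"
    and "\<And>C :: nat \<Rightarrow> 'v set. (\<And>i. right_submodule S V (C i)) \<Longrightarrow> (\<And>i. B \<subseteq> C i) \<Longrightarrow>
      (\<And>i. C i \<subseteq> A) \<Longrightarrow> (\<And>i. C (Suc i) \<subseteq> C i) \<Longrightarrow> \<exists>n. \<forall>i\<ge>n. C i = C (Suc i)"
  shows "(A, B) \<in> artinian"
proof (rule kdim_stepI[OF assms(1-3)])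
  fix C :: "nat \<Rightarrow> 'v set"
  assume C: "\<And>i. right_submodule S V (C i)" "\<And>i. B \<subseteq> C i" "\<And>i. C i \<subseteq> A" "\<And>i. C (Suc i) \<subseteq> C i"
  from assms(4)[of C, OF this] show "\<exists>n. \<forall>i\<ge>n. (C i, C (Suc i)) \<in> kdim_zero S V"
    using C(1) by (auto simp: kdim_zero_def)
qed

lemma artinianE:
  assumes "(A, B) \<in> artinian"
    and "\<And>i. right_submodule S V (C i)" "\<And>i. B \<subseteq> C i" "\<And>i. C i \<subseteq> A" "\<And>i. C (Suc i) \<subseteq> C i"
  obtains n where "\<And>i. i \<ge> n \<Longrightarrow> C i = C (Suc i)"
  by (rule kdim_stepE[where C = C, OF assms]) (auto simp: kdim_zero_def)

lemma artinian_subinterval: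
  assumes "(A, B) \<in> artinian" "right_submodule S V A'" "right_submodule S V B'"
    "B \<subseteq> B'" "B' \<subseteq> A'" "A' \<subseteq> A"
  shows "(A', B') \<in> artinian"
proof (rule artinianI)
  fix C :: "nat \<Rightarrow> 'v set"
  assume C: "\<And>i. right_submodule S V (C i)" "\<And>i. B' \<subseteq> C i" "\<And>i. C i \<subseteq> A'" "\<And>i. C (Suc i) \<subseteq> C i"
  obtain n where "\<And>i. i \<ge> n \<Longrightarrow> C i = C (Suc i)"
  proof (rule artinianE[OF assms(1), of C])
    show "B \<subseteq> C i" "C i \<subseteq> A" for i using C(2)[of i] C(3)[of i] assms(4,6) by auto
  qed (use C in auto)
  thus "\<exists>n. \<forall>i\<ge>n. C i = C (Suc i)" by blast
qed (use assms in auto)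

text \<open>A descending chain reaches \<open>B\<close>, and is then constant, or all its factors are artinian.\<close>

lemma kdim_le_1_if_proper_factors_artinian:
  assumes "right_submodule S V A" "right_submodule S V B" "B \<subseteq> A"
    and fac: "\<And>N. right_submodule S V N \<Longrightarrow> B \<subset> N \<Longrightarrow> N \<subseteq> A \<Longrightarrow> (A, N) \<in> artinian"
  shows "(A, B) \<in> kdim_step S V artinian"
proof (rule kdim_stepI[OF assms(1-3)])
  fix C :: "nat \<Rightarrow> 'v set"
  assume C: "\<And>i. right_submodule S V (C i)" "\<And>i. B \<subseteq> C i" "\<And>i. C i \<subseteq> A" "\<And>i. C (Suc i) \<subseteq> C i"
  have dec: "decseq C" using C(4) by (auto intro: decseq_SucI)
  show "\<exists>n. \<forall>i\<ge>n. (C i, C (Suc i)) \<in> artinian"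
  proof (cases "\<exists>n. C n = B")
    case True
    then obtain n where n: "C n = B" ..
    have "(C i, C (Suc i)) \<in> artinian" if "i \<ge> n" for i
    proof -
      have "C i = B" "C (Suc i) = B" using decseqD[OF dec] n C(2) that le_SucI by blast+
      thus ?thesis using kdim_zero_subset_step[OF subset_refl] assms(2) by (auto simp: kdim_zero_def)
    qed
    thus ?thesis by blast
  next
    case False
    have "(C i, C (Suc i)) \<in> artinian" for i
      using artinian_subinterval[OF fac[of "C (Suc i)"] C(1)[of i] C(1)[of "Suc i"]] C False by blast
    thus ?thesis by blast
  qed
qed

text \<open>A class that contains \<open>V/N\<close> but not \<open>V\<close>, where \<open>V\<close> has Krull dimension one, is too small to contain all
  subfactors of Krull dimension at most one, so it consists of artinian subfactors.\<close>

lemma one_critical_iff: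
  "n_critical 1 S V \<longleftrightarrow> (carrier V, {\<zero>\<^bsub>V\<^esub>}) \<notin> artinian \<and>
     (\<forall>N. right_submodule S V N \<and> N \<noteq> {\<zero>\<^bsub>V\<^esub>} \<longrightarrow> (carrier V, N) \<in> artinian)"
proof
  assume *: "n_critical 1 S V"
  hence V: "(carrier V, {\<zero>\<^bsub>V\<^esub>}) \<notin> artinian" "(carrier V, {\<zero>\<^bsub>V\<^esub>}) \<in> kdim_step S V artinian"
    by (auto simp: n_critical_def kdim_equals_def)
  have "(carrier V, N) \<in> artinian" if N: "right_submodule S V N" "N \<noteq> {\<zero>\<^bsub>V\<^esub>}" for N
  proof -
    obtain K where "K \<in> kdim_classes S V" "(carrier V, N) \<in> K" "(carrier V, {\<zero>\<^bsub>V\<^esub>}) \<notin> K"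
      using * N by (auto simp: n_critical_def critical_def kdim_less_def)
    thus ?thesis using kdim_class_cases[of K] V kdim_zero_subset_step[OF subset_refl] by blast
  qed
  thus "(carrier V, {\<zero>\<^bsub>V\<^esub>}) \<notin> artinian \<and>
     (\<forall>N. right_submodule S V N \<and> N \<noteq> {\<zero>\<^bsub>V\<^esub>} \<longrightarrow> (carrier V, N) \<in> artinian)"
    using V by blast
next
  assume *: "(carrier V, {\<zero>\<^bsub>V\<^esub>}) \<notin> artinian \<and>
     (\<forall>N. right_submodule S V N \<and> N \<noteq> {\<zero>\<^bsub>V\<^esub>} \<longrightarrow> (carrier V, N) \<in> artinian)"
  have "(carrier V, {\<zero>\<^bsub>V\<^esub>}) \<in> kdim_step S V artinian"
    using * by (intro kdim_le_1_if_proper_factors_artinian)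
      (auto simp: submodule_zero submodule_carrier)
  moreover have "kdim_step S V artinian \<in> kdim_classes S V" by (intro kdim_classes.intros)
  moreover have "carrier V \<noteq> {\<zero>\<^bsub>V\<^esub>}"
  proof
    assume "carrier V = {\<zero>\<^bsub>V\<^esub>}"
    thus False using * kdim_zero_subset_step[OF subset_refl] submodule_zero by (auto simp: kdim_zero_def)
  qed
  ultimately show "n_critical 1 S V" using * artinian_class right_module_axioms
    by (auto simp: n_critical_def critical_def has_kdim_def kdim_equals_def kdim_less_def)
qed

lemma simple_submodule_artinian:
  assumes A: "right_submodule S V A"
    and simple: "\<And>N. right_submodule S V N \<Longrightarrow> N \<subseteq> A \<Longrightarrow> N = {\<zero>\<^bsub>V\<^esub>} \<or> N = A"
  shows "(A, {\<zero>\<^bsub>V\<^esub>}) \<in> artinian"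
proof (rule artinianI)
  fix C :: "nat \<Rightarrow> 'v set"
  assume C: "\<And>i. right_submodule S V (C i)" "\<And>i. {\<zero>\<^bsub>V\<^esub>} \<subseteq> C i" "\<And>i. C i \<subseteq> A"
    "\<And>i. C (Suc i) \<subseteq> C i"
  have 01: "C i = {\<zero>\<^bsub>V\<^esub>} \<or> C i = A" for i using C(1,3) simple by blast
  show "\<exists>n. \<forall>i\<ge>n. C i = C (Suc i)"
  proof (cases "\<exists>n. C n = {\<zero>\<^bsub>V\<^esub>}")
    case True
    then obtain n where n: "C n = {\<zero>\<^bsub>V\<^esub>}" ..
    have "decseq C" using C(4) by (auto intro: decseq_SucI)
    hence "C i = {\<zero>\<^bsub>V\<^esub>}" if "i \<ge> n" for i using decseqD[of C n i] n C(2) that by blast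
    thus ?thesis by (intro exI[of _ n]) auto
  qed (use 01 in auto)
qed (use A submodule_zero right_submoduleD(2)[OF A] in auto)

lemma simple_kdim_zero:
  assumes "simple_module S V"
  shows "(carrier V, {\<zero>\<^bsub>V\<^esub>}) \<in> artinian"
  using assms by (intro simple_submodule_artinian submodule_carrier) (auto simp: simple_module_def)

lemma simple_critical:
  assumes "simple_module S V"
  shows "critical S V"
  unfolding critical_def
proof (intro conjI allI impI)
  show "has_kdim S V" unfolding has_kdim_def using simple_kdim_zero[OF assms] artinian_class by blast
  fix N assume "right_submodule S V N \<and> N \<noteq> {\<zero>\<^bsub>V\<^esub>}"
  hence "N = carrier V" using assms by (auto simp: simple_module_def)
  hence "(carrier V, N) \<in> kdim_zero S V" using submodule_carrier by (simp add: kdim_zero_def)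
  moreover have "(carrier V, {\<zero>\<^bsub>V\<^esub>}) \<notin> kdim_zero S V"
    using assms by (auto simp: kdim_zero_def simple_module_def)
  ultimately show "kdim_less S V (carrier V, N) (carrier V, {\<zero>\<^bsub>V\<^esub>})"
    unfolding kdim_less_def by (intro bexI[OF _ kdim_classes.zero]) simp
qed (use assms in \<open>auto simp: simple_module_def\<close>)

text \<open>A critical module has the Krull dimension of each of its nonzero submodules, so one
  submodule of Krull dimension at most one is enough.\<close>

lemma critical_simple_or_1_critical:
  assumes V: "critical S V" and N: "right_submodule S V N" "N \<noteq> {\<zero>\<^bsub>V\<^esub>}"
    and N2: "(N, {\<zero>\<^bsub>V\<^esub>}) \<in> kdim_step S V artinian"
  shows "simple_module S V \<or> n_critical 1 S V"
proof -
  have less: "\<exists>K\<in>kdim_classes S V. (carrier V, M) \<in> K \<and> (carrier V, {\<zero>\<^bsub>V\<^esub>}) \<notin> K"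
    if "right_submodule S V M" "M \<noteq> {\<zero>\<^bsub>V\<^esub>}" for M
    using V that by (auto simp: critical_def kdim_less_def)
  have 01: "kdim_zero S V \<subseteq> artinian" using kdim_zero_subset_step by blast
  hence 12: "artinian \<subseteq> kdim_step S V artinian" by (rule kdim_step_mono)
  have V2: "(carrier V, {\<zero>\<^bsub>V\<^esub>}) \<in> kdim_step S V artinian"
  proof -
    obtain K where K: "K \<in> kdim_classes S V" "(carrier V, N) \<in> K" "(carrier V, {\<zero>\<^bsub>V\<^esub>}) \<notin> K"
      using less[OF N] by blast
    have "\<not> kdim_step S V artinian \<subseteq> K"
      using K N2 kdim_class_serre[OF K(1)] unfolding serre_class_def by blast
    hence "(carrier V, N) \<in> kdim_step S V artinian" using kdim_class_cases[OF K(1)] K(2) 01 12 by blast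
    thus ?thesis using N2 kdim_class_serre[OF kdim_classes.step[OF artinian_class]]
      unfolding serre_class_def by blast
  qed
  show ?thesis
  proof (cases "(carrier V, {\<zero>\<^bsub>V\<^esub>}) \<in> artinian")
    case True
    have "M = carrier V" if M: "right_submodule S V M" "M \<noteq> {\<zero>\<^bsub>V\<^esub>}" for M
    proof -
      obtain K where K: "K \<in> kdim_classes S V" "(carrier V, M) \<in> K" "(carrier V, {\<zero>\<^bsub>V\<^esub>}) \<notin> K"
        using less[OF M] by blast
      hence "K = kdim_zero S V" using kdim_class_cases[OF K(1)] True V2 by blast
      thus ?thesis using K(2) by (auto simp: kdim_zero_def)
    qed
    thus ?thesis using V by (auto simp: simple_module_def critical_def)
  next
    case False
    thus ?thesis using V V2 by (simp add: n_critical_def kdim_equals_def)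
  qed
qed

text \<open>If \<open>M \<inter> N = 0\<close>, then \<open>M\<close> embeds in the artinian module \<open>V/N\<close>, and \<open>V\<close> is an extension of the artinian
  modules \<open>M\<close> and \<open>V/M\<close>.\<close>

lemma one_critical_uniform:
  assumes V: "n_critical 1 S V"
    and N: "right_submodule S V N" "N \<noteq> {\<zero>\<^bsub>V\<^esub>}" and M: "right_submodule S V M" "M \<noteq> {\<zero>\<^bsub>V\<^esub>}"
  shows "M \<inter> N \<noteq> {\<zero>\<^bsub>V\<^esub>}"
proof
  assume 0: "M \<inter> N = {\<zero>\<^bsub>V\<^esub>}"
  have V': "(carrier V, {\<zero>\<^bsub>V\<^esub>}) \<notin> artinian" "(carrier V, N) \<in> artinian" "(carrier V, M) \<in> artinian"
    using V N M unfolding one_critical_iff by simp_all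
  have "(M <+>\<^bsub>V\<^esub> N, N) \<in> artinian"
    using submodule_sum_upper(2)[OF M(1) N(1)] right_submoduleD(1)[OF submodule_sum[OF M(1) N(1)]]
    by (intro artinian_subinterval[OF V'(2) submodule_sum[OF M(1) N(1)] N(1)]) simp_all
  hence "(M, {\<zero>\<^bsub>V\<^esub>}) \<in> artinian" using artinian_transpose[OF M(1) N(1)] 0 by simp
  thus False using V'(1,3) artinian_extension by blast
qed

text \<open>For a normal element \<open>x\<close> of the ring, \<open>v \<mapsto> vx\<close> is semilinear, so it maps chains of
  submodules to chains of submodules.\<close>

lemma normal_kernel_submodule:
  assumes "x \<in> carrier S" and "\<And>s. s \<in> carrier S \<Longrightarrow> \<exists>t\<in>carrier S. s \<otimes>\<^bsub>S\<^esub> x = x \<otimes>\<^bsub>S\<^esub> t"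
    and N: "right_submodule S V N"
  shows "right_submodule S V {v \<in> carrier V. v \<cdot>\<^bsub>V\<^esub> x \<in> N}"
proof (rule right_submoduleI)
  note N' = right_submoduleD[OF N]
  fix v s assume v: "v \<in> {v \<in> carrier V. v \<cdot>\<^bsub>V\<^esub> x \<in> N}" and s: "s \<in> carrier S"
  obtain t where t: "t \<in> carrier S" "s \<otimes>\<^bsub>S\<^esub> x = x \<otimes>\<^bsub>S\<^esub> t" using assms s by blast
  have "(v \<cdot>\<^bsub>V\<^esub> s) \<cdot>\<^bsub>V\<^esub> x = (v \<cdot>\<^bsub>V\<^esub> x) \<cdot>\<^bsub>V\<^esub> t"
    using v s t assms(1) by (simp add: ract_assoc[symmetric])
  thus "v \<cdot>\<^bsub>V\<^esub> s \<in> {v \<in> carrier V. v \<cdot>\<^bsub>V\<^esub> x \<in> N}" using v s t N'(5) by (auto simp: ract_closed)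
qed (use right_submoduleD[OF N] assms(1) in \<open>auto simp: ract_l_distr\<close>)

lemma normal_image_submodule:
  assumes "x \<in> carrier S" and "\<And>s. s \<in> carrier S \<Longrightarrow> \<exists>t\<in>carrier S. x \<otimes>\<^bsub>S\<^esub> s = t \<otimes>\<^bsub>S\<^esub> x"
    and N: "right_submodule S V N"
  shows "right_submodule S V ((\<lambda>v. v \<cdot>\<^bsub>V\<^esub> x) ` N)"
proof (rule right_submoduleI)
  note N' = right_submoduleD[OF N]
  show "(\<lambda>v. v \<cdot>\<^bsub>V\<^esub> x) ` N \<subseteq> carrier V" using N' assms(1) by (auto simp: ract_closed)
  show "\<zero>\<^bsub>V\<^esub> \<in> (\<lambda>v. v \<cdot>\<^bsub>V\<^esub> x) ` N" using N'(2) assms(1) zero_ract by (metis imageI)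
  fix v assume v: "v \<in> (\<lambda>v. v \<cdot>\<^bsub>V\<^esub> x) ` N"
  then obtain v' where v': "v' \<in> N" "v = v' \<cdot>\<^bsub>V\<^esub> x" by blast
  {
    fix w assume "w \<in> (\<lambda>v. v \<cdot>\<^bsub>V\<^esub> x) ` N"
    then obtain w' where w': "w' \<in> N" "w = w' \<cdot>\<^bsub>V\<^esub> x" by blast
    hence "v \<oplus>\<^bsub>V\<^esub> w = (v' \<oplus>\<^bsub>V\<^esub> w') \<cdot>\<^bsub>V\<^esub> x"
      using v' subsetD[OF N'(1)] assms(1) by (simp add: ract_l_distr)
    thus "v \<oplus>\<^bsub>V\<^esub> w \<in> (\<lambda>v. v \<cdot>\<^bsub>V\<^esub> x) ` N" using N'(3) v' w' by blast
  }
  fix s assume s: "s \<in> carrier S"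
  obtain t where t: "t \<in> carrier S" "x \<otimes>\<^bsub>S\<^esub> s = t \<otimes>\<^bsub>S\<^esub> x" using assms s by blast
  have "v \<cdot>\<^bsub>V\<^esub> s = (v' \<cdot>\<^bsub>V\<^esub> t) \<cdot>\<^bsub>V\<^esub> x"
    using v' N'(1) s t assms(1) by (metis ract_assoc subsetD)
  thus "v \<cdot>\<^bsub>V\<^esub> s \<in> (\<lambda>v. v \<cdot>\<^bsub>V\<^esub> x) ` N" using N'(5) v' t by blast
qed

text \<open>If \<open>x\<close> has a nonzero kernel and a nonzero image on \<open>V\<close>, then the factors of \<open>V\<close> by both are artinian.
  The image is itself a twisted copy of the factor by the kernel, so \<open>V\<close> would be artinian.\<close>

lemma one_critical_normal_dichotomy:
  assumes V: "n_critical 1 S V" and x: "x \<in> carrier S"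
    and xl: "\<And>s. s \<in> carrier S \<Longrightarrow> \<exists>t\<in>carrier S. s \<otimes>\<^bsub>S\<^esub> x = x \<otimes>\<^bsub>S\<^esub> t"
    and xr: "\<And>s. s \<in> carrier S \<Longrightarrow> \<exists>t\<in>carrier S. x \<otimes>\<^bsub>S\<^esub> s = t \<otimes>\<^bsub>S\<^esub> x"
  shows "(\<forall>v\<in>carrier V. v \<cdot>\<^bsub>V\<^esub> x = \<zero>\<^bsub>V\<^esub>) \<or> (\<forall>v\<in>carrier V. v \<cdot>\<^bsub>V\<^esub> x = \<zero>\<^bsub>V\<^esub> \<longrightarrow> v = \<zero>\<^bsub>V\<^esub>)"
proof (rule ccontr)
  assume "\<not> ?thesis"
  then obtain u w where u: "u \<in> carrier V" "u \<cdot>\<^bsub>V\<^esub> x \<noteq> \<zero>\<^bsub>V\<^esub>" and w: "w \<in> carrier V" "w \<cdot>\<^bsub>V\<^esub> x = \<zero>\<^bsub>V\<^esub>" "w \<noteq> \<zero>\<^bsub>V\<^esub>"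
    by blast
  define ker where "ker = {v \<in> carrier V. v \<cdot>\<^bsub>V\<^esub> x \<in> {\<zero>\<^bsub>V\<^esub>}}"
  define im where "im = (\<lambda>v. v \<cdot>\<^bsub>V\<^esub> x) ` carrier V"
  have ker: "right_submodule S V ker"
    unfolding ker_def by (rule normal_kernel_submodule[OF x xl submodule_zero])
  have im: "right_submodule S V im"
    unfolding im_def by (rule normal_image_submodule[OF x xr submodule_carrier])
  have "(carrier V, ker) \<in> artinian" using V ker w unfolding one_critical_iff ker_def by blast
  \<comment> \<open>The image is isomorphic to the quotient by the kernel, up to a twist of the action.\<close>
  moreover have "(im, {\<zero>\<^bsub>V\<^esub>}) \<in> artinian" if *: "(carrier V, ker) \<in> artinian"
  proof (rule artinianI)
    fix C :: "nat \<Rightarrow> 'v set"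
    assume C: "\<And>i. right_submodule S V (C i)" "\<And>i. {\<zero>\<^bsub>V\<^esub>} \<subseteq> C i" "\<And>i. C i \<subseteq> im"
      "\<And>i. C (Suc i) \<subseteq> C i"
    define D where "D i = {v \<in> carrier V. v \<cdot>\<^bsub>V\<^esub> x \<in> C i}" for i
    obtain n where n: "\<And>i. i \<ge> n \<Longrightarrow> D i = D (Suc i)"
    proof (rule artinianE[OF *, of D])
      show "right_submodule S V (D i)" for i
        unfolding D_def by (rule normal_kernel_submodule[OF x xl C(1)])
    qed (use C(2) subsetD[OF C(4)] in \<open>auto simp: D_def ker_def\<close>)
    have "C i = (\<lambda>v. v \<cdot>\<^bsub>V\<^esub> x) ` D i" for i using C(3)[of i] by (auto simp: D_def im_def)
    thus "\<exists>n. \<forall>i\<ge>n. C i = C (Suc i)" using n by metis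
  qed (use im submodule_zero right_submoduleD(2)[OF im] in auto)
  moreover have "(carrier V, im) \<in> artinian"
    using V im u unfolding one_critical_iff im_def by blast
  ultimately show False using V artinian_extension unfolding one_critical_iff by blast
qed

end

section \<open>Isomorphism and hull similarity\<close>

definition is_mod_iso where
  "is_mod_iso S V W h \<longleftrightarrow> bij_betw h (carrier V) (carrier W) \<and>
        (\<forall>v\<in>carrier V. \<forall>w\<in>carrier V. h (v \<oplus>\<^bsub>V\<^esub> w) = h v \<oplus>\<^bsub>W\<^esub> h w) \<and>
        (\<forall>v\<in>carrier V. \<forall>s\<in>carrier S. h (v \<cdot>\<^bsub>V\<^esub> s) = h v \<cdot>\<^bsub>W\<^esub> s)"

lemma mod_iso_iff: "mod_iso S V W \<longleftrightarrow> (\<exists>h. is_mod_iso S V W h)"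
  by (simp add: mod_iso_def is_mod_iso_def)

lemma mod_iso_refl: "mod_iso S V V"
  unfolding mod_iso_def by (intro exI[of _ "\<lambda>x. x"]) (auto simp: bij_betw_def)

lemma mod_iso_sym:
  assumes "right_module S V" "mod_iso S V W"
  shows "mod_iso S W V"
proof -
  interpret V: right_module S V by fact
  obtain h where h: "is_mod_iso S V W h" using assms by (auto simp: mod_iso_iff)
  hence b: "bij_betw h (carrier V) (carrier W)" by (simp add: is_mod_iso_def)
  define g where "g = inv_into (carrier V) h"
  have g: "bij_betw g (carrier W) (carrier V)" unfolding g_def by (rule bij_betw_inv_into[OF b])
  have hg: "h (g w) = w" "g w \<in> carrier V" if "w \<in> carrier W" for w
    using that b g by (auto simp: g_def bij_betw_def f_inv_into_f)
  have gh: "g (h v) = v" if "v \<in> carrier V" for v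
    using that b by (auto simp: g_def bij_betw_def inv_into_f_f)
  have "g (v \<oplus>\<^bsub>W\<^esub> w) = g v \<oplus>\<^bsub>V\<^esub> g w" if "v \<in> carrier W" "w \<in> carrier W" for v w
  proof -
    have "h (g v \<oplus>\<^bsub>V\<^esub> g w) = v \<oplus>\<^bsub>W\<^esub> w" using h hg that by (simp add: is_mod_iso_def)
    thus ?thesis using gh[of "g v \<oplus>\<^bsub>V\<^esub> g w"] hg that by simp
  qed
  moreover have "g (v \<cdot>\<^bsub>W\<^esub> s) = g v \<cdot>\<^bsub>V\<^esub> s" if "v \<in> carrier W" "s \<in> carrier S" for v s
  proof -
    have "h (g v \<cdot>\<^bsub>V\<^esub> s) = v \<cdot>\<^bsub>W\<^esub> s" using h hg that by (simp add: is_mod_iso_def)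
    thus ?thesis using gh[of "g v \<cdot>\<^bsub>V\<^esub> s"] hg that by (simp add: V.ract_closed)
  qed
  ultimately show ?thesis using g by (auto simp: mod_iso_iff is_mod_iso_def)
qed

lemma mod_iso_trans:
  assumes "mod_iso S V W" "mod_iso S W U"
  shows "mod_iso S V U"
proof -
  obtain h g where h: "is_mod_iso S V W h" and g: "is_mod_iso S W U g"
    using assms by (auto simp: mod_iso_iff)
  hence "h v \<in> carrier W" if "v \<in> carrier V" for v
    using that by (auto simp: is_mod_iso_def bij_betw_def)
  hence "is_mod_iso S V U (g \<circ> h)"
    using h g by (auto simp: is_mod_iso_def intro: bij_betw_trans)
  thus ?thesis by (auto simp: mod_iso_iff)
qed

lemma is_mod_iso_zero:
  assumes "right_module S V" "right_module S W" "is_mod_iso S V W h"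
  shows "h \<zero>\<^bsub>V\<^esub> = \<zero>\<^bsub>W\<^esub>"
proof -
  interpret V: right_module S V by fact
  interpret W: right_module S W by fact
  have "h \<zero>\<^bsub>V\<^esub> \<in> carrier W" using assms(3) by (auto simp: is_mod_iso_def bij_betw_def)
  moreover have "h (\<zero>\<^bsub>V\<^esub> \<cdot>\<^bsub>V\<^esub> \<zero>\<^bsub>S\<^esub>) = h \<zero>\<^bsub>V\<^esub> \<cdot>\<^bsub>W\<^esub> \<zero>\<^bsub>S\<^esub>"
    using assms(3) by (simp add: is_mod_iso_def del: V.zero_ract V.ract_zero)
  ultimately show ?thesis by simp
qed

lemma mod_iso_annihilates:
  assumes "right_module S V" "right_module S W" "mod_iso S V W" "s \<in> carrier S"
    and "\<forall>v\<in>carrier V. v \<cdot>\<^bsub>V\<^esub> s = \<zero>\<^bsub>V\<^esub>"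
  shows "\<forall>w\<in>carrier W. w \<cdot>\<^bsub>W\<^esub> s = \<zero>\<^bsub>W\<^esub>"
proof
  obtain h where h: "is_mod_iso S V W h" using assms by (auto simp: mod_iso_iff)
  fix w assume "w \<in> carrier W"
  then obtain v where "v \<in> carrier V" "w = h v" using h unfolding is_mod_iso_def bij_betw_def by blast
  thus "w \<cdot>\<^bsub>W\<^esub> s = \<zero>\<^bsub>W\<^esub>"
    using h assms(4,5) is_mod_iso_zero[OF assms(1,2) h] unfolding is_mod_iso_def by metis
qed

text \<open>The isomorphism is \<open>vs \<mapsto> ws\<close>; equality of the annihilators makes it well defined and injective.\<close>

lemma mod_iso_of_same_annihilator:
  assumes V: "right_module S V" and W: "right_module S W"
    and v: "v \<in> carrier V" "carrier V = right_module.cyclic_submodule S V v"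
    and w: "w \<in> carrier W" "carrier W = right_module.cyclic_submodule S W w"
    and ann: "\<And>s. s \<in> carrier S \<Longrightarrow> v \<cdot>\<^bsub>V\<^esub> s = \<zero>\<^bsub>V\<^esub> \<longleftrightarrow> w \<cdot>\<^bsub>W\<^esub> s = \<zero>\<^bsub>W\<^esub>"
  shows "mod_iso S V W"
proof -
  interpret V: right_module S V by fact
  interpret W: right_module S W by fact
  have ann2: "v \<cdot>\<^bsub>V\<^esub> s = v \<cdot>\<^bsub>V\<^esub> t \<longleftrightarrow> w \<cdot>\<^bsub>W\<^esub> s = w \<cdot>\<^bsub>W\<^esub> t" if "s \<in> carrier S" "t \<in> carrier S" for s t
  proof -
    have "v \<cdot>\<^bsub>V\<^esub> s = v \<cdot>\<^bsub>V\<^esub> t \<longleftrightarrow> v \<cdot>\<^bsub>V\<^esub> (s \<ominus>\<^bsub>S\<^esub> t) = \<zero>\<^bsub>V\<^esub>"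
      using that v(1) V.V.minus_eq_zero_iff[of "v \<cdot>\<^bsub>V\<^esub> s" "v \<cdot>\<^bsub>V\<^esub> t"]
      by (simp add: a_minus_def V.ract_r_distr V.ract_minus V.ract_closed)
    also have "\<dots> \<longleftrightarrow> w \<cdot>\<^bsub>W\<^esub> (s \<ominus>\<^bsub>S\<^esub> t) = \<zero>\<^bsub>W\<^esub>" using that by (intro ann) simp
    also have "\<dots> \<longleftrightarrow> w \<cdot>\<^bsub>W\<^esub> s = w \<cdot>\<^bsub>W\<^esub> t"
      using that w(1) W.V.minus_eq_zero_iff[of "w \<cdot>\<^bsub>W\<^esub> s" "w \<cdot>\<^bsub>W\<^esub> t"]
      by (simp add: a_minus_def W.ract_r_distr W.ract_minus W.ract_closed)
    finally show ?thesis .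
  qed
  define h where "h x = w \<cdot>\<^bsub>W\<^esub> (SOME s. s \<in> carrier S \<and> x = v \<cdot>\<^bsub>V\<^esub> s)" for x
  have h: "h (v \<cdot>\<^bsub>V\<^esub> s) = w \<cdot>\<^bsub>W\<^esub> s" if "s \<in> carrier S" for s
    unfolding h_def by (rule someI2[of _ s]) (use that ann2 in auto)
  have "is_mod_iso S V W h"
    unfolding is_mod_iso_def
  proof (intro conjI ballI)
    show "bij_betw h (carrier V) (carrier W)"
      unfolding bij_betw_def inj_on_def v(2) w(2) V.cyclic_submodule_def W.cyclic_submodule_def
      using h ann2 by (force simp: image_iff)
  next
    fix a b assume "a \<in> carrier V" "b \<in> carrier V"
    then obtain s t where st: "s \<in> carrier S" "t \<in> carrier S" "a = v \<cdot>\<^bsub>V\<^esub> s" "b = v \<cdot>\<^bsub>V\<^esub> t"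
      unfolding v(2) V.cyclic_submodule_def by blast
    show "h (a \<oplus>\<^bsub>V\<^esub> b) = h a \<oplus>\<^bsub>W\<^esub> h b"
      using st v(1) w(1) h by (simp add: V.ract_r_distr[symmetric] W.ract_r_distr)
  next
    fix a t assume "a \<in> carrier V" and t: "t \<in> carrier S"
    then obtain s where st: "s \<in> carrier S" "a = v \<cdot>\<^bsub>V\<^esub> s"
      unfolding v(2) V.cyclic_submodule_def by blast
    show "h (a \<cdot>\<^bsub>V\<^esub> t) = h a \<cdot>\<^bsub>W\<^esub> t"
      using st t v(1) w(1) h by (simp add: V.ract_assoc[symmetric] W.ract_assoc)
  qed
  thus ?thesis by (auto simp: mod_iso_iff)
qed

lemma hull_similar_refl:
  assumes "right_module S V" "carrier V \<noteq> {\<zero>\<^bsub>V\<^esub>}"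
  shows "hull_similar S V V"
  using assms right_module.submodule_carrier[OF assms(1)] mod_iso_refl
  unfolding hull_similar_def by blast

lemma hull_similar_sym:
  assumes "right_module S V" "hull_similar S V W"
  shows "hull_similar S W V"
  using assms mod_iso_sym[OF right_module.module_of_submodule[OF assms(1)]]
  unfolding hull_similar_def by blast

text \<open>The two submodules of \<open>W\<close> involved have a nonzero intersection because \<open>W\<close> is uniform; both
  isomorphisms are restricted to it.\<close>

lemma hull_similar_trans:
  assumes V: "right_module S V" and W: "right_module S W" "n_critical 1 S W" and U: "right_module S U"
    and VW: "hull_similar S V W" and WU: "hull_similar S W U"
  shows "hull_similar S V U"
proof -
  interpret V: right_module S V by fact
  interpret W: right_module S W by fact
  interpret U: right_module S U by fact
  obtain N N1 h where N: "right_submodule S V N" "N \<noteq> {\<zero>\<^bsub>V\<^esub>}" "right_submodule S W N1" "N1 \<noteq> {\<zero>\<^bsub>W\<^esub>}"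
    and h: "is_mod_iso S (V\<lparr>carrier := N\<rparr>) (W\<lparr>carrier := N1\<rparr>) h"
    using VW unfolding hull_similar_def mod_iso_iff by blast
  obtain M1 M g where M: "right_submodule S W M1" "M1 \<noteq> {\<zero>\<^bsub>W\<^esub>}" "right_submodule S U M" "M \<noteq> {\<zero>\<^bsub>U\<^esub>}"
    and g: "is_mod_iso S (W\<lparr>carrier := M1\<rparr>) (U\<lparr>carrier := M\<rparr>) g"
    using WU unfolding hull_similar_def mod_iso_iff by blast
  define L where "L = M1 \<inter> N1"
  have L: "right_submodule S W L" "L \<noteq> {\<zero>\<^bsub>W\<^esub>}"
    unfolding L_def using N M W.submodule_Int W.one_critical_uniform[OF W(2)] by auto
  note mN = V.module_of_submodule[OF N(1)] and mN1 = W.module_of_submodule[OF N(3)]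
    and mM1 = W.module_of_submodule[OF M(1)] and mM = U.module_of_submodule[OF M(3)]
  define P where "P = {v \<in> N. h v \<in> L}"
  define Q where "Q = g ` L"
  have h': "bij_betw h N N1" "\<And>v w. v \<in> N \<Longrightarrow> w \<in> N \<Longrightarrow> h (v \<oplus>\<^bsub>V\<^esub> w) = h v \<oplus>\<^bsub>W\<^esub> h w"
    "\<And>v s. v \<in> N \<Longrightarrow> s \<in> carrier S \<Longrightarrow> h (v \<cdot>\<^bsub>V\<^esub> s) = h v \<cdot>\<^bsub>W\<^esub> s" "h \<zero>\<^bsub>V\<^esub> = \<zero>\<^bsub>W\<^esub>"
    using h is_mod_iso_zero[OF mN mN1 h] by (auto simp: is_mod_iso_def)
  have g': "bij_betw g M1 M" "\<And>v w. v \<in> M1 \<Longrightarrow> w \<in> M1 \<Longrightarrow> g (v \<oplus>\<^bsub>W\<^esub> w) = g v \<oplus>\<^bsub>U\<^esub> g w"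
    "\<And>v s. v \<in> M1 \<Longrightarrow> s \<in> carrier S \<Longrightarrow> g (v \<cdot>\<^bsub>W\<^esub> s) = g v \<cdot>\<^bsub>U\<^esub> s" "g \<zero>\<^bsub>W\<^esub> = \<zero>\<^bsub>U\<^esub>"
    using g is_mod_iso_zero[OF mM1 mM g] by (auto simp: is_mod_iso_def)
  note N0 = right_submoduleD[OF N(1)] and L0 = right_submoduleD[OF L(1)]
    and M0 = right_submoduleD[OF M(3)] and M10 = right_submoduleD[OF M(1)]
  have P: "right_submodule S V P"
    by (rule V.right_submoduleI) (use N0 L0 h' in \<open>auto simp: P_def\<close>)
  have Q: "right_submodule S U Q"
  proof (rule U.right_submoduleI)
    show "Q \<subseteq> carrier U" using g'(1) M0(1) by (auto simp: Q_def L_def bij_betw_def)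
    show "\<zero>\<^bsub>U\<^esub> \<in> Q" using L0(2) g'(4) by (force simp: Q_def)
  next
    fix v w assume "v \<in> Q" "w \<in> Q"
    then obtain a b where "a \<in> L" "b \<in> L" "v = g a" "w = g b" by (auto simp: Q_def)
    thus "v \<oplus>\<^bsub>U\<^esub> w \<in> Q" using g'(2)[of a b] L0(3)[of a b] unfolding Q_def L_def by (metis IntD1 imageI)
  next
    fix v s assume "v \<in> Q" "s \<in> carrier S"
    then obtain a where "a \<in> L" "v = g a" by (auto simp: Q_def)
    thus "v \<cdot>\<^bsub>U\<^esub> s \<in> Q" using g'(3)[of a s] L0(5)[of a s] \<open>s \<in> carrier S\<close> unfolding Q_def L_def by (metis IntD1 imageI)
  qed
  have hPL: "bij_betw h P L" unfolding bij_betw_def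
  proof
    show "inj_on h P" using h'(1) by (auto simp: bij_betw_def P_def inj_on_def)
    show "h ` P = L" using h'(1) by (auto simp: bij_betw_def P_def L_def)
  qed
  have gLQ: "bij_betw g L Q"
    using g'(1) unfolding Q_def L_def bij_betw_def by (auto intro: inj_on_subset)
  obtain l where l: "l \<in> L" "l \<noteq> \<zero>\<^bsub>W\<^esub>" using W.nonzero_submodule_obtains[OF L] .
  obtain p where p: "p \<in> P" "h p = l" using hPL l by (auto simp: bij_betw_def)
  have "P \<noteq> {\<zero>\<^bsub>V\<^esub>}" using p l h'(4) by auto
  moreover have "Q \<noteq> {\<zero>\<^bsub>U\<^esub>}"
  proof -
    have "g l \<noteq> g \<zero>\<^bsub>W\<^esub>" using gLQ l L0(2) by (auto simp: bij_betw_def inj_on_def)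
    thus ?thesis using l g'(4) by (auto simp: Q_def)
  qed
  moreover have "mod_iso S (V\<lparr>carrier := P\<rparr>) (W\<lparr>carrier := L\<rparr>)"
    unfolding mod_iso_iff is_mod_iso_def using hPL h' by (auto simp: P_def)
  moreover have "mod_iso S (W\<lparr>carrier := L\<rparr>) (U\<lparr>carrier := Q\<rparr>)"
    unfolding mod_iso_iff is_mod_iso_def using gLQ g' by (auto simp: L_def)
  ultimately show ?thesis using P Q mod_iso_trans unfolding hull_similar_def by blast
qed

section \<open>Cyclic modules\<close>

definition right_ideal :: "('s, 'm) ring_scheme \<Rightarrow> 's set \<Rightarrow> bool" where
  "right_ideal S I \<longleftrightarrow> additive_subgroup I S \<and> (\<forall>a\<in>I. \<forall>s\<in>carrier S. a \<otimes>\<^bsub>S\<^esub> s \<in> I)"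

lemma cyclic_module_sel [simp]:
  "carrier (cyclic_module S I) = a_rcosets\<^bsub>S\<^esub> I"
  "\<zero>\<^bsub>cyclic_module S I\<^esub> = I"
  "add (cyclic_module S I) = set_add S"
  by (simp_all add: cyclic_module_def)

context ring
begin

lemma right_idealI:
  assumes "I \<subseteq> carrier R" "\<zero> \<in> I" "\<And>a b. a \<in> I \<Longrightarrow> b \<in> I \<Longrightarrow> a \<oplus> b \<in> I"
    and act: "\<And>a s. a \<in> I \<Longrightarrow> s \<in> carrier R \<Longrightarrow> a \<otimes> s \<in> I"
  shows "right_ideal R I"
proof -
  have "\<ominus> a \<in> I" if "a \<in> I" for a
    using that act[of a "\<ominus> \<one>"] assms(1) by (auto simp: r_minus)
  hence "additive_subgroup I R"
    using assms by (intro additive_subgroup.intro add.subgroupI) (auto simp: a_inv_def[symmetric])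
  thus ?thesis using act by (auto simp: right_ideal_def)
qed

lemma right_ideal_right_ideal_gen:
  assumes "c \<in> carrier R"
  shows "right_ideal R (right_ideal_gen R c)"
proof (rule right_idealI)
  have eq: "right_ideal_gen R c = {c \<otimes> s | s. s \<in> carrier R}"
    by (auto simp: right_ideal_gen_def l_coset_def)
  show "right_ideal_gen R c \<subseteq> carrier R" using assms by (auto simp: eq)
  show "\<zero> \<in> right_ideal_gen R c" unfolding eq using assms r_null by (metis (mono_tags) mem_Collect_eq zero_closed)
  show "a \<oplus> b \<in> right_ideal_gen R c" if "a \<in> right_ideal_gen R c" "b \<in> right_ideal_gen R c" for a b
    using that assms unfolding eq by clarsimp (metis r_distr a_closed)
  show "a \<otimes> b \<in> right_ideal_gen R c" if "a \<in> right_ideal_gen R c" "b \<in> carrier R" for a b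
    using that assms unfolding eq by clarsimp (metis m_assoc m_closed)
qed

lemma right_ideal_set_add:
  assumes "right_ideal R I" "right_ideal R J"
  shows "right_ideal R (I <+>\<^bsub>R\<^esub> J)"
  unfolding right_ideal_def
proof (intro conjI ballI)
  show "additive_subgroup (I <+>\<^bsub>R\<^esub> J) R"
    using assms add_additive_subgroups by (auto simp: right_ideal_def)
  fix a s assume "a \<in> I <+>\<^bsub>R\<^esub> J" and s: "s \<in> carrier R"
  then obtain i j where *: "i \<in> I" "j \<in> J" "a = i \<oplus> j" by (auto simp: set_add_def')
  moreover have "i \<in> carrier R" "j \<in> carrier R"
    using * assms additive_subgroup.a_subset unfolding right_ideal_def by blast+
  ultimately have "a \<otimes> s = i \<otimes> s \<oplus> j \<otimes> s" "i \<otimes> s \<in> I" "j \<otimes> s \<in> J"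
    using assms s by (auto simp: l_distr right_ideal_def)
  thus "a \<otimes> s \<in> I <+>\<^bsub>R\<^esub> J" by (auto simp: set_add_def')
qed

lemma cyclic_module_act:
  assumes I: "right_ideal R I" and a: "a \<in> carrier R" and s: "s \<in> carrier R"
  shows "(I +> a) \<cdot>\<^bsub>cyclic_module R I\<^esub> s = I +> (a \<otimes> s)"
proof -
  interpret I: additive_subgroup I R using I by (simp add: right_ideal_def)
  interpret I: abelian_subgroup I R by (rule abelian_subgroupI3) unfold_locales
  have "I +> (x \<otimes> s) = I +> (a \<otimes> s)" if x: "x \<in> I +> a" for x
  proof -
    obtain i where i: "i \<in> I" "x = i \<oplus> a" using x by (auto simp: a_r_coset_def')
    have ic: "i \<in> carrier R" using i(1) I.a_subset by auto
    have "i \<otimes> s \<in> I" using i s I by (auto simp: right_ideal_def)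
    moreover have "x \<otimes> s = i \<otimes> s \<oplus> a \<otimes> s" using i ic a s by (simp add: l_distr)
    ultimately have "x \<otimes> s \<in> I +> (a \<otimes> s)" by (auto simp: a_r_coset_def')
    thus ?thesis using a s I.a_repr_independence'[of "x \<otimes> s" "a \<otimes> s"] by simp
  qed
  moreover have "a \<in> I +> a" using a by (rule I.a_rcos_self)
  ultimately have "(\<Union>x\<in>I +> a. I +> (x \<otimes> s)) = I +> (a \<otimes> s)" by (intro SUP_eq_const) blast+
  thus ?thesis by (simp add: cyclic_module_def)
qed

lemma cyclic_module_right_module:
  assumes I: "right_ideal R I"
  shows "right_module R (cyclic_module R I)"
proof -
  interpret I: additive_subgroup I R using I by (simp add: right_ideal_def)
  interpret I: abelian_subgroup I R by (rule abelian_subgroupI3) unfold_locales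
  let ?V = "cyclic_module R I"
  have car: "C \<in> carrier ?V \<longleftrightarrow> (\<exists>a\<in>carrier R. C = I +> a)" for C
    by (auto simp: A_RCOSETS_def')
  have zero: "I +> \<zero> = I" by (simp add: a_coset_add_zero I.a_subset)
  have ab: "abelian_group ?V"
  proof (rule abelian_groupI)
    show "\<zero>\<^bsub>?V\<^esub> \<in> carrier ?V" unfolding car using zero by (auto intro!: bexI[of _ "\<zero>"])
    fix C assume "C \<in> carrier ?V"
    then obtain a where a: "a \<in> carrier R" "C = I +> a" unfolding car by blast
    show "\<zero>\<^bsub>?V\<^esub> \<oplus>\<^bsub>?V\<^esub> C = C" using a I.a_rcos_sum[of "\<zero>" a] zero by simp
    show "\<exists>D\<in>carrier ?V. D \<oplus>\<^bsub>?V\<^esub> C = \<zero>\<^bsub>?V\<^esub>"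
      using a I.a_rcos_sum[of "\<ominus> a" a] zero by (intro bexI[of _ "I +> \<ominus> a"]) (auto simp: l_neg car simp del: cyclic_module_sel(1))
  next
    fix C D assume "C \<in> carrier ?V" "D \<in> carrier ?V"
    then obtain a b where ab: "a \<in> carrier R" "C = I +> a" "b \<in> carrier R" "D = I +> b" unfolding car by blast
    show "C \<oplus>\<^bsub>?V\<^esub> D \<in> carrier ?V" unfolding car using ab by (auto simp: I.a_rcos_sum)
    show "C \<oplus>\<^bsub>?V\<^esub> D = D \<oplus>\<^bsub>?V\<^esub> C" using ab by (simp add: I.a_rcos_sum a_comm)
    fix E assume "E \<in> carrier ?V"
    then obtain c where "c \<in> carrier R" "E = I +> c" unfolding car by blast
    thus "(C \<oplus>\<^bsub>?V\<^esub> D) \<oplus>\<^bsub>?V\<^esub> E = C \<oplus>\<^bsub>?V\<^esub> (D \<oplus>\<^bsub>?V\<^esub> E)" using ab by (simp add: I.a_rcos_sum a_assoc)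
  qed
  show ?thesis
  proof (intro right_module.intro right_module_axioms.intro)
    show "ring R" by (rule ring_axioms)
    show "abelian_group ?V" by (rule ab)
    fix C s assume "C \<in> carrier ?V" and s: "s \<in> carrier R"
    then obtain a where a: "a \<in> carrier R" "C = I +> a" unfolding car by blast
    show "C \<cdot>\<^bsub>?V\<^esub> s \<in> carrier ?V" unfolding car using a s by (auto simp: cyclic_module_act[OF I])
    {
      fix D assume "D \<in> carrier ?V"
      then obtain b where "b \<in> carrier R" "D = I +> b" unfolding car by blast
      thus "(C \<oplus>\<^bsub>?V\<^esub> D) \<cdot>\<^bsub>?V\<^esub> s = C \<cdot>\<^bsub>?V\<^esub> s \<oplus>\<^bsub>?V\<^esub> D \<cdot>\<^bsub>?V\<^esub> s"
        using a s by (simp add: cyclic_module_act[OF I] I.a_rcos_sum l_distr)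
    }
    fix t assume t: "t \<in> carrier R"
    show "C \<cdot>\<^bsub>?V\<^esub> (s \<oplus> t) = C \<cdot>\<^bsub>?V\<^esub> s \<oplus>\<^bsub>?V\<^esub> C \<cdot>\<^bsub>?V\<^esub> t"
      using a s t by (simp add: cyclic_module_act[OF I] I.a_rcos_sum r_distr)
    show "C \<cdot>\<^bsub>?V\<^esub> (s \<otimes> t) = (C \<cdot>\<^bsub>?V\<^esub> s) \<cdot>\<^bsub>?V\<^esub> t"
      using a s t by (simp add: cyclic_module_act[OF I] m_assoc)
  next
    fix C assume "C \<in> carrier ?V"
    then obtain a where a: "a \<in> carrier R" "C = I +> a" unfolding car by blast
    thus "C \<cdot>\<^bsub>?V\<^esub> \<one> = C" by (simp add: cyclic_module_act[OF I])
  qed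
qed

lemma cyclic_module_generator:
  assumes I: "right_ideal R I"
  shows "I +> \<one> \<in> carrier (cyclic_module R I)"
    "carrier (cyclic_module R I) = right_module.cyclic_submodule R (cyclic_module R I) (I +> \<one>)"
    "s \<in> carrier R \<Longrightarrow> (I +> \<one>) \<cdot>\<^bsub>cyclic_module R I\<^esub> s = \<zero>\<^bsub>cyclic_module R I\<^esub> \<longleftrightarrow> s \<in> I"
proof -
  interpret I: additive_subgroup I R using I by (simp add: right_ideal_def)
  interpret I: abelian_subgroup I R by (rule abelian_subgroupI3) unfold_locales
  interpret V: right_module R "cyclic_module R I" by (rule cyclic_module_right_module[OF I])
  show "I +> \<one> \<in> carrier (cyclic_module R I)" by (auto simp: A_RCOSETS_def')
  show "carrier (cyclic_module R I) = right_module.cyclic_submodule R (cyclic_module R I) (I +> \<one>)"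
  proof
    show "carrier (cyclic_module R I) \<subseteq> V.cyclic_submodule (I +> \<one>)"
    proof
      fix C assume "C \<in> carrier (cyclic_module R I)"
      then obtain a where "a \<in> carrier R" "C = I +> a" by (auto simp: A_RCOSETS_def')
      thus "C \<in> V.cyclic_submodule (I +> \<one>)"
        unfolding V.cyclic_submodule_def using cyclic_module_act[OF I one_closed, of a] by fastforce
    qed
  qed (auto simp: V.cyclic_submodule_def A_RCOSETS_def' cyclic_module_act[OF I])
  show "(I +> \<one>) \<cdot>\<^bsub>cyclic_module R I\<^esub> s = \<zero>\<^bsub>cyclic_module R I\<^esub> \<longleftrightarrow> s \<in> I" if s: "s \<in> carrier R" for s
    using s I.a_rcos_self[of s] I.a_subgroup a_coset_join2[of s I] by (auto simp: cyclic_module_act[OF I])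
qed

end

declare cyclic_module_sel [simp del]

section \<open>Normal elements modulo which the ring is a principal ideal domain\<close>

lemma right_ideal_gen_eq: "right_ideal_gen S c = {c \<otimes>\<^bsub>S\<^esub> s | s. s \<in> carrier S}"
  by (auto simp: right_ideal_gen_def l_coset_def)

lemma (in ring) mem_sum_gen_iff:
  "s \<in> right_ideal_gen R c <+>\<^bsub>R\<^esub> right_ideal_gen R d \<longleftrightarrow>
    (\<exists>t\<in>carrier R. \<exists>t'\<in>carrier R. s = c \<otimes> t \<oplus> d \<otimes> t')"
  unfolding set_add_def' right_ideal_gen_eq by blast

lemma (in cring) UnitsI:
  assumes "a \<in> carrier R" "b \<in> carrier R" "a \<otimes> b = \<one>" shows "a \<in> Units R"
  unfolding Units_def using assms m_comm[of a b] by auto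

text \<open>Passing from \<open>I = (g)\<close> to the cofactor \<open>h\<close> in \<open>p = hg\<close> reverses inclusions, so the descending
  chain condition above \<open>p\<close> is the ascending chain condition for the cofactors.\<close>

lemma (in principal_domain) ideals_containing_nonzero_dcc:
  fixes I :: "nat \<Rightarrow> 'a set"
  assumes p: "p \<in> carrier R" "p \<noteq> \<zero>" and I: "\<And>i. ideal (I i) R" "\<And>i. p \<in> I i" "\<And>i. I (Suc i) \<subseteq> I i"
  shows "\<exists>n. \<forall>i\<ge>n. I i = I (Suc i)"
proof -
  have "\<exists>g\<in>carrier R. I i = PIdl g" for i using exists_gen[OF I(1)] .
  then obtain g where g: "\<And>i. g i \<in> carrier R" "\<And>i. I i = PIdl (g i)" by metis
  have "\<exists>h\<in>carrier R. p = h \<otimes> g i" for i using I(2)[of i] g(2) by (auto simp: cgenideal_def)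
  then obtain h where h: "\<And>i. h i \<in> carrier R" "\<And>i. p = h i \<otimes> g i" by metis
  have nz: "g i \<noteq> \<zero>" "h i \<noteq> \<zero>" for i using h[of i] p g(1)[of i] by auto
  have asc: "PIdl (h i) \<subseteq> PIdl (h (Suc i))" for i
  proof -
    have "g (Suc i) \<in> PIdl (g i)" using I(3)[of i] g cgenideal_self[OF g(1)[of "Suc i"]] by auto
    then obtain c where c: "c \<in> carrier R" "g (Suc i) = c \<otimes> g i" by (auto simp: cgenideal_def)
    have "h i \<otimes> g i = (h (Suc i) \<otimes> c) \<otimes> g i"
      using h(2)[of i] h(2)[of "Suc i"] c h(1) g(1) by (simp add: m_assoc)
    hence "h i = h (Suc i) \<otimes> c" using nz h(1) g(1) c by (simp add: m_rcancel)
    thus ?thesis using h(1) c by (subst to_contain_is_to_divide) (auto simp: factor_def)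
  qed
  have mono: "PIdl (h i) \<subseteq> PIdl (h j)" if "i \<le> j" for i j
    using lift_Suc_mono_le[of "\<lambda>i. PIdl (h i)", OF asc that] .
  have "\<Union>(range (\<lambda>i. PIdl (h i))) \<in> range (\<lambda>i. PIdl (h i))"
  proof (rule ideal_chain_is_trivial)
    show "subset.chain {I. ideal I R} (range (\<lambda>i. PIdl (h i)))"
    proof -
      have "PIdl (h i) \<subseteq> PIdl (h j) \<or> PIdl (h j) \<subseteq> PIdl (h i)" for i j
        using mono[of i j] mono[of j i] by linarith
      thus ?thesis unfolding subset_chain_def using cgenideal_ideal h(1) by blast
    qed
  qed simp
  then obtain n where n: "\<And>i. PIdl (h i) \<subseteq> PIdl (h n)" by fastforce
  have "I i \<subseteq> I (Suc i)" if "i \<ge> n" for i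
  proof -
    have "PIdl (h (Suc i)) \<subseteq> PIdl (h i)" using n[of "Suc i"] mono[OF that] by blast
    then obtain d where d: "d \<in> carrier R" "h (Suc i) = h i \<otimes> d"
      using h(1) by (auto simp: to_contain_is_to_divide factor_def)
    have "h i \<otimes> g i = h i \<otimes> (d \<otimes> g (Suc i))"
      using h(2)[of i] h(2)[of "Suc i"] d h(1) g(1) by (simp add: m_assoc)
    hence "g i = d \<otimes> g (Suc i)" using nz h(1) g(1) d by (simp add: m_lcancel)
    hence "g (Suc i) divides g i" using d g(1) by (auto simp: factor_def m_comm)
    thus ?thesis using g by (simp add: to_contain_is_to_divide)
  qed
  thus ?thesis using I(3) by blast
qed

lemma (in domain) nonunit_power_step:
  assumes p: "p \<in> carrier R" "p \<noteq> \<zero>" "p \<notin> Units R" and c: "c \<in> carrier R"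
  shows "p [^] (i::nat) \<noteq> p [^] Suc i \<otimes> c"
proof
  assume "p [^] i = p [^] Suc i \<otimes> c"
  hence "p [^] i \<otimes> \<one> = p [^] i \<otimes> (p \<otimes> c)" using p c by (simp add: m_assoc)
  moreover have "p [^] i \<noteq> \<zero>" using p by (induction i) (auto simp: integral_iff)
  ultimately have "p \<otimes> c = \<one>" using p c m_lcancel[of "p [^] i" \<one> "p \<otimes> c"] by auto
  thus False using p c UnitsI by blast
qed

text \<open>The map \<open>\<epsilon>\<close> is a section of \<open>S \<rightarrow> S/xS \<cong> P\<close>. For \<open>R[\<theta>;\<alpha>]\<close> both \<open>x = X\<close> with \<open>P = k[\<theta>]\<close> and
  \<open>x = \<theta>\<close> with \<open>P = R\<close> are of this kind. That \<open>P\<close> is not a field keeps \<open>S/xS\<close> from being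
  artinian.\<close>

locale normal_section = S?: ring S + P?: principal_domain P
  for S :: "('s, 'm) ring_scheme" (structure) and P :: "('p, 'n) ring_scheme" +
  fixes x :: 's and \<epsilon> :: "'p \<Rightarrow> 's"
  assumes x_closed: "x \<in> carrier S"
    and section_hom: "\<epsilon> \<in> ring_hom P S"
    and normal_left: "s \<in> carrier S \<Longrightarrow> \<exists>t\<in>carrier S. s \<otimes> x = x \<otimes> t"
    and normal_right: "s \<in> carrier S \<Longrightarrow> \<exists>t\<in>carrier S. x \<otimes> s = t \<otimes> x"
    and section_decomp: "s \<in> carrier S \<Longrightarrow> \<exists>p\<in>carrier P. \<exists>t\<in>carrier S. s = \<epsilon> p \<oplus> x \<otimes> t"
    and section_inj: "p \<in> carrier P \<Longrightarrow> t \<in> carrier S \<Longrightarrow> \<epsilon> p = x \<otimes> t \<Longrightarrow> p = \<zero>\<^bsub>P\<^esub>"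
    and quotient_not_field: "\<exists>p\<in>carrier P. p \<noteq> \<zero>\<^bsub>P\<^esub> \<and> p \<notin> Units P"
begin

lemma section_simps [simp]:
  "p \<in> carrier P \<Longrightarrow> \<epsilon> p \<in> carrier S"
  "\<epsilon> \<one>\<^bsub>P\<^esub> = \<one>"
  using section_hom by (auto simp: ring_hom_closed ring_hom_one)

lemma section_mult:
  "p \<in> carrier P \<Longrightarrow> q \<in> carrier P \<Longrightarrow> \<epsilon> (p \<otimes>\<^bsub>P\<^esub> q) = \<epsilon> p \<otimes> \<epsilon> q"
  using section_hom by (auto simp: ring_hom_mult)

lemma section_add:
  "p \<in> carrier P \<Longrightarrow> q \<in> carrier P \<Longrightarrow> \<epsilon> (p \<oplus>\<^bsub>P\<^esub> q) = \<epsilon> p \<oplus> \<epsilon> q"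
  using section_hom by (auto simp: ring_hom_add)

lemma section_zero [simp]: "\<epsilon> \<zero>\<^bsub>P\<^esub> = \<zero>"
  using ring_hom_zero[OF section_hom P.ring_axioms S.ring_axioms] .

lemma section_minus: "p \<in> carrier P \<Longrightarrow> \<epsilon> (\<ominus>\<^bsub>P\<^esub> p) = \<ominus> \<epsilon> p"
  using section_add[of "\<ominus>\<^bsub>P\<^esub> p" p] by (simp add: P.l_neg S.minus_equality)

lemma section_unit: "p \<in> Units P \<Longrightarrow> \<epsilon> p \<in> Units S"
  unfolding Units_def using section_mult by clarsimp (metis section_simps)

lemma section_eq_mod:
  assumes "p \<in> carrier P" "q \<in> carrier P" "t \<in> carrier S" "\<epsilon> p = \<epsilon> q \<oplus> x \<otimes> t"
  shows "p = q"
proof -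
  have "\<epsilon> (p \<ominus>\<^bsub>P\<^esub> q) = x \<otimes> t \<oplus> \<epsilon> q \<oplus> \<ominus> \<epsilon> q"
    using assms x_closed by (simp add: a_minus_def section_add section_minus S.a_comm)
  also have "\<dots> = x \<otimes> t" using assms x_closed by (simp add: S.a_assoc S.r_neg)
  finally have "\<epsilon> (p \<ominus>\<^bsub>P\<^esub> q) = x \<otimes> t" .
  hence "p \<ominus>\<^bsub>P\<^esub> q = \<zero>\<^bsub>P\<^esub>" using assms by (intro section_inj) auto
  thus ?thesis using assms by (simp add: P.minus_eq_zero_iff)
qed

text \<open>Reduction modulo \<open>x\<close> maps \<open>xS + \<epsilon>(f)S\<close> to the ideal \<open>(f)\<close> of \<open>P\<close>.\<close>

lemma section_mem_sum_iff:
  assumes f: "f \<in> carrier P" and p: "p \<in> carrier P"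
  shows "\<epsilon> p \<in> right_ideal_gen S x <+>\<^bsub>S\<^esub> right_ideal_gen S (\<epsilon> f) \<longleftrightarrow> p \<in> PIdl\<^bsub>P\<^esub> f"
proof
  assume "p \<in> PIdl\<^bsub>P\<^esub> f"
  then obtain c where c: "c \<in> carrier P" "p = c \<otimes>\<^bsub>P\<^esub> f" by (auto simp: cgenideal_def)
  hence "\<epsilon> p = x \<otimes> \<zero> \<oplus> \<epsilon> f \<otimes> \<epsilon> c" using f x_closed by (simp add: P.m_comm[of c] section_mult)
  thus "\<epsilon> p \<in> right_ideal_gen S x <+>\<^bsub>S\<^esub> right_ideal_gen S (\<epsilon> f)"
    using c(1) unfolding S.mem_sum_gen_iff by (intro bexI[of _ \<zero>] bexI[of _ "\<epsilon> c"]) simp_all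
next
  assume "\<epsilon> p \<in> right_ideal_gen S x <+>\<^bsub>S\<^esub> right_ideal_gen S (\<epsilon> f)"
  then obtain t t' where t: "t \<in> carrier S" "t' \<in> carrier S" "\<epsilon> p = x \<otimes> t \<oplus> \<epsilon> f \<otimes> t'"
    unfolding S.mem_sum_gen_iff by blast
  obtain c u where c: "c \<in> carrier P" "u \<in> carrier S" "t' = \<epsilon> c \<oplus> x \<otimes> u"
    using section_decomp[OF t(2)] by blast
  obtain w where w: "w \<in> carrier S" "\<epsilon> f \<otimes> x = x \<otimes> w" using normal_left[of "\<epsilon> f"] f by auto
  have "\<epsilon> f \<otimes> t' = \<epsilon> (f \<otimes>\<^bsub>P\<^esub> c) \<oplus> x \<otimes> (w \<otimes> u)"
    using f c w x_closed by (simp add: section_mult S.r_distr S.m_assoc[symmetric])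
  hence "\<epsilon> p = \<epsilon> (f \<otimes>\<^bsub>P\<^esub> c) \<oplus> x \<otimes> (t \<oplus> w \<otimes> u)"
    using t f c w x_closed by (simp add: S.r_distr S.a_ac)
  hence "p = f \<otimes>\<^bsub>P\<^esub> c" using p f c t w by (intro section_eq_mod) auto
  thus "p \<in> PIdl\<^bsub>P\<^esub> f" using f c by (auto simp: cgenideal_def P.m_comm)
qed

end

locale normal_section_module = normal_section S P x \<epsilon> + right_module S V
  for S :: "('s, 'm) ring_scheme" (structure) and P :: "('p, 'n) ring_scheme" and x \<epsilon>
    and V :: "('s, 'v, 'l) right_mod_scheme" (structure)
begin

lemma act_decomp:
  assumes "u \<in> carrier V" "s \<in> carrier S"
  obtains p t where "p \<in> carrier P" "t \<in> carrier S" "s = \<epsilon> p \<oplus> x \<otimes> t"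
    "u \<cdot>\<^bsub>V\<^esub> s = u \<cdot>\<^bsub>V\<^esub> \<epsilon> p \<oplus>\<^bsub>V\<^esub> (u \<cdot>\<^bsub>V\<^esub> x) \<cdot>\<^bsub>V\<^esub> t"
proof -
  obtain p t where pt: "p \<in> carrier P" "t \<in> carrier S" "s = \<epsilon> p \<oplus> x \<otimes> t"
    using section_decomp[OF assms(2)] by blast
  hence "u \<cdot>\<^bsub>V\<^esub> s = u \<cdot>\<^bsub>V\<^esub> \<epsilon> p \<oplus>\<^bsub>V\<^esub> (u \<cdot>\<^bsub>V\<^esub> x) \<cdot>\<^bsub>V\<^esub> t"
    using assms x_closed by (simp add: ract_r_distr ract_assoc)
  thus ?thesis using that pt by blast
qed

lemma act_section_mult:
  "u \<in> carrier V \<Longrightarrow> p \<in> carrier P \<Longrightarrow> q \<in> carrier P \<Longrightarrow> u \<cdot>\<^bsub>V\<^esub> \<epsilon> (p \<otimes>\<^bsub>P\<^esub> q) = (u \<cdot>\<^bsub>V\<^esub> \<epsilon> p) \<cdot>\<^bsub>V\<^esub> \<epsilon> q"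
  by (simp add: section_mult ract_assoc)

lemma transporter_ideal:
  assumes u: "u \<in> carrier V" and N: "right_submodule S V N"
  shows "ideal {p \<in> carrier P. u \<cdot>\<^bsub>V\<^esub> \<epsilon> p \<in> N} P"
proof (rule idealI)
  note N' = right_submoduleD[OF N]
  show "ring P" by (rule P.ring_axioms)
  show "subgroup {p \<in> carrier P. u \<cdot>\<^bsub>V\<^esub> \<epsilon> p \<in> N} (add_monoid P)"
  proof (rule P.add.subgroupI)
    show "{p \<in> carrier P. u \<cdot>\<^bsub>V\<^esub> \<epsilon> p \<in> N} \<noteq> {}" using N' u by (auto intro: exI[of _ "\<zero>\<^bsub>P\<^esub>"])
  next
    fix p assume "p \<in> {p \<in> carrier P. u \<cdot>\<^bsub>V\<^esub> \<epsilon> p \<in> N}"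
    thus "\<ominus>\<^bsub>P\<^esub> p \<in> {p \<in> carrier P. u \<cdot>\<^bsub>V\<^esub> \<epsilon> p \<in> N}"
      using N' u by (simp add: section_minus ract_minus)
  qed (use N' u in \<open>auto simp: section_add ract_r_distr\<close>)
  fix a b assume "a \<in> {p \<in> carrier P. u \<cdot>\<^bsub>V\<^esub> \<epsilon> p \<in> N}" "b \<in> carrier P"
  thus "a \<otimes>\<^bsub>P\<^esub> b \<in> {p \<in> carrier P. u \<cdot>\<^bsub>V\<^esub> \<epsilon> p \<in> N}" "b \<otimes>\<^bsub>P\<^esub> a \<in> {p \<in> carrier P. u \<cdot>\<^bsub>V\<^esub> \<epsilon> p \<in> N}"
    using N' u by (auto simp: act_section_mult P.m_comm[of b])
qed

lemma cyclic_sum_decomp: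
  assumes u: "u \<in> carrier V" and N: "right_submodule S V N" "u \<cdot>\<^bsub>V\<^esub> x \<in> N"
    and w: "w \<in> cyclic_submodule u <+>\<^bsub>V\<^esub> N"
  obtains p n where "p \<in> carrier P" "n \<in> N" "w = u \<cdot>\<^bsub>V\<^esub> \<epsilon> p \<oplus>\<^bsub>V\<^esub> n"
proof -
  note N' = right_submoduleD[OF N(1)]
  obtain s n where sn: "s \<in> carrier S" "n \<in> N" "w = u \<cdot>\<^bsub>V\<^esub> s \<oplus>\<^bsub>V\<^esub> n"
    using w by (auto simp: set_add_def' cyclic_submodule_def)
  obtain p t where pt: "p \<in> carrier P" "t \<in> carrier S"
    "u \<cdot>\<^bsub>V\<^esub> s = u \<cdot>\<^bsub>V\<^esub> \<epsilon> p \<oplus>\<^bsub>V\<^esub> (u \<cdot>\<^bsub>V\<^esub> x) \<cdot>\<^bsub>V\<^esub> t"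
    using act_decomp[OF u sn(1)] by blast
  have n': "(u \<cdot>\<^bsub>V\<^esub> x) \<cdot>\<^bsub>V\<^esub> t \<in> N" using N N' pt by blast
  hence "w = u \<cdot>\<^bsub>V\<^esub> \<epsilon> p \<oplus>\<^bsub>V\<^esub> ((u \<cdot>\<^bsub>V\<^esub> x) \<cdot>\<^bsub>V\<^esub> t \<oplus>\<^bsub>V\<^esub> n)"
    using sn pt N' u by (simp add: subsetD V.a_assoc ract_closed)
  thus ?thesis using that[of p] pt n' sn N' by blast
qed

text \<open>As \<open>ux\<close> and \<open>u\<epsilon>(p)\<close> lie in \<open>N\<close>, the module \<open>(uS + N)/N\<close> is a quotient of the artinian \<open>P\<close>-module
  \<open>P/(p)\<close>.\<close>

lemma cyclic_sum_artinian:
  assumes u: "u \<in> carrier V" and N: "right_submodule S V N" "u \<cdot>\<^bsub>V\<^esub> x \<in> N"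
    and p: "p \<in> carrier P" "p \<noteq> \<zero>\<^bsub>P\<^esub>" "u \<cdot>\<^bsub>V\<^esub> \<epsilon> p \<in> N"
  shows "(cyclic_submodule u <+>\<^bsub>V\<^esub> N, N) \<in> artinian"
proof (rule artinianI)
  note cu = cyclic_submodule_submodule[OF u]
  show "right_submodule S V (cyclic_submodule u <+>\<^bsub>V\<^esub> N)" by (rule submodule_sum[OF cu N(1)])
  show "N \<subseteq> cyclic_submodule u <+>\<^bsub>V\<^esub> N" by (rule submodule_sum_upper[OF cu N(1)])
  fix C :: "nat \<Rightarrow> 'v set"
  assume C: "\<And>i. right_submodule S V (C i)" "\<And>i. N \<subseteq> C i" "\<And>i. C i \<subseteq> cyclic_submodule u <+>\<^bsub>V\<^esub> N"
    "\<And>i. C (Suc i) \<subseteq> C i"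
  define I where "I i = {p \<in> carrier P. u \<cdot>\<^bsub>V\<^esub> \<epsilon> p \<in> C i}" for i
  have "\<exists>n. \<forall>i\<ge>n. I i = I (Suc i)"
    by (rule P.ideals_containing_nonzero_dcc[OF p(1,2)])
      (use p C(2) subsetD[OF C(4)] transporter_ideal[OF u C(1)] in \<open>auto simp: I_def\<close>)
  then obtain n where n: "\<And>i. i \<ge> n \<Longrightarrow> I i = I (Suc i)" by blast
  have "C i \<subseteq> C (Suc i)" if i: "i \<ge> n" for i
  proof
    fix w assume w: "w \<in> C i"
    obtain q m where q: "q \<in> carrier P" "m \<in> N" "w = u \<cdot>\<^bsub>V\<^esub> \<epsilon> q \<oplus>\<^bsub>V\<^esub> m"
      using cyclic_sum_decomp[OF u N] w C(3) by blast
    have "m \<in> carrier V" using q right_submoduleD(1)[OF N(1)] by blast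
    hence "u \<cdot>\<^bsub>V\<^esub> \<epsilon> q = w \<oplus>\<^bsub>V\<^esub> (\<ominus>\<^bsub>V\<^esub> m)"
      using q u by (simp add: V.a_assoc V.r_neg ract_closed)
    hence "u \<cdot>\<^bsub>V\<^esub> \<epsilon> q \<in> C i" using right_submoduleD(3,4)[OF C(1)[of i]] q(2) C(2)[of i] w by auto
    hence "q \<in> I i" using q by (simp add: I_def)
    hence "q \<in> I (Suc i)" using n[OF i] by blast
    hence "u \<cdot>\<^bsub>V\<^esub> \<epsilon> q \<in> C (Suc i)" by (simp add: I_def)
    thus "w \<in> C (Suc i)" using q right_submoduleD(3)[OF C(1)[of "Suc i"]] C(2)[of "Suc i"] by auto
  qed
  thus "\<exists>n. \<forall>i\<ge>n. C i = C (Suc i)" using C(4) by blast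
qed (rule N(1))

text \<open>Here \<open>(uS + N)/N\<close> is isomorphic to \<open>P\<close>, where the powers of a nonzero nonunit generate a strictly
  descending chain.\<close>

lemma cyclic_sum_not_artinian:
  assumes u: "u \<in> carrier V" and N: "right_submodule S V N" "u \<cdot>\<^bsub>V\<^esub> x \<in> N"
    and free: "\<And>p. p \<in> carrier P \<Longrightarrow> u \<cdot>\<^bsub>V\<^esub> \<epsilon> p \<in> N \<Longrightarrow> p = \<zero>\<^bsub>P\<^esub>"
  shows "(cyclic_submodule u <+>\<^bsub>V\<^esub> N, N) \<notin> artinian"
proof
  assume art: "(cyclic_submodule u <+>\<^bsub>V\<^esub> N, N) \<in> artinian"
  obtain p where p: "p \<in> carrier P" "p \<noteq> \<zero>\<^bsub>P\<^esub>" "p \<notin> Units P" using quotient_not_field by blast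
  define v where "v i = u \<cdot>\<^bsub>V\<^esub> \<epsilon> (p [^]\<^bsub>P\<^esub> (i::nat))" for i
  have v: "v i \<in> carrier V" for i unfolding v_def using u p by (simp add: ract_closed)
  have vx: "v i \<cdot>\<^bsub>V\<^esub> x \<in> N" for i
  proof -
    obtain t where "t \<in> carrier S" "\<epsilon> (p [^]\<^bsub>P\<^esub> i) \<otimes> x = x \<otimes> t"
      using normal_left[of "\<epsilon> (p [^]\<^bsub>P\<^esub> i)"] p by auto
    hence "v i \<cdot>\<^bsub>V\<^esub> x = (u \<cdot>\<^bsub>V\<^esub> x) \<cdot>\<^bsub>V\<^esub> t"
      unfolding v_def using u p x_closed by (simp add: ract_assoc[symmetric])
    thus ?thesis using right_submoduleD(5)[OF N(1)] N(2) \<open>t \<in> carrier S\<close> by simp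
  qed
  note cv = cyclic_submodule_submodule[OF v]
  have v_Suc: "v (Suc i) \<in> cyclic_submodule (v i)" for i
  proof -
    have "v (Suc i) = v i \<cdot>\<^bsub>V\<^esub> \<epsilon> p" unfolding v_def using u p by (simp add: act_section_mult)
    thus ?thesis using p by (auto simp: cyclic_submodule_def)
  qed
  have v_u: "v i \<in> cyclic_submodule u" for i unfolding v_def cyclic_submodule_def using p by auto
  define C where "C i = cyclic_submodule (v i) <+>\<^bsub>V\<^esub> N" for i
  have C: "right_submodule S V (C i)" "N \<subseteq> C i" "v i \<in> C i" for i
    unfolding C_def using submodule_sum[OF cv N(1)] submodule_sum_upper(2)[OF cv N(1)]
      subsetD[OF submodule_sum_upper(1)[OF cv N(1)] self_in_cyclic_submodule[OF v]] by auto
  have Cu: "C i \<subseteq> cyclic_submodule u <+>\<^bsub>V\<^esub> N" for i unfolding C_def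
    using submodule_sum_upper[OF cyclic_submodule_submodule[OF u] N(1)] v_u
    by (intro submodule_sum_least submodule_sum cyclic_submodule_least cyclic_submodule_submodule u N) auto
  have Cd: "C (Suc i) \<subseteq> C i" for i
    using cyclic_submodule_least[OF cv v_Suc[of i]] submodule_sum_upper[OF cv[of i] N(1)] C(1,2)
    unfolding C_def[of "Suc i"] by (intro submodule_sum_least) (auto simp: C_def)
  obtain n where "C n = C (Suc n)" using artinianE[OF art, of C] C Cu Cd by (metis le_refl)
  hence "v n \<in> cyclic_submodule (v (Suc n)) <+>\<^bsub>V\<^esub> N" using C(3)[of n] by (simp add: C_def)
  then obtain q m where q: "q \<in> carrier P" "m \<in> N" "v n = v (Suc n) \<cdot>\<^bsub>V\<^esub> \<epsilon> q \<oplus>\<^bsub>V\<^esub> m"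
    using cyclic_sum_decomp[OF v N(1) vx] by blast
  have m: "m \<in> carrier V" using q right_submoduleD(1)[OF N(1)] by blast
  define a where "a = p [^]\<^bsub>P\<^esub> n \<oplus>\<^bsub>P\<^esub> (\<ominus>\<^bsub>P\<^esub> (p [^]\<^bsub>P\<^esub> Suc n \<otimes>\<^bsub>P\<^esub> q))"
  have "u \<cdot>\<^bsub>V\<^esub> \<epsilon> a = v n \<oplus>\<^bsub>V\<^esub> (\<ominus>\<^bsub>V\<^esub> (v (Suc n) \<cdot>\<^bsub>V\<^esub> \<epsilon> q))"
    unfolding a_def v_def using u p q
    by (simp add: section_add section_minus ract_r_distr ract_minus act_section_mult del: P.nat_pow_Suc)
  also have "\<dots> = m" unfolding q(3) using m v q(1)
    by (simp add: V.a_comm[of _ m] V.a_assoc V.r_neg ract_closed)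
  finally have "a = \<zero>\<^bsub>P\<^esub>" using q(2) p q(1) by (intro free) (auto simp: a_def)
  hence "p [^]\<^bsub>P\<^esub> n = p [^]\<^bsub>P\<^esub> Suc n \<otimes>\<^bsub>P\<^esub> q"
    using p q(1) P.minus_eq_zero_iff[of "p [^]\<^bsub>P\<^esub> n" "p [^]\<^bsub>P\<^esub> Suc n \<otimes>\<^bsub>P\<^esub> q"] by (simp add: a_def a_minus_def)
  thus False using P.nonunit_power_step[OF p q(1)] by blast
qed

lemma finsum_in_submodule:
  assumes N: "right_submodule S V N" and "finite B" "f \<in> B \<rightarrow> N"
  shows "(\<Oplus>\<^bsub>V\<^esub>b\<in>B. f b) \<in> N"
  using assms(2,3)
proof (induction B rule: finite_induct)
  case (insert b B)
  have "f \<in> insert b B \<rightarrow> carrier V" using insert right_submoduleD(1)[OF N] by auto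
  thus ?case using insert right_submoduleD(3)[OF N] by (simp add: V.finsum_insert)
qed (simp add: right_submoduleD(2)[OF N])

text \<open>The module \<open>uS\<close> is a quotient of \<open>P\<close>, and \<open>N\<close> contains some \<open>u\<epsilon>(p)\<close> with \<open>p \<noteq> 0\<close>.\<close>

lemma killed_submodule_artinian:
  assumes u: "u \<in> carrier V" and N: "right_submodule S V N" "N \<noteq> {\<zero>\<^bsub>V\<^esub>}" "N \<subseteq> cyclic_submodule u"
    and ux: "u \<cdot>\<^bsub>V\<^esub> x = \<zero>\<^bsub>V\<^esub>"
  shows "(cyclic_submodule u, N) \<in> artinian"
proof -
  obtain w where w: "w \<in> N" "w \<noteq> \<zero>\<^bsub>V\<^esub>" using nonzero_submodule_obtains[OF N(1,2)] .
  then obtain s where s: "s \<in> carrier S" "w = u \<cdot>\<^bsub>V\<^esub> s" using N(3) by (auto simp: cyclic_submodule_def)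
  obtain p t where pt: "p \<in> carrier P" "t \<in> carrier S"
    "u \<cdot>\<^bsub>V\<^esub> s = u \<cdot>\<^bsub>V\<^esub> \<epsilon> p \<oplus>\<^bsub>V\<^esub> (u \<cdot>\<^bsub>V\<^esub> x) \<cdot>\<^bsub>V\<^esub> t" using act_decomp[OF u s(1)] by blast
  hence wp: "w = u \<cdot>\<^bsub>V\<^esub> \<epsilon> p" using s ux u by (simp add: ract_closed)
  hence "p \<noteq> \<zero>\<^bsub>P\<^esub>" using w u by auto
  hence "(cyclic_submodule u <+>\<^bsub>V\<^esub> N, N) \<in> artinian"
    using pt w wp ux right_submoduleD(2)[OF N(1)] by (intro cyclic_sum_artinian[OF u N(1)]) auto
  thus ?thesis using submodule_sum_absorb[OF N(1) cyclic_submodule_submodule[OF u] N(3)] by simp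
qed

text \<open>A critical module over a principal ideal domain that is not artinian is torsionfree and uniform;
  two elements of it with a nonzero common multiple lie in a common cyclic submodule by Bezout, so
  it is free of rank one once it is finitely generated.\<close>

lemma killed_one_critical_cyclic:
  assumes V: "n_critical 1 S V" and fg: "finitely_generated S V"
    and kill: "\<And>v. v \<in> carrier V \<Longrightarrow> v \<cdot>\<^bsub>V\<^esub> x = \<zero>\<^bsub>V\<^esub>"
  obtains u where "u \<in> carrier V" "carrier V = cyclic_submodule u"
    "\<And>s. s \<in> carrier S \<Longrightarrow> u \<cdot>\<^bsub>V\<^esub> s = \<zero>\<^bsub>V\<^esub> \<longleftrightarrow> s \<in> right_ideal_gen S x"
proof -
  have V0: "(carrier V, {\<zero>\<^bsub>V\<^esub>}) \<notin> artinian"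
    and VN: "\<And>N. right_submodule S V N \<Longrightarrow> N \<noteq> {\<zero>\<^bsub>V\<^esub>} \<Longrightarrow> (carrier V, N) \<in> artinian"
    using V unfolding one_critical_iff by blast+
  have act: "\<exists>p\<in>carrier P. \<exists>t\<in>carrier S. s = \<epsilon> p \<oplus> x \<otimes> t \<and> u \<cdot>\<^bsub>V\<^esub> s = u \<cdot>\<^bsub>V\<^esub> \<epsilon> p"
    if "u \<in> carrier V" "s \<in> carrier S" for u s
    using act_decomp[OF that] kill[OF that(1)] that by (metis V.r_zero ract_closed section_simps(1) zero_ract)
  have tf: "u = \<zero>\<^bsub>V\<^esub>" if u: "u \<in> carrier V" and p: "p \<in> carrier P" "p \<noteq> \<zero>\<^bsub>P\<^esub>" "u \<cdot>\<^bsub>V\<^esub> \<epsilon> p = \<zero>\<^bsub>V\<^esub>" for u p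
  proof (rule ccontr)
    assume "u \<noteq> \<zero>\<^bsub>V\<^esub>"
    note cu = cyclic_submodule_submodule[OF u]
    have "(cyclic_submodule u <+>\<^bsub>V\<^esub> {\<zero>\<^bsub>V\<^esub>}, {\<zero>\<^bsub>V\<^esub>}) \<in> artinian"
      using p kill[OF u] by (intro cyclic_sum_artinian[OF u submodule_zero]) auto
    moreover have "cyclic_submodule u <+>\<^bsub>V\<^esub> {\<zero>\<^bsub>V\<^esub>} = cyclic_submodule u"
      using right_submoduleD(2)[OF cu] by (intro submodule_sum_absorb submodule_zero cu) auto
    ultimately show False
      using artinian_extension VN[OF cu cyclic_submodule_nonzero[OF u \<open>u \<noteq> \<zero>\<^bsub>V\<^esub>\<close>]] V0 by metis
  qed
  have pair: "\<exists>u\<in>carrier V. v \<in> cyclic_submodule u \<and> w \<in> cyclic_submodule u"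
    if v: "v \<in> carrier V" and w: "w \<in> carrier V" for v w
  proof (cases "v = \<zero>\<^bsub>V\<^esub> \<or> w = \<zero>\<^bsub>V\<^esub>")
    case True
    thus ?thesis using v w self_in_cyclic_submodule right_submoduleD(2)[OF cyclic_submodule_submodule] by blast
  next
    case False
    note cv = cyclic_submodule_submodule[OF v] and cw = cyclic_submodule_submodule[OF w]
    have "cyclic_submodule v \<inter> cyclic_submodule w \<noteq> {\<zero>\<^bsub>V\<^esub>}"
      using False one_critical_uniform[OF V cw _ cv] cyclic_submodule_nonzero v w by blast
    then obtain y where y: "y \<in> cyclic_submodule v" "y \<in> cyclic_submodule w" "y \<noteq> \<zero>\<^bsub>V\<^esub>"
      using nonzero_submodule_obtains[OF submodule_Int[OF cv cw]] by blast
    obtain a where a: "a \<in> carrier P" "y = v \<cdot>\<^bsub>V\<^esub> \<epsilon> a"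
      using y(1) act[OF v] unfolding cyclic_submodule_def by blast
    obtain b where b: "b \<in> carrier P" "y = w \<cdot>\<^bsub>V\<^esub> \<epsilon> b"
      using y(2) act[OF w] unfolding cyclic_submodule_def by blast
    have a0: "a \<noteq> \<zero>\<^bsub>P\<^esub>" using a y v by auto
    obtain g where g: "g \<in> carrier P" "PIdl\<^bsub>P\<^esub> a <+>\<^bsub>P\<^esub> PIdl\<^bsub>P\<^esub> b = PIdl\<^bsub>P\<^esub> g"
      using P.exists_gen[OF P.add_ideals[OF P.cgenideal_ideal[OF a(1)] P.cgenideal_ideal[OF b(1)]]] by blast
    have z: "\<zero>\<^bsub>P\<^esub> \<in> PIdl\<^bsub>P\<^esub> c" if "c \<in> carrier P" for c
      using that by (auto simp: cgenideal_def intro!: exI[of _ "\<zero>\<^bsub>P\<^esub>"])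
    have "a \<oplus>\<^bsub>P\<^esub> \<zero>\<^bsub>P\<^esub> \<in> PIdl\<^bsub>P\<^esub> g"
      unfolding g(2)[symmetric] set_add_def' using z[OF b(1)] P.cgenideal_self[OF a(1)] by blast
    then obtain a' where a': "a' \<in> carrier P" "a = a' \<otimes>\<^bsub>P\<^esub> g" using a by (auto simp: cgenideal_def)
    have "\<zero>\<^bsub>P\<^esub> \<oplus>\<^bsub>P\<^esub> b \<in> PIdl\<^bsub>P\<^esub> g"
      unfolding g(2)[symmetric] set_add_def' using z[OF a(1)] P.cgenideal_self[OF b(1)] by blast
    then obtain b' where b': "b' \<in> carrier P" "b = b' \<otimes>\<^bsub>P\<^esub> g" using b by (auto simp: cgenideal_def)
    have "g \<in> PIdl\<^bsub>P\<^esub> a <+>\<^bsub>P\<^esub> PIdl\<^bsub>P\<^esub> b" using g P.cgenideal_self by simp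
    then obtain c d where cd: "c \<in> carrier P" "d \<in> carrier P" "g = c \<otimes>\<^bsub>P\<^esub> a \<oplus>\<^bsub>P\<^esub> d \<otimes>\<^bsub>P\<^esub> b"
      by (auto simp: cgenideal_def set_add_def')
    have g0: "g \<noteq> \<zero>\<^bsub>P\<^esub>" using a0 a' by auto
    have "\<one>\<^bsub>P\<^esub> \<otimes>\<^bsub>P\<^esub> g = (c \<otimes>\<^bsub>P\<^esub> a' \<oplus>\<^bsub>P\<^esub> d \<otimes>\<^bsub>P\<^esub> b') \<otimes>\<^bsub>P\<^esub> g"
      using cd a' b' g(1) by (simp add: P.l_distr P.m_assoc)
    hence one: "c \<otimes>\<^bsub>P\<^esub> a' \<oplus>\<^bsub>P\<^esub> d \<otimes>\<^bsub>P\<^esub> b' = \<one>\<^bsub>P\<^esub>"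
      using P.m_rcancel[OF g0 g(1)] cd a' b' by (metis P.a_closed P.m_closed P.one_closed)
    have vw: "v \<cdot>\<^bsub>V\<^esub> \<epsilon> a' = w \<cdot>\<^bsub>V\<^esub> \<epsilon> b'"
    proof -
      have "(v \<cdot>\<^bsub>V\<^esub> \<epsilon> a' \<ominus>\<^bsub>V\<^esub> w \<cdot>\<^bsub>V\<^esub> \<epsilon> b') \<cdot>\<^bsub>V\<^esub> \<epsilon> g = v \<cdot>\<^bsub>V\<^esub> \<epsilon> a \<ominus>\<^bsub>V\<^esub> w \<cdot>\<^bsub>V\<^esub> \<epsilon> b"
        unfolding a'(2) b'(2)
        using v w a'(1) b'(1) g(1) by (simp add: a_minus_def ract_l_distr minus_ract act_section_mult ract_closed)
      also have "v \<cdot>\<^bsub>V\<^esub> \<epsilon> a = w \<cdot>\<^bsub>V\<^esub> \<epsilon> b" using a(2) b(2) by simp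
      also have "w \<cdot>\<^bsub>V\<^esub> \<epsilon> b \<ominus>\<^bsub>V\<^esub> w \<cdot>\<^bsub>V\<^esub> \<epsilon> b = \<zero>\<^bsub>V\<^esub>"
        using w b(1) by (simp add: a_minus_def V.r_neg ract_closed)
      finally have "(v \<cdot>\<^bsub>V\<^esub> \<epsilon> a' \<ominus>\<^bsub>V\<^esub> w \<cdot>\<^bsub>V\<^esub> \<epsilon> b') \<cdot>\<^bsub>V\<^esub> \<epsilon> g = \<zero>\<^bsub>V\<^esub>" .
      moreover have "v \<cdot>\<^bsub>V\<^esub> \<epsilon> a' \<ominus>\<^bsub>V\<^esub> w \<cdot>\<^bsub>V\<^esub> \<epsilon> b' \<in> carrier V"
        using v w a'(1) b'(1) by (simp add: ract_closed)
      ultimately have "v \<cdot>\<^bsub>V\<^esub> \<epsilon> a' \<ominus>\<^bsub>V\<^esub> w \<cdot>\<^bsub>V\<^esub> \<epsilon> b' = \<zero>\<^bsub>V\<^esub>" using tf g(1) g0 by blast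
      thus ?thesis using v w a'(1) b'(1) by (simp add: V.minus_eq_zero_iff ract_closed)
    qed
    define u where "u = v \<cdot>\<^bsub>V\<^esub> \<epsilon> d \<oplus>\<^bsub>V\<^esub> w \<cdot>\<^bsub>V\<^esub> \<epsilon> c"
    have u: "u \<in> carrier V" unfolding u_def using v w cd(1,2) by (simp add: ract_closed)
    have "u \<cdot>\<^bsub>V\<^esub> \<epsilon> b' = v \<cdot>\<^bsub>V\<^esub> \<epsilon> (d \<otimes>\<^bsub>P\<^esub> b') \<oplus>\<^bsub>V\<^esub> w \<cdot>\<^bsub>V\<^esub> \<epsilon> (b' \<otimes>\<^bsub>P\<^esub> c)"
      unfolding u_def using v w cd(1,2) b'(1) by (simp add: ract_l_distr act_section_mult[symmetric] ract_closed P.m_comm[of b' c] P.m_comm[of c a'] P.m_comm[of a' d])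
    also have "w \<cdot>\<^bsub>V\<^esub> \<epsilon> (b' \<otimes>\<^bsub>P\<^esub> c) = v \<cdot>\<^bsub>V\<^esub> \<epsilon> (c \<otimes>\<^bsub>P\<^esub> a')"
      using w v b'(1) a'(1) cd(1,2) by (simp add: act_section_mult vw[symmetric] P.m_comm[of c a'])
    also have "v \<cdot>\<^bsub>V\<^esub> \<epsilon> (d \<otimes>\<^bsub>P\<^esub> b') \<oplus>\<^bsub>V\<^esub> \<dots> = v \<cdot>\<^bsub>V\<^esub> \<epsilon> (c \<otimes>\<^bsub>P\<^esub> a' \<oplus>\<^bsub>P\<^esub> d \<otimes>\<^bsub>P\<^esub> b')"
      using v cd(1,2) a'(1) b'(1) by (simp add: section_add ract_r_distr V.a_comm ract_closed)
    finally have "v = u \<cdot>\<^bsub>V\<^esub> \<epsilon> b'" using one v by (simp add: ract_one)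
    moreover have "u \<cdot>\<^bsub>V\<^esub> \<epsilon> a' = v \<cdot>\<^bsub>V\<^esub> \<epsilon> (a' \<otimes>\<^bsub>P\<^esub> d) \<oplus>\<^bsub>V\<^esub> w \<cdot>\<^bsub>V\<^esub> \<epsilon> (c \<otimes>\<^bsub>P\<^esub> a')"
      unfolding u_def using v w cd(1,2) a'(1) by (simp add: ract_l_distr act_section_mult[symmetric] ract_closed P.m_comm[of b' c] P.m_comm[of c a'] P.m_comm[of a' d])
    moreover have "v \<cdot>\<^bsub>V\<^esub> \<epsilon> (a' \<otimes>\<^bsub>P\<^esub> d) = w \<cdot>\<^bsub>V\<^esub> \<epsilon> (d \<otimes>\<^bsub>P\<^esub> b')"
      using w v b'(1) a'(1) cd(1,2) by (simp add: act_section_mult vw P.m_comm[of d b'])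
    moreover have "w \<cdot>\<^bsub>V\<^esub> \<epsilon> (d \<otimes>\<^bsub>P\<^esub> b') \<oplus>\<^bsub>V\<^esub> w \<cdot>\<^bsub>V\<^esub> \<epsilon> (c \<otimes>\<^bsub>P\<^esub> a') = w"
    proof -
      have "w \<cdot>\<^bsub>V\<^esub> \<epsilon> (d \<otimes>\<^bsub>P\<^esub> b') \<oplus>\<^bsub>V\<^esub> w \<cdot>\<^bsub>V\<^esub> \<epsilon> (c \<otimes>\<^bsub>P\<^esub> a') = w \<cdot>\<^bsub>V\<^esub> \<epsilon> (c \<otimes>\<^bsub>P\<^esub> a' \<oplus>\<^bsub>P\<^esub> d \<otimes>\<^bsub>P\<^esub> b')"
        using w cd(1,2) a'(1) b'(1) by (simp add: section_add ract_r_distr V.a_comm ract_closed)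
      thus ?thesis using one w by (simp add: ract_one)
    qed
    ultimately have "v = u \<cdot>\<^bsub>V\<^esub> \<epsilon> b'" "w = u \<cdot>\<^bsub>V\<^esub> \<epsilon> a'" by simp_all
    thus ?thesis using u a'(1) b'(1) section_simps(1) unfolding cyclic_submodule_def by blast
  qed
  have fin: "\<exists>u\<in>carrier V. B \<subseteq> cyclic_submodule u" if "finite B" "B \<subseteq> carrier V" for B
    using that
  proof (induction B rule: finite_induct)
    case (insert b B)
    then obtain u where u: "u \<in> carrier V" "B \<subseteq> cyclic_submodule u" by auto
    obtain u' where u': "u' \<in> carrier V" "u \<in> cyclic_submodule u'" "b \<in> cyclic_submodule u'"
      using pair[of u b] u insert by blast
    thus ?case using cyclic_submodule_least[OF cyclic_submodule_submodule[OF u'(1)] u'(2)] u(2) by blast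
  qed auto
  obtain B where B: "finite B" "B \<subseteq> carrier V"
    "\<And>v. v \<in> carrier V \<Longrightarrow> \<exists>a\<in>B \<rightarrow> carrier S. v = (\<Oplus>\<^bsub>V\<^esub>b\<in>B. b \<cdot>\<^bsub>V\<^esub> a b)"
    using fg unfolding finitely_generated_def finitely_spanned_over_def by blast
  obtain u where u: "u \<in> carrier V" "B \<subseteq> cyclic_submodule u" using fin[OF B(1,2)] by blast
  note cu = cyclic_submodule_submodule[OF u(1)]
  have Vu: "carrier V = cyclic_submodule u"
  proof
    show "carrier V \<subseteq> cyclic_submodule u"
    proof
      fix v assume "v \<in> carrier V"
      then obtain a where a: "a \<in> B \<rightarrow> carrier S" "v = (\<Oplus>\<^bsub>V\<^esub>b\<in>B. b \<cdot>\<^bsub>V\<^esub> a b)" using B(3) by blast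
      show "v \<in> cyclic_submodule u"
        unfolding a(2) using a(1) u(2) right_submoduleD(5)[OF cu] by (intro finsum_in_submodule cu B(1)) auto
    qed
  qed (use right_submoduleD(1)[OF cu] in blast)
  have u0: "u \<noteq> \<zero>\<^bsub>V\<^esub>"
  proof
    assume "u = \<zero>\<^bsub>V\<^esub>"
    hence "carrier V = {\<zero>\<^bsub>V\<^esub>}" using Vu u by (auto simp: cyclic_submodule_def)
    thus False using V by (auto simp: n_critical_def critical_def)
  qed
  show ?thesis
  proof (rule that[OF u(1) Vu])
    fix s assume s: "s \<in> carrier S"
    show "u \<cdot>\<^bsub>V\<^esub> s = \<zero>\<^bsub>V\<^esub> \<longleftrightarrow> s \<in> right_ideal_gen S x"
    proof
      assume us: "u \<cdot>\<^bsub>V\<^esub> s = \<zero>\<^bsub>V\<^esub>"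
      obtain p t where pt: "p \<in> carrier P" "t \<in> carrier S" "s = \<epsilon> p \<oplus> x \<otimes> t" "u \<cdot>\<^bsub>V\<^esub> s = u \<cdot>\<^bsub>V\<^esub> \<epsilon> p"
        using act[OF u(1) s] by blast
      hence "p = \<zero>\<^bsub>P\<^esub>" using us tf[OF u(1) pt(1)] u0 by metis
      thus "s \<in> right_ideal_gen S x" using pt x_closed by (auto simp: right_ideal_gen_eq)
    qed (use kill[OF u(1)] u x_closed in \<open>auto simp: right_ideal_gen_eq ract_assoc\<close>)
  qed
qed

lemma killed_all:
  assumes "u \<in> carrier V" "carrier V = cyclic_submodule u" "u \<cdot>\<^bsub>V\<^esub> x = \<zero>\<^bsub>V\<^esub>" "v \<in> carrier V"
  shows "v \<cdot>\<^bsub>V\<^esub> x = \<zero>\<^bsub>V\<^esub>"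
proof -
  obtain s where s: "s \<in> carrier S" "v = u \<cdot>\<^bsub>V\<^esub> s" using assms by (auto simp: cyclic_submodule_def)
  obtain t where "t \<in> carrier S" "s \<otimes> x = x \<otimes> t" using normal_left[OF s(1)] by blast
  hence "v \<cdot>\<^bsub>V\<^esub> x = (u \<cdot>\<^bsub>V\<^esub> x) \<cdot>\<^bsub>V\<^esub> t" using s assms(1) x_closed by (simp add: ract_assoc[symmetric])
  thus ?thesis using assms(3) \<open>t \<in> carrier S\<close> by simp
qed

text \<open>As a \<open>P\<close>-module, \<open>V\<close> is \<open>P\<close> itself, which is not artinian because \<open>P\<close> is not a field, while its
  proper factors are.\<close>

lemma one_critical_of_annihilator_x:
  assumes u: "u \<in> carrier V" "carrier V = cyclic_submodule u"
    and ann: "\<And>s. s \<in> carrier S \<Longrightarrow> u \<cdot>\<^bsub>V\<^esub> s = \<zero>\<^bsub>V\<^esub> \<longleftrightarrow> s \<in> right_ideal_gen S x"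
  shows "n_critical 1 S V" "\<And>v. v \<in> carrier V \<Longrightarrow> v \<cdot>\<^bsub>V\<^esub> x = \<zero>\<^bsub>V\<^esub>"
proof -
  have "x \<in> right_ideal_gen S x" using x_closed by (force simp: right_ideal_gen_eq intro!: exI[of _ \<one>])
  hence ux: "u \<cdot>\<^bsub>V\<^esub> x = \<zero>\<^bsub>V\<^esub>" using ann x_closed by blast
  show "v \<cdot>\<^bsub>V\<^esub> x = \<zero>\<^bsub>V\<^esub>" if "v \<in> carrier V" for v using killed_all[OF u ux that] .
  note cu = cyclic_submodule_submodule[OF u(1)]
  have "(cyclic_submodule u <+>\<^bsub>V\<^esub> {\<zero>\<^bsub>V\<^esub>}, {\<zero>\<^bsub>V\<^esub>}) \<notin> artinian"
  proof (rule cyclic_sum_not_artinian[OF u(1) submodule_zero])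
    fix p assume p: "p \<in> carrier P" "u \<cdot>\<^bsub>V\<^esub> \<epsilon> p \<in> {\<zero>\<^bsub>V\<^esub>}"
    then obtain t where "t \<in> carrier S" "\<epsilon> p = x \<otimes> t" using ann[of "\<epsilon> p"] by (auto simp: right_ideal_gen_eq)
    thus "p = \<zero>\<^bsub>P\<^esub>" using section_inj p by blast
  qed (use ux in simp)
  moreover have "cyclic_submodule u <+>\<^bsub>V\<^esub> {\<zero>\<^bsub>V\<^esub>} = cyclic_submodule u"
    using right_submoduleD(2)[OF cu] by (intro submodule_sum_absorb submodule_zero cu) auto
  moreover have "(carrier V, N) \<in> artinian" if "right_submodule S V N" "N \<noteq> {\<zero>\<^bsub>V\<^esub>}" for N
    unfolding u(2) using killed_submodule_artinian[OF u(1) that _ ux] right_submoduleD(1)[OF that(1)] u(2) by simp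
  ultimately show "n_critical 1 S V" unfolding one_critical_iff using u(2) by simp
qed

text \<open>The simple modules killed by \<open>x\<close> are the simple \<open>P\<close>-modules \<open>P/(f)\<close>.\<close>

lemma killed_simple_annihilator:
  assumes V: "simple_module S V" and v: "v \<in> carrier V" "v \<noteq> \<zero>\<^bsub>V\<^esub>" and vx: "v \<cdot>\<^bsub>V\<^esub> x = \<zero>\<^bsub>V\<^esub>"
  obtains f where "f \<in> irreducible_elements P"
    "\<And>s. s \<in> carrier S \<Longrightarrow> v \<cdot>\<^bsub>V\<^esub> s = \<zero>\<^bsub>V\<^esub> \<longleftrightarrow> s \<in> right_ideal_gen S x <+>\<^bsub>S\<^esub> right_ideal_gen S (\<epsilon> f)"
proof -
  note cv = cyclic_submodule_submodule[OF v(1)]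
  have Vv: "carrier V = cyclic_submodule v" by (rule simple_cyclic[OF V v])
  obtain f where f: "f \<in> carrier P" "{p \<in> carrier P. v \<cdot>\<^bsub>V\<^esub> \<epsilon> p \<in> {\<zero>\<^bsub>V\<^esub>}} = PIdl\<^bsub>P\<^esub> f"
    using P.exists_gen[OF transporter_ideal[OF v(1) submodule_zero]] by blast
  hence ann: "v \<cdot>\<^bsub>V\<^esub> \<epsilon> p = \<zero>\<^bsub>V\<^esub> \<longleftrightarrow> p \<in> PIdl\<^bsub>P\<^esub> f" if "p \<in> carrier P" for p using that by auto
  have vf: "v \<cdot>\<^bsub>V\<^esub> \<epsilon> f = \<zero>\<^bsub>V\<^esub>" using ann f(1) P.cgenideal_self by blast
  have "f \<noteq> \<zero>\<^bsub>P\<^esub>"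
  proof
    assume "f = \<zero>\<^bsub>P\<^esub>"
    hence "(cyclic_submodule v <+>\<^bsub>V\<^esub> {\<zero>\<^bsub>V\<^esub>}, {\<zero>\<^bsub>V\<^esub>}) \<notin> artinian"
      using ann vx by (intro cyclic_sum_not_artinian[OF v(1) submodule_zero]) (auto simp: cgenideal_def)
    moreover have "cyclic_submodule v <+>\<^bsub>V\<^esub> {\<zero>\<^bsub>V\<^esub>} = cyclic_submodule v"
      using right_submoduleD(2)[OF cv] by (intro submodule_sum_absorb submodule_zero cv) auto
    ultimately show False using simple_kdim_zero[OF V] Vv by simp
  qed
  moreover have "f \<notin> Units P"
  proof
    assume "f \<in> Units P"
    hence "\<one>\<^bsub>P\<^esub> \<in> PIdl\<^bsub>P\<^esub> f" using P.ideal_eq_carrier_iff[OF f(1)] P.one_closed by blast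
    thus False using ann[of "\<one>\<^bsub>P\<^esub>"] v by (simp add: ract_one)
  qed
  moreover have "a \<in> Units P \<or> b \<in> Units P" if ab: "a \<in> carrier P" "b \<in> carrier P" "f = a \<otimes>\<^bsub>P\<^esub> b" for a b
  proof (cases "v \<cdot>\<^bsub>V\<^esub> \<epsilon> a = \<zero>\<^bsub>V\<^esub>")
    case True
    then obtain c where c: "c \<in> carrier P" "a = c \<otimes>\<^bsub>P\<^esub> f" using ann[OF ab(1)] by (auto simp: cgenideal_def)
    have "f \<otimes>\<^bsub>P\<^esub> \<one>\<^bsub>P\<^esub> = f \<otimes>\<^bsub>P\<^esub> (b \<otimes>\<^bsub>P\<^esub> c)"
      using ab c f(1) by (metis P.m_assoc P.m_comm P.m_closed P.r_one)
    hence "b \<otimes>\<^bsub>P\<^esub> c = \<one>\<^bsub>P\<^esub>" using \<open>f \<noteq> \<zero>\<^bsub>P\<^esub>\<close> f(1) ab c by (metis P.m_lcancel P.m_closed P.one_closed)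
    thus ?thesis using ab c P.UnitsI by blast
  next
    case False
    have va: "v \<cdot>\<^bsub>V\<^esub> \<epsilon> a \<in> carrier V" using v ab by (simp add: ract_closed)
    have "v \<in> cyclic_submodule (v \<cdot>\<^bsub>V\<^esub> \<epsilon> a)" using simple_cyclic[OF V va False] v by simp
    then obtain s where s: "s \<in> carrier S" "v = (v \<cdot>\<^bsub>V\<^esub> \<epsilon> a) \<cdot>\<^bsub>V\<^esub> s" by (auto simp: cyclic_submodule_def)
    obtain c t where c: "c \<in> carrier P" "t \<in> carrier S"
      "v = (v \<cdot>\<^bsub>V\<^esub> \<epsilon> a) \<cdot>\<^bsub>V\<^esub> \<epsilon> c \<oplus>\<^bsub>V\<^esub> ((v \<cdot>\<^bsub>V\<^esub> \<epsilon> a) \<cdot>\<^bsub>V\<^esub> x) \<cdot>\<^bsub>V\<^esub> t"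
      using act_decomp[OF va s(1)] s(2) by metis
    hence "v = v \<cdot>\<^bsub>V\<^esub> \<epsilon> (a \<otimes>\<^bsub>P\<^esub> c)"
      using killed_all[OF v(1) Vv vx va] v ab by (simp add: act_section_mult ract_closed)
    hence "v \<cdot>\<^bsub>V\<^esub> \<epsilon> (\<one>\<^bsub>P\<^esub> \<ominus>\<^bsub>P\<^esub> a \<otimes>\<^bsub>P\<^esub> c) = \<zero>\<^bsub>V\<^esub>"
      using v ab c by (simp add: a_minus_def section_add section_minus ract_r_distr ract_minus ract_one V.r_neg)
    then obtain d where d: "d \<in> carrier P" "\<one>\<^bsub>P\<^esub> \<ominus>\<^bsub>P\<^esub> a \<otimes>\<^bsub>P\<^esub> c = d \<otimes>\<^bsub>P\<^esub> f"
      using ann[of "\<one>\<^bsub>P\<^esub> \<ominus>\<^bsub>P\<^esub> a \<otimes>\<^bsub>P\<^esub> c"] ab c by (auto simp: cgenideal_def)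
    have "\<one>\<^bsub>P\<^esub> = (\<one>\<^bsub>P\<^esub> \<ominus>\<^bsub>P\<^esub> a \<otimes>\<^bsub>P\<^esub> c) \<oplus>\<^bsub>P\<^esub> a \<otimes>\<^bsub>P\<^esub> c"
      using ab c by (simp add: a_minus_def P.a_assoc P.l_neg)
    also have "\<dots> = a \<otimes>\<^bsub>P\<^esub> (d \<otimes>\<^bsub>P\<^esub> b \<oplus>\<^bsub>P\<^esub> c)"
      unfolding d(2) ab(3) using ab c d by (simp add: P.r_distr P.m_lcomm)
    finally have "a \<in> Units P" using ab c d P.UnitsI[of a "d \<otimes>\<^bsub>P\<^esub> b \<oplus>\<^bsub>P\<^esub> c"] by simp
    thus ?thesis ..
  qed
  ultimately have irr: "f \<in> irreducible_elements P" using f(1) by (auto simp: irreducible_elements_def)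
  show ?thesis
  proof (rule that[OF irr])
    fix s assume s: "s \<in> carrier S"
    show "v \<cdot>\<^bsub>V\<^esub> s = \<zero>\<^bsub>V\<^esub> \<longleftrightarrow> s \<in> right_ideal_gen S x <+>\<^bsub>S\<^esub> right_ideal_gen S (\<epsilon> f)"
    proof
      assume vs: "v \<cdot>\<^bsub>V\<^esub> s = \<zero>\<^bsub>V\<^esub>"
      obtain p t where pt: "p \<in> carrier P" "t \<in> carrier S" "s = \<epsilon> p \<oplus> x \<otimes> t"
        "v \<cdot>\<^bsub>V\<^esub> s = v \<cdot>\<^bsub>V\<^esub> \<epsilon> p \<oplus>\<^bsub>V\<^esub> (v \<cdot>\<^bsub>V\<^esub> x) \<cdot>\<^bsub>V\<^esub> t" using act_decomp[OF v(1) s] .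
      hence "p \<in> PIdl\<^bsub>P\<^esub> f" using ann[OF pt(1)] vs vx v by (simp add: ract_closed)
      then obtain c where c: "c \<in> carrier P" "p = c \<otimes>\<^bsub>P\<^esub> f" by (auto simp: cgenideal_def)
      hence "s = x \<otimes> t \<oplus> \<epsilon> f \<otimes> \<epsilon> c"
        using pt f(1) x_closed by (simp add: P.m_comm[of c] section_mult S.a_comm)
      thus "s \<in> right_ideal_gen S x <+>\<^bsub>S\<^esub> right_ideal_gen S (\<epsilon> f)"
        using pt(2) c(1) unfolding S.mem_sum_gen_iff by (intro bexI[of _ t] bexI[of _ "\<epsilon> c"]) simp_all
    next
      assume "s \<in> right_ideal_gen S x <+>\<^bsub>S\<^esub> right_ideal_gen S (\<epsilon> f)"
      then obtain t t' where "t \<in> carrier S" "t' \<in> carrier S" "s = x \<otimes> t \<oplus> \<epsilon> f \<otimes> t'"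
        unfolding S.mem_sum_gen_iff by blast
      thus "v \<cdot>\<^bsub>V\<^esub> s = \<zero>\<^bsub>V\<^esub>" using v vx vf f(1) x_closed by (simp add: ract_r_distr ract_assoc)
    qed
  qed
qed

text \<open>By Bezout's identity, an element of \<open>P\<close> that \<open>f\<close> does not divide is invertible modulo \<open>f\<close>, so each
  nonzero element of \<open>V\<close> generates \<open>V\<close>.\<close>

lemma simple_of_irreducible_annihilator:
  assumes f: "f \<in> irreducible_elements P" and v: "v \<in> carrier V" "carrier V = cyclic_submodule v"
    and ann: "\<And>s. s \<in> carrier S \<Longrightarrow>
      v \<cdot>\<^bsub>V\<^esub> s = \<zero>\<^bsub>V\<^esub> \<longleftrightarrow> s \<in> right_ideal_gen S x <+>\<^bsub>S\<^esub> right_ideal_gen S (\<epsilon> f)"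
  shows "simple_module S V" "v \<cdot>\<^bsub>V\<^esub> x = \<zero>\<^bsub>V\<^esub>"
proof -
  have fP: "f \<in> carrier P" and fU: "f \<notin> Units P" and f0: "f \<noteq> \<zero>\<^bsub>P\<^esub>"
    using f by (auto simp: irreducible_elements_def)
  have annP: "v \<cdot>\<^bsub>V\<^esub> \<epsilon> p = \<zero>\<^bsub>V\<^esub> \<longleftrightarrow> p \<in> PIdl\<^bsub>P\<^esub> f" if "p \<in> carrier P" for p
    using ann[of "\<epsilon> p"] section_mem_sum_iff[OF fP that] that by simp
  have "x = x \<otimes> \<one> \<oplus> \<epsilon> f \<otimes> \<zero>" using x_closed fP by simp
  hence "x \<in> right_ideal_gen S x <+>\<^bsub>S\<^esub> right_ideal_gen S (\<epsilon> f)"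
    unfolding S.mem_sum_gen_iff by (intro bexI[of _ \<one>] bexI[of _ \<zero>]) simp_all
  thus vx: "v \<cdot>\<^bsub>V\<^esub> x = \<zero>\<^bsub>V\<^esub>" using ann x_closed by blast
  have one: "\<one>\<^bsub>P\<^esub> \<notin> PIdl\<^bsub>P\<^esub> f"
  proof
    assume "\<one>\<^bsub>P\<^esub> \<in> PIdl\<^bsub>P\<^esub> f"
    then obtain c where "c \<in> carrier P" "c \<otimes>\<^bsub>P\<^esub> f = \<one>\<^bsub>P\<^esub>" by (auto simp: cgenideal_def)
    thus False using fU fP P.UnitsI[of f c] P.m_comm[of f c] by simp
  qed
  hence v0: "v \<noteq> \<zero>\<^bsub>V\<^esub>" using annP[of "\<one>\<^bsub>P\<^esub>"] v by (auto simp: ract_one)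
  show "simple_module S V"
    unfolding simple_module_def
  proof (intro conjI allI impI)
    show "right_module S V" by (rule right_module_axioms)
    show "carrier V \<noteq> {\<zero>\<^bsub>V\<^esub>}" using v v0 by blast
    fix N assume N: "right_submodule S V N"
    show "N = {\<zero>\<^bsub>V\<^esub>} \<or> N = carrier V"
    proof (cases "N = {\<zero>\<^bsub>V\<^esub>}")
      case False
      then obtain w where w: "w \<in> N" "w \<noteq> \<zero>\<^bsub>V\<^esub>" using nonzero_submodule_obtains[OF N] by blast
      then obtain s where s: "s \<in> carrier S" "w = v \<cdot>\<^bsub>V\<^esub> s"
        using right_submoduleD(1)[OF N] v by (auto simp: cyclic_submodule_def)
      obtain p t where pt: "p \<in> carrier P" "t \<in> carrier S"
        "v \<cdot>\<^bsub>V\<^esub> s = v \<cdot>\<^bsub>V\<^esub> \<epsilon> p \<oplus>\<^bsub>V\<^esub> (v \<cdot>\<^bsub>V\<^esub> x) \<cdot>\<^bsub>V\<^esub> t" using act_decomp[OF v(1) s(1)] by blast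
      hence wp: "w = v \<cdot>\<^bsub>V\<^esub> \<epsilon> p" using s vx v(1) by (simp add: ract_closed)
      have p: "p \<notin> PIdl\<^bsub>P\<^esub> f" using annP[OF pt(1)] w wp by simp
      obtain g where g: "g \<in> carrier P" "PIdl\<^bsub>P\<^esub> f <+>\<^bsub>P\<^esub> PIdl\<^bsub>P\<^esub> p = PIdl\<^bsub>P\<^esub> g"
        using P.exists_gen[OF P.add_ideals[OF P.cgenideal_ideal[OF fP] P.cgenideal_ideal[OF pt(1)]]] by blast
      have z: "\<zero>\<^bsub>P\<^esub> \<in> PIdl\<^bsub>P\<^esub> c" if "c \<in> carrier P" for c
        using that by (auto simp: cgenideal_def intro!: exI[of _ "\<zero>\<^bsub>P\<^esub>"])
      have "f \<oplus>\<^bsub>P\<^esub> \<zero>\<^bsub>P\<^esub> \<in> PIdl\<^bsub>P\<^esub> g"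
        unfolding g(2)[symmetric] set_add_def' using z[OF pt(1)] P.cgenideal_self[OF fP] by blast
      then obtain c where c: "c \<in> carrier P" "f = c \<otimes>\<^bsub>P\<^esub> g" using fP by (auto simp: cgenideal_def)
      have "\<zero>\<^bsub>P\<^esub> \<oplus>\<^bsub>P\<^esub> p \<in> PIdl\<^bsub>P\<^esub> g"
        unfolding g(2)[symmetric] set_add_def' using z[OF fP] P.cgenideal_self[OF pt(1)] by blast
      then obtain d where d: "d \<in> carrier P" "p = d \<otimes>\<^bsub>P\<^esub> g" using pt by (auto simp: cgenideal_def)
      have "c \<notin> Units P"
      proof
        assume cU: "c \<in> Units P"
        have "inv\<^bsub>P\<^esub> c \<otimes>\<^bsub>P\<^esub> f = g" using cU c g(1) by (simp add: P.m_assoc[symmetric])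
        hence "p = (d \<otimes>\<^bsub>P\<^esub> inv\<^bsub>P\<^esub> c) \<otimes>\<^bsub>P\<^esub> f" using d cU fP by (simp add: P.m_assoc)
        thus False using p d cU by (auto simp: cgenideal_def)
      qed
      hence "g \<in> Units P" using f c g(1) by (auto simp: irreducible_elements_def)
      hence "\<one>\<^bsub>P\<^esub> \<in> PIdl\<^bsub>P\<^esub> f <+>\<^bsub>P\<^esub> PIdl\<^bsub>P\<^esub> p" using P.ideal_eq_carrier_iff[OF g(1)] g(2) P.one_closed by blast
      then obtain a b where ab: "a \<in> carrier P" "b \<in> carrier P" "\<one>\<^bsub>P\<^esub> = a \<otimes>\<^bsub>P\<^esub> f \<oplus>\<^bsub>P\<^esub> b \<otimes>\<^bsub>P\<^esub> p"
        by (auto simp: cgenideal_def set_add_def')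
      have "v = v \<cdot>\<^bsub>V\<^esub> \<epsilon> (a \<otimes>\<^bsub>P\<^esub> f \<oplus>\<^bsub>P\<^esub> b \<otimes>\<^bsub>P\<^esub> p)" unfolding ab(3)[symmetric] using v by (simp add: ract_one)
      also have "\<dots> = v \<cdot>\<^bsub>V\<^esub> \<epsilon> (a \<otimes>\<^bsub>P\<^esub> f) \<oplus>\<^bsub>V\<^esub> v \<cdot>\<^bsub>V\<^esub> \<epsilon> (b \<otimes>\<^bsub>P\<^esub> p)"
        using v ab fP pt by (simp add: section_add ract_r_distr)
      also have "v \<cdot>\<^bsub>V\<^esub> \<epsilon> (a \<otimes>\<^bsub>P\<^esub> f) = \<zero>\<^bsub>V\<^esub>" using annP ab fP by (auto simp: cgenideal_def)
      also have "v \<cdot>\<^bsub>V\<^esub> \<epsilon> (b \<otimes>\<^bsub>P\<^esub> p) = w \<cdot>\<^bsub>V\<^esub> \<epsilon> b"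
        using v ab pt wp by (simp add: P.m_comm[of b] act_section_mult)
      finally have "v = w \<cdot>\<^bsub>V\<^esub> \<epsilon> b" using right_submoduleD(1)[OF N] w ab by (auto simp: ract_closed)
      hence "v \<in> N" using right_submoduleD(5)[OF N w(1)] ab by simp
      hence "carrier V \<subseteq> N" using cyclic_submodule_least[OF N] v by simp
      thus ?thesis using right_submoduleD(1)[OF N] by blast
    qed simp
  qed
qed

end

section \<open>Nakayama's lemma\<close>

text \<open>The subset \<open>A\<close> stands for a ring of scalars such as \<open>R \<subseteq> S\<close>, and \<open>x\<close> lies in its radical because
  the elements \<open>1 - ax\<close> are invertible. A member \<open>b\<close> of a smallest spanning set is of the form \<open>wx\<close>;
  expanding \<open>w\<close> in the spanning set and solving for \<open>b\<close> expresses \<open>b\<close> by the other members.\<close>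

lemma (in right_module) nakayama:
  assumes A: "A \<subseteq> carrier S" "\<zero>\<^bsub>S\<^esub> \<in> A" "\<And>a b. a \<in> A \<Longrightarrow> b \<in> A \<Longrightarrow> a \<oplus>\<^bsub>S\<^esub> b \<in> A"
      "\<And>a b. a \<in> A \<Longrightarrow> b \<in> A \<Longrightarrow> a \<otimes>\<^bsub>S\<^esub> b \<in> A"
    and x: "x \<in> A" "\<And>a. a \<in> A \<Longrightarrow> \<exists>b\<in>A. (\<one>\<^bsub>S\<^esub> \<ominus>\<^bsub>S\<^esub> a \<otimes>\<^bsub>S\<^esub> x) \<otimes>\<^bsub>S\<^esub> b = \<one>\<^bsub>S\<^esub>"
    and fin: "finitely_spanned_over A V"
    and div: "\<And>v. v \<in> carrier V \<Longrightarrow> \<exists>w\<in>carrier V. v = w \<cdot>\<^bsub>V\<^esub> x"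
  shows "carrier V = {\<zero>\<^bsub>V\<^esub>}"
proof -
  define spans where "spans B \<longleftrightarrow> finite B \<and> B \<subseteq> carrier V \<and>
      (\<forall>v\<in>carrier V. \<exists>a\<in>B \<rightarrow> A. v = (\<Oplus>\<^bsub>V\<^esub>b\<in>B. b \<cdot>\<^bsub>V\<^esub> a b))" for B
  obtain B0 where "spans B0" using fin unfolding finitely_spanned_over_def spans_def by blast
  then obtain B where B: "spans B" and min: "\<And>C. spans C \<Longrightarrow> card B \<le> card C"
    using ex_has_least_nat[of spans B0 card] by blast
  have "B = {}"
  proof (rule ccontr)
    assume "B \<noteq> {}"
    then obtain b where b: "b \<in> B" by blast
    define C where "C = B - {b}"
    have C: "finite C" "C \<subseteq> carrier V" "b \<notin> C" "B = insert b C" and bV: "b \<in> carrier V"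
      using B b by (auto simp: C_def spans_def)
    have split: "(\<Oplus>\<^bsub>V\<^esub>c\<in>B. c \<cdot>\<^bsub>V\<^esub> a c) = b \<cdot>\<^bsub>V\<^esub> a b \<oplus>\<^bsub>V\<^esub> (\<Oplus>\<^bsub>V\<^esub>c\<in>C. c \<cdot>\<^bsub>V\<^esub> a c)" if "a \<in> B \<rightarrow> A" for a
      unfolding C(4) using C bV that A(1)
      by (intro V.finsum_insert) (auto simp: Pi_def subset_iff intro!: ract_closed)
    have cl: "(\<lambda>c. c \<cdot>\<^bsub>V\<^esub> a c) \<in> C \<rightarrow> carrier V" if "a \<in> C \<rightarrow> A" for a
      using that C(2) A(1) by (auto intro!: ract_closed)
    have fcl: "(\<Oplus>\<^bsub>V\<^esub>c\<in>C. c \<cdot>\<^bsub>V\<^esub> a c) \<in> carrier V" if "a \<in> C \<rightarrow> A" for a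
      using cl[OF that] by (rule V.finsum_closed)
    have smul: "(\<Oplus>\<^bsub>V\<^esub>c\<in>C. c \<cdot>\<^bsub>V\<^esub> a c) \<cdot>\<^bsub>V\<^esub> s = (\<Oplus>\<^bsub>V\<^esub>c\<in>C. c \<cdot>\<^bsub>V\<^esub> (a c \<otimes>\<^bsub>S\<^esub> s))"
      if "a \<in> C \<rightarrow> A" "s \<in> A" for a s
    proof -
      have "(\<Oplus>\<^bsub>V\<^esub>c\<in>C. c \<cdot>\<^bsub>V\<^esub> a c) \<cdot>\<^bsub>V\<^esub> s = (\<Oplus>\<^bsub>V\<^esub>c\<in>C. (c \<cdot>\<^bsub>V\<^esub> a c) \<cdot>\<^bsub>V\<^esub> s)"
        using C(1) cl[OF that(1)] that(2) A(1) by (intro finsum_ract) auto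
      also have "\<dots> = (\<Oplus>\<^bsub>V\<^esub>c\<in>C. c \<cdot>\<^bsub>V\<^esub> (a c \<otimes>\<^bsub>S\<^esub> s))"
        using that C(2) A(1) by (intro V.finsum_cong') (auto simp: Pi_def subset_iff ract_assoc intro!: ract_closed)
      finally show ?thesis .
    qed
    obtain w where w: "w \<in> carrier V" "b = w \<cdot>\<^bsub>V\<^esub> x" using div bV by blast
    obtain a where a: "a \<in> B \<rightarrow> A" "w = (\<Oplus>\<^bsub>V\<^esub>c\<in>B. c \<cdot>\<^bsub>V\<^esub> a c)" using B w unfolding spans_def by blast
    have aC: "a \<in> C \<rightarrow> A" and ab: "a b \<in> A" using a(1) C(4) by auto
    obtain d where d: "d \<in> A" "(\<one>\<^bsub>S\<^esub> \<ominus>\<^bsub>S\<^esub> a b \<otimes>\<^bsub>S\<^esub> x) \<otimes>\<^bsub>S\<^esub> d = \<one>\<^bsub>S\<^esub>" using x(2)[OF ab] by blast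
    have S: "x \<in> carrier S" "d \<in> carrier S" "a b \<in> carrier S" using x(1) d ab A(1) by auto
    define r where "r = (\<Oplus>\<^bsub>V\<^esub>c\<in>C. c \<cdot>\<^bsub>V\<^esub> (a c \<otimes>\<^bsub>S\<^esub> x))"
    have r: "r \<in> carrier V" unfolding r_def using aC x(1) A(4) by (intro fcl) auto
    have b_eq: "b = b \<cdot>\<^bsub>V\<^esub> (a b \<otimes>\<^bsub>S\<^esub> x) \<oplus>\<^bsub>V\<^esub> r"
    proof -
      have "b = (b \<cdot>\<^bsub>V\<^esub> a b \<oplus>\<^bsub>V\<^esub> (\<Oplus>\<^bsub>V\<^esub>c\<in>C. c \<cdot>\<^bsub>V\<^esub> a c)) \<cdot>\<^bsub>V\<^esub> x" using w(2) a(2) split[OF a(1)] by simp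
      also have "\<dots> = (b \<cdot>\<^bsub>V\<^esub> a b) \<cdot>\<^bsub>V\<^esub> x \<oplus>\<^bsub>V\<^esub> (\<Oplus>\<^bsub>V\<^esub>c\<in>C. c \<cdot>\<^bsub>V\<^esub> a c) \<cdot>\<^bsub>V\<^esub> x"
        using bV S fcl[OF aC] by (intro ract_l_distr ract_closed)
      also have "\<dots> = b \<cdot>\<^bsub>V\<^esub> (a b \<otimes>\<^bsub>S\<^esub> x) \<oplus>\<^bsub>V\<^esub> r"
        unfolding r_def using smul[OF aC x(1)] bV S by (simp add: ract_assoc)
      finally show ?thesis .
    qed
    have "b \<cdot>\<^bsub>V\<^esub> (\<one>\<^bsub>S\<^esub> \<ominus>\<^bsub>S\<^esub> a b \<otimes>\<^bsub>S\<^esub> x) = r"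
    proof -
      have "b \<cdot>\<^bsub>V\<^esub> (\<one>\<^bsub>S\<^esub> \<ominus>\<^bsub>S\<^esub> a b \<otimes>\<^bsub>S\<^esub> x) = b \<oplus>\<^bsub>V\<^esub> \<ominus>\<^bsub>V\<^esub> (b \<cdot>\<^bsub>V\<^esub> (a b \<otimes>\<^bsub>S\<^esub> x))"
        using bV S by (simp add: a_minus_def ract_r_distr ract_minus ract_one)
      also have "\<dots> = (r \<oplus>\<^bsub>V\<^esub> b \<cdot>\<^bsub>V\<^esub> (a b \<otimes>\<^bsub>S\<^esub> x)) \<oplus>\<^bsub>V\<^esub> \<ominus>\<^bsub>V\<^esub> (b \<cdot>\<^bsub>V\<^esub> (a b \<otimes>\<^bsub>S\<^esub> x))"
        using b_eq bV S r V.a_comm[of r "b \<cdot>\<^bsub>V\<^esub> (a b \<otimes>\<^bsub>S\<^esub> x)"] ract_closed[of b "a b \<otimes>\<^bsub>S\<^esub> x"] by simp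
      also have "\<dots> = r" using bV S r by (simp add: V.a_assoc V.r_neg ract_closed)
      finally show ?thesis .
    qed
    hence b_rd: "b = r \<cdot>\<^bsub>V\<^esub> d" using d bV S by (metis ract_assoc ract_one S.m_closed S.minus_closed S.one_closed)
    have "spans C"
      unfolding spans_def
    proof (intro conjI C(1,2) ballI)
      fix v assume "v \<in> carrier V"
      then obtain e where e: "e \<in> B \<rightarrow> A" "v = (\<Oplus>\<^bsub>V\<^esub>c\<in>B. c \<cdot>\<^bsub>V\<^esub> e c)" using B unfolding spans_def by blast
      have eb: "e b \<in> A" and eC: "e \<in> C \<rightarrow> A" using e(1) C(4) by auto
      define g where "g c = (a c \<otimes>\<^bsub>S\<^esub> x \<otimes>\<^bsub>S\<^esub> d) \<otimes>\<^bsub>S\<^esub> e b" for c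
      have g: "g \<in> C \<rightarrow> A" using aC x(1) d(1) eb A(4) by (auto simp: g_def Pi_def)
      have "b \<cdot>\<^bsub>V\<^esub> e b = (\<Oplus>\<^bsub>V\<^esub>c\<in>C. c \<cdot>\<^bsub>V\<^esub> g c)"
      proof -
        have "(\<lambda>c. a c \<otimes>\<^bsub>S\<^esub> x) \<in> C \<rightarrow> A" "(\<lambda>c. a c \<otimes>\<^bsub>S\<^esub> x \<otimes>\<^bsub>S\<^esub> d) \<in> C \<rightarrow> A"
          using aC x(1) d(1) A(4) by (auto simp: Pi_def)
        hence "(r \<cdot>\<^bsub>V\<^esub> d) \<cdot>\<^bsub>V\<^esub> e b = (\<Oplus>\<^bsub>V\<^esub>c\<in>C. c \<cdot>\<^bsub>V\<^esub> g c)"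
          unfolding r_def g_def using smul d(1) eb by simp
        thus ?thesis using b_rd by simp
      qed
      hence "v = (\<Oplus>\<^bsub>V\<^esub>c\<in>C. c \<cdot>\<^bsub>V\<^esub> g c) \<oplus>\<^bsub>V\<^esub> (\<Oplus>\<^bsub>V\<^esub>c\<in>C. c \<cdot>\<^bsub>V\<^esub> e c)" using e(2) split[OF e(1)] by simp
      also have "\<dots> = (\<Oplus>\<^bsub>V\<^esub>c\<in>C. c \<cdot>\<^bsub>V\<^esub> g c \<oplus>\<^bsub>V\<^esub> c \<cdot>\<^bsub>V\<^esub> e c)"
        using cl[OF g] cl[OF eC] by (rule V.finsum_addf[symmetric])
      also have "\<dots> = (\<Oplus>\<^bsub>V\<^esub>c\<in>C. c \<cdot>\<^bsub>V\<^esub> (g c \<oplus>\<^bsub>S\<^esub> e c))"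
        using g eC C(2) A(1) by (intro V.finsum_cong')
          (auto simp: Pi_def subset_iff ract_r_distr intro!: ract_closed)
      finally show "\<exists>a\<in>C \<rightarrow> A. v = (\<Oplus>\<^bsub>V\<^esub>c\<in>C. c \<cdot>\<^bsub>V\<^esub> a c)"
        using g eC A(3) by (intro bexI[of _ "\<lambda>c. g c \<oplus>\<^bsub>S\<^esub> e c"]) auto
    qed
    hence "card B \<le> card C" by (rule min)
    thus False using C by simp
  qed
  thus ?thesis using B by (auto simp: spans_def)
qed

section \<open>Division up to powers of a normal prime element\<close>

text \<open>In \<open>R[\<theta>;\<alpha>]\<close>, with \<open>x = X\<close>, the function \<open>deg\<close> is the degree in \<open>\<theta>\<close> and \<open>sz\<close> is the degree plus the
  valuation of the leading coefficient. Both are additive, and only units have size zero, so that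
  minimizing the size gives irreducible elements. Division with remainder becomes possible once a power of \<open>x\<close> has made
  the leading coefficient of the dividend divisible by that of the divisor.\<close>

locale skew_division = normal_section S P x \<epsilon>
  for S :: "('s, 'm) ring_scheme" (structure) and P :: "('p, 'n) ring_scheme" and x \<epsilon> +
  fixes deg sz :: "'s \<Rightarrow> nat"
  assumes one_nonzero: "\<one> \<noteq> \<zero>"
    and integral: "a \<in> carrier S \<Longrightarrow> b \<in> carrier S \<Longrightarrow> a \<otimes> b = \<zero> \<Longrightarrow> a = \<zero> \<or> b = \<zero>"
    and x_nonzero: "x \<noteq> \<zero>"
    and deg_mult: "a \<in> carrier S \<Longrightarrow> b \<in> carrier S \<Longrightarrow> a \<noteq> \<zero> \<Longrightarrow> b \<noteq> \<zero> \<Longrightarrow> deg (a \<otimes> b) = deg a + deg b"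
    and deg_x: "deg x = 0"
    and sz_mult: "a \<in> carrier S \<Longrightarrow> b \<in> carrier S \<Longrightarrow> a \<noteq> \<zero> \<Longrightarrow> b \<noteq> \<zero> \<Longrightarrow> sz (a \<otimes> b) = sz a + sz b"
    and sz_zero_iff: "a \<in> carrier S \<Longrightarrow> a \<noteq> \<zero> \<Longrightarrow> sz a = 0 \<longleftrightarrow> a \<in> Units S"
    and division: "z \<in> carrier S \<Longrightarrow> w \<in> carrier S \<Longrightarrow> z \<noteq> \<zero> \<Longrightarrow> w \<noteq> \<zero> \<Longrightarrow> deg z \<le> deg w \<Longrightarrow>
      \<exists>n. \<exists>s\<in>carrier S. w \<otimes> x [^] (n::nat) \<ominus> z \<otimes> s = \<zero> \<or> deg (w \<otimes> x [^] n \<ominus> z \<otimes> s) < deg w"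
begin

abbreviation xS where "xS \<equiv> right_ideal_gen S x"

lemma lcancel:
  assumes "a \<in> carrier S" "b \<in> carrier S" "c \<in> carrier S" "a \<noteq> \<zero>" "a \<otimes> b = a \<otimes> c"
  shows "b = c"
proof -
  have "a \<otimes> (b \<ominus> c) = \<zero>" using assms by (simp add: a_minus_def S.r_distr S.r_minus S.r_neg)
  hence "b \<ominus> c = \<zero>" using integral[of a "b \<ominus> c"] assms by simp
  thus ?thesis using assms S.minus_eq_zero_iff by simp
qed

lemma rcancel:
  assumes "a \<in> carrier S" "b \<in> carrier S" "c \<in> carrier S" "a \<noteq> \<zero>" "b \<otimes> a = c \<otimes> a"
  shows "b = c"
proof -
  have "(b \<ominus> c) \<otimes> a = \<zero>" using assms by (simp add: a_minus_def S.l_distr S.l_minus S.r_neg)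
  hence "b \<ominus> c = \<zero>" using integral[of "b \<ominus> c" a] assms by simp
  thus ?thesis using assms S.minus_eq_zero_iff by simp
qed

lemma unitI:
  assumes "a \<in> carrier S" "b \<in> carrier S" "a \<otimes> b = \<one>"
  shows "a \<in> Units S" "b \<in> Units S"
proof -
  have "a \<noteq> \<zero>" using assms one_nonzero by auto
  moreover have "a \<otimes> (b \<otimes> a) = a \<otimes> \<one>" using assms by (simp add: S.m_assoc[symmetric])
  ultimately have "b \<otimes> a = \<one>" using assms lcancel[of a "b \<otimes> a" \<one>] by simp
  thus "a \<in> Units S" "b \<in> Units S" using assms by (auto simp: Units_def)
qed

lemma x_nonunit: "x \<notin> Units S"
proof
  assume x: "x \<in> Units S"
  obtain p where p: "p \<in> carrier P" "p \<noteq> \<zero>\<^bsub>P\<^esub>" using quotient_not_field by blast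
  have "\<epsilon> p = x \<otimes> (inv x \<otimes> \<epsilon> p)" using x p x_closed by (simp add: S.m_assoc[symmetric])
  thus False using section_inj[of p "inv x \<otimes> \<epsilon> p"] p x by simp
qed

lemma self_mem_gen: "y \<in> carrier S \<Longrightarrow> y \<in> right_ideal_gen S y"
  by (force simp: right_ideal_gen_eq intro!: exI[of _ \<one>])

lemma mem_xS_iff: "s \<in> xS \<longleftrightarrow> (\<exists>t\<in>carrier S. s = x \<otimes> t)"
  by (auto simp: right_ideal_gen_eq)

lemma mem_xS_iff': "s \<in> xS \<longleftrightarrow> (\<exists>t\<in>carrier S. s = t \<otimes> x)"
  unfolding mem_xS_iff using normal_left normal_right by metis

lemma xS_I: "t \<in> carrier S \<Longrightarrow> x \<otimes> t \<in> xS" "t \<in> carrier S \<Longrightarrow> t \<otimes> x \<in> xS"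
  by (auto simp: mem_xS_iff' ) (auto simp: mem_xS_iff'[symmetric] mem_xS_iff)

lemma section_product:
  assumes "p \<in> carrier P" "q \<in> carrier P" "t \<in> carrier S" "t' \<in> carrier S"
  shows "\<exists>u\<in>carrier S. (\<epsilon> p \<oplus> x \<otimes> t) \<otimes> (\<epsilon> q \<oplus> x \<otimes> t') = \<epsilon> (p \<otimes>\<^bsub>P\<^esub> q) \<oplus> x \<otimes> u"
proof -
  obtain r where r: "r \<in> carrier S" "\<epsilon> p \<otimes> x = x \<otimes> r" using normal_left[of "\<epsilon> p"] assms by auto
  have "(\<epsilon> p \<oplus> x \<otimes> t) \<otimes> (\<epsilon> q \<oplus> x \<otimes> t') =
      \<epsilon> (p \<otimes>\<^bsub>P\<^esub> q) \<oplus> ((\<epsilon> p \<otimes> x) \<otimes> t' \<oplus> x \<otimes> (t \<otimes> (\<epsilon> q \<oplus> x \<otimes> t')))"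
    using assms x_closed by (simp add: section_mult S.l_distr S.r_distr S.m_assoc S.a_ac)
  also have "\<dots> = \<epsilon> (p \<otimes>\<^bsub>P\<^esub> q) \<oplus> x \<otimes> (r \<otimes> t' \<oplus> t \<otimes> (\<epsilon> q \<oplus> x \<otimes> t'))"
    unfolding r(2) using assms r(1) x_closed by (simp add: S.r_distr S.m_assoc)
  finally show ?thesis using assms r x_closed by (intro bexI[of _ "r \<otimes> t' \<oplus> t \<otimes> (\<epsilon> q \<oplus> x \<otimes> t')"]) simp_all
qed

lemma section_notin_xS:
  assumes "p \<in> carrier P" "t \<in> carrier S" "p \<noteq> \<zero>\<^bsub>P\<^esub>"
  shows "\<epsilon> p \<oplus> x \<otimes> t \<notin> xS"
proof
  assume "\<epsilon> p \<oplus> x \<otimes> t \<in> xS"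
  then obtain t' where t': "t' \<in> carrier S" "\<epsilon> p \<oplus> x \<otimes> t = x \<otimes> t'" by (auto simp: mem_xS_iff)
  have "\<epsilon> p = (\<epsilon> p \<oplus> x \<otimes> t) \<oplus> \<ominus> (x \<otimes> t)" using assms x_closed by (simp add: S.a_assoc S.r_neg)
  also have "\<dots> = x \<otimes> (t' \<ominus> t)" unfolding t'(2) using assms t'(1) x_closed
    by (simp add: a_minus_def S.r_distr S.r_minus)
  finally show False using section_inj[of p "t' \<ominus> t"] assms t'(1) by simp
qed

text \<open>The factor \<open>S/xS\<close> is the domain \<open>P\<close>.\<close>

lemma xS_prime:
  assumes ab: "a \<in> carrier S" "b \<in> carrier S" "a \<otimes> b \<in> xS"
  shows "a \<in> xS \<or> b \<in> xS"
proof -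
  obtain p t where p: "p \<in> carrier P" "t \<in> carrier S" "a = \<epsilon> p \<oplus> x \<otimes> t" using section_decomp[OF ab(1)] by blast
  obtain q t' where q: "q \<in> carrier P" "t' \<in> carrier S" "b = \<epsilon> q \<oplus> x \<otimes> t'" using section_decomp[OF ab(2)] by blast
  obtain u where "u \<in> carrier S" "a \<otimes> b = \<epsilon> (p \<otimes>\<^bsub>P\<^esub> q) \<oplus> x \<otimes> u"
    using section_product[OF p(1) q(1) p(2) q(2)] p(3) q(3) by blast
  hence "p \<otimes>\<^bsub>P\<^esub> q = \<zero>\<^bsub>P\<^esub>" using section_notin_xS[of "p \<otimes>\<^bsub>P\<^esub> q" u] ab(3) p q by auto
  hence "p = \<zero>\<^bsub>P\<^esub> \<or> q = \<zero>\<^bsub>P\<^esub>" using p q P.integral by blast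
  thus ?thesis using p q x_closed xS_I by auto
qed

text \<open>In an equation \<open>wx = zs\<close> the factor \<open>x\<close> must divide \<open>s\<close>, as \<open>xS\<close> is completely prime, and can be
  cancelled.\<close>

lemma saturated_of_notin_xS:
  assumes z: "z \<in> carrier S" "z \<notin> xS" and w: "w \<in> carrier S" "w \<otimes> x \<in> right_ideal_gen S z"
  shows "w \<in> right_ideal_gen S z"
proof -
  obtain s where s: "s \<in> carrier S" "w \<otimes> x = z \<otimes> s" using w by (auto simp: right_ideal_gen_eq)
  have "z \<otimes> s \<in> xS" using s(2) xS_I(2)[OF w(1)] by simp
  hence "s \<in> xS" using xS_prime[OF z(1) s(1)] z(2) by blast
  then obtain s' where s': "s' \<in> carrier S" "s = s' \<otimes> x" by (auto simp: mem_xS_iff')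
  have "w \<otimes> x = (z \<otimes> s') \<otimes> x" using s s' z x_closed by (simp add: S.m_assoc)
  hence "w = z \<otimes> s'" using rcancel[of x w "z \<otimes> s'"] w z s' x_closed x_nonzero by simp
  thus ?thesis using s' by (auto simp: right_ideal_gen_eq)
qed

lemma saturated_power:
  assumes z: "z \<in> carrier S" "z \<notin> xS" and w: "w \<in> carrier S" "w \<otimes> x [^] (n::nat) \<in> right_ideal_gen S z"
  shows "w \<in> right_ideal_gen S z"
  using w(2)
proof (induction n)
  case (Suc n)
  have "(w \<otimes> x [^] n) \<otimes> x \<in> right_ideal_gen S z" using Suc.prems w(1) x_closed by (simp add: S.m_assoc)
  moreover have "w \<otimes> x [^] n \<in> carrier S" using w(1) x_closed by simp
  ultimately have "w \<otimes> x [^] n \<in> right_ideal_gen S z" by (rule saturated_of_notin_xS[OF z, rotated])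
  thus ?case by (rule Suc.IH)
qed (use w(1) in simp)

lemma right_idealD:
  assumes "right_ideal S I"
  shows "I \<subseteq> carrier S" "\<zero> \<in> I" "\<And>a b. a \<in> I \<Longrightarrow> b \<in> I \<Longrightarrow> a \<oplus> b \<in> I" "\<And>a. a \<in> I \<Longrightarrow> \<ominus> a \<in> I"
    "\<And>a s. a \<in> I \<Longrightarrow> s \<in> carrier S \<Longrightarrow> a \<otimes> s \<in> I"
  using assms additive_subgroup.a_subset[of I S] additive_subgroup.zero_closed[of I S]
    additive_subgroup.a_closed[of I S] additive_subgroup.a_inv_closed[of I S]
  unfolding right_ideal_def by auto

text \<open>Gauss' lemma: an element \<open>z\<close> of least degree in \<open>I\<close> divides every element of \<open>I\<close> up to a power
  of \<open>x\<close>; if \<open>z\<close> is moreover not divisible by \<open>x\<close>, the power of \<open>x\<close> can be cancelled, as \<open>xS\<close> is a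
  completely prime ideal.\<close>

lemma principal_of_saturated:
  assumes I: "right_ideal S I" "I \<noteq> {\<zero>}"
    and sat: "\<And>w. w \<in> carrier S \<Longrightarrow> w \<otimes> x \<in> I \<Longrightarrow> w \<in> I"
  obtains z where "z \<in> carrier S" "z \<noteq> \<zero>" "z \<notin> xS" "I = right_ideal_gen S z"
proof -
  note I' = right_idealD[OF I(1)]
  obtain a where "a \<in> I" "a \<noteq> \<zero>" using I I'(2) by blast
  then obtain z0 where z0: "z0 \<in> I \<and> z0 \<noteq> \<zero>" "\<And>w. w \<in> I \<and> w \<noteq> \<zero> \<Longrightarrow> deg z0 \<le> deg w"
    using ex_has_least_nat[of "\<lambda>w. w \<in> I \<and> w \<noteq> \<zero>" a deg] by blast
  then obtain z where z: "z \<in> I \<and> z \<noteq> \<zero> \<and> deg z = deg z0"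
      "\<And>w. w \<in> I \<and> w \<noteq> \<zero> \<and> deg w = deg z0 \<Longrightarrow> sz z \<le> sz w"
    using ex_has_least_nat[of "\<lambda>w. w \<in> I \<and> w \<noteq> \<zero> \<and> deg w = deg z0" z0 sz] by blast
  have min: "deg z \<le> deg w" if "w \<in> I" "w \<noteq> \<zero>" for w using z z0 that by auto
  have zS: "z \<in> carrier S" "z \<noteq> \<zero>" using z I' by auto
  have zx: "z \<notin> xS"
  proof
    assume "z \<in> xS"
    then obtain z' where z': "z' \<in> carrier S" "z = z' \<otimes> x" by (auto simp: mem_xS_iff')
    have "z' \<in> I" using sat[OF z'(1)] z z'(2) by simp
    moreover have "z' \<noteq> \<zero>" using z' zS x_closed by auto
    moreover have "deg z = deg z'" using deg_mult[of z' x] z' x_closed x_nonzero deg_x \<open>z' \<noteq> \<zero>\<close> by simp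
    ultimately have "sz z \<le> sz z'" using z by simp
    moreover have "sz z = sz z' + sz x" using sz_mult[of z' x] z' x_closed x_nonzero \<open>z' \<noteq> \<zero>\<close> by simp
    moreover have "sz x \<noteq> 0" using sz_zero_iff[OF x_closed x_nonzero] x_nonunit by simp
    ultimately show False by simp
  qed
  have "\<exists>n::nat. w \<otimes> x [^] n \<in> right_ideal_gen S z" if "w \<in> I" for w
    using that
  proof (induction "deg w" arbitrary: w rule: less_induct)
    case less
    show ?case
    proof (cases "w = \<zero>")
      case True
      thus ?thesis using zS by (intro exI[of _ 0]) (auto simp: right_ideal_gen_eq intro!: exI[of _ \<zero>])
    next
      case False
      have wS: "w \<in> carrier S" using less I' by auto
      obtain n s where s: "s \<in> carrier S"
        "w \<otimes> x [^] (n::nat) \<ominus> z \<otimes> s = \<zero> \<or> deg (w \<otimes> x [^] n \<ominus> z \<otimes> s) < deg w"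
        using division[OF zS(1) wS zS(2) False min[OF less.prems False]] by blast
      define r where "r = w \<otimes> x [^] n \<ominus> z \<otimes> s"
      have r: "r \<in> I" unfolding r_def a_minus_def
        using I' z less.prems s(1) x_closed by (intro I'(3,4,5)) auto
      have rS: "r \<in> carrier S" using r I' by auto
      have w: "w \<otimes> x [^] n = z \<otimes> s \<oplus> r"
        unfolding r_def using wS x_closed zS s(1) by (simp add: a_minus_def S.a_comm S.a_assoc S.r_neg2)
      show ?thesis
      proof (cases "r = \<zero>")
        case True
        thus ?thesis using w s zS by (intro exI[of _ n]) (auto simp: right_ideal_gen_eq)
      next
        case False
        then obtain m where "r \<otimes> x [^] (m::nat) \<in> right_ideal_gen S z"
          using less.hyps[of r] r s(2) by (auto simp: r_def)
        then obtain s' where s': "s' \<in> carrier S" "r \<otimes> x [^] m = z \<otimes> s'" by (auto simp: right_ideal_gen_eq)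
        have "w \<otimes> x [^] (n + m) = (w \<otimes> x [^] n) \<otimes> x [^] m"
          using wS x_closed by (simp add: S.nat_pow_mult[symmetric] S.m_assoc)
        also have "\<dots> = z \<otimes> (s \<otimes> x [^] m) \<oplus> z \<otimes> s'"
          unfolding w using zS s(1) rS x_closed s'(2) by (simp add: S.l_distr S.m_assoc)
        also have "\<dots> = z \<otimes> (s \<otimes> x [^] m \<oplus> s')" using zS s(1) s'(1) x_closed by (simp add: S.r_distr)
        finally show ?thesis using s(1) s'(1) x_closed
          by (intro exI[of _ "n + m"]) (auto simp: right_ideal_gen_eq)
      qed
    qed
  qed
  hence "I \<subseteq> right_ideal_gen S z" using saturated_power[OF zS(1) zx] I'(1) by blast
  moreover have "right_ideal_gen S z \<subseteq> I" using I'(5) z by (auto simp: right_ideal_gen_eq)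
  ultimately show ?thesis using that[OF zS zx] by blast
qed

lemma power_normal:
  assumes "s \<in> carrier S"
  shows "\<exists>t\<in>carrier S. s \<otimes> x [^] (n::nat) = x [^] n \<otimes> t"
proof (induction n)
  case (Suc n)
  then obtain t where t: "t \<in> carrier S" "s \<otimes> x [^] n = x [^] n \<otimes> t" by blast
  obtain u where u: "u \<in> carrier S" "t \<otimes> x = x \<otimes> u" using normal_left[OF t(1)] by blast
  have "s \<otimes> x [^] Suc n = (s \<otimes> x [^] n) \<otimes> x" using assms x_closed by (simp add: S.m_assoc)
  also have "\<dots> = x [^] n \<otimes> (t \<otimes> x)" unfolding t(2) using t(1) x_closed by (simp add: S.m_assoc)
  also have "\<dots> = x [^] Suc n \<otimes> u" unfolding u(2) using u(1) x_closed by (simp add: S.m_assoc)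
  finally show ?case using u(1) by blast
qed (use assms in \<open>auto intro: bexI[of _ s]\<close>)

lemma irreducibleD:
  assumes "z \<in> irreducible_elements S"
  shows "z \<in> carrier S" "z \<noteq> \<zero>" "z \<notin> Units S"
    "\<And>a b. a \<in> carrier S \<Longrightarrow> b \<in> carrier S \<Longrightarrow> z = a \<otimes> b \<Longrightarrow> a \<in> Units S \<or> b \<in> Units S"
  using assms by (auto simp: irreducible_elements_def)

lemma right_ideal_gen_unit:
  assumes "z \<in> carrier S" "u \<in> Units S"
  shows "right_ideal_gen S (z \<otimes> u) = right_ideal_gen S z"
proof
  show "right_ideal_gen S (z \<otimes> u) \<subseteq> right_ideal_gen S z"
  proof
    fix a assume "a \<in> right_ideal_gen S (z \<otimes> u)"
    then obtain s where "s \<in> carrier S" "a = z \<otimes> (u \<otimes> s)" using assms by (auto simp: right_ideal_gen_eq S.m_assoc)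
    thus "a \<in> right_ideal_gen S z" using assms by (auto simp: right_ideal_gen_eq)
  qed
  show "right_ideal_gen S z \<subseteq> right_ideal_gen S (z \<otimes> u)"
  proof
    fix a assume "a \<in> right_ideal_gen S z"
    then obtain s where s: "s \<in> carrier S" "a = z \<otimes> s" by (auto simp: right_ideal_gen_eq)
    have "u \<otimes> (inv u \<otimes> s) = s" using assms s(1) S.Units_closed[OF assms(2)] by (simp add: S.m_assoc[symmetric])
    hence "a = (z \<otimes> u) \<otimes> (inv u \<otimes> s)" using assms s S.Units_closed[OF assms(2)] by (simp add: S.m_assoc)
    thus "a \<in> right_ideal_gen S (z \<otimes> u)" using assms s(1) by (auto simp: right_ideal_gen_eq)
  qed
qed

text \<open>The saturation of \<open>J\<close> is principal, so it is \<open>yS\<close> or \<open>S\<close> because \<open>y\<close> is irreducible.\<close>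

lemma power_mem_of_irreducible:
  assumes y: "y \<in> irreducible_elements S" and J: "right_ideal S J" "right_ideal_gen S y \<subset> J"
  shows "\<exists>n::nat. x [^] n \<in> J"
proof -
  note y' = irreducibleD[OF y] and J' = right_idealD[OF J(1)]
  have yJ: "y \<in> J" using J(2) self_mem_gen[OF y'(1)] by blast
  define I where "I = {w \<in> carrier S. \<exists>n::nat. w \<otimes> x [^] n \<in> J}"
  have JI: "J \<subseteq> I" unfolding I_def using J'(1) by (auto intro!: exI[of _ 0])
  have up: "w \<otimes> x [^] (n + m) \<in> J" if "w \<in> carrier S" "w \<otimes> x [^] (n::nat) \<in> J" for w n m
    using J'(5)[OF that(2), of "x [^] m"] that(1) x_closed by (simp add: S.nat_pow_mult[symmetric] S.m_assoc)
  have I: "right_ideal S I"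
  proof (rule S.right_idealI)
    fix a b assume "a \<in> I" "b \<in> I"
    then obtain n m where *: "a \<in> carrier S" "b \<in> carrier S" "a \<otimes> x [^] (n::nat) \<in> J" "b \<otimes> x [^] (m::nat) \<in> J"
      by (auto simp: I_def)
    have "a \<otimes> x [^] (n + m) \<in> J" "b \<otimes> x [^] (n + m) \<in> J"
      using up[of a n m] up[of b m n] * by (auto simp: add.commute)
    hence "(a \<oplus> b) \<otimes> x [^] (n + m) \<in> J" using * x_closed J'(3) by (simp add: S.l_distr)
    thus "a \<oplus> b \<in> I" using * by (auto simp: I_def)
  next
    fix a s assume "a \<in> I" and s: "s \<in> carrier S"
    then obtain n where a: "a \<in> carrier S" "a \<otimes> x [^] (n::nat) \<in> J" by (auto simp: I_def)
    obtain t where t: "t \<in> carrier S" "s \<otimes> x [^] n = x [^] n \<otimes> t" using power_normal[OF s] by blast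
    have "(a \<otimes> s) \<otimes> x [^] n = (a \<otimes> x [^] n) \<otimes> t" using a s t x_closed by (simp add: S.m_assoc)
    thus "a \<otimes> s \<in> I" using a s t J'(5) by (auto simp: I_def intro!: exI[of _ n])
  qed (use JI J' in \<open>auto simp: I_def\<close>)
  have "I \<noteq> {\<zero>}" using JI yJ y'(2) by auto
  then obtain z where z: "z \<in> carrier S" "z \<noteq> \<zero>" "I = right_ideal_gen S z"
  proof (rule principal_of_saturated[OF I])
    fix w assume w: "w \<in> carrier S" "w \<otimes> x \<in> I"
    then obtain n where "(w \<otimes> x) \<otimes> x [^] (n::nat) \<in> J" by (auto simp: I_def)
    hence "w \<otimes> x [^] Suc n \<in> J"
      using w(1) x_closed S.nat_pow_mult[of x 1 n] by (simp add: S.m_assoc)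
    thus "w \<in> I" using w(1) unfolding I_def by blast
  qed
  have "y \<in> I" using yJ JI by blast
  then obtain c where c: "c \<in> carrier S" "y = z \<otimes> c" using z by (auto simp: right_ideal_gen_eq)
  have "c \<notin> Units S"
  proof
    assume "c \<in> Units S"
    hence "right_ideal_gen S y = I" using right_ideal_gen_unit[OF z(1)] c z(3) by simp
    thus False using J(2) JI by blast
  qed
  hence "z \<in> Units S" using y'(4)[OF z(1) c(1)] c(2) by blast
  hence "z \<otimes> inv z = \<one>" "inv z \<in> carrier S" by simp_all
  hence "\<one> \<in> I" unfolding z(3) right_ideal_gen_eq by force
  thus ?thesis using x_closed by (auto simp: I_def)
qed

text \<open>Reducing the equation modulo \<open>x\<close> gives an inverse of \<open>f\<close> in \<open>P\<close>.\<close>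

lemma section_unit_of_comaximal:
  assumes f: "f \<in> carrier P" "t \<in> carrier S" and c: "c \<in> carrier S" "s \<in> carrier S"
    and one: "\<one> = x \<otimes> s \<oplus> (\<epsilon> f \<oplus> x \<otimes> t) \<otimes> c"
  shows "f \<in> Units P"
proof -
  obtain q t' where q: "q \<in> carrier P" "t' \<in> carrier S" "c = \<epsilon> q \<oplus> x \<otimes> t'" using section_decomp[OF c(1)] by blast
  obtain u where u: "u \<in> carrier S" "(\<epsilon> f \<oplus> x \<otimes> t) \<otimes> c = \<epsilon> (f \<otimes>\<^bsub>P\<^esub> q) \<oplus> x \<otimes> u"
    using section_product[OF f(1) q(1) f(2) q(2)] q(3) by blast
  have "\<epsilon> \<one>\<^bsub>P\<^esub> = \<epsilon> (f \<otimes>\<^bsub>P\<^esub> q) \<oplus> x \<otimes> (s \<oplus> u)"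
    using one unfolding u(2) using f q u(1) c x_closed by (simp add: S.r_distr S.a_ac)
  hence "f \<otimes>\<^bsub>P\<^esub> q = \<one>\<^bsub>P\<^esub>" using section_eq_mod[of "\<one>\<^bsub>P\<^esub>" "f \<otimes>\<^bsub>P\<^esub> q" "s \<oplus> u"] f q u(1) c by simp
  thus ?thesis using P.UnitsI[OF f(1) q(1)] by simp
qed

end

section \<open>Modules over such rings\<close>

locale skew_division_module = skew_division S P x \<epsilon> deg sz + right_module S V
  for S :: "('s, 'm) ring_scheme" (structure) and P :: "('p, 'n) ring_scheme" and x \<epsilon> deg sz
    and V :: "('s, 'v, 'l) right_mod_scheme" (structure)
begin

sublocale normal_section_module S P x \<epsilon> V ..

lemma annihilator_right_ideal:
  assumes "v \<in> carrier V" "right_submodule S V N"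
  shows "right_ideal S {s \<in> carrier S. v \<cdot>\<^bsub>V\<^esub> s \<in> N}"
  using right_submoduleD[OF assms(2)] assms(1)
  by (intro S.right_idealI) (auto simp: ract_r_distr ract_assoc)

text \<open>The filtration \<open>A i = vx\<^sup>iS + N\<close> leads from \<open>vS\<close> to \<open>N\<close> in \<open>n\<close> steps. Writing \<open>yx\<^sup>i = x\<^sup>iy'\<close>, the
  generator \<open>vx\<^sup>i\<close> of \<open>A i\<close> is killed modulo \<open>A (i + 1)\<close> by \<open>x\<close> and by \<open>y'\<close>, hence by the residue of \<open>y'\<close>
  in \<open>P\<close>, which is nonzero. So each step is artinian.\<close>

lemma artinian_of_power_and_element:
  assumes v: "v \<in> carrier V" and N: "right_submodule S V N" "N \<subseteq> cyclic_submodule v"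
    and y: "y \<in> carrier S" "y \<notin> xS" "v \<cdot>\<^bsub>V\<^esub> y \<in> N" and n: "v \<cdot>\<^bsub>V\<^esub> x [^] (n::nat) \<in> N"
  shows "(cyclic_submodule v, N) \<in> artinian"
proof -
  note N' = right_submoduleD[OF N(1)]
  define u where "u i = v \<cdot>\<^bsub>V\<^esub> x [^] (i::nat)" for i
  have u: "u i \<in> carrier V" for i unfolding u_def using v x_closed by (simp add: ract_closed)
  define A where "A i = cyclic_submodule (u i) <+>\<^bsub>V\<^esub> N" for i
  note cu = cyclic_submodule_submodule[OF u]
  have A: "right_submodule S V (A i)" for i unfolding A_def by (rule submodule_sum[OF cu N(1)])
  have NA: "N \<subseteq> A i" and uA: "u i \<in> A i" for i
    using submodule_sum_upper[OF cu N(1), of i] self_in_cyclic_submodule[OF u, of i] by (auto simp: A_def)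
  have ux: "u i \<cdot>\<^bsub>V\<^esub> x = u (Suc i)" for i unfolding u_def using v x_closed by (simp add: ract_assoc)
  have step: "(A i, A (Suc i)) \<in> artinian" for i
  proof -
    obtain y' where y': "y' \<in> carrier S" "y \<otimes> x [^] i = x [^] i \<otimes> y'" using power_normal[OF y(1)] by blast
    obtain p t where pt: "p \<in> carrier P" "t \<in> carrier S" "y' = \<epsilon> p \<oplus> x \<otimes> t" using section_decomp[OF y'(1)] by blast
    have "p \<noteq> \<zero>\<^bsub>P\<^esub>"
    proof
      \<comment> \<open>Otherwise \<open>x\<close> could be cancelled from \<open>yx^i \<in> Sx^(i+1)\<close>, making \<open>y\<close> divisible by \<open>x\<close>.\<close>
      assume "p = \<zero>\<^bsub>P\<^esub>"
      hence "y' = x \<otimes> t" using pt x_closed by simp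
      hence "y \<otimes> x [^] i = x [^] i \<otimes> (x \<otimes> t)" using y'(2) by simp
      also have "\<dots> = x [^] Suc i \<otimes> t" using pt(2) x_closed by (simp add: S.m_assoc)
      finally have e1: "y \<otimes> x [^] i = x [^] Suc i \<otimes> t" .
      have xr: "\<exists>t'\<in>carrier S. x [^] (j::nat) \<otimes> t = t' \<otimes> x [^] j" for j
      proof (induction j)
        case (Suc j)
        then obtain t' where t': "t' \<in> carrier S" "x [^] j \<otimes> t = t' \<otimes> x [^] j" by blast
        obtain t'' where t'': "t'' \<in> carrier S" "x \<otimes> t' = t'' \<otimes> x" using normal_right[OF t'(1)] by blast
        have "x [^] Suc j \<otimes> t = x \<otimes> (x [^] j \<otimes> t)"
          using x_closed pt(2) S.nat_pow_Suc2[OF x_closed, of j] by (simp add: S.m_assoc)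
        also have "\<dots> = t'' \<otimes> (x \<otimes> x [^] j)"
          unfolding t'(2) using t' t'' x_closed by (simp add: S.m_assoc[symmetric])
        finally show ?case using t''(1) x_closed S.nat_pow_Suc2[OF x_closed, of j] by auto
      qed (use pt(2) in \<open>auto intro: bexI[of _ t]\<close>)
      obtain t' where t': "t' \<in> carrier S" "x [^] Suc i \<otimes> t = t' \<otimes> x [^] Suc i" using xr by blast
      have "x [^] i \<noteq> \<zero>"
      proof (induction i)
        case (Suc i) thus ?case using integral[of "x [^] i" x] x_closed x_nonzero by auto
      qed (use one_nonzero in simp)
      moreover have "y \<otimes> x [^] i = (t' \<otimes> x) \<otimes> x [^] i"
        using e1 t' x_closed S.nat_pow_Suc2[OF x_closed, of i] by (simp add: S.m_assoc)
      ultimately have "y = t' \<otimes> x" using rcancel[of "x [^] i" y "t' \<otimes> x"] y(1) t'(1) x_closed by simp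
      thus False using y(2) t'(1) xS_I by blast
    qed
    have "u i \<cdot>\<^bsub>V\<^esub> y' = (v \<cdot>\<^bsub>V\<^esub> y) \<cdot>\<^bsub>V\<^esub> x [^] i"
      unfolding u_def using v y(1) y' x_closed by (simp add: ract_assoc[symmetric])
    hence "u i \<cdot>\<^bsub>V\<^esub> y' \<in> N" using N'(5)[OF y(3)] x_closed by simp
    moreover have "u i \<cdot>\<^bsub>V\<^esub> y' = u i \<cdot>\<^bsub>V\<^esub> \<epsilon> p \<oplus>\<^bsub>V\<^esub> u (Suc i) \<cdot>\<^bsub>V\<^esub> t"
      unfolding pt(3) using u[of i] pt(1,2) x_closed by (simp add: ract_r_distr ract_assoc ux)
    moreover have *: "u (Suc i) \<cdot>\<^bsub>V\<^esub> t \<in> A (Suc i)" using right_submoduleD(5)[OF A uA] pt(2) .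
    moreover have "u i \<cdot>\<^bsub>V\<^esub> \<epsilon> p = (u i \<cdot>\<^bsub>V\<^esub> \<epsilon> p \<oplus>\<^bsub>V\<^esub> u (Suc i) \<cdot>\<^bsub>V\<^esub> t) \<oplus>\<^bsub>V\<^esub> \<ominus>\<^bsub>V\<^esub> (u (Suc i) \<cdot>\<^bsub>V\<^esub> t)"
      using u[of i] u[of "Suc i"] pt(1,2) by (simp add: V.a_assoc V.r_neg ract_closed)
    ultimately have mem: "u i \<cdot>\<^bsub>V\<^esub> \<epsilon> p \<in> A (Suc i)"
      using right_submoduleD(3,4)[OF A[of "Suc i"]] NA[of "Suc i"] by (metis subsetD)
    have art: "(cyclic_submodule (u i) <+>\<^bsub>V\<^esub> A (Suc i), A (Suc i)) \<in> artinian"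
      by (rule cyclic_sum_artinian[OF u A _ pt(1) \<open>p \<noteq> \<zero>\<^bsub>P\<^esub>\<close> mem]) (simp add: ux uA)
    have "A i \<subseteq> cyclic_submodule (u i) <+>\<^bsub>V\<^esub> A (Suc i)"
      unfolding A_def[of i] using submodule_sum_upper[OF cu A] NA
      by (intro submodule_sum_least submodule_sum cu A) blast+
    moreover have "A (Suc i) \<subseteq> A i"
    proof -
      have "u (Suc i) \<in> A i" using right_submoduleD(5)[OF A uA x_closed] by (simp add: ux)
      thus ?thesis unfolding A_def[of "Suc i"] using NA
        by (intro submodule_sum_least A cyclic_submodule_least)
    qed
    ultimately show ?thesis using artinian_subinterval[OF art A A] by blast
  qed
  have "(A 0, A i) \<in> artinian" for i
  proof (induction i)
    case 0
    show ?case using kdim_zero_subset_step[OF subset_refl] A by (auto simp: kdim_zero_def)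
  qed (use artinian_extension[OF _ step] in blast)
  hence "(A 0, A n) \<in> artinian" .
  moreover have "A 0 = cyclic_submodule v"
    unfolding A_def u_def using submodule_sum_absorb[OF N(1) cyclic_submodule_submodule[OF v] N(2)] v
    by (simp add: ract_one)
  moreover have "A n = N"
    unfolding A_def using n cyclic_submodule_least[OF N(1)]
    by (intro submodule_sum_absorb cu N(1)) (auto simp: u_def)
  ultimately show ?thesis by simp
qed

lemma transporter_strict:
  assumes v: "v \<in> carrier V" and ann: "\<And>s. s \<in> carrier S \<Longrightarrow> v \<cdot>\<^bsub>V\<^esub> s = \<zero>\<^bsub>V\<^esub> \<longleftrightarrow> s \<in> right_ideal_gen S y"
    and y: "y \<in> carrier S"
    and N: "right_submodule S V N" "N \<noteq> {\<zero>\<^bsub>V\<^esub>}" "N \<subseteq> cyclic_submodule v"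
  shows "right_ideal_gen S y \<subset> {s \<in> carrier S. v \<cdot>\<^bsub>V\<^esub> s \<in> N}"
proof -
  have "right_ideal_gen S y \<subseteq> carrier S" using y by (auto simp: right_ideal_gen_eq)
  hence "s \<in> carrier S \<and> v \<cdot>\<^bsub>V\<^esub> s = \<zero>\<^bsub>V\<^esub>" if "s \<in> right_ideal_gen S y" for s
    using that ann by blast
  hence "right_ideal_gen S y \<subseteq> {s \<in> carrier S. v \<cdot>\<^bsub>V\<^esub> s \<in> N}"
    using right_submoduleD(2)[OF N(1)] by auto
  moreover obtain w where "w \<in> N" "w \<noteq> \<zero>\<^bsub>V\<^esub>" using nonzero_submodule_obtains[OF N(1,2)] .
  moreover from this obtain s where "s \<in> carrier S" "w = v \<cdot>\<^bsub>V\<^esub> s" using N(3) by (auto simp: cyclic_submodule_def)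
  ultimately show ?thesis using ann by blast
qed

text \<open>The right ideal of all \<open>s\<close> with \<open>vs \<in> N\<close> lies strictly above \<open>yS\<close>, so it contains a power of \<open>x\<close> as
  well as \<open>y\<close>.\<close>

lemma irreducible_proper_factor_artinian:
  assumes v: "v \<in> carrier V" and ann: "\<And>s. s \<in> carrier S \<Longrightarrow> v \<cdot>\<^bsub>V\<^esub> s = \<zero>\<^bsub>V\<^esub> \<longleftrightarrow> s \<in> right_ideal_gen S y"
    and y: "y \<in> irreducible_elements S" "y \<notin> xS"
    and N: "right_submodule S V N" "N \<noteq> {\<zero>\<^bsub>V\<^esub>}" "N \<subseteq> cyclic_submodule v"
  shows "(cyclic_submodule v, N) \<in> artinian"
proof -
  note y' = irreducibleD[OF y(1)]
  let ?J = "{s \<in> carrier S. v \<cdot>\<^bsub>V\<^esub> s \<in> N}"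
  have st: "right_ideal_gen S y \<subset> ?J" by (rule transporter_strict[OF v ann y'(1) N])
  have "y \<in> ?J" using st self_mem_gen[OF y'(1)] by blast
  moreover obtain n where "x [^] (n::nat) \<in> ?J"
    using power_mem_of_irreducible[OF y(1) annihilator_right_ideal[OF v N(1)] st] by blast
  ultimately show ?thesis using artinian_of_power_and_element[OF v N(1,3) y'(1) y(2)] by blast
qed

text \<open>A pair \<open>(v, y)\<close> with \<open>vy = 0\<close> and \<open>y\<close> of least size: a factorization of \<open>y\<close> would give a smaller
  pair.\<close>

lemma irreducible_annihilator_exists:
  assumes inj: "\<And>v. v \<in> carrier V \<Longrightarrow> v \<cdot>\<^bsub>V\<^esub> x = \<zero>\<^bsub>V\<^esub> \<Longrightarrow> v = \<zero>\<^bsub>V\<^esub>"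
    and ex: "v0 \<in> carrier V" "v0 \<noteq> \<zero>\<^bsub>V\<^esub>" "y0 \<in> carrier S" "y0 \<noteq> \<zero>" "v0 \<cdot>\<^bsub>V\<^esub> y0 = \<zero>\<^bsub>V\<^esub>"
  obtains v y where "v \<in> carrier V" "v \<noteq> \<zero>\<^bsub>V\<^esub>" "y \<in> irreducible_elements S" "y \<notin> xS"
    "\<And>s. s \<in> carrier S \<Longrightarrow> v \<cdot>\<^bsub>V\<^esub> s = \<zero>\<^bsub>V\<^esub> \<longleftrightarrow> s \<in> right_ideal_gen S y"
proof -
  define Q where "Q y \<longleftrightarrow> y \<in> carrier S \<and> y \<noteq> \<zero> \<and> (\<exists>v\<in>carrier V. v \<noteq> \<zero>\<^bsub>V\<^esub> \<and> v \<cdot>\<^bsub>V\<^esub> y = \<zero>\<^bsub>V\<^esub>)" for y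
  have "Q y0" using ex by (auto simp: Q_def)
  then obtain y1 where y1: "Q y1" "\<And>y. Q y \<Longrightarrow> sz y1 \<le> sz y" using ex_has_least_nat[of Q y0 sz] by blast
  then obtain v where v: "v \<in> carrier V" "v \<noteq> \<zero>\<^bsub>V\<^esub>" "v \<cdot>\<^bsub>V\<^esub> y1 = \<zero>\<^bsub>V\<^esub>" "y1 \<in> carrier S" "y1 \<noteq> \<zero>" by (auto simp: Q_def)
  let ?I = "{s \<in> carrier S. v \<cdot>\<^bsub>V\<^esub> s \<in> {\<zero>\<^bsub>V\<^esub>}}"
  obtain y where y: "y \<in> carrier S" "y \<noteq> \<zero>" "y \<notin> xS" "?I = right_ideal_gen S y"
  proof (rule principal_of_saturated)
    show "right_ideal S ?I" by (rule annihilator_right_ideal[OF v(1) submodule_zero])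
    show "?I \<noteq> {\<zero>}" using v by blast
    fix w assume "w \<in> carrier S" "w \<otimes> x \<in> ?I"
    thus "w \<in> ?I" using inj[of "v \<cdot>\<^bsub>V\<^esub> w"] v(1) x_closed by (simp add: ract_assoc ract_closed)
  qed
  have ann: "v \<cdot>\<^bsub>V\<^esub> s = \<zero>\<^bsub>V\<^esub> \<longleftrightarrow> s \<in> right_ideal_gen S y" if "s \<in> carrier S" for s
    using that y(4) by auto
  have vy: "v \<cdot>\<^bsub>V\<^esub> y = \<zero>\<^bsub>V\<^esub>" using ann[OF y(1)] self_mem_gen[OF y(1)] by simp
  obtain c where c: "c \<in> carrier S" "y1 = y \<otimes> c" using ann[OF v(4)] v(3) by (auto simp: right_ideal_gen_eq)
  hence "c \<noteq> \<zero>" using v(5) y(1) by auto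
  hence "sz y \<le> sz y1" using sz_mult[of y c] c y by simp
  hence min: "sz y \<le> sz a" if "Q a" for a using y1(2)[OF that] by simp
  have "y \<notin> Units S"
  proof
    assume u: "y \<in> Units S"
    have "v = (v \<cdot>\<^bsub>V\<^esub> y) \<cdot>\<^bsub>V\<^esub> inv y" using v(1) u y(1) by (simp add: ract_assoc[symmetric] ract_one)
    thus False using vy u v(2) by simp
  qed
  moreover have "a \<in> Units S \<or> b \<in> Units S" if ab: "a \<in> carrier S" "b \<in> carrier S" "y = a \<otimes> b" for a b
  proof -
    have nz: "a \<noteq> \<zero>" "b \<noteq> \<zero>" using ab y(2) by auto
    have s: "sz y = sz a + sz b" using sz_mult[OF ab(1,2) nz] ab(3) by simp
    show ?thesis
    proof (cases "v \<cdot>\<^bsub>V\<^esub> a = \<zero>\<^bsub>V\<^esub>")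
      case True
      hence "sz y \<le> sz a" using min[of a] nz ab v by (auto simp: Q_def)
      thus ?thesis using s sz_zero_iff[OF ab(2) nz(2)] by simp
    next
      case False
      have "(v \<cdot>\<^bsub>V\<^esub> a) \<cdot>\<^bsub>V\<^esub> b = \<zero>\<^bsub>V\<^esub>" using vy ab v(1) by (simp add: ract_assoc)
      hence "sz y \<le> sz b" using min[of b] nz ab v False ract_closed unfolding Q_def by blast
      thus ?thesis using s sz_zero_iff[OF ab(1) nz(1)] by simp
    qed
  qed
  ultimately have "y \<in> irreducible_elements S" using y by (auto simp: irreducible_elements_def)
  thus ?thesis using that[OF v(1,2) _ y(3) ann] by blast
qed

text \<open>A nonzero element killed by \<open>x\<close> generates a quotient of \<open>P\<close>; if there is none, an element whose
  annihilator is generated by an irreducible element exists. In both cases the proper factors of the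
  cyclic submodule are artinian.\<close>

lemma torsion_has_small_submodule:
  assumes tor: "torsion S V" and nz: "carrier V \<noteq> {\<zero>\<^bsub>V\<^esub>}"
  obtains N where "right_submodule S V N" "N \<noteq> {\<zero>\<^bsub>V\<^esub>}" "(N, {\<zero>\<^bsub>V\<^esub>}) \<in> kdim_step S V artinian"
proof -
  have *: "(cyclic_submodule v, {\<zero>\<^bsub>V\<^esub>}) \<in> kdim_step S V artinian"
    if v: "v \<in> carrier V" "v \<noteq> \<zero>\<^bsub>V\<^esub>"
      and fac: "\<And>N. right_submodule S V N \<Longrightarrow> N \<noteq> {\<zero>\<^bsub>V\<^esub>} \<Longrightarrow> N \<subseteq> cyclic_submodule v \<Longrightarrow>
        (cyclic_submodule v, N) \<in> artinian" for v
    using right_submoduleD(2)[OF cyclic_submodule_submodule[OF v(1)]] fac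
    by (intro kdim_le_1_if_proper_factors_artinian cyclic_submodule_submodule v(1) submodule_zero) auto
  have "\<exists>v\<in>carrier V. v \<noteq> \<zero>\<^bsub>V\<^esub> \<and> (\<forall>N. right_submodule S V N \<longrightarrow> N \<noteq> {\<zero>\<^bsub>V\<^esub>} \<longrightarrow> N \<subseteq> cyclic_submodule v \<longrightarrow>
        (cyclic_submodule v, N) \<in> artinian)"
  proof (cases "\<exists>v\<in>carrier V. v \<cdot>\<^bsub>V\<^esub> x = \<zero>\<^bsub>V\<^esub> \<and> v \<noteq> \<zero>\<^bsub>V\<^esub>")
    case True
    thus ?thesis using killed_submodule_artinian by blast
  next
    case False
    obtain v0 where v0: "v0 \<in> carrier V" "v0 \<noteq> \<zero>\<^bsub>V\<^esub>" using nonzero_submodule_obtains[OF submodule_carrier nz] .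
    then obtain y0 where "y0 \<in> carrier S" "y0 \<noteq> \<zero>" "v0 \<cdot>\<^bsub>V\<^esub> y0 = \<zero>\<^bsub>V\<^esub>" using tor unfolding torsion_def by blast
    then obtain v y where "v \<in> carrier V" "v \<noteq> \<zero>\<^bsub>V\<^esub>" "y \<in> irreducible_elements S" "y \<notin> xS"
      "\<And>s. s \<in> carrier S \<Longrightarrow> v \<cdot>\<^bsub>V\<^esub> s = \<zero>\<^bsub>V\<^esub> \<longleftrightarrow> s \<in> right_ideal_gen S y"
      using irreducible_annihilator_exists[OF _ v0] False by metis
    thus ?thesis using irreducible_proper_factor_artinian by metis
  qed
  then obtain v where v: "v \<in> carrier V" "v \<noteq> \<zero>\<^bsub>V\<^esub>"
    "\<And>N. right_submodule S V N \<Longrightarrow> N \<noteq> {\<zero>\<^bsub>V\<^esub>} \<Longrightarrow> N \<subseteq> cyclic_submodule v \<Longrightarrow> (cyclic_submodule v, N) \<in> artinian"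
    by blast
  show ?thesis
    by (rule that[OF cyclic_submodule_submodule[OF v(1)] cyclic_submodule_nonzero[OF v(1,2)] *[OF v]])
qed

text \<open>If \<open>vx \<noteq> 0\<close>, then \<open>v = vxs\<close> for some \<open>s\<close> by simplicity, and \<open>1 - xs\<close> kills \<open>v\<close>. It is nonzero because
  \<open>x\<close> is not a unit.\<close>

lemma simple_torsion:
  assumes V: "simple_module S V"
  shows "torsion S V"
  unfolding torsion_def
proof
  fix v assume v: "v \<in> carrier V"
  show "\<exists>s\<in>carrier S. s \<noteq> \<zero> \<and> v \<cdot>\<^bsub>V\<^esub> s = \<zero>\<^bsub>V\<^esub>"
  proof (cases "v \<cdot>\<^bsub>V\<^esub> x = \<zero>\<^bsub>V\<^esub>")
    case False
    have vx: "v \<cdot>\<^bsub>V\<^esub> x \<in> carrier V" using v x_closed by (simp add: ract_closed)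
    obtain s where s: "s \<in> carrier S" "v = (v \<cdot>\<^bsub>V\<^esub> x) \<cdot>\<^bsub>V\<^esub> s"
      using simple_cyclic[OF V vx False] v by (auto simp: cyclic_submodule_def)
    have "v \<cdot>\<^bsub>V\<^esub> (\<one> \<ominus> x \<otimes> s) = v \<oplus>\<^bsub>V\<^esub> \<ominus>\<^bsub>V\<^esub> ((v \<cdot>\<^bsub>V\<^esub> x) \<cdot>\<^bsub>V\<^esub> s)"
      using v s(1) x_closed by (simp add: a_minus_def ract_r_distr ract_minus ract_one ract_assoc)
    also have "\<dots> = \<zero>\<^bsub>V\<^esub>" using s(2) v V.r_neg by metis
    finally have "v \<cdot>\<^bsub>V\<^esub> (\<one> \<ominus> x \<otimes> s) = \<zero>\<^bsub>V\<^esub>" .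
    moreover have "\<one> \<ominus> x \<otimes> s \<noteq> \<zero>"
      using S.minus_eq_zero_iff[of \<one> "x \<otimes> s"] s(1) x_closed unitI(1)[of x s] x_nonunit by auto
    ultimately show ?thesis using s(1) x_closed by (intro bexI[of _ "\<one> \<ominus> x \<otimes> s"]) auto
  qed (use x_closed x_nonzero in auto)
qed

text \<open>If \<open>vS\<close> were free, then the factor \<open>vS/vxS\<close> would not be artinian, as it is isomorphic to \<open>P\<close>.\<close>

lemma one_critical_torsion:
  assumes V: "n_critical 1 S V"
  shows "torsion S V"
  unfolding torsion_def
proof (rule ballI, rule ccontr)
  fix v assume v: "v \<in> carrier V" and "\<not> (\<exists>s\<in>carrier S. s \<noteq> \<zero> \<and> v \<cdot>\<^bsub>V\<^esub> s = \<zero>\<^bsub>V\<^esub>)"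
  hence free: "s = \<zero>" if "s \<in> carrier S" "v \<cdot>\<^bsub>V\<^esub> s = \<zero>\<^bsub>V\<^esub>" for s using that by blast
  have vx: "v \<cdot>\<^bsub>V\<^esub> x \<in> carrier V" "v \<cdot>\<^bsub>V\<^esub> x \<noteq> \<zero>\<^bsub>V\<^esub>" using v x_closed x_nonzero free by (auto simp: ract_closed)
  let ?N = "cyclic_submodule (v \<cdot>\<^bsub>V\<^esub> x)"
  note cv = cyclic_submodule_submodule[OF v] and N = cyclic_submodule_submodule[OF vx(1)]
  have Nv: "?N \<subseteq> cyclic_submodule v"
    using x_closed by (intro cyclic_submodule_least cv) (auto simp: cyclic_submodule_def)
  have "(carrier V, ?N) \<in> artinian"
    using V N cyclic_submodule_nonzero[OF vx] unfolding one_critical_iff by blast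
  hence "(cyclic_submodule v, ?N) \<in> artinian"
    using artinian_subinterval[OF _ cv N subset_refl Nv] right_submoduleD(1)[OF cv] by blast
  moreover have "(cyclic_submodule v <+>\<^bsub>V\<^esub> ?N, ?N) \<notin> artinian"
  proof (rule cyclic_sum_not_artinian[OF v N self_in_cyclic_submodule[OF vx(1)]])
    fix p assume p: "p \<in> carrier P" "v \<cdot>\<^bsub>V\<^esub> \<epsilon> p \<in> ?N"
    then obtain s where s: "s \<in> carrier S" "v \<cdot>\<^bsub>V\<^esub> \<epsilon> p = (v \<cdot>\<^bsub>V\<^esub> x) \<cdot>\<^bsub>V\<^esub> s" by (auto simp: cyclic_submodule_def)
    hence "v \<cdot>\<^bsub>V\<^esub> (\<epsilon> p \<ominus> x \<otimes> s) = \<zero>\<^bsub>V\<^esub>"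
      using v p(1) x_closed by (simp add: a_minus_def ract_r_distr ract_minus ract_assoc V.r_neg ract_closed)
    hence "\<epsilon> p \<ominus> x \<otimes> s = \<zero>" using p(1) s(1) x_closed by (intro free) auto
    hence "\<epsilon> p = x \<otimes> s" using p(1) s(1) x_closed S.minus_eq_zero_iff by simp
    thus "p = \<zero>\<^bsub>P\<^esub>" using section_inj p(1) s(1) by blast
  qed
  ultimately show False using submodule_sum_absorb[OF N cv Nv] by simp
qed

text \<open>The right ideal \<open>J\<close> of all \<open>s\<close> with \<open>vs \<in> N\<close> contains \<open>z\<close> and some power of \<open>x\<close>. As \<open>f\<close> is a unit,
  \<open>1 = za + xb\<close> for some \<open>a\<close> and \<open>b\<close>, so \<open>x\<^sup>n \<in> zS + x\<^sup>n\<^sup>+\<^sup>1S\<close>. Thus the exponent can be lowered down to zero.\<close>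

lemma unit_section_simple:
  assumes v: "v \<in> carrier V" and ann: "\<And>s. s \<in> carrier S \<Longrightarrow> v \<cdot>\<^bsub>V\<^esub> s = \<zero>\<^bsub>V\<^esub> \<longleftrightarrow> s \<in> right_ideal_gen S z"
    and z: "z \<in> irreducible_elements S" "z = \<epsilon> f \<oplus> x \<otimes> t" "f \<in> Units P" "t \<in> carrier S"
    and N: "right_submodule S V N" "N \<noteq> {\<zero>\<^bsub>V\<^esub>}" "N \<subseteq> cyclic_submodule v"
  shows "N = cyclic_submodule v"
proof -
  note z' = irreducibleD[OF z(1)]
  let ?J = "{s \<in> carrier S. v \<cdot>\<^bsub>V\<^esub> s \<in> N}"
  have J: "right_ideal S ?J" by (rule annihilator_right_ideal[OF v N(1)])
  note J' = right_idealD[OF J]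
  have st: "right_ideal_gen S z \<subset> ?J" by (rule transporter_strict[OF v ann z'(1) N])
  have zJ: "z \<in> ?J" using st self_mem_gen[OF z'(1)] by blast
  have fU: "f \<in> carrier P" "inv\<^bsub>P\<^esub> f \<in> carrier P" "f \<otimes>\<^bsub>P\<^esub> inv\<^bsub>P\<^esub> f = \<one>\<^bsub>P\<^esub>" using z(3) by auto
  define a where "a = \<epsilon> (inv\<^bsub>P\<^esub> f)"
  define b where "b = \<ominus> (t \<otimes> a)"
  have a: "a \<in> carrier S" and b: "b \<in> carrier S" using fU z(4) by (auto simp: a_def b_def)
  have fa: "\<epsilon> f \<otimes> a = \<one>" unfolding a_def using section_mult[OF fU(1,2)] fU(3) by simp
  have one: "\<one> = z \<otimes> a \<oplus> x \<otimes> b"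
    unfolding z(2) b_def using fU(1) z(4) a x_closed fa
    by (simp add: S.l_distr S.m_assoc S.r_minus S.a_assoc S.r_neg)
  obtain n where n: "x [^] (n::nat) \<in> ?J" using power_mem_of_irreducible[OF z(1) J st] by blast
  have "\<one> \<in> ?J" using n
  proof (induction n)
    case (Suc n)
    obtain b' where b': "b' \<in> carrier S" "b \<otimes> x [^] n = x [^] n \<otimes> b'" using power_normal[OF b] by blast
    have "x [^] n = (z \<otimes> a \<oplus> x \<otimes> b) \<otimes> x [^] n"
      unfolding one[symmetric] using x_closed by simp
    also have "\<dots> = z \<otimes> (a \<otimes> x [^] n) \<oplus> x \<otimes> (b \<otimes> x [^] n)"
      using z'(1) a b x_closed by (simp add: S.l_distr S.m_assoc)
    also have "x \<otimes> (b \<otimes> x [^] n) = x [^] Suc n \<otimes> b'"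
      unfolding b'(2) using b'(1) x_closed S.nat_pow_Suc2[OF x_closed, of n] by (simp add: S.m_assoc[symmetric])
    finally have "x [^] n \<in> ?J"
      using J'(3)[OF J'(5)[OF zJ, of "a \<otimes> x [^] n"] J'(5)[OF Suc.prems b'(1)]] a x_closed by simp
    thus ?case by (rule Suc.IH)
  qed simp
  hence "v \<in> N" using v by (simp add: ract_one)
  thus ?thesis using cyclic_submodule_least[OF N(1)] N(3) by blast
qed

lemma x_injective:
  assumes v: "v \<in> carrier V" "carrier V = cyclic_submodule v"
    and ann: "\<And>s. s \<in> carrier S \<Longrightarrow> v \<cdot>\<^bsub>V\<^esub> s = \<zero>\<^bsub>V\<^esub> \<longleftrightarrow> s \<in> right_ideal_gen S z"
    and z: "z \<in> carrier S" "z \<notin> xS" and w: "w \<in> carrier V" "w \<cdot>\<^bsub>V\<^esub> x = \<zero>\<^bsub>V\<^esub>"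
  shows "w = \<zero>\<^bsub>V\<^esub>"
proof -
  obtain s where s: "s \<in> carrier S" "w = v \<cdot>\<^bsub>V\<^esub> s" using w v by (auto simp: cyclic_submodule_def)
  hence "s \<otimes> x \<in> right_ideal_gen S z" using ann[of "s \<otimes> x"] w v(1) x_closed by (simp add: ract_assoc)
  thus ?thesis using saturated_of_notin_xS[OF z s(1)] ann s by blast
qed

text \<open>If \<open>v = vsx = vxs'\<close>, then \<open>1 - xs'\<close> annihilates \<open>v\<close>, so it is a multiple of \<open>z\<close>.\<close>

lemma section_unit_of_divisible:
  assumes v: "v \<in> carrier V" "carrier V = cyclic_submodule v"
    and ann: "\<And>s. s \<in> carrier S \<Longrightarrow> v \<cdot>\<^bsub>V\<^esub> s = \<zero>\<^bsub>V\<^esub> \<longleftrightarrow> s \<in> right_ideal_gen S z"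
    and z: "z = \<epsilon> f \<oplus> x \<otimes> t" "f \<in> carrier P" "t \<in> carrier S"
    and div: "w \<in> carrier V" "v = w \<cdot>\<^bsub>V\<^esub> x"
  shows "f \<in> Units P"
proof -
  obtain s where s: "s \<in> carrier S" "w = v \<cdot>\<^bsub>V\<^esub> s" using div v by (auto simp: cyclic_submodule_def)
  obtain s' where s': "s' \<in> carrier S" "s \<otimes> x = x \<otimes> s'" using normal_left[OF s(1)] by blast
  have "v \<cdot>\<^bsub>V\<^esub> (x \<otimes> s') = v" using div(2) s s'(2)[symmetric] v(1) x_closed by (simp add: ract_assoc)
  hence "v \<cdot>\<^bsub>V\<^esub> (\<one> \<ominus> x \<otimes> s') = \<zero>\<^bsub>V\<^esub>"
    using v(1) s'(1) x_closed by (simp add: a_minus_def ract_r_distr ract_minus ract_one V.r_neg)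
  then obtain c where c: "c \<in> carrier S" "\<one> \<ominus> x \<otimes> s' = z \<otimes> c"
    using ann[of "\<one> \<ominus> x \<otimes> s'"] s'(1) x_closed by (auto simp: right_ideal_gen_eq)
  have "\<one> = x \<otimes> s' \<oplus> (\<one> \<ominus> x \<otimes> s')" using s'(1) x_closed by (simp add: a_minus_def S.a_lcomm S.r_neg)
  thus ?thesis unfolding c(2) z(1) using section_unit_of_comaximal[OF z(2,3) c(1) s'(1)] by blast
qed

lemma simple_of_unit_section:
  assumes v: "v \<in> carrier V" "carrier V = cyclic_submodule v"
    and ann: "\<And>s. s \<in> carrier S \<Longrightarrow> v \<cdot>\<^bsub>V\<^esub> s = \<zero>\<^bsub>V\<^esub> \<longleftrightarrow> s \<in> right_ideal_gen S z"
    and z: "z \<in> irreducible_elements S" "z = \<epsilon> f \<oplus> x \<otimes> t" "f \<in> Units P" "t \<in> carrier S"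
  shows "simple_module S V" "v \<cdot>\<^bsub>V\<^esub> x \<noteq> \<zero>\<^bsub>V\<^esub>"
proof -
  note z' = irreducibleD[OF z(1)]
  have "f \<noteq> \<zero>\<^bsub>P\<^esub>" using z(3) by (metis P.Units_r_inv P.Units_inv_closed P.l_null P.one_not_zero)
  hence zx: "z \<notin> xS" unfolding z(2) using z(3,4) by (intro section_notin_xS) auto
  have v0: "v \<noteq> \<zero>\<^bsub>V\<^esub>"
  proof
    assume "v = \<zero>\<^bsub>V\<^esub>"
    hence "\<one> \<in> right_ideal_gen S z" using ann[of \<one>] by simp
    then obtain c where "c \<in> carrier S" "z \<otimes> c = \<one>" by (auto simp: right_ideal_gen_eq)
    thus False using z'(1,3) unitI by blast
  qed
  thus "v \<cdot>\<^bsub>V\<^esub> x \<noteq> \<zero>\<^bsub>V\<^esub>" using x_injective[OF v ann z'(1) zx v(1)] by blast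
  show "simple_module S V"
    unfolding simple_module_def
  proof (intro conjI allI impI)
    fix N assume N: "right_submodule S V N"
    show "N = {\<zero>\<^bsub>V\<^esub>} \<or> N = carrier V"
      using unit_section_simple[OF v(1) ann z N] right_submoduleD(1)[OF N] unfolding v(2) by blast
  qed (use right_module_axioms v v0 in auto)
qed

text \<open>Schur's lemma for the semilinear map \<open>v \<mapsto> vx\<close>, whose kernel and image are submodules.\<close>

lemma simple_x_bijective:
  assumes V: "simple_module S V" and u: "u \<in> carrier V" "u \<cdot>\<^bsub>V\<^esub> x \<noteq> \<zero>\<^bsub>V\<^esub>" and v: "v \<in> carrier V"
  shows "v \<cdot>\<^bsub>V\<^esub> x = \<zero>\<^bsub>V\<^esub> \<Longrightarrow> v = \<zero>\<^bsub>V\<^esub>" "\<exists>w\<in>carrier V. v = w \<cdot>\<^bsub>V\<^esub> x"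
proof -
  have 01: "N = {\<zero>\<^bsub>V\<^esub>} \<or> N = carrier V" if "right_submodule S V N" for N
    using V that by (auto simp: simple_module_def)
  show "v = \<zero>\<^bsub>V\<^esub>" if "v \<cdot>\<^bsub>V\<^esub> x = \<zero>\<^bsub>V\<^esub>"
    using 01[OF normal_kernel_submodule[OF x_closed normal_left submodule_zero]] u v that by blast
  have "(\<lambda>v. v \<cdot>\<^bsub>V\<^esub> x) ` carrier V = carrier V"
    using 01[OF normal_image_submodule[OF x_closed normal_right submodule_carrier]] u by blast
  thus "\<exists>w\<in>carrier V. v = w \<cdot>\<^bsub>V\<^esub> x" using v by blast
qed

text \<open>Since \<open>x\<close> acts injectively, an element \<open>v\<close> with annihilator \<open>zS\<close> for an irreducible \<open>z\<close> exists; since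
  \<open>v\<close> is divisible by \<open>x\<close>, the residue of \<open>z\<close> is a unit.\<close>

lemma simple_annihilator:
  assumes V: "simple_module S V" and u: "u \<in> carrier V" "u \<cdot>\<^bsub>V\<^esub> x \<noteq> \<zero>\<^bsub>V\<^esub>"
  obtains v z f t where "v \<in> carrier V" "carrier V = cyclic_submodule v"
    "\<And>s. s \<in> carrier S \<Longrightarrow> v \<cdot>\<^bsub>V\<^esub> s = \<zero>\<^bsub>V\<^esub> \<longleftrightarrow> s \<in> right_ideal_gen S z"
    "z \<in> irreducible_elements S" "z = \<epsilon> f \<oplus> x \<otimes> t" "f \<in> Units P" "t \<in> carrier S"
proof -
  note bij = simple_x_bijective[OF V u]
  have u0: "u \<noteq> \<zero>\<^bsub>V\<^esub>" using u x_closed by auto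
  obtain y0 where y0: "y0 \<in> carrier S" "y0 \<noteq> \<zero>" "u \<cdot>\<^bsub>V\<^esub> y0 = \<zero>\<^bsub>V\<^esub>"
    using simple_torsion[OF V] u unfolding torsion_def by blast
  obtain v z where v: "v \<in> carrier V" "v \<noteq> \<zero>\<^bsub>V\<^esub>" and z: "z \<in> irreducible_elements S" "z \<notin> xS"
    and ann: "\<And>s. s \<in> carrier S \<Longrightarrow> v \<cdot>\<^bsub>V\<^esub> s = \<zero>\<^bsub>V\<^esub> \<longleftrightarrow> s \<in> right_ideal_gen S z"
    using irreducible_annihilator_exists[OF bij(1) u(1) u0 y0] by blast
  obtain f t where f: "f \<in> carrier P" "t \<in> carrier S" "z = \<epsilon> f \<oplus> x \<otimes> t"
    using section_decomp irreducibleD(1)[OF z(1)] by blast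
  note Vv = simple_cyclic[OF V v]
  obtain w where "w \<in> carrier V" "v = w \<cdot>\<^bsub>V\<^esub> x" using bij(2)[OF v(1)] by blast
  hence "f \<in> Units P" using section_unit_of_divisible[OF v(1) Vv ann f(3,1,2)] by blast
  thus ?thesis using that[OF v(1) Vv ann z(1) f(3)] f(2) by blast
qed

text \<open>As \<open>x\<close> acts injectively, the chain \<open>V \<supseteq> Vx \<supseteq> Vx\<^sup>2 \<supseteq> \<dots>\<close> can become constant only if \<open>V = Vx\<close>, and
  then \<open>f\<close> would be a unit.\<close>

lemma one_critical_of_nonunit_section:
  assumes v: "v \<in> carrier V" "carrier V = cyclic_submodule v"
    and ann: "\<And>s. s \<in> carrier S \<Longrightarrow> v \<cdot>\<^bsub>V\<^esub> s = \<zero>\<^bsub>V\<^esub> \<longleftrightarrow> s \<in> right_ideal_gen S z"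
    and z: "z \<in> irreducible_elements S" "z = \<epsilon> f \<oplus> x \<otimes> t" "f \<in> carrier P" "f \<noteq> \<zero>\<^bsub>P\<^esub>" "f \<notin> Units P" "t \<in> carrier S"
  shows "n_critical 1 S V"
proof -
  note z' = irreducibleD[OF z(1)]
  have zx: "z \<notin> xS" unfolding z(2) by (rule section_notin_xS[OF z(3,6,4)])
  note inj = x_injective[OF v ann z'(1) zx]
  have "(carrier V, N) \<in> artinian" if "right_submodule S V N" "N \<noteq> {\<zero>\<^bsub>V\<^esub>}" for N
    using irreducible_proper_factor_artinian[OF v(1) ann z(1) zx that] right_submoduleD(1)[OF that(1)] v(2) by simp
  moreover have "(carrier V, {\<zero>\<^bsub>V\<^esub>}) \<notin> artinian"
  proof
    assume art: "(carrier V, {\<zero>\<^bsub>V\<^esub>}) \<in> artinian"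
    let ?g = "\<lambda>N. (\<lambda>v. v \<cdot>\<^bsub>V\<^esub> x) ` N"
    define C where "C i = (?g ^^ i) (carrier V)" for i
    have C: "right_submodule S V (C i)" for i
      by (induction i) (auto simp: C_def submodule_carrier intro!: normal_image_submodule x_closed normal_right)
    have CV: "C i \<subseteq> carrier V" for i using right_submoduleD(1)[OF C] .
    have dec: "C (Suc i) \<subseteq> C i" for i
    proof (induction i)
      case 0 show ?case using CV[of 1] by (simp add: C_def)
    next
      case (Suc i)
      have "C (Suc (Suc i)) = ?g (C (Suc i))" "C (Suc i) = ?g (C i)" by (simp_all add: C_def)
      thus ?case using Suc by (metis image_mono)
    qed
    obtain n where n: "C n = C (Suc n)"
    proof (rule artinianE[OF art, of C])
      show "{\<zero>\<^bsub>V\<^esub>} \<subseteq> C i" for i using right_submoduleD(2)[OF C] by simp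
    qed (use C CV dec in auto)
    have inj_on: "inj_on (\<lambda>v. v \<cdot>\<^bsub>V\<^esub> x) (carrier V)"
    proof (rule inj_onI)
      fix a b assume ab: "a \<in> carrier V" "b \<in> carrier V" "a \<cdot>\<^bsub>V\<^esub> x = b \<cdot>\<^bsub>V\<^esub> x"
      have "(a \<ominus>\<^bsub>V\<^esub> b) \<cdot>\<^bsub>V\<^esub> x = \<zero>\<^bsub>V\<^esub>"
        using ab x_closed by (simp add: a_minus_def ract_l_distr minus_ract V.r_neg ract_closed)
      hence "a \<ominus>\<^bsub>V\<^esub> b = \<zero>\<^bsub>V\<^esub>" using inj[of "a \<ominus>\<^bsub>V\<^esub> b"] ab by simp
      thus "a = b" using ab V.minus_eq_zero_iff by simp
    qed
    have "C 0 = C 1" using n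
    proof (induction n)
      case (Suc n)
      have "?g (C n) = ?g (C (Suc n))" using Suc.prems by (simp add: C_def)
      hence "C n = C (Suc n)" using inj_on_image_eq_iff[OF inj_on CV CV] by blast
      thus ?case by (rule Suc.IH)
    qed simp
    hence "v \<in> ?g (carrier V)" using v(1) by (simp add: C_def)
    then obtain w where "w \<in> carrier V" "v = w \<cdot>\<^bsub>V\<^esub> x" by blast
    thus False using section_unit_of_divisible[OF v ann z(2,3,6)] z(5) by blast
  qed
  ultimately show ?thesis unfolding one_critical_iff by blast
qed

text \<open>The residue \<open>f\<close> is nonzero because \<open>z \<notin> xS\<close>. If it were a unit, then \<open>vS\<close> would be simple and \<open>V\<close>, as
  an extension of the artinian module \<open>V/vS\<close> by \<open>vS\<close>, artinian.\<close>

lemma one_critical_annihilator: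
  assumes V: "n_critical 1 S V" and u: "u \<in> carrier V" "u \<cdot>\<^bsub>V\<^esub> x \<noteq> \<zero>\<^bsub>V\<^esub>"
  obtains v z f t where "v \<in> carrier V" "v \<noteq> \<zero>\<^bsub>V\<^esub>"
    "\<And>s. s \<in> carrier S \<Longrightarrow> v \<cdot>\<^bsub>V\<^esub> s = \<zero>\<^bsub>V\<^esub> \<longleftrightarrow> s \<in> right_ideal_gen S z"
    "z \<in> irreducible_elements S" "z = \<epsilon> f \<oplus> x \<otimes> t"
    "f \<in> carrier P" "f \<noteq> \<zero>\<^bsub>P\<^esub>" "f \<notin> Units P" "t \<in> carrier S"
proof -
  have inj: "v = \<zero>\<^bsub>V\<^esub>" if "v \<in> carrier V" "v \<cdot>\<^bsub>V\<^esub> x = \<zero>\<^bsub>V\<^esub>" for v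
    using one_critical_normal_dichotomy[OF V x_closed normal_left normal_right] u that by blast
  have u0: "u \<noteq> \<zero>\<^bsub>V\<^esub>" using u x_closed by auto
  obtain y0 where y0: "y0 \<in> carrier S" "y0 \<noteq> \<zero>" "u \<cdot>\<^bsub>V\<^esub> y0 = \<zero>\<^bsub>V\<^esub>"
    using one_critical_torsion[OF V] u unfolding torsion_def by blast
  obtain v z where v: "v \<in> carrier V" "v \<noteq> \<zero>\<^bsub>V\<^esub>" and z: "z \<in> irreducible_elements S" "z \<notin> xS"
    and ann: "\<And>s. s \<in> carrier S \<Longrightarrow> v \<cdot>\<^bsub>V\<^esub> s = \<zero>\<^bsub>V\<^esub> \<longleftrightarrow> s \<in> right_ideal_gen S z"
    using irreducible_annihilator_exists[OF inj u(1) u0 y0] by blast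
  obtain f t where f: "f \<in> carrier P" "t \<in> carrier S" "z = \<epsilon> f \<oplus> x \<otimes> t"
    using section_decomp irreducibleD(1)[OF z(1)] by blast
  have "f \<noteq> \<zero>\<^bsub>P\<^esub>" using z(2) f x_closed by (auto simp: xS_I)
  moreover have "f \<notin> Units P"
  proof
    assume fU: "f \<in> Units P"
    note cv = cyclic_submodule_submodule[OF v(1)]
    have "(cyclic_submodule v, {\<zero>\<^bsub>V\<^esub>}) \<in> artinian"
      using unit_section_simple[OF v(1) ann z(1) f(3) fU f(2)] by (intro simple_submodule_artinian cv) blast
    moreover have "(carrier V, cyclic_submodule v) \<in> artinian" "(carrier V, {\<zero>\<^bsub>V\<^esub>}) \<notin> artinian"
      using V cv cyclic_submodule_nonzero[OF v] unfolding one_critical_iff by blast+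
    ultimately show False using artinian_extension by blast
  qed
  ultimately show ?thesis using that[OF v ann z(1) f(3,1)] f(2) by blast
qed

end

section \<open>The skew polynomial ring\<close>

lemma (in abelian_monoid) finsum_triangle:
  fixes f :: "nat \<Rightarrow> nat \<Rightarrow> 'a"
  assumes "\<And>i j. f i j \<in> carrier G"
  shows "(\<Oplus>i\<in>{..n}. \<Oplus>j\<in>{..i}. f j (i - j)) = (\<Oplus>j\<in>{..n}. \<Oplus>l\<in>{..n - j}. f j l)"
proof (induction n)
  case (Suc n)
  have "(\<Oplus>j\<in>{..Suc n}. \<Oplus>l\<in>{..Suc n - j}. f j l)
      = (\<Oplus>j\<in>{..n}. \<Oplus>l\<in>{..Suc n - j}. f j l) \<oplus> f (Suc n) 0"
    using assms by (simp add: a_comm)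
  also have "(\<Oplus>j\<in>{..n}. \<Oplus>l\<in>{..Suc n - j}. f j l) = (\<Oplus>j\<in>{..n}. (\<Oplus>l\<in>{..n - j}. f j l) \<oplus> f j (Suc n - j))"
    using assms by (intro finsum_cong') (auto simp: Suc_diff_le a_comm Pi_def)
  also have "\<dots> = (\<Oplus>j\<in>{..n}. \<Oplus>l\<in>{..n - j}. f j l) \<oplus> (\<Oplus>j\<in>{..n}. f j (Suc n - j))"
    using assms by (intro finsum_addf) auto
  also have "\<dots> \<oplus> f (Suc n) 0 = (\<Oplus>j\<in>{..n}. \<Oplus>l\<in>{..n - j}. f j l) \<oplus> (\<Oplus>j\<in>{..Suc n}. f j (Suc n - j))"
    using assms by (simp add: a_ac)
  finally show ?case using Suc assms by (simp add: a_comm)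
qed (use assms in simp)

lemma (in abelian_monoid) finsum_only:
  assumes "finite A" "i \<in> A" "f i \<in> carrier G" "\<And>j. j \<in> A \<Longrightarrow> j \<noteq> i \<Longrightarrow> f j = \<zero>"
  shows "(\<Oplus>j\<in>A. f j) = f i"
proof -
  have "(\<Oplus>j\<in>A. f j) = (\<Oplus>j\<in>A. if i = j then f j else \<zero>)"
    using assms by (intro finsum_cong') (auto simp: Pi_def)
  also have "\<dots> = f i"
  proof -
    have "f \<in> A \<rightarrow> carrier G" using assms(3,4) by (auto simp: Pi_def) (metis zero_closed)
    thus ?thesis using assms by (intro finsum_singleton)
  qed
  finally show ?thesis .
qed

locale skew_poly = "domain" R for R :: "('a, 'm) ring_scheme" (structure) +
  fixes \<alpha> :: "'a \<Rightarrow> 'a"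
  assumes \<alpha>_iso: "\<alpha> \<in> ring_iso R R"
begin

abbreviation S where "S \<equiv> skew_poly_ring R \<alpha>"

lemma pow_iso: "\<alpha> ^^ i \<in> ring_iso R R"
proof (induction i)
  case 0 show ?case by (auto simp: ring_iso_def ring_hom_def bij_betw_def)
next
  case (Suc i)
  thus ?case using \<alpha>_iso
    by (auto simp: ring_iso_def ring_hom_def Pi_def intro: bij_betw_trans[unfolded comp_def])
qed

lemma pow_hom: "\<alpha> ^^ i \<in> ring_hom R R" using pow_iso by (simp add: ring_iso_def)

lemma pow_simps [simp]:
  "r \<in> carrier R \<Longrightarrow> (\<alpha> ^^ i) r \<in> carrier R" "(\<alpha> ^^ i) \<one> = \<one>" "(\<alpha> ^^ i) \<zero> = \<zero>"
  using pow_hom[of i] ring_hom_zero[OF pow_hom[of i] ring_axioms ring_axioms]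
  by (auto simp: ring_hom_closed ring_hom_one)

lemma pow_mult: "r \<in> carrier R \<Longrightarrow> s \<in> carrier R \<Longrightarrow> (\<alpha> ^^ i) (r \<otimes> s) = (\<alpha> ^^ i) r \<otimes> (\<alpha> ^^ i) s"
  using pow_hom by (rule ring_hom_mult)

lemma pow_add: "r \<in> carrier R \<Longrightarrow> s \<in> carrier R \<Longrightarrow> (\<alpha> ^^ i) (r \<oplus> s) = (\<alpha> ^^ i) r \<oplus> (\<alpha> ^^ i) s"
  using pow_hom by (rule ring_hom_add)

lemma pow_inj: "r \<in> carrier R \<Longrightarrow> s \<in> carrier R \<Longrightarrow> (\<alpha> ^^ i) r = (\<alpha> ^^ i) s \<Longrightarrow> r = s"
  using pow_iso[of i] by (auto simp: ring_iso_def bij_betw_def inj_on_def)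

lemma pow_surj: "r \<in> carrier R \<Longrightarrow> \<exists>s\<in>carrier R. r = (\<alpha> ^^ i) s"
  using pow_iso[of i] by (auto simp: ring_iso_def bij_betw_def)

lemma pow_eq_zero_iff: "r \<in> carrier R \<Longrightarrow> (\<alpha> ^^ i) r = \<zero> \<longleftrightarrow> r = \<zero>"
  using pow_inj[of r \<zero> i] by auto

lemma pow_finsum:
  assumes "f \<in> A \<rightarrow> carrier R"
  shows "(\<alpha> ^^ i) (\<Oplus>j\<in>A. f j) = (\<Oplus>j\<in>A. (\<alpha> ^^ i) (f j))"
proof -
  interpret ring_hom_ring R R "\<alpha> ^^ i" by (rule ring_hom_ringI2[OF ring_axioms ring_axioms pow_hom])
  show ?thesis using hom_finsum[OF assms] by (simp add: comp_def)
qed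

lemma carrier_S [simp]: "carrier S = up R" by (simp add: skew_poly_ring_def)

lemma zero_S: "\<zero>\<^bsub>S\<^esub> = (\<lambda>i. \<zero>)" by (simp add: skew_poly_ring_def)

lemma one_S: "\<one>\<^bsub>S\<^esub> = (\<lambda>i. if i = 0 then \<one> else \<zero>)" by (simp add: skew_poly_ring_def)

lemma add_S: "p \<in> up R \<Longrightarrow> q \<in> up R \<Longrightarrow> (p \<oplus>\<^bsub>S\<^esub> q) i = p i \<oplus> q i" by (simp add: skew_poly_ring_def)

lemma mult_S:
  "p \<in> up R \<Longrightarrow> q \<in> up R \<Longrightarrow> (p \<otimes>\<^bsub>S\<^esub> q) n = (\<Oplus>i\<in>{..n}. p i \<otimes> (\<alpha> ^^ i) (q (n - i)))"
  by (simp add: skew_poly_ring_def)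

lemma up_closed [simp]: "p \<in> up R \<Longrightarrow> p i \<in> carrier R" by auto

lemma upE: assumes "p \<in> up R" obtains n where "\<And>i. i > n \<Longrightarrow> p i = \<zero>"
  using bound_upD[OF assms] by (auto simp: bound_def)

lemma upI: "(\<And>i. p i \<in> carrier R) \<Longrightarrow> (\<And>i. i > n \<Longrightarrow> p i = \<zero>) \<Longrightarrow> p \<in> up R"
  by (rule mem_upI) (auto simp: bound_def)

lemma S_add_closed: "p \<in> up R \<Longrightarrow> q \<in> up R \<Longrightarrow> p \<oplus>\<^bsub>S\<^esub> q \<in> up R"
  by (simp add: skew_poly_ring_def up_add_closed)

lemma S_mult_closed:
  assumes "p \<in> up R" "q \<in> up R"
  shows "p \<otimes>\<^bsub>S\<^esub> q \<in> up R"
proof -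
  obtain n where n: "\<And>i. i > n \<Longrightarrow> p i = \<zero>" using upE[OF assms(1)] by blast
  obtain m where m: "\<And>i. i > m \<Longrightarrow> q i = \<zero>" using upE[OF assms(2)] by blast
  show ?thesis
  proof (rule upI[of _ "n + m"])
    fix k assume k: "k > n + m"
    have "p i \<otimes> (\<alpha> ^^ i) (q (k - i)) = \<zero>" for i
      using n[of i] m[of "k - i"] k assms by (cases "i > n") auto
    thus "(p \<otimes>\<^bsub>S\<^esub> q) k = \<zero>" using assms by (simp add: mult_S)
  qed (use assms in \<open>auto simp: mult_S intro!: finsum_closed\<close>)
qed

lemma S_one_closed: "\<one>\<^bsub>S\<^esub> \<in> up R" by (rule upI[of _ 0]) (auto simp: one_S)

lemma S_zero_closed: "\<zero>\<^bsub>S\<^esub> \<in> up R" by (rule upI[of _ 0]) (auto simp: zero_S)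

lemma S_mult_assoc:
  assumes p: "p \<in> up R" and q: "q \<in> up R" and r: "r \<in> up R"
  shows "(p \<otimes>\<^bsub>S\<^esub> q) \<otimes>\<^bsub>S\<^esub> r = p \<otimes>\<^bsub>S\<^esub> (q \<otimes>\<^bsub>S\<^esub> r)"
proof
  fix n
  define f where "f j l = p j \<otimes> (\<alpha> ^^ j) (q l) \<otimes> (\<alpha> ^^ (j + l)) (r (n - (j + l)))" for j l
  have f: "f j l \<in> carrier R" for j l using assms by (simp add: f_def)
  have "((p \<otimes>\<^bsub>S\<^esub> q) \<otimes>\<^bsub>S\<^esub> r) n
      = (\<Oplus>i\<in>{..n}. (\<Oplus>j\<in>{..i}. p j \<otimes> (\<alpha> ^^ j) (q (i - j))) \<otimes> (\<alpha> ^^ i) (r (n - i)))"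
    using assms by (simp add: mult_S S_mult_closed)
  also have "\<dots> = (\<Oplus>i\<in>{..n}. \<Oplus>j\<in>{..i}. f j (i - j))"
  proof (rule finsum_cong')
    fix i assume i: "i \<in> {..n}"
    have "(\<Oplus>j\<in>{..i}. p j \<otimes> (\<alpha> ^^ j) (q (i - j))) \<otimes> (\<alpha> ^^ i) (r (n - i))
        = (\<Oplus>j\<in>{..i}. p j \<otimes> (\<alpha> ^^ j) (q (i - j)) \<otimes> (\<alpha> ^^ i) (r (n - i)))"
      using assms by (intro finsum_ldistr) auto
    also have "\<dots> = (\<Oplus>j\<in>{..i}. f j (i - j))"
      using assms by (intro finsum_cong') (auto simp: f_def)
    finally show "(\<Oplus>j\<in>{..i}. p j \<otimes> (\<alpha> ^^ j) (q (i - j))) \<otimes> (\<alpha> ^^ i) (r (n - i))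
        = (\<Oplus>j\<in>{..i}. f j (i - j))" .
  qed (use f in \<open>auto intro!: finsum_closed\<close>)
  also have "\<dots> = (\<Oplus>j\<in>{..n}. \<Oplus>l\<in>{..n - j}. f j l)" by (rule finsum_triangle[OF f])
  also have "\<dots> = (\<Oplus>j\<in>{..n}. p j \<otimes> (\<alpha> ^^ j) ((q \<otimes>\<^bsub>S\<^esub> r) (n - j)))"
  proof (rule finsum_cong')
    fix j assume j: "j \<in> {..n}"
    have "p j \<otimes> (\<alpha> ^^ j) ((q \<otimes>\<^bsub>S\<^esub> r) (n - j))
        = p j \<otimes> (\<Oplus>l\<in>{..n - j}. (\<alpha> ^^ j) (q l \<otimes> (\<alpha> ^^ l) (r (n - j - l))))"
      using q r by (simp add: mult_S pow_finsum)
    also have "\<dots> = (\<Oplus>l\<in>{..n - j}. p j \<otimes> (\<alpha> ^^ j) (q l \<otimes> (\<alpha> ^^ l) (r (n - j - l))))"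
      using assms by (intro finsum_rdistr) auto
    also have "\<dots> = (\<Oplus>l\<in>{..n - j}. f j l)"
      using assms by (intro finsum_cong') (auto simp: f_def pow_mult m_assoc funpow_add)
    finally show "(\<Oplus>l\<in>{..n - j}. f j l) = p j \<otimes> (\<alpha> ^^ j) ((q \<otimes>\<^bsub>S\<^esub> r) (n - j))" by simp
  qed (use assms in \<open>auto simp: S_mult_closed\<close>)
  also have "\<dots> = (p \<otimes>\<^bsub>S\<^esub> (q \<otimes>\<^bsub>S\<^esub> r)) n" using assms by (simp add: mult_S S_mult_closed)
  finally show "((p \<otimes>\<^bsub>S\<^esub> q) \<otimes>\<^bsub>S\<^esub> r) n = (p \<otimes>\<^bsub>S\<^esub> (q \<otimes>\<^bsub>S\<^esub> r)) n" .
qed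

definition monomial :: "'a \<Rightarrow> nat \<Rightarrow> nat \<Rightarrow> 'a" where
  "monomial c d = (\<lambda>i. if i = d then c else \<zero>)"

lemma monomial_closed [simp]: "c \<in> carrier R \<Longrightarrow> monomial c d \<in> up R"
  by (rule upI[of _ d]) (auto simp: monomial_def)

lemma monomial_mult:
  assumes "c \<in> carrier R" "q \<in> up R"
  shows "(monomial c d \<otimes>\<^bsub>S\<^esub> q) n = (if d \<le> n then c \<otimes> (\<alpha> ^^ d) (q (n - d)) else \<zero>)"
proof (cases "d \<le> n")
  case True
  have "(\<Oplus>i\<in>{..n}. monomial c d i \<otimes> (\<alpha> ^^ i) (q (n - i))) = monomial c d d \<otimes> (\<alpha> ^^ d) (q (n - d))"
    by (rule finsum_only) (use assms True in \<open>auto simp: monomial_def\<close>)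
  thus ?thesis using assms True by (simp add: mult_S) (simp add: monomial_def)
next
  case False
  have "(\<Oplus>i\<in>{..n}. monomial c d i \<otimes> (\<alpha> ^^ i) (q (n - i))) = \<zero>"
    by (rule add.finprod_one_eqI) (use assms False in \<open>auto simp: monomial_def\<close>)
  thus ?thesis using assms False by (simp add: mult_S)
qed

lemma mult_monomial:
  assumes "c \<in> carrier R" "p \<in> up R"
  shows "(p \<otimes>\<^bsub>S\<^esub> monomial c d) n = (if d \<le> n then p (n - d) \<otimes> (\<alpha> ^^ (n - d)) c else \<zero>)"
proof (cases "d \<le> n")
  case True
  have "(\<Oplus>i\<in>{..n}. p i \<otimes> (\<alpha> ^^ i) (monomial c d (n - i))) = p (n - d) \<otimes> (\<alpha> ^^ (n - d)) (monomial c d (n - (n - d)))"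
    by (rule finsum_only) (use assms True in \<open>auto simp: monomial_def\<close>)
  thus ?thesis using assms True by (simp add: mult_S) (simp add: monomial_def)
next
  case False
  have "(\<Oplus>i\<in>{..n}. p i \<otimes> (\<alpha> ^^ i) (monomial c d (n - i))) = \<zero>"
    by (rule add.finprod_one_eqI) (use assms False in \<open>auto simp: monomial_def\<close>)
  thus ?thesis using assms False by (simp add: mult_S)
qed

lemma one_S_monomial: "\<one>\<^bsub>S\<^esub> = monomial \<one> 0" by (auto simp: one_S monomial_def)

lemma ring_S: "ring S"
proof (rule ringI)
  show "abelian_group S"
  proof (rule abelian_groupI)
    fix p assume p: "p \<in> carrier S"
    have "(\<lambda>i. \<ominus> p i) \<in> up R" using p by (simp add: up_a_inv_closed)
    moreover have "(\<lambda>i. \<ominus> p i) \<oplus>\<^bsub>S\<^esub> p = \<zero>\<^bsub>S\<^esub>"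
      using p calculation by (auto simp: add_S zero_S l_neg)
    ultimately show "\<exists>q\<in>carrier S. q \<oplus>\<^bsub>S\<^esub> p = \<zero>\<^bsub>S\<^esub>" by auto
    show "\<zero>\<^bsub>S\<^esub> \<oplus>\<^bsub>S\<^esub> p = p" using p S_zero_closed
      by (intro ext) (simp add: add_S fun_cong[OF zero_S])
  next
    fix p q r assume "p \<in> carrier S" "q \<in> carrier S" "r \<in> carrier S"
    thus "p \<oplus>\<^bsub>S\<^esub> q \<oplus>\<^bsub>S\<^esub> r = p \<oplus>\<^bsub>S\<^esub> (q \<oplus>\<^bsub>S\<^esub> r)"
      by (intro ext) (simp add: add_S S_add_closed a_assoc)
  next
    fix p q assume "p \<in> carrier S" "q \<in> carrier S"
    thus "p \<oplus>\<^bsub>S\<^esub> q = q \<oplus>\<^bsub>S\<^esub> p" by (intro ext) (simp add: add_S a_comm)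
  qed (auto simp: S_add_closed S_zero_closed)
  show "monoid S"
  proof (rule monoidI)
    show "\<one>\<^bsub>S\<^esub> \<otimes>\<^bsub>S\<^esub> p = p" if "p \<in> carrier S" for p
      using that unfolding one_S_monomial by (intro ext) (simp add: monomial_mult)
    show "p \<otimes>\<^bsub>S\<^esub> \<one>\<^bsub>S\<^esub> = p" if "p \<in> carrier S" for p
      using that unfolding one_S_monomial by (intro ext) (simp add: mult_monomial)
  qed (auto simp: S_mult_closed S_one_closed S_mult_assoc)
next
  fix p q r assume a: "p \<in> carrier S" "q \<in> carrier S" "r \<in> carrier S"
  have "((p \<oplus>\<^bsub>S\<^esub> q) \<otimes>\<^bsub>S\<^esub> r) n = (p \<otimes>\<^bsub>S\<^esub> r \<oplus>\<^bsub>S\<^esub> q \<otimes>\<^bsub>S\<^esub> r) n" for n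
  proof -
    have "((p \<oplus>\<^bsub>S\<^esub> q) \<otimes>\<^bsub>S\<^esub> r) n
        = (\<Oplus>i\<in>{..n}. p i \<otimes> (\<alpha> ^^ i) (r (n - i)) \<oplus> q i \<otimes> (\<alpha> ^^ i) (r (n - i)))"
      using a by (simp add: mult_S S_add_closed add_S l_distr Pi_def)
    also have "\<dots> = (p \<otimes>\<^bsub>S\<^esub> r \<oplus>\<^bsub>S\<^esub> q \<otimes>\<^bsub>S\<^esub> r) n"
      using a by (simp add: mult_S S_mult_closed add_S finsum_addf)
    finally show ?thesis .
  qed
  thus "(p \<oplus>\<^bsub>S\<^esub> q) \<otimes>\<^bsub>S\<^esub> r = p \<otimes>\<^bsub>S\<^esub> r \<oplus>\<^bsub>S\<^esub> q \<otimes>\<^bsub>S\<^esub> r" by (rule ext)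
  have "(r \<otimes>\<^bsub>S\<^esub> (p \<oplus>\<^bsub>S\<^esub> q)) n = (r \<otimes>\<^bsub>S\<^esub> p \<oplus>\<^bsub>S\<^esub> r \<otimes>\<^bsub>S\<^esub> q) n" for n
  proof -
    have "(r \<otimes>\<^bsub>S\<^esub> (p \<oplus>\<^bsub>S\<^esub> q)) n
        = (\<Oplus>i\<in>{..n}. r i \<otimes> (\<alpha> ^^ i) (p (n - i)) \<oplus> r i \<otimes> (\<alpha> ^^ i) (q (n - i)))"
      using a by (simp add: mult_S S_add_closed add_S r_distr pow_add Pi_def)
    also have "\<dots> = (r \<otimes>\<^bsub>S\<^esub> p \<oplus>\<^bsub>S\<^esub> r \<otimes>\<^bsub>S\<^esub> q) n"
      using a by (simp add: mult_S S_mult_closed add_S finsum_addf)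
    finally show ?thesis .
  qed
  thus "r \<otimes>\<^bsub>S\<^esub> (p \<oplus>\<^bsub>S\<^esub> q) = r \<otimes>\<^bsub>S\<^esub> p \<oplus>\<^bsub>S\<^esub> r \<otimes>\<^bsub>S\<^esub> q" by (rule ext)
qed

sublocale S: ring S by (rule ring_S)

lemma a_inv_S: "p \<in> up R \<Longrightarrow> (\<ominus>\<^bsub>S\<^esub> p) i = \<ominus> p i"
proof -
  assume p: "p \<in> up R"
  have m: "\<ominus>\<^bsub>S\<^esub> p \<in> up R" using S.a_inv_closed p by simp
  have "(\<ominus>\<^bsub>S\<^esub> p \<oplus>\<^bsub>S\<^esub> p) i = \<zero>" using p S.l_neg by (simp add: zero_S)
  thus ?thesis using p m by (simp add: add_S minus_equality)
qed

lemma minus_S: "p \<in> up R \<Longrightarrow> q \<in> up R \<Longrightarrow> (p \<ominus>\<^bsub>S\<^esub> q) i = p i \<ominus> q i"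
  using S.a_inv_closed[of q] by (simp add: a_minus_def add_S a_inv_S)

subsection \<open>Degree\<close>

definition sdeg :: "(nat \<Rightarrow> 'a) \<Rightarrow> nat" where "sdeg p = Max {i. p i \<noteq> \<zero>}"

lemma support_finite: "p \<in> up R \<Longrightarrow> finite {i. p i \<noteq> \<zero>}"
proof -
  assume "p \<in> up R"
  then obtain n where "\<And>i. i > n \<Longrightarrow> p i = \<zero>" using upE by blast
  hence "{i. p i \<noteq> \<zero>} \<subseteq> {..n}" by (auto simp: not_le[symmetric])
  thus ?thesis by (rule finite_subset) simp
qed

lemma lead_nonzero:
  assumes "p \<in> up R" "p \<noteq> \<zero>\<^bsub>S\<^esub>" shows "p (sdeg p) \<noteq> \<zero>"
proof -
  have "{i. p i \<noteq> \<zero>} \<noteq> {}" using assms by (auto simp: zero_S)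
  from Max_in[OF support_finite[OF assms(1)] this] show ?thesis by (simp add: sdeg_def)
qed

lemma above_sdeg: "p \<in> up R \<Longrightarrow> i > sdeg p \<Longrightarrow> p i = \<zero>"
  using Max_ge[OF support_finite, of p i] by (auto simp: sdeg_def)

lemma sdeg_eqI: "p \<in> up R \<Longrightarrow> p n \<noteq> \<zero> \<Longrightarrow> (\<And>i. i > n \<Longrightarrow> p i = \<zero>) \<Longrightarrow> sdeg p = n"
  unfolding sdeg_def by (intro Max_eqI support_finite) (auto simp: not_less[symmetric])

lemma mult_top:
  assumes "p \<in> up R" "q \<in> up R" "\<And>i. i > m \<Longrightarrow> p i = \<zero>" "\<And>i. i > n \<Longrightarrow> q i = \<zero>"
  shows "(p \<otimes>\<^bsub>S\<^esub> q) (m + n) = p m \<otimes> (\<alpha> ^^ m) (q n)" "i > m + n \<Longrightarrow> (p \<otimes>\<^bsub>S\<^esub> q) i = \<zero>"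
proof -
  have "(\<Oplus>i\<in>{..m + n}. p i \<otimes> (\<alpha> ^^ i) (q (m + n - i))) = p m \<otimes> (\<alpha> ^^ m) (q (m + n - m))"
  proof (rule finsum_only)
    fix j assume "j \<noteq> m"
    thus "p j \<otimes> (\<alpha> ^^ j) (q (m + n - j)) = \<zero>"
      using assms(1,2) assms(3)[of j] assms(4)[of "m + n - j"] by (cases "j > m") auto
  qed (use assms in auto)
  thus "(p \<otimes>\<^bsub>S\<^esub> q) (m + n) = p m \<otimes> (\<alpha> ^^ m) (q n)" using assms by (simp add: mult_S)
  assume i: "i > m + n"
  have "p j \<otimes> (\<alpha> ^^ j) (q (i - j)) = \<zero>" for j
    using assms(1,2) assms(3)[of j] assms(4)[of "i - j"] i by (cases "j > m") auto
  thus "(p \<otimes>\<^bsub>S\<^esub> q) i = \<zero>" using assms by (simp add: mult_S)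
qed

lemma lead_mult:
  assumes "p \<in> up R" "q \<in> up R" "p \<noteq> \<zero>\<^bsub>S\<^esub>" "q \<noteq> \<zero>\<^bsub>S\<^esub>"
  shows "sdeg (p \<otimes>\<^bsub>S\<^esub> q) = sdeg p + sdeg q"
    "(p \<otimes>\<^bsub>S\<^esub> q) (sdeg p + sdeg q) = p (sdeg p) \<otimes> (\<alpha> ^^ sdeg p) (q (sdeg q))"
    "p \<otimes>\<^bsub>S\<^esub> q \<noteq> \<zero>\<^bsub>S\<^esub>"
proof -
  note top = mult_top[OF assms(1,2) above_sdeg[OF assms(1)] above_sdeg[OF assms(2)]]
  show eq: "(p \<otimes>\<^bsub>S\<^esub> q) (sdeg p + sdeg q) = p (sdeg p) \<otimes> (\<alpha> ^^ sdeg p) (q (sdeg q))"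
    by (rule top(1))
  have nz: "(p \<otimes>\<^bsub>S\<^esub> q) (sdeg p + sdeg q) \<noteq> \<zero>"
    unfolding eq using assms lead_nonzero by (simp add: integral_iff pow_eq_zero_iff)
  show "sdeg (p \<otimes>\<^bsub>S\<^esub> q) = sdeg p + sdeg q"
    by (rule sdeg_eqI[OF S_mult_closed[OF assms(1,2)] nz top(2)])
  show "p \<otimes>\<^bsub>S\<^esub> q \<noteq> \<zero>\<^bsub>S\<^esub>" using nz by (auto simp: zero_S)
qed

lemma S_integral:
  "p \<in> carrier S \<Longrightarrow> q \<in> carrier S \<Longrightarrow> p \<otimes>\<^bsub>S\<^esub> q = \<zero>\<^bsub>S\<^esub> \<Longrightarrow> p = \<zero>\<^bsub>S\<^esub> \<or> q = \<zero>\<^bsub>S\<^esub>"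
  using lead_mult(3) by auto

subsection \<open>Constants and \<open>\<theta>\<close>\<close>

lemma const_monomial: "skew_const R r = monomial r 0" by (auto simp: skew_const_def monomial_def)

lemma var_monomial: "skew_var R = monomial \<one> 1" by (auto simp: skew_var_def monomial_def)

lemma monomial_monomial:
  assumes "c \<in> carrier R" "d \<in> carrier R"
  shows "monomial c i \<otimes>\<^bsub>S\<^esub> monomial d j = monomial (c \<otimes> (\<alpha> ^^ i) d) (i + j)"
proof
  fix n show "(monomial c i \<otimes>\<^bsub>S\<^esub> monomial d j) n = monomial (c \<otimes> (\<alpha> ^^ i) d) (i + j) n"
    using assms by (simp add: monomial_mult) (auto simp: monomial_def)
qed

lemma const_hom: "skew_const R \<in> ring_hom R S"
proof (rule ring_hom_memI)
  fix r s assume rs: "r \<in> carrier R" "s \<in> carrier R"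
  show "skew_const R (r \<otimes> s) = skew_const R r \<otimes>\<^bsub>S\<^esub> skew_const R s"
    using rs by (simp add: const_monomial monomial_monomial)
  show "skew_const R (r \<oplus> s) = skew_const R r \<oplus>\<^bsub>S\<^esub> skew_const R s"
  proof
    fix n show "skew_const R (r \<oplus> s) n = (skew_const R r \<oplus>\<^bsub>S\<^esub> skew_const R s) n"
      using rs by (simp add: const_monomial add_S) (simp add: monomial_def)
  qed
qed (auto simp: const_monomial one_S_monomial)

lemma var_pow: "skew_var R [^]\<^bsub>S\<^esub> (n::nat) = monomial \<one> n"
  by (induction n) (simp_all add: one_S_monomial var_monomial monomial_monomial)

lemma const_pow: "r \<in> carrier R \<Longrightarrow> skew_const R r [^]\<^bsub>S\<^esub> (n::nat) = skew_const R (r [^] n)"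
  by (induction n) (simp_all add: one_S_monomial const_monomial monomial_monomial)

lemma monomial_nonzero: "c \<noteq> \<zero> \<Longrightarrow> monomial c d \<noteq> \<zero>\<^bsub>S\<^esub>"
  by (metis monomial_def zero_S)

lemma sdeg_monomial: "c \<in> carrier R \<Longrightarrow> c \<noteq> \<zero> \<Longrightarrow> sdeg (monomial c d) = d"
  by (rule sdeg_eqI[OF monomial_closed]) (auto simp: monomial_def)

lemma sdeg_zero_const:
  assumes "p \<in> up R" "sdeg p = 0" shows "p = skew_const R (p 0)"
  using above_sdeg[OF assms(1)] assms(2) by (auto simp: skew_const_def)

lemma const_unit: "u \<in> Units R \<Longrightarrow> skew_const R u \<in> Units S"
proof -
  assume u: "u \<in> Units R"
  hence "monomial u 0 \<otimes>\<^bsub>S\<^esub> monomial (inv u) 0 = \<one>\<^bsub>S\<^esub>" "monomial (inv u) 0 \<otimes>\<^bsub>S\<^esub> monomial u 0 = \<one>\<^bsub>S\<^esub>"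
    using Units_closed[OF u] by (simp_all add: monomial_monomial one_S_monomial)
  moreover have "monomial u 0 \<in> carrier S" "monomial (inv u) 0 \<in> carrier S" using u Units_closed by auto
  ultimately show ?thesis unfolding const_monomial Units_def by blast
qed

lemma unit_const:
  assumes "p \<in> Units S" shows "\<exists>u\<in>Units R. p = skew_const R u"
proof -
  obtain q where q: "p \<in> up R" "q \<in> up R" "p \<otimes>\<^bsub>S\<^esub> q = \<one>\<^bsub>S\<^esub>"
    using assms by (auto simp: Units_def)
  have one: "\<one>\<^bsub>S\<^esub> \<noteq> \<zero>\<^bsub>S\<^esub>" unfolding one_S_monomial by (rule monomial_nonzero) simp
  have nz: "p \<noteq> \<zero>\<^bsub>S\<^esub>" "q \<noteq> \<zero>\<^bsub>S\<^esub>" using q one by auto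
  have "sdeg p + sdeg q = 0" using lead_mult(1)[OF q(1,2) nz] q(3) by (simp add: one_S_monomial sdeg_monomial)
  hence d: "sdeg p = 0" "sdeg q = 0" by auto
  have "p 0 \<otimes> q 0 = \<one>" using lead_mult(2)[OF q(1,2) nz] q(3) d by (simp add: one_S)
  hence "p 0 \<in> Units R" using q UnitsI[of "p 0" "q 0"] by simp
  thus ?thesis using sdeg_zero_const[OF q(1) d(1)] by blast
qed

lemma one_nonzero_S: "\<one>\<^bsub>S\<^esub> \<noteq> \<zero>\<^bsub>S\<^esub>" unfolding one_S_monomial by (rule monomial_nonzero) simp

text \<open>An element with the fewest terms in a nonzero two-sided ideal is a monomial: otherwise
  \<open>pr - \<alpha>^m(r)p\<close>, for \<open>m\<close> the degree of \<open>p\<close>, would have fewer terms.\<close>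

lemma two_sided_ideal_contains_monomial:
  assumes inf: "\<forall>n>0. \<exists>r\<in>carrier R. (\<alpha> ^^ n) r \<noteq> r"
    and J: "ideal J S" "J \<noteq> {\<zero>\<^bsub>S\<^esub>}"
  obtains c d where "c \<in> carrier R" "c \<noteq> \<zero>" "monomial c d \<in> J"
proof -
  interpret J: ideal J S by fact
  have JS: "J \<subseteq> up R" using J.a_subset by simp
  obtain p0 where "p0 \<in> J \<and> p0 \<noteq> \<zero>\<^bsub>S\<^esub>" using J(2) J.zero_closed by blast
  then obtain p where p: "p \<in> J \<and> p \<noteq> \<zero>\<^bsub>S\<^esub>"
    and min: "\<And>q. q \<in> J \<and> q \<noteq> \<zero>\<^bsub>S\<^esub> \<Longrightarrow> card {i. p i \<noteq> \<zero>} \<le> card {i. q i \<noteq> \<zero>}"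
    using ex_has_least_nat[of "\<lambda>p. p \<in> J \<and> p \<noteq> \<zero>\<^bsub>S\<^esub>" p0 "\<lambda>p. card {i. p i \<noteq> \<zero>}"] by blast
  have pS: "p \<in> up R" using p JS by blast
  define m where "m = sdeg p"
  have pm: "p m \<noteq> \<zero>" using lead_nonzero[OF pS] p by (simp add: m_def)
  have comm: "p i \<otimes> (\<alpha> ^^ i) r = p i \<otimes> (\<alpha> ^^ m) r" if r: "r \<in> carrier R" for r i
  proof -
    define q where "q = p \<otimes>\<^bsub>S\<^esub> monomial r 0 \<ominus>\<^bsub>S\<^esub> monomial ((\<alpha> ^^ m) r) 0 \<otimes>\<^bsub>S\<^esub> p"
    have qJ: "q \<in> J"
      unfolding q_def a_minus_def using p r by (intro J.a_closed J.a_inv_closed J.I_r_closed J.I_l_closed) auto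
    have q: "q j = p j \<otimes> (\<alpha> ^^ j) r \<ominus> (\<alpha> ^^ m) r \<otimes> p j" for j
      unfolding q_def using pS r by (simp add: minus_S S_mult_closed mult_monomial monomial_mult)
    have "q m = \<zero>" unfolding q using pS r by (simp add: m_comm minus_eq_zero_iff)
    moreover have "q j = \<zero>" if "p j = \<zero>" for j unfolding q using that r by (simp add: minus_eq_zero_iff)
    ultimately have "{j. q j \<noteq> \<zero>} \<subset> {j. p j \<noteq> \<zero>}" using pm by blast
    hence "card {j. q j \<noteq> \<zero>} < card {j. p j \<noteq> \<zero>}" by (rule psubset_card_mono[OF support_finite[OF pS]])
    hence "q = \<zero>\<^bsub>S\<^esub>" using min[of q] qJ by fastforce
    hence "q i = \<zero>" by (simp add: zero_S)
    thus ?thesis using pS r unfolding q by (simp add: minus_eq_zero_iff m_comm)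
  qed
  have "p i = \<zero>" if "i \<noteq> m" for i
  proof (rule ccontr)
    assume pi: "p i \<noteq> \<zero>"
    hence "i < m" using above_sdeg[OF pS, of i] that unfolding m_def by (metis linorder_neqE_nat)
    then obtain n where n: "m = i + n" "n > 0" using less_imp_add_positive by blast
    have "(\<alpha> ^^ n) r = r" if r: "r \<in> carrier R" for r
    proof -
      have "(\<alpha> ^^ i) r = (\<alpha> ^^ m) r" using comm[OF r, of i] pi pS r m_lcancel[of "p i"] by simp
      hence "(\<alpha> ^^ i) r = (\<alpha> ^^ i) ((\<alpha> ^^ n) r)" by (simp add: n funpow_add)
      thus ?thesis using pow_inj[of r "(\<alpha> ^^ n) r" i] r by simp
    qed
    thus False using inf n(2) by blast
  qed
  hence "p = monomial (p m) m" by (auto simp: monomial_def)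
  thus ?thesis using that[of "p m" m] pS pm p by simp
qed

end

section \<open>Skew polynomials over a discrete valuation ring\<close>

locale skew_poly_dvr = skew_poly R \<alpha> for R :: "('a, 'm) ring_scheme" (structure) and \<alpha> +
  fixes X :: 'a
  assumes dvr: "discrete_valuation_ring R"
    and X_closed: "X \<in> carrier R"
    and X_max: "maximalideal (PIdl X) R"
begin

lemma principal_domain_R: "principal_domain R"
  using dvr by (simp add: discrete_valuation_ring_def)

sublocale principal_domain R by (rule principal_domain_R)

lemma X_nonzero: "X \<noteq> \<zero>"
proof
  assume X: "X = \<zero>"
  have X0: "PIdl X = {\<zero>}" unfolding X cgenideal_def by (auto intro: exI[of _ \<zero>])
  have "field R"
  proof (rule cring_fieldI2)
    fix a assume a: "a \<in> carrier R" "a \<noteq> \<zero>"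
    note Ia = cgenideal_ideal[OF a(1)]
    have "\<zero> \<in> PIdl a" "PIdl a \<subseteq> carrier R"
      using additive_subgroup.zero_closed[OF ideal.axioms(1)[OF Ia]]
        additive_subgroup.a_subset[OF ideal.axioms(1)[OF Ia]] by auto
    moreover have "a \<in> PIdl a" using cgenideal_self[OF a(1)] .
    ultimately have "PIdl a = carrier R" using maximalideal.I_maximal[OF X_max Ia] X0 a(2) by auto
    hence "a \<in> Units R" using ideal_eq_carrier_iff[OF a(1)] by simp
    thus "\<exists>b\<in>carrier R. a \<otimes> b = \<one>" using Units_r_inv Units_inv_closed by blast
  qed simp
  thus False using dvr by (simp add: discrete_valuation_ring_def)
qed

lemma X_nonunit: "X \<notin> Units R"
  using maximalideal.I_notcarr[OF X_max] ideal_eq_carrier_iff[OF X_closed] by simp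

lemma nonunit_divisible:
  assumes r: "r \<in> carrier R" "r \<notin> Units R"
  shows "\<exists>s\<in>carrier R. r = s \<otimes> X"
proof (cases "r = \<zero>")
  case False
  obtain b where b: "b \<in> carrier R" "ring_irreducible b" "b divides r"
    using exists_irreducible_divisor[of r] r False by blast
  have "PIdl b = PIdl X"
    using irreducible_imp_maximalideal[OF b(1,2)] X_max dvr by (auto simp: discrete_valuation_ring_def)
  hence "PIdl r \<subseteq> PIdl X" using to_contain_is_to_divide[OF b(1) r(1)] b(3) by simp
  thus ?thesis using cgenideal_self[OF r(1)] by (auto simp: cgenideal_def)
qed (use X_closed in \<open>auto intro: bexI[of _ \<zero>]\<close>)

text \<open>The ideals \<open>(X\<^sup>i)\<close> descend strictly, so by the descending chain condition for the ideals above
  \<open>r \<noteq> 0\<close> not all of them contain \<open>r\<close>; in \<open>r = uX\<^sup>n\<close> with \<open>n\<close> the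
  largest possible exponent, \<open>u\<close> is a unit.\<close>

lemma valuation_exists:
  assumes r: "r \<in> carrier R" "r \<noteq> \<zero>"
  shows "\<exists>n. \<exists>u\<in>Units R. r = u \<otimes> X [^] (n::nat)"
proof -
  have "\<exists>i. r \<notin> PIdl (X [^] (i::nat))"
  proof (rule ccontr)
    assume "\<not> ?thesis"
    hence "\<exists>n. \<forall>i\<ge>n. PIdl (X [^] i) = PIdl (X [^] Suc i)"
    proof (intro ideals_containing_nonzero_dcc[OF r])
      fix i :: nat
      show "ideal (PIdl (X [^] i)) R" using X_closed by (intro cgenideal_ideal) simp
      show "PIdl (X [^] Suc i) \<subseteq> PIdl (X [^] i)"
        using X_closed by (subst to_contain_is_to_divide) (auto simp: factor_def)
    qed auto
    then obtain n where "PIdl (X [^] n) = PIdl (X [^] Suc n)" by blast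
    hence "X [^] n \<in> PIdl (X [^] Suc n)" using cgenideal_self[of "X [^] n"] X_closed by simp
    then obtain c where "c \<in> carrier R" "X [^] n = c \<otimes> X [^] Suc n" by (auto simp: cgenideal_def)
    thus False using nonunit_power_step[OF X_closed X_nonzero X_nonunit, of c n] X_closed by (simp add: m_comm)
  qed
  then obtain i where i: "r \<notin> PIdl (X [^] (i::nat))" "\<And>j. j < i \<Longrightarrow> r \<in> PIdl (X [^] j)"
    using exists_least_iff[of "\<lambda>i. r \<notin> PIdl (X [^] (i::nat))"] by blast
  have "i \<noteq> 0"
  proof
    assume "i = 0"
    hence "r \<notin> PIdl \<one>" using i(1) by simp
    moreover have "r = r \<otimes> \<one>" using r by simp
    ultimately show False using r(1) unfolding cgenideal_def by blast
  qed
  then obtain n where n: "i = Suc n" using not0_implies_Suc by blast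
  then obtain u where u: "u \<in> carrier R" "r = u \<otimes> X [^] n" using i(2)[of n] by (auto simp: cgenideal_def)
  have "u \<in> Units R"
  proof (rule ccontr)
    assume "u \<notin> Units R"
    then obtain s where s: "s \<in> carrier R" "u = s \<otimes> X" using nonunit_divisible[OF u(1)] by blast
    have "r = s \<otimes> X [^] Suc n"
      unfolding u(2) s(2) using s(1) X_closed nat_pow_Suc2[OF X_closed, of n] by (simp add: m_assoc)
    hence "r \<in> PIdl (X [^] i)" using s n by (auto simp: cgenideal_def)
    thus False using i(1) by simp
  qed
  thus ?thesis using u by blast
qed

lemma X_pow_nonzero: "X [^] (n::nat) \<noteq> \<zero>"
  by (induction n) (use X_closed X_nonzero in \<open>auto simp: integral_iff\<close>)

lemma valuation_le:
  assumes "u \<in> Units R" "w \<in> Units R" "u \<otimes> X [^] (n::nat) = w \<otimes> X [^] (m::nat)"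
  shows "m \<le> n"
proof (rule ccontr)
  assume "\<not> m \<le> n"
  then obtain d where m: "m = n + Suc d" using less_imp_Suc_add[of n m] by auto
  have cl: "u \<in> carrier R" "w \<in> carrier R" using assms by auto
  have "X [^] n \<otimes> u = X [^] n \<otimes> (w \<otimes> X [^] d \<otimes> X)"
    using assms(3) cl X_closed by (simp add: m nat_pow_mult[symmetric] m_ac)
  hence "u = w \<otimes> X [^] d \<otimes> X"
    using m_lcancel[OF X_pow_nonzero, of n u "w \<otimes> X [^] d \<otimes> X"] cl X_closed by simp
  hence "(w \<otimes> X [^] d \<otimes> X) \<otimes> inv u = \<one>" using Units_r_inv[OF assms(1)] by simp
  moreover have "(w \<otimes> X [^] d \<otimes> X) \<otimes> inv u = X \<otimes> (w \<otimes> X [^] d \<otimes> inv u)"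
    using cl X_closed Units_inv_closed[OF assms(1)] by (simp add: m_ac)
  ultimately show False using X_nonunit UnitsI[of X "w \<otimes> X [^] d \<otimes> inv u"] X_closed cl assms(1) by simp
qed

definition val :: "'a \<Rightarrow> nat" where
  "val r = (THE n. \<exists>u\<in>Units R. r = u \<otimes> X [^] n)"

lemma val_eqI: "u \<in> Units R \<Longrightarrow> val (u \<otimes> X [^] n) = n"
  unfolding val_def by (rule the_equality) (blast, metis valuation_le le_antisym)

lemma valE:
  assumes "r \<in> carrier R" "r \<noteq> \<zero>" obtains u where "u \<in> Units R" "r = u \<otimes> X [^] val r"
  using valuation_exists[OF assms] val_eqI by metis

lemma val_mult:
  assumes "r \<in> carrier R" "r \<noteq> \<zero>" "s \<in> carrier R" "s \<noteq> \<zero>"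
  shows "val (r \<otimes> s) = val r + val s"
proof -
  obtain u where u: "u \<in> Units R" "r = u \<otimes> X [^] val r" using valE[OF assms(1,2)] .
  obtain w where w: "w \<in> Units R" "s = w \<otimes> X [^] val s" using valE[OF assms(3,4)] .
  have cl: "u \<in> carrier R" "w \<in> carrier R" using u w by auto
  have "r \<otimes> s = (u \<otimes> X [^] val r) \<otimes> (w \<otimes> X [^] val s)" using u(2) w(2) by simp
  also have "\<dots> = (u \<otimes> w) \<otimes> X [^] (val r + val s)"
    using cl X_closed by (simp add: nat_pow_mult[symmetric] m_ac)
  finally show ?thesis using val_eqI[of "u \<otimes> w" "val r + val s"] u w by simp
qed

lemma val_zero_iff:
  assumes "r \<in> carrier R" "r \<noteq> \<zero>" shows "val r = 0 \<longleftrightarrow> r \<in> Units R"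
proof
  assume "val r = 0"
  thus "r \<in> Units R" using valE[OF assms] by (metis Units_closed nat_pow_0 r_one)
next
  assume "r \<in> Units R"
  thus "val r = 0" using val_eqI[of r 0] Units_closed by simp
qed

lemma pow_unit: "u \<in> Units R \<Longrightarrow> (\<alpha> ^^ i) u \<in> Units R"
  using pow_mult[of u "inv u" i] by (intro UnitsI[of _ "(\<alpha> ^^ i) (inv u)"]) auto

lemma pow_unit_iff: "u \<in> carrier R \<Longrightarrow> (\<alpha> ^^ i) u \<in> Units R \<Longrightarrow> u \<in> Units R"
proof -
  assume u: "u \<in> carrier R" "(\<alpha> ^^ i) u \<in> Units R"
  obtain c where c: "c \<in> carrier R" "inv ((\<alpha> ^^ i) u) = (\<alpha> ^^ i) c" using pow_surj u by blast
  have "(\<alpha> ^^ i) (u \<otimes> c) = (\<alpha> ^^ i) \<one>" using u c(1) c(2)[symmetric] by (simp add: pow_mult)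
  hence "u \<otimes> c = \<one>" using pow_inj[of "u \<otimes> c" \<one> i] u(1) c(1) by simp
  thus ?thesis using UnitsI u(1) c(1) by blast
qed

text \<open>An automorphism preserves the maximal ideal, and maps a generator of it to a generator.\<close>

lemma pow_X: "\<exists>t\<in>Units R. (\<alpha> ^^ i) X = t \<otimes> X"
proof -
  have "(\<alpha> ^^ i) X \<notin> Units R" using pow_unit_iff X_closed X_nonunit by blast
  then obtain t where t: "t \<in> carrier R" "(\<alpha> ^^ i) X = t \<otimes> X" using nonunit_divisible[of "(\<alpha> ^^ i) X"] X_closed by auto
  obtain Y where Y: "Y \<in> carrier R" "X = (\<alpha> ^^ i) Y" using pow_surj[OF X_closed] by blast
  have "Y \<notin> Units R" using Y pow_unit X_nonunit by metis
  then obtain c where c: "c \<in> carrier R" "Y = c \<otimes> X" using nonunit_divisible[OF Y(1)] by blast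
  have "\<one> \<otimes> X = ((\<alpha> ^^ i) c \<otimes> t) \<otimes> X"
    using Y(2) c t X_closed by (simp add: pow_mult m_assoc)
  hence "(\<alpha> ^^ i) c \<otimes> t = \<one>" using m_rcancel[OF X_nonzero X_closed, of \<one> "(\<alpha> ^^ i) c \<otimes> t"] c(1) t(1) by simp
  hence "t \<in> Units R" using UnitsI[of t "(\<alpha> ^^ i) c"] t(1) c(1) by (simp add: m_comm)
  thus ?thesis using t by blast
qed

lemma pow_X_pow: "\<exists>t\<in>Units R. (\<alpha> ^^ i) (X [^] (n::nat)) = t \<otimes> X [^] n"
proof (induction n)
  case (Suc n)
  obtain t where t: "t \<in> Units R" "(\<alpha> ^^ i) (X [^] n) = t \<otimes> X [^] n" using Suc by blast
  obtain u where u: "u \<in> Units R" "(\<alpha> ^^ i) X = u \<otimes> X" using pow_X by blast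
  have "(\<alpha> ^^ i) (X [^] Suc n) = (t \<otimes> X [^] n) \<otimes> (u \<otimes> X)" using t u X_closed by (simp add: pow_mult)
  also have "\<dots> = (t \<otimes> u) \<otimes> X [^] Suc n" using t(1) u(1) X_closed Units_closed by (simp add: m_ac)
  finally show ?case using t(1) u(1) by blast
qed (auto intro!: bexI[of _ \<one>])

lemma val_pow:
  assumes "r \<in> carrier R" "r \<noteq> \<zero>" shows "val ((\<alpha> ^^ i) r) = val r"
proof -
  obtain u where u: "u \<in> Units R" "r = u \<otimes> X [^] val r" using valE[OF assms] .
  obtain t where t: "t \<in> Units R" "(\<alpha> ^^ i) (X [^] val r) = t \<otimes> X [^] val r" using pow_X_pow by blast
  have "(\<alpha> ^^ i) r = (\<alpha> ^^ i) u \<otimes> (\<alpha> ^^ i) (X [^] val r)"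
    using u X_closed by (metis Units_closed nat_pow_closed pow_mult)
  also have "\<dots> = ((\<alpha> ^^ i) u \<otimes> t) \<otimes> X [^] val r" using t u(1) X_closed Units_closed by (simp add: m_assoc)
  finally show ?thesis using val_eqI[of "(\<alpha> ^^ i) u \<otimes> t" "val r"] pow_unit[OF u(1)] t(1) by simp
qed

text \<open>The degree is also zero on nonunits of \<open>R\<close>; adding the valuation of the leading coefficient
  gives an additive function that vanishes exactly on the units.\<close>

definition size :: "(nat \<Rightarrow> 'a) \<Rightarrow> nat" where "size p = sdeg p + val (p (sdeg p))"

lemma size_mult:
  assumes "p \<in> up R" "q \<in> up R" "p \<noteq> \<zero>\<^bsub>S\<^esub>" "q \<noteq> \<zero>\<^bsub>S\<^esub>"
  shows "size (p \<otimes>\<^bsub>S\<^esub> q) = size p + size q"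
  unfolding size_def lead_mult(1)[OF assms] lead_mult(2)[OF assms]
  using assms lead_nonzero by (subst val_mult) (auto simp: val_pow pow_eq_zero_iff)

lemma size_zero_iff:
  assumes "p \<in> up R" "p \<noteq> \<zero>\<^bsub>S\<^esub>" shows "size p = 0 \<longleftrightarrow> p \<in> Units S"
proof
  assume "size p = 0"
  hence d: "sdeg p = 0" and v: "val (p 0) = 0" by (auto simp: size_def)
  have "p 0 \<in> Units R" using val_zero_iff[of "p 0"] lead_nonzero[OF assms] d v assms by simp
  thus "p \<in> Units S" using sdeg_zero_const[OF assms(1) d] const_unit by metis
next
  assume "p \<in> Units S"
  then obtain u where u: "u \<in> Units R" "p = monomial u 0" using unit_const by (auto simp: const_monomial)
  have u0: "u \<noteq> \<zero>" using assms(2) u(2) by (auto simp: zero_S monomial_def)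
  have d: "sdeg p = 0" using u u0 Units_closed by (simp add: sdeg_monomial)
  have "val (p 0) = 0" using val_zero_iff[of u] u u0 Units_closed by (simp add: monomial_def)
  thus "size p = 0" using d by (simp add: size_def)
qed

lemma const_X_nonzero: "skew_const R X \<noteq> \<zero>\<^bsub>S\<^esub>"
  unfolding const_monomial by (rule monomial_nonzero[OF X_nonzero])

lemma const_closed [simp]: "r \<in> carrier R \<Longrightarrow> skew_const R r \<in> up R" by (simp add: const_monomial)

lemma const_X_mult: "s \<in> up R \<Longrightarrow> (skew_const R X \<otimes>\<^bsub>S\<^esub> s) i = X \<otimes> s i"
  using X_closed by (simp add: const_monomial monomial_mult)

lemma mult_const_X: "s \<in> up R \<Longrightarrow> (s \<otimes>\<^bsub>S\<^esub> skew_const R X) i = s i \<otimes> (\<alpha> ^^ i) X"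
  using X_closed by (simp add: const_monomial mult_monomial)

text \<open>The coefficients of \<open>t\<close> are those of \<open>s\<close> times the units \<open>\<alpha>\<^sup>i(X)/X\<close>.\<close>

lemma X_normal_left: "s \<in> up R \<Longrightarrow> \<exists>t\<in>up R. s \<otimes>\<^bsub>S\<^esub> skew_const R X = skew_const R X \<otimes>\<^bsub>S\<^esub> t"
proof -
  assume s: "s \<in> up R"
  obtain u where u: "\<And>i. u i \<in> Units R" "\<And>i. (\<alpha> ^^ i) X = u i \<otimes> X" using pow_X by metis
  obtain n where n: "\<And>i. i > n \<Longrightarrow> s i = \<zero>" using upE[OF s] by blast
  have cl: "u i \<in> carrier R" for i using u(1) by (rule Units_closed)
  define t where "t i = s i \<otimes> u i" for i
  have t: "t \<in> up R" by (rule upI[of _ n]) (use s cl n in \<open>auto simp: t_def\<close>)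
  have "s \<otimes>\<^bsub>S\<^esub> skew_const R X = skew_const R X \<otimes>\<^bsub>S\<^esub> t"
    by (rule ext) (use s t u cl X_closed in \<open>simp add: const_X_mult mult_const_X t_def m_ac\<close>)
  thus ?thesis using t by blast
qed

lemma X_normal_right: "s \<in> up R \<Longrightarrow> \<exists>t\<in>up R. skew_const R X \<otimes>\<^bsub>S\<^esub> s = t \<otimes>\<^bsub>S\<^esub> skew_const R X"
proof -
  assume s: "s \<in> up R"
  obtain u where u: "\<And>i. u i \<in> Units R" "\<And>i. (\<alpha> ^^ i) X = u i \<otimes> X" using pow_X by metis
  obtain n where n: "\<And>i. i > n \<Longrightarrow> s i = \<zero>" using upE[OF s] by blast
  have cl: "u i \<in> carrier R" "inv (u i) \<in> carrier R" "inv (u i) \<otimes> u i = \<one>" for i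
    using u(1)[of i] by (auto simp: Units_closed)
  define t where "t i = s i \<otimes> inv (u i)" for i
  have t: "t \<in> up R" by (rule upI[of _ n]) (use s cl n in \<open>auto simp: t_def\<close>)
  have "t i \<otimes> (u i \<otimes> X) = X \<otimes> s i" for i
  proof -
    have "t i \<otimes> (u i \<otimes> X) = s i \<otimes> (inv (u i) \<otimes> u i) \<otimes> X"
      unfolding t_def using s cl(1,2) X_closed by (simp add: m_assoc)
    thus ?thesis using cl(3) s X_closed by (simp add: m_comm)
  qed
  hence "skew_const R X \<otimes>\<^bsub>S\<^esub> s = t \<otimes>\<^bsub>S\<^esub> skew_const R X"
    using s t by (intro ext) (simp add: const_X_mult mult_const_X u(2))
  thus ?thesis using t by blast
qed

text \<open>If \<open>n\<close> is the valuation of the leading coefficient of \<open>z\<close>, then the leading coefficient of \<open>wX\<^sup>n\<close> is a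
  multiple of that of \<open>z\<close>, because \<open>\<alpha>\<^sup>m(X\<^sup>n)\<close> is a unit times \<open>X\<^sup>n\<close>.\<close>

lemma X_division:
  assumes z: "z \<in> up R" "z \<noteq> \<zero>\<^bsub>S\<^esub>" and w: "w \<in> up R" "w \<noteq> \<zero>\<^bsub>S\<^esub>" and le: "sdeg z \<le> sdeg w"
  shows "\<exists>n. \<exists>s\<in>up R. w \<otimes>\<^bsub>S\<^esub> skew_const R X [^]\<^bsub>S\<^esub> (n::nat) \<ominus>\<^bsub>S\<^esub> z \<otimes>\<^bsub>S\<^esub> s = \<zero>\<^bsub>S\<^esub> \<or>
      sdeg (w \<otimes>\<^bsub>S\<^esub> skew_const R X [^]\<^bsub>S\<^esub> n \<ominus>\<^bsub>S\<^esub> z \<otimes>\<^bsub>S\<^esub> s) < sdeg w"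
proof -
  define d where "d = sdeg z"
  define m where "m = sdeg w"
  define n where "n = val (z d)"
  have zd: "z d \<noteq> \<zero>" using lead_nonzero[OF z] by (simp add: d_def)
  obtain u where u: "u \<in> Units R" "z d = u \<otimes> X [^] n" using valE[of "z d"] zd z(1) by (auto simp: n_def)
  obtain t where t: "t \<in> Units R" "(\<alpha> ^^ m) (X [^] n) = t \<otimes> X [^] n" using pow_X_pow by blast
  have cl: "u \<in> carrier R" "inv u \<in> carrier R" "t \<in> carrier R" "u \<otimes> inv u = \<one>"
    using u t by (auto simp: Units_closed)
  obtain c where c: "c \<in> carrier R" "inv u \<otimes> (w m \<otimes> t) = (\<alpha> ^^ d) c"
    using pow_surj[of "inv u \<otimes> (w m \<otimes> t)" d] cl w by auto
  have lead: "z d \<otimes> (\<alpha> ^^ d) c = w m \<otimes> (\<alpha> ^^ m) (X [^] n)"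
  proof -
    have "z d \<otimes> (\<alpha> ^^ d) c = (u \<otimes> inv u) \<otimes> (w m \<otimes> (t \<otimes> X [^] n))"
      unfolding u(2) c(2)[symmetric] using cl(1,2,3) w X_closed by (simp add: m_ac)
    thus ?thesis unfolding cl(4) t(2) using cl w X_closed by simp
  qed
  define s where "s = monomial c (m - d)"
  have s: "s \<in> up R" using c by (simp add: s_def)
  define r where "r = w \<otimes>\<^bsub>S\<^esub> skew_const R X [^]\<^bsub>S\<^esub> n \<ominus>\<^bsub>S\<^esub> z \<otimes>\<^bsub>S\<^esub> s"
  have Xn: "skew_const R X [^]\<^bsub>S\<^esub> n = monomial (X [^] n) 0" using X_closed by (simp add: const_pow) (simp add: const_monomial)
  have r: "r i = w i \<otimes> (\<alpha> ^^ i) (X [^] n) \<ominus> (z \<otimes>\<^bsub>S\<^esub> s) i" for i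
    unfolding r_def Xn using w z s X_closed by (simp add: minus_S S_mult_closed mult_monomial)
  have rS: "r \<in> up R"
  proof -
    have "r \<in> carrier S" unfolding r_def Xn using w z s X_closed
      by (intro S.minus_closed S.m_closed) auto
    thus ?thesis by simp
  qed
  have "r i = \<zero>" if i: "i \<ge> m" for i
  proof (cases "i = m")
    case True
    have "m - (m - d) = d" using le by (simp add: d_def m_def)
    hence "(z \<otimes>\<^bsub>S\<^esub> s) m = z d \<otimes> (\<alpha> ^^ d) c" unfolding s_def using z c by (simp add: mult_monomial)
    thus ?thesis unfolding r True using lead w X_closed by (simp add: minus_eq_zero_iff)
  next
    case False
    have "z (i - (m - d)) = \<zero>" using False i le above_sdeg[OF z(1), of "i - (m - d)"] by (simp add: d_def m_def)
    hence "(z \<otimes>\<^bsub>S\<^esub> s) i = \<zero>" unfolding s_def using z c by (simp add: mult_monomial)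
    moreover have "w i = \<zero>" using above_sdeg[OF w(1), of i] False i by (simp add: m_def)
    ultimately show ?thesis unfolding r using X_closed by (simp add: minus_eq_zero_iff)
  qed
  hence "r = \<zero>\<^bsub>S\<^esub> \<or> sdeg r < m" using lead_nonzero[OF rS] by (meson not_less)
  thus ?thesis using s unfolding r_def m_def by blast
qed

lemma size_irreducible_one:
  assumes p: "p \<in> up R" and sz: "size p = 1" and nz: "p \<noteq> \<zero>\<^bsub>S\<^esub>"
  shows "p \<in> irreducible_elements S"
proof -
  have "a \<in> Units S \<or> b \<in> Units S" if ab: "a \<in> up R" "b \<in> up R" "p = a \<otimes>\<^bsub>S\<^esub> b" for a b
  proof -
    have n: "a \<noteq> \<zero>\<^bsub>S\<^esub>" "b \<noteq> \<zero>\<^bsub>S\<^esub>" using ab nz by auto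
    have "size a + size b = 1" using size_mult[OF ab(1,2) n] ab(3) sz by simp
    thus ?thesis using size_zero_iff[OF ab(1) n(1)] size_zero_iff[OF ab(2) n(2)] by linarith
  qed
  thus ?thesis using p nz size_zero_iff[OF p nz] sz by (auto simp: irreducible_elements_def)
qed

lemma val_X: "val X = 1" using val_eqI[of \<one> 1] X_closed by simp

lemma X_irreducible: "skew_const R X \<in> irreducible_elements S"
  using X_closed X_nonzero by (intro size_irreducible_one const_X_nonzero)
    (auto simp: size_def sdeg_monomial const_monomial, auto simp: monomial_def val_X)

lemma var_irreducible: "skew_var R \<in> irreducible_elements S"
proof (rule size_irreducible_one)
  have "val \<one> = 0" using val_zero_iff[of \<one>] by simp
  thus "size (skew_var R) = 1" by (simp add: size_def var_monomial sdeg_monomial) (simp add: monomial_def)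
qed (auto simp: var_monomial monomial_nonzero)

lemma var_mult: "s \<in> up R \<Longrightarrow> (skew_var R \<otimes>\<^bsub>S\<^esub> s) i = (case i of 0 \<Rightarrow> \<zero> | Suc j \<Rightarrow> \<alpha> (s j))"
  using pow_simps(1)[of _ 1] by (auto simp: var_monomial monomial_mult split: nat.split)

lemma mult_var: "s \<in> up R \<Longrightarrow> (s \<otimes>\<^bsub>S\<^esub> skew_var R) i = (case i of 0 \<Rightarrow> \<zero> | Suc j \<Rightarrow> s j)"
  by (auto simp: var_monomial mult_monomial split: nat.split)

lemma \<alpha>_inv: obtains \<beta> where "\<And>r. r \<in> carrier R \<Longrightarrow> \<beta> r \<in> carrier R \<and> \<alpha> (\<beta> r) = r" "\<beta> \<zero> = \<zero>"
proof -
  define \<beta> where "\<beta> = inv_into (carrier R) \<alpha>"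
  have b: "bij_betw \<alpha> (carrier R) (carrier R)" using \<alpha>_iso by (simp add: ring_iso_def)
  have "\<alpha> \<zero> = \<zero>" using pow_simps(3)[of 1] by simp
  hence "\<beta> \<zero> = \<zero>" using b inv_into_f_f[of \<alpha> "carrier R" \<zero>] by (simp add: \<beta>_def bij_betw_def)
  moreover have "\<beta> r \<in> carrier R \<and> \<alpha> (\<beta> r) = r" if "r \<in> carrier R" for r
    using that b by (simp add: \<beta>_def bij_betw_def inv_into_into f_inv_into_f)
  ultimately show ?thesis using that by blast
qed

lemma var_factor:
  assumes s: "s \<in> up R" "s 0 = \<zero>"
  shows "\<exists>t\<in>up R. s = skew_var R \<otimes>\<^bsub>S\<^esub> t"
proof -
  obtain \<beta> where \<beta>: "\<And>r. r \<in> carrier R \<Longrightarrow> \<beta> r \<in> carrier R \<and> \<alpha> (\<beta> r) = r" "\<beta> \<zero> = \<zero>" using \<alpha>_inv by blast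
  obtain n where n: "\<And>i. i > n \<Longrightarrow> s i = \<zero>" using upE[OF s(1)] by blast
  have t: "(\<lambda>i. \<beta> (s (Suc i))) \<in> up R" by (rule upI[of _ n]) (use \<beta> s n in auto)
  moreover have "s = skew_var R \<otimes>\<^bsub>S\<^esub> (\<lambda>i. \<beta> (s (Suc i)))"
    by (rule ext) (use t s \<beta> in \<open>auto simp: var_mult split: nat.split\<close>)
  ultimately show ?thesis by blast
qed

lemma normal_section_var: "normal_section S R (skew_var R) (skew_const R)"
proof (intro normal_section.intro normal_section_axioms.intro)
  show "ring S" by (rule ring_S)
  show "principal_domain R" by (rule principal_domain_R)
  show "skew_var R \<in> carrier S" by (simp add: var_monomial)
  show "skew_const R \<in> ring_hom R S" by (rule const_hom)
  show "\<exists>p\<in>carrier R. p \<noteq> \<zero> \<and> p \<notin> Units R" using X_closed X_nonzero X_nonunit by blast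
next
  fix s assume "s \<in> carrier S" hence s: "s \<in> up R" by simp
  have "s \<otimes>\<^bsub>S\<^esub> skew_var R \<in> up R" using s by (intro S_mult_closed) (simp_all add: var_monomial)
  thus "\<exists>t\<in>carrier S. s \<otimes>\<^bsub>S\<^esub> skew_var R = skew_var R \<otimes>\<^bsub>S\<^esub> t"
    using var_factor[of "s \<otimes>\<^bsub>S\<^esub> skew_var R"] s by (simp add: mult_var)
  obtain n where n: "\<And>i. i > n \<Longrightarrow> s i = \<zero>" using upE[OF s] by blast
  have \<alpha>0: "\<alpha> \<zero> = \<zero>" and \<alpha>c: "\<And>r. r \<in> carrier R \<Longrightarrow> \<alpha> r \<in> carrier R"
    using pow_simps(1)[of _ 1] pow_simps(3)[of 1] by simp_all
  have t: "(\<lambda>i. \<alpha> (s i)) \<in> up R" by (rule upI[of _ n]) (use s n \<alpha>0 \<alpha>c in auto)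
  have "skew_var R \<otimes>\<^bsub>S\<^esub> s = (\<lambda>i. \<alpha> (s i)) \<otimes>\<^bsub>S\<^esub> skew_var R"
    by (rule ext) (use s t in \<open>simp add: mult_var var_mult\<close>)
  thus "\<exists>t\<in>carrier S. skew_var R \<otimes>\<^bsub>S\<^esub> s = t \<otimes>\<^bsub>S\<^esub> skew_var R" using t by auto
  define r where "r = s \<ominus>\<^bsub>S\<^esub> skew_const R (s 0)"
  have r: "r \<in> up R" unfolding r_def using S.minus_closed[of s "skew_const R (s 0)"] s by simp
  have "r 0 = \<zero>" unfolding r_def using s by (simp add: minus_S minus_eq_zero_iff) (simp add: skew_const_def minus_eq_zero_iff)
  then obtain t where t: "t \<in> up R" "r = skew_var R \<otimes>\<^bsub>S\<^esub> t" using var_factor[OF r] by blast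
  have "s = skew_const R (s 0) \<oplus>\<^bsub>S\<^esub> r"
  proof
    fix i
    have "skew_const R (s 0) i \<in> carrier R" using s by (intro up_closed) simp
    moreover have "r i = s i \<ominus> skew_const R (s 0) i" unfolding r_def using s by (intro minus_S) auto
    ultimately show "s i = (skew_const R (s 0) \<oplus>\<^bsub>S\<^esub> r) i" using s r
      by (simp add: add_S a_minus_def a_lcomm r_neg)
  qed
  thus "\<exists>p\<in>carrier R. \<exists>t\<in>carrier S. s = skew_const R p \<oplus>\<^bsub>S\<^esub> skew_var R \<otimes>\<^bsub>S\<^esub> t"
    using t s by (intro bexI[of _ "s 0"] bexI[of _ t]) auto
next
  fix p t assume p: "p \<in> carrier R" and t: "t \<in> carrier S" "skew_const R p = skew_var R \<otimes>\<^bsub>S\<^esub> t"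
  from t(2) have "skew_const R p 0 = (skew_var R \<otimes>\<^bsub>S\<^esub> t) 0" by simp
  thus "p = \<zero>" using t(1) by (simp add: var_mult) (simp add: skew_const_def)
qed

end

section \<open>Polynomials over a field\<close>

lemma euclidean_domain_UP:
  assumes "field k"
  shows "euclidean_domain (UP k) (deg k)"
proof -
  interpret k: field k by fact
  interpret UP_domain k "UP k" by unfold_locales simp
  show ?thesis
  proof (rule euclidean_domainI)
    fix a b assume ab: "a \<in> carrier (UP k) - {\<zero>\<^bsub>UP k\<^esub>}" "b \<in> carrier (UP k) - {\<zero>\<^bsub>UP k\<^esub>}"
    let ?l = "coeff (UP k) b (deg k b)"
    obtain q r n where qr: "q \<in> carrier (UP k)" "r \<in> carrier (UP k)"
      "?l [^]\<^bsub>k\<^esub> (n::nat) \<odot>\<^bsub>UP k\<^esub> a = b \<otimes>\<^bsub>UP k\<^esub> q \<oplus>\<^bsub>UP k\<^esub> r" "r = \<zero>\<^bsub>UP k\<^esub> \<or> deg k r < deg k b"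
      using long_div_theorem[of b a] ab by auto
    have l: "?l \<in> Units k" using ab lcoeff_nonzero[of b] by (simp add: k.field_Units)
    hence ln: "?l [^]\<^bsub>k\<^esub> n \<in> Units k" by (rule k.Units_pow_closed)
    define c where "c = inv\<^bsub>k\<^esub> (?l [^]\<^bsub>k\<^esub> n)"
    have c: "c \<in> carrier k" "c \<otimes>\<^bsub>k\<^esub> (?l [^]\<^bsub>k\<^esub> n) = \<one>\<^bsub>k\<^esub>" using ln by (simp_all add: c_def)
    have "a = c \<odot>\<^bsub>UP k\<^esub> (?l [^]\<^bsub>k\<^esub> n \<odot>\<^bsub>UP k\<^esub> a)"
      using ab c ln by (simp add: UP_smult_assoc1[symmetric])
    also have "\<dots> = (c \<odot>\<^bsub>UP k\<^esub> b) \<otimes>\<^bsub>UP k\<^esub> q \<oplus>\<^bsub>UP k\<^esub> c \<odot>\<^bsub>UP k\<^esub> r"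
      unfolding qr(3) using ab qr(1,2) c(1) by (simp add: UP_smult_r_distr UP_smult_assoc2)
    also have "(c \<odot>\<^bsub>UP k\<^esub> b) \<otimes>\<^bsub>UP k\<^esub> q = b \<otimes>\<^bsub>UP k\<^esub> (c \<odot>\<^bsub>UP k\<^esub> q)"
      using ab qr(1) c(1) P.m_comm[of b "c \<odot>\<^bsub>UP k\<^esub> q"] P.m_comm[of b q] by (simp add: UP_smult_assoc2)
    finally have "a = b \<otimes>\<^bsub>UP k\<^esub> (c \<odot>\<^bsub>UP k\<^esub> q) \<oplus>\<^bsub>UP k\<^esub> c \<odot>\<^bsub>UP k\<^esub> r" .
    moreover have "c \<odot>\<^bsub>UP k\<^esub> r = \<zero>\<^bsub>UP k\<^esub> \<or> deg k (c \<odot>\<^bsub>UP k\<^esub> r) < deg k b"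
      using qr(2,4) c(1) deg_smult_decr[of c r] smult_r_null[of c] by (metis le_less_trans)
    ultimately show "\<exists>q r. q \<in> carrier (UP k) \<and> r \<in> carrier (UP k) \<and> a = b \<otimes>\<^bsub>UP k\<^esub> q \<oplus>\<^bsub>UP k\<^esub> r \<and>
        (r = \<zero>\<^bsub>UP k\<^esub> \<or> deg k r < deg k b)"
      using qr(1,2) c(1) by (intro exI[of _ "c \<odot>\<^bsub>UP k\<^esub> q"] exI[of _ "c \<odot>\<^bsub>UP k\<^esub> r"]) auto
  qed
qed

lemma principal_domain_UP:
  assumes "field k"
  shows "principal_domain (UP k)"
proof -
  interpret euclidean_domain "UP k" "deg k" by (rule euclidean_domain_UP[OF assms])
  show ?thesis by (rule principal_domain_axioms)
qed

lemma UP_coeff: "f \<in> carrier (UP k) \<Longrightarrow> coeff (UP k) f i = f i"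
  by (simp add: UP_def)

lemma UP_unit_iff:
  assumes "field k" and f: "f \<in> carrier (UP k)" "f \<noteq> \<zero>\<^bsub>UP k\<^esub>"
  shows "f \<in> Units (UP k) \<longleftrightarrow> deg k f = 0"
proof -
  interpret k: field k by fact
  interpret UP_domain k "UP k" by unfold_locales simp
  show ?thesis
  proof
    assume "f \<in> Units (UP k)"
    then obtain g where g: "g \<in> carrier (UP k)" "f \<otimes>\<^bsub>UP k\<^esub> g = \<one>\<^bsub>UP k\<^esub>" by (auto simp: Units_def)
    hence "g \<noteq> \<zero>\<^bsub>UP k\<^esub>" using f by auto
    hence "deg k f + deg k g = deg k \<one>\<^bsub>UP k\<^esub>" using deg_mult[of f g] f g by simp
    thus "deg k f = 0" by simp
  next
    assume d: "deg k f = 0"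
    let ?c = "coeff (UP k) f 0"
    have "?c \<noteq> \<zero>\<^bsub>k\<^esub>" using lcoeff_nonzero[of f] f d by simp
    hence c: "?c \<in> Units k" using f by (simp add: k.field_Units)
    have "monom (UP k) ?c 0 \<otimes>\<^bsub>UP k\<^esub> monom (UP k) (inv\<^bsub>k\<^esub> ?c) 0 = \<one>\<^bsub>UP k\<^esub>"
      using c f monom_mult[of ?c "inv\<^bsub>k\<^esub> ?c" 0 0] by (simp add: k.Units_r_inv)
    hence "f \<otimes>\<^bsub>UP k\<^esub> monom (UP k) (inv\<^bsub>k\<^esub> ?c) 0 = \<one>\<^bsub>UP k\<^esub>"
      using deg_zero_impl_monom[OF f(1) d] by simp
    moreover have "monom (UP k) (inv\<^bsub>k\<^esub> ?c) 0 \<in> carrier (UP k)" using k.Units_inv_closed[OF c] by simp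
    ultimately show "f \<in> Units (UP k)" using P.UnitsI[OF f(1)] by blast
  qed
qed

lemma (in ring) irreducible_mult_unit:
  assumes z: "z \<in> irreducible_elements R" and u: "u \<in> Units R" and nz: "z \<otimes> u \<noteq> \<zero>"
  shows "z \<otimes> u \<in> irreducible_elements R"
proof -
  have zc: "z \<in> carrier R" "z \<notin> Units R" using z by (auto simp: irreducible_elements_def)
  have uc: "u \<in> carrier R" "inv u \<in> Units R" "inv u \<in> carrier R" using u by auto
  have canc: "(w \<otimes> u) \<otimes> inv u = w" "(w \<otimes> inv u) \<otimes> u = w" if "w \<in> carrier R" for w
    using that u uc by (simp_all add: m_assoc)
  have "z \<otimes> u \<notin> Units R"
  proof
    assume "z \<otimes> u \<in> Units R"
    hence "(z \<otimes> u) \<otimes> inv u \<in> Units R" using uc(2) by (rule Units_m_closed)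
    thus False using canc zc by simp
  qed
  moreover have "a \<in> Units R \<or> b \<in> Units R" if ab: "a \<in> carrier R" "b \<in> carrier R" "z \<otimes> u = a \<otimes> b" for a b
  proof -
    have "z = a \<otimes> (b \<otimes> inv u)" using canc(1)[OF zc(1)] ab uc by (simp add: m_assoc)
    hence "a \<in> Units R \<or> b \<otimes> inv u \<in> Units R" using z ab uc by (auto simp: irreducible_elements_def)
    moreover have "b \<in> Units R" if "b \<otimes> inv u \<in> Units R"
    proof -
      have "(b \<otimes> inv u) \<otimes> u \<in> Units R" using that u by (rule Units_m_closed)
      thus ?thesis using canc(2)[OF ab(2)] by simp
    qed
    ultimately show ?thesis by blast
  qed
  ultimately show ?thesis using zc uc nz by (auto simp: irreducible_elements_def)
qed

section \<open>Residue field and polynomial section\<close>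

locale skew_poly_dvr_algebra = skew_poly_dvr R \<alpha> X
  for R :: "('k, 'a, 'm) module_scheme" (structure) and \<alpha> and X +
  fixes k :: "('k, 'n) ring_scheme"
  assumes field_k: "field k"
    and algebra_R: "algebra k R"
    and residue: "bij_betw (\<lambda>c. (PIdl X) +> (c \<odot> \<one>)) (carrier k) (carrier (R Quot (PIdl X)))"
    and \<alpha>_linear: "\<forall>c\<in>carrier k. \<forall>r\<in>carrier R. \<alpha> (c \<odot> r) = c \<odot> \<alpha> r"
    and \<alpha>_infinite_order: "\<forall>n>0. \<exists>r\<in>carrier R. (\<alpha> ^^ n) r \<noteq> r"
begin

interpretation k: field k by (rule field_k)
interpretation A: algebra k R by (rule algebra_R)
interpretation UPk: UP_domain k "UP k" by unfold_locales simp

definition \<kappa> :: "'k \<Rightarrow> 'a" where "\<kappa> c = c \<odot> \<one>"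

lemma \<kappa>_hom: "\<kappa> \<in> ring_hom k R"
proof (rule ring_hom_memI)
  fix c d assume cd: "c \<in> carrier k" "d \<in> carrier k"
  show "\<kappa> c \<in> carrier R" using cd by (simp add: \<kappa>_def)
  show "\<kappa> (c \<oplus>\<^bsub>k\<^esub> d) = \<kappa> c \<oplus> \<kappa> d" using cd by (simp add: \<kappa>_def A.smult_l_distr)
  show "\<kappa> (c \<otimes>\<^bsub>k\<^esub> d) = \<kappa> c \<otimes> \<kappa> d" using cd by (simp add: \<kappa>_def A.smult_assoc1 A.smult_assoc2)
qed (simp add: \<kappa>_def)

lemma \<kappa>_simps [simp]: "c \<in> carrier k \<Longrightarrow> \<kappa> c \<in> carrier R" "\<kappa> \<one>\<^bsub>k\<^esub> = \<one>" "\<kappa> \<zero>\<^bsub>k\<^esub> = \<zero>"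
  using \<kappa>_hom ring_hom_zero[OF \<kappa>_hom k.ring_axioms ring_axioms] by (auto simp: ring_hom_closed ring_hom_one)

lemma \<kappa>_fixed: "c \<in> carrier k \<Longrightarrow> (\<alpha> ^^ i) (\<kappa> c) = \<kappa> c"
proof (induction i)
  case (Suc i)
  have "\<alpha> (c \<odot> \<one>) = c \<odot> \<alpha> \<one>" using \<alpha>_linear Suc.prems by blast
  also have "\<alpha> \<one> = \<one>" using pow_simps(2)[of 1] by simp
  finally show ?case using Suc by (simp add: \<kappa>_def)
qed simp

lemma PIdl_X_iff: "r \<in> PIdl X \<longleftrightarrow> (\<exists>t\<in>carrier R. r = X \<otimes> t)"
  using X_closed by (auto simp: cgenideal_def m_comm)

lemma residue_decomp:
  assumes r: "r \<in> carrier R"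
  shows "\<exists>c\<in>carrier k. \<exists>t\<in>carrier R. r = \<kappa> c \<oplus> X \<otimes> t"
proof -
  interpret I: ideal "PIdl X" R by (rule cgenideal_ideal[OF X_closed])
  have "PIdl X +> r \<in> carrier (R Quot (PIdl X))" using r by (auto simp: FactRing_def A_RCOSETS_def')
  then obtain c where c: "c \<in> carrier k" "PIdl X +> r = PIdl X +> \<kappa> c"
    using residue by (auto simp: bij_betw_def \<kappa>_def)
  have "r \<in> PIdl X +> \<kappa> c" using I.a_rcos_self[OF r] c(2) by simp
  then obtain i where i: "i \<in> PIdl X" "r = i \<oplus> \<kappa> c" by (auto simp: a_r_coset_def')
  then obtain t where "t \<in> carrier R" "i = X \<otimes> t" by (auto simp: PIdl_X_iff)
  thus ?thesis using i c X_closed by (intro bexI[of _ c] bexI[of _ t]) (auto simp: a_comm)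
qed

lemma residue_inj:
  assumes c: "c \<in> carrier k" and t: "t \<in> carrier R" "\<kappa> c = X \<otimes> t"
  shows "c = \<zero>\<^bsub>k\<^esub>"
proof -
  interpret I: ideal "PIdl X" R by (rule cgenideal_ideal[OF X_closed])
  have "\<kappa> c \<in> PIdl X" using t PIdl_X_iff by blast
  hence "PIdl X +> \<kappa> c = PIdl X +> \<kappa> \<zero>\<^bsub>k\<^esub>"
    using a_coset_join2[of "\<kappa> c" "PIdl X"] a_coset_join2[of "\<zero>" "PIdl X"] c I.a_subgroup I.zero_closed by simp
  thus ?thesis using residue c by (auto simp: bij_betw_def inj_on_def \<kappa>_def)
qed

abbreviation \<epsilon> where "\<epsilon> \<equiv> emb_poly k R"
abbreviation XX where "XX \<equiv> skew_const R X"
abbreviation \<theta> where "\<theta> \<equiv> skew_var R"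

lemma emb_apply: "f \<in> carrier (UP k) \<Longrightarrow> \<epsilon> f i = \<kappa> (f i)"
  by (simp add: emb_poly_def UP_coeff \<kappa>_def)

lemma UP_carrier: "carrier (UP k) = up k" by (simp add: UP_def)

lemma UP_closed: "f \<in> carrier (UP k) \<Longrightarrow> f i \<in> carrier k" by (auto simp: UP_carrier)

lemma emb_closed: assumes "f \<in> carrier (UP k)" shows "\<epsilon> f \<in> up R"
proof -
  obtain n where "bound \<zero>\<^bsub>k\<^esub> n f" using assms k.bound_upD by (auto simp: UP_carrier)
  thus ?thesis using assms UP_closed by (intro upI[of _ n]) (auto simp: emb_apply bound_def)
qed

lemma emb_hom: "\<epsilon> \<in> ring_hom (UP k) S"
proof (rule ring_hom_memI)
  fix f g assume fg: "f \<in> carrier (UP k)" "g \<in> carrier (UP k)"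
  interpret h: ring_hom_ring k R \<kappa> by (rule ring_hom_ringI2[OF k.ring_axioms ring_axioms \<kappa>_hom])
  show "\<epsilon> f \<in> carrier S" using emb_closed[OF fg(1)] by simp
  show "\<epsilon> (f \<oplus>\<^bsub>UP k\<^esub> g) = \<epsilon> f \<oplus>\<^bsub>S\<^esub> \<epsilon> g"
  proof
    fix i
    have "(f \<oplus>\<^bsub>UP k\<^esub> g) i = f i \<oplus>\<^bsub>k\<^esub> g i" using fg by (simp add: UP_def)
    thus "\<epsilon> (f \<oplus>\<^bsub>UP k\<^esub> g) i = (\<epsilon> f \<oplus>\<^bsub>S\<^esub> \<epsilon> g) i"
      using fg by (simp add: emb_apply add_S emb_closed UP_closed)
  qed
  show "\<epsilon> (f \<otimes>\<^bsub>UP k\<^esub> g) = \<epsilon> f \<otimes>\<^bsub>S\<^esub> \<epsilon> g"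
  proof
    fix n
    have "(f \<otimes>\<^bsub>UP k\<^esub> g) n = (\<Oplus>\<^bsub>k\<^esub>i\<in>{..n}. f i \<otimes>\<^bsub>k\<^esub> g (n - i))" using fg by (simp add: UP_def)
    hence "\<epsilon> (f \<otimes>\<^bsub>UP k\<^esub> g) n = \<kappa> (\<Oplus>\<^bsub>k\<^esub>i\<in>{..n}. f i \<otimes>\<^bsub>k\<^esub> g (n - i))"
      using fg by (simp add: emb_apply)
    also have "\<dots> = (\<Oplus>i\<in>{..n}. \<kappa> (f i \<otimes>\<^bsub>k\<^esub> g (n - i)))"
      using h.hom_finsum[of "\<lambda>i. f i \<otimes>\<^bsub>k\<^esub> g (n - i)" "{..n}"] fg UP_closed by (simp add: comp_def Pi_def)
    also have "\<dots> = (\<Oplus>i\<in>{..n}. \<epsilon> f i \<otimes> (\<alpha> ^^ i) (\<epsilon> g (n - i)))"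
      using fg UP_closed by (intro finsum_cong') (auto simp: emb_apply \<kappa>_fixed)
    also have "\<dots> = (\<epsilon> f \<otimes>\<^bsub>S\<^esub> \<epsilon> g) n" using fg by (simp add: mult_S emb_closed)
    finally show "\<epsilon> (f \<otimes>\<^bsub>UP k\<^esub> g) n = (\<epsilon> f \<otimes>\<^bsub>S\<^esub> \<epsilon> g) n" .
  qed
next
  have "\<one>\<^bsub>UP k\<^esub> i = (if i = 0 then \<one>\<^bsub>k\<^esub> else \<zero>\<^bsub>k\<^esub>)" for i by (simp add: UP_def)
  thus "\<epsilon> \<one>\<^bsub>UP k\<^esub> = \<one>\<^bsub>S\<^esub>" by (intro ext) (simp add: emb_apply one_S)
qed

lemma UP_zero: "\<zero>\<^bsub>UP k\<^esub> = (\<lambda>i. \<zero>\<^bsub>k\<^esub>)" by (simp add: UP_def)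

lemma emb_decomp:
  assumes s: "s \<in> up R"
  shows "\<exists>f\<in>carrier (UP k). \<exists>t\<in>up R. s = \<epsilon> f \<oplus>\<^bsub>S\<^esub> XX \<otimes>\<^bsub>S\<^esub> t"
proof -
  \<comment> \<open>Zero coefficients have to be split as \<open>0 + X0\<close>, so that \<open>f\<close> and \<open>t\<close> have finite support.\<close>
  have "\<forall>i. \<exists>c t. c \<in> carrier k \<and> t \<in> carrier R \<and> s i = \<kappa> c \<oplus> X \<otimes> t \<and> (s i = \<zero> \<longrightarrow> c = \<zero>\<^bsub>k\<^esub> \<and> t = \<zero>)"
    (is "\<forall>i. \<exists>c t. ?P i c t")
  proof (rule allI)
   fix i show "\<exists>c t. ?P i c t"
   proof (cases "s i = \<zero>")
    case True
    thus ?thesis using X_closed by (intro exI[of _ "\<zero>\<^bsub>k\<^esub>"] exI[of _ \<zero>]) simp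
  next
    case False
    obtain c t where "c \<in> carrier k" "t \<in> carrier R" "s i = \<kappa> c \<oplus> X \<otimes> t"
      using residue_decomp[of "s i"] s by auto
    thus ?thesis using False by blast
   qed
  qed
  from choice[OF this] obtain f where "\<forall>i. \<exists>t. ?P i (f i) t" by blast
  from choice[OF this] obtain t where "\<forall>i. ?P i (f i) (t i)" by blast
  hence ft: "\<And>i. f i \<in> carrier k" "\<And>i. t i \<in> carrier R" "\<And>i. s i = \<kappa> (f i) \<oplus> X \<otimes> t i"
    "\<And>i. s i = \<zero> \<Longrightarrow> f i = \<zero>\<^bsub>k\<^esub>" "\<And>i. s i = \<zero> \<Longrightarrow> t i = \<zero>" by blast+
  obtain n where n: "\<And>i. i > n \<Longrightarrow> s i = \<zero>" using upE[OF s] by blast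
  have f: "f \<in> carrier (UP k)" unfolding UP_carrier using ft(1,4) n by (intro mem_upI) (auto simp: bound_def)
  have t: "t \<in> up R" using ft(2,5) n by (intro upI[of _ n]) auto
  have "s = \<epsilon> f \<oplus>\<^bsub>S\<^esub> XX \<otimes>\<^bsub>S\<^esub> t"
    by (rule ext) (use f t ft(3) X_closed in \<open>simp add: add_S emb_closed S_mult_closed const_X_mult emb_apply\<close>)
  thus ?thesis using f t by blast
qed

lemma UPk_X: "monom (UP k) \<one>\<^bsub>k\<^esub> 1 \<in> carrier (UP k)" "monom (UP k) \<one>\<^bsub>k\<^esub> 1 \<noteq> \<zero>\<^bsub>UP k\<^esub>"
    "monom (UP k) \<one>\<^bsub>k\<^esub> 1 \<notin> Units (UP k)" "\<epsilon> (monom (UP k) \<one>\<^bsub>k\<^esub> 1) = \<theta>"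
proof -
  let ?m = "monom (UP k) \<one>\<^bsub>k\<^esub> 1"
  show m: "?m \<in> carrier (UP k)" by simp
  have d: "deg k ?m = 1" by simp
  have a: "?m i = (if i = 1 then \<one>\<^bsub>k\<^esub> else \<zero>\<^bsub>k\<^esub>)" for i by (simp add: UP_def)
  show nz: "?m \<noteq> \<zero>\<^bsub>UP k\<^esub>"
  proof
    assume "?m = \<zero>\<^bsub>UP k\<^esub>"
    hence "?m 1 = \<zero>\<^bsub>k\<^esub>" by (simp add: UP_zero)
    thus False using a[of 1] by simp
  qed
  show "?m \<notin> Units (UP k)" using UP_unit_iff[OF field_k m nz] d by simp
  show "\<epsilon> ?m = \<theta>" by (rule ext) (simp only: emb_apply[OF m] a, simp add: skew_var_def)
qed

lemma skew_division_X: "skew_division S (UP k) XX \<epsilon> sdeg size"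
proof (intro skew_division.intro skew_division_axioms.intro normal_section.intro normal_section_axioms.intro)
  show "ring S" by (rule ring_S)
  show "principal_domain (UP k)" by (rule principal_domain_UP[OF field_k])
  show "\<epsilon> \<in> ring_hom (UP k) S" by (rule emb_hom)
  show "\<exists>p\<in>carrier (UP k). p \<noteq> \<zero>\<^bsub>UP k\<^esub> \<and> p \<notin> Units (UP k)" using UPk_X by blast
  show "p = \<zero>\<^bsub>UP k\<^esub>" if p: "p \<in> carrier (UP k)" and t: "t \<in> carrier S" "\<epsilon> p = XX \<otimes>\<^bsub>S\<^esub> t" for p t
  proof
    fix i
    have "\<kappa> (p i) = X \<otimes> t i" using fun_cong[OF t(2), of i] t(1) p by (simp add: emb_apply const_X_mult)
    thus "p i = \<zero>\<^bsub>UP k\<^esub> i" using residue_inj[of "p i" "t i"] p t(1) UP_closed by (simp add: UP_zero)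
  qed
  show "XX \<in> carrier S" using X_closed by simp
  show "sdeg XX = 0" using X_closed X_nonzero by (simp add: const_monomial sdeg_monomial)
qed (use X_normal_left X_normal_right emb_decomp one_nonzero_S S_integral const_X_nonzero lead_mult(1) size_mult
    size_zero_iff X_division in auto)

sublocale XD: skew_division S "UP k" XX \<epsilon> sdeg size by (rule skew_division_X)
sublocale TH: normal_section S R \<theta> "skew_const R" by (rule normal_section_var)

end

section \<open>Classes of irreducible elements\<close>

context skew_poly_dvr_algebra
begin

interpretation k: field k by (rule field_k)
interpretation A: algebra k R by (rule algebra_R)
interpretation UPk: UP_domain k "UP k" by unfold_locales simp

lemma set_B_iff:
  "z \<in> set_B R \<alpha> X \<longleftrightarrow> z \<in> irreducible_elements S \<and>
    (\<exists>s\<in>carrier S - skew_const R ` carrier R. z = \<one>\<^bsub>S\<^esub> \<oplus>\<^bsub>S\<^esub> XX \<otimes>\<^bsub>S\<^esub> s)"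
  by (simp add: set_B_def Let_def)

lemma set_C_iff:
  "z \<in> set_C k R \<alpha> X \<longleftrightarrow> z \<in> irreducible_elements S \<and>
    (\<exists>f\<in>monic_polys k. deg k f > 0 \<and> (\<exists>s\<in>carrier S. z = \<epsilon> f \<oplus>\<^bsub>S\<^esub> XX \<otimes>\<^bsub>S\<^esub> s)) \<and>
    (\<forall>u\<in>Units S. z \<noteq> \<theta> \<otimes>\<^bsub>S\<^esub> u)"
  by (simp add: set_C_def Let_def)

lemma positive_deg:
  assumes "f \<in> carrier (UP k)" "deg k f > 0"
  shows "f \<noteq> \<zero>\<^bsub>UP k\<^esub>" "f \<notin> Units (UP k)"
proof -
  show "f \<noteq> \<zero>\<^bsub>UP k\<^esub>" using assms(2) by auto
  thus "f \<notin> Units (UP k)" using UP_unit_iff[OF field_k assms(1)] assms(2) by simp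
qed

lemma set_B_section:
  assumes "z \<in> set_B R \<alpha> X"
  obtains f t where "z \<in> irreducible_elements S" "z = \<epsilon> f \<oplus>\<^bsub>S\<^esub> XX \<otimes>\<^bsub>S\<^esub> t" "f \<in> Units (UP k)" "t \<in> carrier S"
  using assms that[of "\<one>\<^bsub>UP k\<^esub>"] unfolding set_B_iff by (auto simp del: carrier_S)

lemma set_C_section:
  assumes "z \<in> set_C k R \<alpha> X"
  obtains f t where "z \<in> irreducible_elements S" "z = \<epsilon> f \<oplus>\<^bsub>S\<^esub> XX \<otimes>\<^bsub>S\<^esub> t"
    "f \<in> carrier (UP k)" "f \<noteq> \<zero>\<^bsub>UP k\<^esub>" "f \<notin> Units (UP k)" "t \<in> carrier S"
    "\<And>u. u \<in> Units S \<Longrightarrow> z \<noteq> \<theta> \<otimes>\<^bsub>S\<^esub> u"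
proof -
  obtain f s where f: "f \<in> monic_polys k" "deg k f > 0" "s \<in> carrier S" "z = \<epsilon> f \<oplus>\<^bsub>S\<^esub> XX \<otimes>\<^bsub>S\<^esub> s"
    using assms unfolding set_C_iff by blast
  thus ?thesis using that[of f s] positive_deg[of f] assms unfolding set_C_iff monic_polys_def by blast
qed

lemma const_unit_apply:
  assumes "u \<in> Units S" obtains r where "r \<in> Units R" "u = monomial r 0"
  using unit_const[OF assms] by (auto simp: const_monomial)

lemma var_mult_unit_0: "u \<in> Units S \<Longrightarrow> (\<theta> \<otimes>\<^bsub>S\<^esub> u) 0 = \<zero>"
  using S.Units_closed[of u] by (simp add: var_mult)

text \<open>The constant coefficient of an element of \<open>(B)\<close> lies in \<open>1 + XR\<close>, that of an associate of \<open>X\<close> or \<open>\<theta>\<close>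
  in \<open>XR\<close>.\<close>

lemma A_B_separate:
  assumes a: "a \<in> set_A R X" and b: "b \<in> set_B R \<alpha> X" and u: "u \<in> Units S"
  shows "b \<noteq> a \<otimes>\<^bsub>S\<^esub> u"
proof
  assume ba: "b = a \<otimes>\<^bsub>S\<^esub> u"
  have uS: "u \<in> up R" using S.Units_closed[OF u] by simp
  obtain s where s: "s \<in> up R" "b = \<one>\<^bsub>S\<^esub> \<oplus>\<^bsub>S\<^esub> XX \<otimes>\<^bsub>S\<^esub> s" using b by (auto simp: set_B_iff)
  have b0: "b 0 = \<one> \<oplus> X \<otimes> s 0"
    unfolding s(2) using s(1) X_closed by (simp add: add_S S_one_closed S_mult_closed const_X_mult one_S_monomial)
      (simp add: monomial_def)
  have "\<exists>t\<in>carrier R. b 0 = X \<otimes> t"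
  proof (cases "a = XX")
    case True
    thus ?thesis unfolding ba using uS by (auto simp: const_X_mult)
  next
    case False
    hence "b 0 = \<zero>" using a var_mult_unit_0[OF u] by (auto simp: set_A_def ba)
    thus ?thesis using X_closed by (intro bexI[of _ \<zero>]) auto
  qed
  then obtain t where t: "t \<in> carrier R" "b 0 = X \<otimes> t" by blast
  have "\<one> = (\<one> \<oplus> X \<otimes> s 0) \<ominus> X \<otimes> s 0" using s(1) X_closed by (simp add: a_minus_def a_assoc r_neg)
  also have "\<dots> = X \<otimes> (t \<ominus> s 0)" unfolding b0[symmetric] t(2) using s(1) t(1) X_closed
    by (simp add: a_minus_def r_distr r_minus)
  finally show False using UnitsI[of X "t \<ominus> s 0"] X_nonunit X_closed s(1) t(1) by simp
qed

lemma A_C_separate: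
  assumes a: "a \<in> set_A R X" and c: "c \<in> set_C k R \<alpha> X" and u: "u \<in> Units S"
  shows "c \<noteq> a \<otimes>\<^bsub>S\<^esub> u"
proof (cases "a = XX")
  case True
  obtain f t where f: "c = \<epsilon> f \<oplus>\<^bsub>S\<^esub> XX \<otimes>\<^bsub>S\<^esub> t" "f \<in> carrier (UP k)" "f \<noteq> \<zero>\<^bsub>UP k\<^esub>" "t \<in> carrier S"
    using set_C_section[OF c] by metis
  have "c \<notin> XD.xS" unfolding f(1) by (rule XD.section_notin_xS[OF f(2,4,3)])
  thus ?thesis using True XD.xS_I(1)[OF S.Units_closed[OF u]] by blast
next
  case False
  thus ?thesis using a c u by (auto simp: set_A_def set_C_iff)
qed

text \<open>All coefficients of positive degree of an associate of an element of \<open>(B)\<close> lie in \<open>XR\<close>, whereas an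
  element of \<open>(C)\<close> with residue \<open>f\<close> has a coefficient in \<open>1 + XR\<close> at the degree of \<open>f\<close>.\<close>

lemma B_C_separate:
  assumes b: "b \<in> set_B R \<alpha> X" and c: "c \<in> set_C k R \<alpha> X" and u: "u \<in> Units S"
  shows "c \<noteq> b \<otimes>\<^bsub>S\<^esub> u"
proof
  assume cb: "c = b \<otimes>\<^bsub>S\<^esub> u"
  obtain r where r: "r \<in> Units R" "u = monomial r 0" using const_unit_apply[OF u] .
  have rR: "r \<in> carrier R" using r by auto
  obtain s where s: "s \<in> up R" "b = \<one>\<^bsub>S\<^esub> \<oplus>\<^bsub>S\<^esub> XX \<otimes>\<^bsub>S\<^esub> s" using b by (auto simp: set_B_iff)
  obtain f t where f: "f \<in> monic_polys k" "deg k f > 0" "t \<in> up R" "c = \<epsilon> f \<oplus>\<^bsub>S\<^esub> XX \<otimes>\<^bsub>S\<^esub> t"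
    using c by (auto simp: set_C_iff)
  define n where "n = deg k f"
  have fn: "f \<in> carrier (UP k)" "f n = \<one>\<^bsub>k\<^esub>" using f(1) by (auto simp: monic_polys_def n_def UP_coeff)
  have bS: "b \<in> up R" unfolding s(2) using s(1) X_closed by (intro S_add_closed S_mult_closed S_one_closed) auto
  have "c n = \<one> \<oplus> X \<otimes> t n"
    unfolding f(4) using f(3) fn X_closed by (simp add: add_S emb_closed S_mult_closed const_X_mult emb_apply)
  moreover have "b n = X \<otimes> s n"
    unfolding s(2) using s(1) X_closed f(2)
    by (simp add: add_S S_one_closed S_mult_closed const_X_mult one_S_monomial) (simp add: monomial_def n_def)
  hence "c n = X \<otimes> (s n \<otimes> (\<alpha> ^^ n) r)"
    unfolding cb r(2) using bS s(1) rR X_closed by (simp add: mult_monomial m_assoc)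
  ultimately have e: "\<one> \<oplus> X \<otimes> t n = X \<otimes> (s n \<otimes> (\<alpha> ^^ n) r)" by simp
  have "\<one> = (\<one> \<oplus> X \<otimes> t n) \<ominus> X \<otimes> t n" using f(3) X_closed by (simp add: a_minus_def a_assoc r_neg)
  also have "\<dots> = X \<otimes> (s n \<otimes> (\<alpha> ^^ n) r \<ominus> t n)" unfolding e using s(1) f(3) rR X_closed
    by (simp add: a_minus_def r_distr r_minus)
  finally show False using UnitsI[of X "s n \<otimes> (\<alpha> ^^ n) r \<ominus> t n"] X_nonunit X_closed s(1) f(3) rR by simp
qed

lemma emb_unit: "f \<in> Units (UP k) \<Longrightarrow> \<epsilon> f \<in> Units S"
  by (rule XD.section_unit)

lemma S_irreducible_mult_unit:
  assumes "z \<in> irreducible_elements S" "u \<in> Units S"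
  shows "z \<otimes>\<^bsub>S\<^esub> u \<in> irreducible_elements S"
proof -
  have u: "u \<noteq> \<zero>\<^bsub>S\<^esub>" using assms(2) one_nonzero_S by (metis S.Units_inv_closed S.Units_r_inv S.l_null)
  have "z \<otimes>\<^bsub>S\<^esub> u \<noteq> \<zero>\<^bsub>S\<^esub>" using assms u S_integral[of z u] by (auto simp: irreducible_elements_def)
  thus ?thesis using assms S.irreducible_mult_unit by blast
qed

lemma section_mult_unit:
  assumes "f \<in> carrier (UP k)" "g \<in> carrier (UP k)" "t \<in> carrier S"
  shows "\<exists>u\<in>carrier S. (\<epsilon> f \<oplus>\<^bsub>S\<^esub> XX \<otimes>\<^bsub>S\<^esub> t) \<otimes>\<^bsub>S\<^esub> \<epsilon> g = \<epsilon> (f \<otimes>\<^bsub>UP k\<^esub> g) \<oplus>\<^bsub>S\<^esub> XX \<otimes>\<^bsub>S\<^esub> u"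
  using assms X_closed by (intro bexI[of _ "t \<otimes>\<^bsub>S\<^esub> \<epsilon> g"])
    (auto simp: S.l_distr S.m_assoc XD.section_mult S_mult_closed emb_closed S_add_closed simp del: carrier_S
       intro: XD.section_simps(1) XD.x_closed)

lemma monic_associate:
  assumes f: "f \<in> carrier (UP k)" "f \<noteq> \<zero>\<^bsub>UP k\<^esub>"
  obtains g where "g \<in> Units (UP k)" "f \<otimes>\<^bsub>UP k\<^esub> g \<in> monic_polys k" "deg k (f \<otimes>\<^bsub>UP k\<^esub> g) = deg k f"
proof -
  let ?l = "coeff (UP k) f (deg k f)"
  have l: "?l \<in> Units k" using UPk.lcoeff_nonzero[OF f(2,1)] f(1) by (simp add: k.field_Units)
  define c where "c = inv\<^bsub>k\<^esub> ?l"
  have cU: "c \<in> Units k" and c: "c \<in> carrier k" "c \<noteq> \<zero>\<^bsub>k\<^esub>" "c \<otimes>\<^bsub>k\<^esub> ?l = \<one>\<^bsub>k\<^esub>"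
    using l k.Units_inv_Units[OF l] by (auto simp: c_def k.field_Units)
  define g where "g = monom (UP k) c 0"
  have g: "g \<in> carrier (UP k)" "deg k g = 0" using c by (simp_all add: g_def)
  have g0: "g \<noteq> \<zero>\<^bsub>UP k\<^esub>"
  proof
    assume "g = \<zero>\<^bsub>UP k\<^esub>"
    hence "coeff (UP k) g 0 = \<zero>\<^bsub>k\<^esub>" by simp
    thus False using c by (simp add: g_def)
  qed
  have gU: "g \<in> Units (UP k)" using UP_unit_iff[OF field_k g(1) g0] g(2) by simp
  have fg: "f \<otimes>\<^bsub>UP k\<^esub> g = c \<odot>\<^bsub>UP k\<^esub> f"
    using UPk.monom_mult_is_smult[OF c(1) f(1)] XD.P.m_comm[OF f(1) g(1)] by (simp add: g_def)
  have d: "deg k (f \<otimes>\<^bsub>UP k\<^esub> g) = deg k f" using UPk.deg_mult[OF f(2) g0 f(1) g(1)] g(2) by simp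
  have "f \<otimes>\<^bsub>UP k\<^esub> g \<in> monic_polys k"
    unfolding monic_polys_def using d f(1) g(1) c by (simp add: fg)
  thus ?thesis using that gU d by blast
qed

text \<open>The class is determined by the residue \<open>f\<close> of \<open>z\<close>. If \<open>f = 0\<close>, then \<open>X\<close> divides \<open>z\<close>. Otherwise
  multiplication by a constant \<open>g \<in> k\<close> turns \<open>f\<close> into \<open>1\<close> or into a monic polynomial of positive degree. The second and the
  third statement are the cases \<open>(B)\<close> and \<open>(C)\<close> for a given residue.\<close>

lemma irreducible_normal_form:
  assumes z: "z \<in> irreducible_elements S"
  shows "\<exists>T\<in>{set_A R X, set_B R \<alpha> X, set_C k R \<alpha> X}. \<exists>u\<in>Units S. z \<otimes>\<^bsub>S\<^esub> u \<in> T"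
    "z = \<epsilon> f \<oplus>\<^bsub>S\<^esub> XX \<otimes>\<^bsub>S\<^esub> t \<Longrightarrow> f \<in> Units (UP k) \<Longrightarrow> t \<in> carrier S \<Longrightarrow> \<exists>u\<in>Units S. z \<otimes>\<^bsub>S\<^esub> u \<in> set_B R \<alpha> X"
    "z = \<epsilon> f \<oplus>\<^bsub>S\<^esub> XX \<otimes>\<^bsub>S\<^esub> t \<Longrightarrow> f \<in> carrier (UP k) \<Longrightarrow> f \<noteq> \<zero>\<^bsub>UP k\<^esub> \<Longrightarrow> f \<notin> Units (UP k) \<Longrightarrow> t \<in> carrier S \<Longrightarrow>
      (\<And>u. u \<in> Units S \<Longrightarrow> z \<noteq> \<theta> \<otimes>\<^bsub>S\<^esub> u) \<Longrightarrow> \<exists>u\<in>Units S. z \<otimes>\<^bsub>S\<^esub> u \<in> set_C k R \<alpha> X"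
proof -
  note z' = XD.irreducibleD[OF z]
  have B: "\<exists>u\<in>Units S. z \<otimes>\<^bsub>S\<^esub> u \<in> set_B R \<alpha> X"
    if zf: "z = \<epsilon> f \<oplus>\<^bsub>S\<^esub> XX \<otimes>\<^bsub>S\<^esub> t" and f: "f \<in> Units (UP k)" and t: "t \<in> carrier S" for f t
  proof -
    define g where "g = inv\<^bsub>UP k\<^esub> f"
    have g: "g \<in> Units (UP k)" "g \<in> carrier (UP k)" "f \<in> carrier (UP k)" "f \<otimes>\<^bsub>UP k\<^esub> g = \<one>\<^bsub>UP k\<^esub>"
      using f by (auto simp: g_def)
    obtain s where s: "s \<in> carrier S" "z \<otimes>\<^bsub>S\<^esub> \<epsilon> g = \<epsilon> (f \<otimes>\<^bsub>UP k\<^esub> g) \<oplus>\<^bsub>S\<^esub> XX \<otimes>\<^bsub>S\<^esub> s"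
      using section_mult_unit[OF g(3,2) t] zf by blast
    hence zg: "z \<otimes>\<^bsub>S\<^esub> \<epsilon> g = \<one>\<^bsub>S\<^esub> \<oplus>\<^bsub>S\<^esub> XX \<otimes>\<^bsub>S\<^esub> s" by (simp add: g(4))
    have irr: "z \<otimes>\<^bsub>S\<^esub> \<epsilon> g \<in> irreducible_elements S" by (rule S_irreducible_mult_unit[OF z emb_unit[OF g(1)]])
    \<comment> \<open>For \<open>s \<in> R\<close> the element \<open>1 + Xs\<close> would be a unit.\<close>
    have "s \<notin> skew_const R ` carrier R"
    proof
      assume "s \<in> skew_const R ` carrier R"
      then obtain r where r: "r \<in> carrier R" "s = monomial r 0" by (auto simp: const_monomial)
      have e: "z \<otimes>\<^bsub>S\<^esub> \<epsilon> g = skew_const R (\<one> \<oplus> X \<otimes> r)"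
      proof
        fix i
        show "(z \<otimes>\<^bsub>S\<^esub> \<epsilon> g) i = skew_const R (\<one> \<oplus> X \<otimes> r) i"
          unfolding zg using s(1) r X_closed
          by (simp add: add_S S_one_closed S_mult_closed const_X_mult) (simp add: one_S monomial_def skew_const_def)
      qed
      have "\<one> \<oplus> X \<otimes> r \<in> Units R"
      proof (rule ccontr)
        assume n: "\<one> \<oplus> X \<otimes> r \<notin> Units R"
        then obtain q where q: "q \<in> carrier R" "\<one> \<oplus> X \<otimes> r = q \<otimes> X"
          using nonunit_divisible[of "\<one> \<oplus> X \<otimes> r"] r X_closed by auto
        have "\<one> = (\<one> \<oplus> X \<otimes> r) \<ominus> X \<otimes> r" using r X_closed by (simp add: a_minus_def a_assoc r_neg)
        also have "\<dots> = X \<otimes> (q \<ominus> r)" unfolding q(2) using r q X_closed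
          by (simp add: a_minus_def r_distr r_minus m_comm[of q])
        finally show False using UnitsI[of X "q \<ominus> r"] X_nonunit X_closed r q by simp
      qed
      hence "z \<otimes>\<^bsub>S\<^esub> \<epsilon> g \<in> Units S" unfolding e by (rule const_unit)
      thus False using irr by (simp add: irreducible_elements_def)
    qed
    hence "z \<otimes>\<^bsub>S\<^esub> \<epsilon> g \<in> set_B R \<alpha> X" unfolding set_B_iff using irr zg s(1) by blast
    thus ?thesis using emb_unit[OF g(1)] by blast
  qed
  have C: "\<exists>u\<in>Units S. z \<otimes>\<^bsub>S\<^esub> u \<in> set_C k R \<alpha> X"
    if zf: "z = \<epsilon> f \<oplus>\<^bsub>S\<^esub> XX \<otimes>\<^bsub>S\<^esub> t" and f: "f \<in> carrier (UP k)" "f \<noteq> \<zero>\<^bsub>UP k\<^esub>" "f \<notin> Units (UP k)"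
      and t: "t \<in> carrier S" and \<theta>: "\<And>u. u \<in> Units S \<Longrightarrow> z \<noteq> \<theta> \<otimes>\<^bsub>S\<^esub> u" for f t
  proof -
    have d: "deg k f > 0" using UP_unit_iff[OF field_k f(1,2)] f(3) by simp
    obtain g where g: "g \<in> Units (UP k)" "f \<otimes>\<^bsub>UP k\<^esub> g \<in> monic_polys k" "deg k (f \<otimes>\<^bsub>UP k\<^esub> g) = deg k f"
      using monic_associate[OF f(1,2)] .
    have gc: "g \<in> carrier (UP k)" using g(1) by auto
    obtain s where s: "s \<in> carrier S" "z \<otimes>\<^bsub>S\<^esub> \<epsilon> g = \<epsilon> (f \<otimes>\<^bsub>UP k\<^esub> g) \<oplus>\<^bsub>S\<^esub> XX \<otimes>\<^bsub>S\<^esub> s"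
      using section_mult_unit[OF f(1) gc t] zf by blast
    have irr: "z \<otimes>\<^bsub>S\<^esub> \<epsilon> g \<in> irreducible_elements S" by (rule S_irreducible_mult_unit[OF z emb_unit[OF g(1)]])
    have "z \<otimes>\<^bsub>S\<^esub> \<epsilon> g \<noteq> \<theta> \<otimes>\<^bsub>S\<^esub> u" if u: "u \<in> Units S" for u
    proof
      assume e: "z \<otimes>\<^bsub>S\<^esub> \<epsilon> g = \<theta> \<otimes>\<^bsub>S\<^esub> u"
      let ?w = "inv\<^bsub>S\<^esub> (\<epsilon> g)"
      have w: "?w \<in> Units S" "\<epsilon> g \<otimes>\<^bsub>S\<^esub> ?w = \<one>\<^bsub>S\<^esub>" using emb_unit[OF g(1)] by auto
      have cl: "\<epsilon> g \<in> carrier S" "?w \<in> carrier S" "u \<in> carrier S" "\<theta> \<in> carrier S"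
        using emb_unit[OF g(1)] u S.Units_closed TH.x_closed by auto
      have "z = (z \<otimes>\<^bsub>S\<^esub> \<epsilon> g) \<otimes>\<^bsub>S\<^esub> ?w" using z'(1) cl w(2) by (simp add: S.m_assoc del: carrier_S)
      also have "\<dots> = \<theta> \<otimes>\<^bsub>S\<^esub> (u \<otimes>\<^bsub>S\<^esub> ?w)" unfolding e using cl by (simp add: S.m_assoc del: carrier_S)
      finally show False using \<theta> S.Units_m_closed[OF u w(1)] by blast
    qed
    hence "z \<otimes>\<^bsub>S\<^esub> \<epsilon> g \<in> set_C k R \<alpha> X"
      unfolding set_C_iff using irr g(2,3) d s by (intro conjI bexI[of _ "f \<otimes>\<^bsub>UP k\<^esub> g"] bexI[of _ s]) auto
    thus ?thesis using emb_unit[OF g(1)] by blast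
  qed
  show "z = \<epsilon> f \<oplus>\<^bsub>S\<^esub> XX \<otimes>\<^bsub>S\<^esub> t \<Longrightarrow> f \<in> Units (UP k) \<Longrightarrow> t \<in> carrier S \<Longrightarrow> \<exists>u\<in>Units S. z \<otimes>\<^bsub>S\<^esub> u \<in> set_B R \<alpha> X"
    by (rule B)
  show "z = \<epsilon> f \<oplus>\<^bsub>S\<^esub> XX \<otimes>\<^bsub>S\<^esub> t \<Longrightarrow> f \<in> carrier (UP k) \<Longrightarrow> f \<noteq> \<zero>\<^bsub>UP k\<^esub> \<Longrightarrow> f \<notin> Units (UP k) \<Longrightarrow> t \<in> carrier S \<Longrightarrow>
      (\<And>u. u \<in> Units S \<Longrightarrow> z \<noteq> \<theta> \<otimes>\<^bsub>S\<^esub> u) \<Longrightarrow> \<exists>u\<in>Units S. z \<otimes>\<^bsub>S\<^esub> u \<in> set_C k R \<alpha> X"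
    by (rule C)
  have assoc: "\<exists>v\<in>Units S. z \<otimes>\<^bsub>S\<^esub> v \<in> set_A R X" if a: "a \<in> set_A R X" "u \<in> Units S" "z = a \<otimes>\<^bsub>S\<^esub> u" for a u
  proof -
    have "a \<in> carrier S" using a(1) XD.x_closed TH.x_closed by (auto simp: set_A_def)
    hence "z \<otimes>\<^bsub>S\<^esub> inv\<^bsub>S\<^esub> u = a" using a(2,3) S.Units_closed[OF a(2)] by (simp add: S.m_assoc del: carrier_S)
    thus ?thesis using a(1,2) by (intro bexI[of _ "inv\<^bsub>S\<^esub> u"]) auto
  qed
  obtain f t where ft: "f \<in> carrier (UP k)" "t \<in> carrier S" "z = \<epsilon> f \<oplus>\<^bsub>S\<^esub> XX \<otimes>\<^bsub>S\<^esub> t"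
    using XD.section_decomp[OF z'(1)] by blast
  consider "f = \<zero>\<^bsub>UP k\<^esub>" | "f \<in> Units (UP k)" | u where "u \<in> Units S" "z = \<theta> \<otimes>\<^bsub>S\<^esub> u"
    | "f \<noteq> \<zero>\<^bsub>UP k\<^esub>" "f \<notin> Units (UP k)" "\<forall>u\<in>Units S. z \<noteq> \<theta> \<otimes>\<^bsub>S\<^esub> u" by blast
  thus "\<exists>T\<in>{set_A R X, set_B R \<alpha> X, set_C k R \<alpha> X}. \<exists>u\<in>Units S. z \<otimes>\<^bsub>S\<^esub> u \<in> T"
  proof cases
    case 1
    hence zX: "z = XX \<otimes>\<^bsub>S\<^esub> t" using ft XD.x_closed by (simp del: carrier_S)
    hence "t \<in> Units S" using z'(4)[OF XD.x_closed ft(2)] XD.x_nonunit by blast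
    thus ?thesis using assoc[of XX t] zX by (simp add: set_A_def)
  next
    case 2 thus ?thesis using B[OF ft(3) 2 ft(2)] by simp
  next
    case 3 thus ?thesis using assoc[of \<theta> u] by (simp add: set_A_def)
  next
    case 4
    have "\<exists>u\<in>Units S. z \<otimes>\<^bsub>S\<^esub> u \<in> set_C k R \<alpha> X"
      by (rule C[OF ft(3,1) 4(1,2) ft(2)]) (use 4(3) in simp)
    thus ?thesis by simp
  qed
qed

lemma irreducible_class_unique:
  assumes "z \<in> carrier S" "T \<in> {set_A R X, set_B R \<alpha> X, set_C k R \<alpha> X}" "u \<in> Units S" "z \<otimes>\<^bsub>S\<^esub> u \<in> T"
    "T' \<in> {set_A R X, set_B R \<alpha> X, set_C k R \<alpha> X}" "u' \<in> Units S" "z \<otimes>\<^bsub>S\<^esub> u' \<in> T'"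
  shows "T = T'"
proof -
  have eq: "z \<otimes>\<^bsub>S\<^esub> v' = (z \<otimes>\<^bsub>S\<^esub> v) \<otimes>\<^bsub>S\<^esub> (inv\<^bsub>S\<^esub> v \<otimes>\<^bsub>S\<^esub> v')" "inv\<^bsub>S\<^esub> v \<otimes>\<^bsub>S\<^esub> v' \<in> Units S"
    if "v \<in> Units S" "v' \<in> Units S" for v v'
  proof -
    have cl: "v \<in> carrier S" "v' \<in> carrier S" "inv\<^bsub>S\<^esub> v \<in> carrier S" using that S.Units_closed by auto
    have "v \<otimes>\<^bsub>S\<^esub> (inv\<^bsub>S\<^esub> v \<otimes>\<^bsub>S\<^esub> v') = v'"
      using cl that by (simp add: S.m_assoc[symmetric] del: carrier_S)
    thus "z \<otimes>\<^bsub>S\<^esub> v' = (z \<otimes>\<^bsub>S\<^esub> v) \<otimes>\<^bsub>S\<^esub> (inv\<^bsub>S\<^esub> v \<otimes>\<^bsub>S\<^esub> v')"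
      using cl assms(1) by (simp add: S.m_assoc del: carrier_S)
    show "inv\<^bsub>S\<^esub> v \<otimes>\<^bsub>S\<^esub> v' \<in> Units S" using that by (intro S.Units_m_closed S.Units_inv_Units)
  qed
  have "\<not> (z \<otimes>\<^bsub>S\<^esub> v \<in> set_A R X \<and> z \<otimes>\<^bsub>S\<^esub> v' \<in> set_B R \<alpha> X)"
    "\<not> (z \<otimes>\<^bsub>S\<^esub> v \<in> set_A R X \<and> z \<otimes>\<^bsub>S\<^esub> v' \<in> set_C k R \<alpha> X)"
    "\<not> (z \<otimes>\<^bsub>S\<^esub> v \<in> set_B R \<alpha> X \<and> z \<otimes>\<^bsub>S\<^esub> v' \<in> set_C k R \<alpha> X)"
    if v: "v \<in> Units S" "v' \<in> Units S" for v v'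
    using A_B_separate[OF _ _ eq(2)[OF v]] A_C_separate[OF _ _ eq(2)[OF v]] B_C_separate[OF _ _ eq(2)[OF v]]
      eq(1)[OF v] by blast+
  note this[OF assms(3,6)] this[OF assms(6,3)]
  thus ?thesis using assms(2,4,5,7) by blast
qed

end

section \<open>Bijections onto classes\<close>

lemma equiv_rel_on:
  assumes "\<And>V. V \<in> M \<Longrightarrow> E V V" "\<And>V W. V \<in> M \<Longrightarrow> W \<in> M \<Longrightarrow> E V W \<Longrightarrow> E W V"
    "\<And>V W U. V \<in> M \<Longrightarrow> W \<in> M \<Longrightarrow> U \<in> M \<Longrightarrow> E V W \<Longrightarrow> E W U \<Longrightarrow> E V U"
  shows "equiv M (rel_on M E)"
proof (rule equivI)
  show "rel_on M E \<subseteq> M \<times> M" by (auto simp: rel_on_def)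
  show "refl_on M (rel_on M E)" using assms(1) by (auto simp: refl_on_def rel_on_def)
  show "sym (rel_on M E)" using assms(2) by (auto simp: sym_def rel_on_def)
  show "trans (rel_on M E)" unfolding trans_def rel_on_def using assms(3) by blast
qed

lemma bijection_onto_classesI:
  assumes eq: "equiv M (rel_on M E)" and \<phi>: "\<And>c. c \<in> L \<Longrightarrow> \<phi> c \<in> M"
    and inj: "\<And>c d. c \<in> L \<Longrightarrow> d \<in> L \<Longrightarrow> E (\<phi> c) (\<phi> d) \<Longrightarrow> c = d"
    and surj: "\<And>V. V \<in> M \<Longrightarrow> \<exists>c\<in>L. E V (\<phi> c)"
  shows "bijection_onto_classes L \<phi> M E"
  unfolding bijection_onto_classes_def
proof (intro conjI eq)
  show "\<phi> ` L \<subseteq> M" using \<phi> by auto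
  show "bij_betw (\<lambda>c. rel_on M E `` {\<phi> c}) L (M // rel_on M E)"
    unfolding bij_betw_def
  proof
    show "inj_on (\<lambda>c. rel_on M E `` {\<phi> c}) L"
    proof (rule inj_onI)
      fix c d assume cd: "c \<in> L" "d \<in> L" "rel_on M E `` {\<phi> c} = rel_on M E `` {\<phi> d}"
      hence "(\<phi> c, \<phi> d) \<in> rel_on M E" using eq_equiv_class[OF cd(3) eq] \<phi> by blast
      thus "c = d" using inj cd by (auto simp: rel_on_def)
    qed
    show "(\<lambda>c. rel_on M E `` {\<phi> c}) ` L = M // rel_on M E"
    proof
      show "(\<lambda>c. rel_on M E `` {\<phi> c}) ` L \<subseteq> M // rel_on M E" using \<phi> by (auto intro: quotientI)
      show "M // rel_on M E \<subseteq> (\<lambda>c. rel_on M E `` {\<phi> c}) ` L"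
      proof
        fix Q assume "Q \<in> M // rel_on M E"
        then obtain V where V: "V \<in> M" "Q = rel_on M E `` {V}" by (rule quotientE)
        then obtain c where c: "c \<in> L" "E V (\<phi> c)" using surj by blast
        hence "(V, \<phi> c) \<in> rel_on M E" using V \<phi> by (auto simp: rel_on_def)
        hence "Q = rel_on M E `` {\<phi> c}" using equiv_class_eq[OF eq] V(2) by simp
        thus "Q \<in> (\<lambda>c. rel_on M E `` {\<phi> c}) ` L" using c by blast
      qed
    qed
  qed
qed

text \<open>Injectivity is automatic, as similarity of \<open>c\<close> and \<open>d\<close> is equivalence of \<open>\<phi> c\<close> and \<open>\<phi> d\<close>.\<close>

lemma bijection_onto_classes_up_to_similarityI:
  assumes eq: "equiv M (rel_on M E)" and \<phi>: "\<And>c. c \<in> L \<Longrightarrow> \<phi> c \<in> M"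
    and surj: "\<And>V. V \<in> M \<Longrightarrow> \<exists>c\<in>L. E V (\<phi> c)"
  shows "bijection_onto_classes_up_to_similarity L \<phi> M E"
  unfolding bijection_onto_classes_up_to_similarity_def
proof (intro conjI eq)
  let ?\<rho> = "rel_on L (\<lambda>c d. E (\<phi> c) (\<phi> d))"
  let ?F = "\<lambda>Q. \<Union>c\<in>Q. rel_on M E `` {\<phi> c}"
  show "\<phi> ` L \<subseteq> M" using \<phi> by auto
  have rho: "(c, d) \<in> ?\<rho> \<longleftrightarrow> c \<in> L \<and> d \<in> L \<and> (\<phi> c, \<phi> d) \<in> rel_on M E" for c d
    using \<phi> by (auto simp: rel_on_def)
  have "refl_on M (rel_on M E)" "sym (rel_on M E)" "trans (rel_on M E)" using eq by (auto simp: equiv_def)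
  hence E: "V \<in> M \<Longrightarrow> E V V" "V \<in> M \<Longrightarrow> W \<in> M \<Longrightarrow> E V W \<Longrightarrow> E W V"
    "V \<in> M \<Longrightarrow> W \<in> M \<Longrightarrow> U \<in> M \<Longrightarrow> E V W \<Longrightarrow> E W U \<Longrightarrow> E V U" for V W U
    unfolding refl_on_def sym_def trans_def rel_on_def by blast+
  have eq\<rho>: "equiv L ?\<rho>"
    by (rule equiv_rel_on) (use E \<phi> in blast)+
  have F: "?F (?\<rho> `` {c}) = rel_on M E `` {\<phi> c}" if c: "c \<in> L" for c
  proof -
    have "rel_on M E `` {\<phi> d} = rel_on M E `` {\<phi> c}" if "d \<in> ?\<rho> `` {c}" for d
      using that equiv_class_eq[OF eq] rho by (metis Image_singleton_iff)
    moreover have "c \<in> ?\<rho> `` {c}" using equiv_class_self[OF eq\<rho> c] .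
    ultimately show ?thesis by (intro SUP_eq_const) blast+
  qed
  show "bij_betw ?F (L // ?\<rho>) (M // rel_on M E)"
    unfolding bij_betw_def
  proof
    show "inj_on ?F (L // ?\<rho>)"
    proof (rule inj_onI)
      fix Q Q' assume Q: "Q \<in> L // ?\<rho>" "Q' \<in> L // ?\<rho>" and e: "?F Q = ?F Q'"
      obtain c where c: "c \<in> L" "Q = ?\<rho> `` {c}" using Q(1) by (rule quotientE)
      obtain d where d: "d \<in> L" "Q' = ?\<rho> `` {d}" using Q(2) by (rule quotientE)
      have "rel_on M E `` {\<phi> c} = rel_on M E `` {\<phi> d}" using e F c d by simp
      hence "(\<phi> c, \<phi> d) \<in> rel_on M E" using eq_equiv_class[OF _ eq] \<phi> d by blast
      hence "(c, d) \<in> ?\<rho>" using rho c d by blast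
      thus "Q = Q'" using equiv_class_eq[OF eq\<rho>] c d by simp
    qed
    show "?F ` (L // ?\<rho>) = M // rel_on M E"
    proof
      show "?F ` (L // ?\<rho>) \<subseteq> M // rel_on M E"
      proof
        fix P assume "P \<in> ?F ` (L // ?\<rho>)"
        then obtain Q where Q: "Q \<in> L // ?\<rho>" "P = ?F Q" by blast
        obtain c where "c \<in> L" "Q = ?\<rho> `` {c}" using Q(1) by (rule quotientE)
        thus "P \<in> M // rel_on M E" using F Q(2) \<phi> by (auto intro: quotientI)
      qed
      show "M // rel_on M E \<subseteq> ?F ` (L // ?\<rho>)"
      proof
        fix P assume "P \<in> M // rel_on M E"
        then obtain V where V: "V \<in> M" "P = rel_on M E `` {V}" by (rule quotientE)
        then obtain c where c: "c \<in> L" "E V (\<phi> c)" using surj by blast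
        hence "(V, \<phi> c) \<in> rel_on M E" using V \<phi> by (auto simp: rel_on_def)
        hence "P = rel_on M E `` {\<phi> c}" using equiv_class_eq[OF eq] V(2) by simp
        hence "P = ?F (?\<rho> `` {c})" using F c by simp
        thus "P \<in> ?F ` (L // ?\<rho>)" using quotientI[OF c(1), of ?\<rho>] by blast
      qed
    qed
  qed
qed

section \<open>Finite dimension\<close>

lemma finitely_spanned_over_mono:
  assumes "finitely_spanned_over A V" "A \<subseteq> A'"
  shows "finitely_spanned_over A' V"
proof -
  obtain B where B: "finite B" "B \<subseteq> carrier V"
    "\<And>v. v \<in> carrier V \<Longrightarrow> \<exists>a\<in>B \<rightarrow> A. v = (\<Oplus>\<^bsub>V\<^esub>b\<in>B. b \<cdot>\<^bsub>V\<^esub> a b)"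
    using assms(1) unfolding finitely_spanned_over_def by blast
  have "a \<in> B \<rightarrow> A'" if "a \<in> B \<rightarrow> A" for a using that assms(2) by auto
  hence "\<exists>a\<in>B \<rightarrow> A'. v = (\<Oplus>\<^bsub>V\<^esub>b\<in>B. b \<cdot>\<^bsub>V\<^esub> a b)" if "v \<in> carrier V" for v
    using B(3)[OF that] by (elim bexE) (rule bexI)
  thus ?thesis unfolding finitely_spanned_over_def using B(1,2) by (intro exI[of _ B]) simp
qed

lemma (in right_module) span_add:
  assumes B: "finite B" "B \<subseteq> carrier V" and A: "A \<subseteq> carrier S" "\<And>a b. a \<in> A \<Longrightarrow> b \<in> A \<Longrightarrow> a \<oplus>\<^bsub>S\<^esub> b \<in> A"
    and a: "a \<in> B \<rightarrow> A" and b: "b \<in> B" and c: "c \<in> A"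
  shows "\<exists>a'\<in>B \<rightarrow> A. (\<Oplus>\<^bsub>V\<^esub>b\<in>B. b \<cdot>\<^bsub>V\<^esub> a b) \<oplus>\<^bsub>V\<^esub> b \<cdot>\<^bsub>V\<^esub> c = (\<Oplus>\<^bsub>V\<^esub>b\<in>B. b \<cdot>\<^bsub>V\<^esub> a' b)"
proof
  define C where "C = B - {b}"
  have C: "finite C" "C \<subseteq> carrier V" "b \<notin> C" "B = insert b C" and bV: "b \<in> carrier V"
    using B b by (auto simp: C_def)
  have split: "(\<Oplus>\<^bsub>V\<^esub>d\<in>B. d \<cdot>\<^bsub>V\<^esub> e d) = b \<cdot>\<^bsub>V\<^esub> e b \<oplus>\<^bsub>V\<^esub> (\<Oplus>\<^bsub>V\<^esub>d\<in>C. d \<cdot>\<^bsub>V\<^esub> e d)" if "e \<in> B \<rightarrow> A" for e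
    unfolding C(4) using C bV that A(1)
    by (intro V.finsum_insert) (auto simp: Pi_def subset_iff intro!: ract_closed)
  let ?a = "a(b := a b \<oplus>\<^bsub>S\<^esub> c)"
  show a': "?a \<in> B \<rightarrow> A" using a b c A(2) by (auto simp: Pi_def)
  have aC: "(\<lambda>d. d \<cdot>\<^bsub>V\<^esub> a d) \<in> C \<rightarrow> carrier V" using a C A(1) by (auto intro!: ract_closed)
  have sC: "(\<Oplus>\<^bsub>V\<^esub>d\<in>C. d \<cdot>\<^bsub>V\<^esub> ?a d) = (\<Oplus>\<^bsub>V\<^esub>d\<in>C. d \<cdot>\<^bsub>V\<^esub> a d)"
    using aC C(3) by (intro V.finsum_cong') auto
  have s: "(\<Oplus>\<^bsub>V\<^esub>d\<in>C. d \<cdot>\<^bsub>V\<^esub> a d) \<in> carrier V" using aC by (rule V.finsum_closed)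
  have cl: "a b \<in> carrier S" "c \<in> carrier S" using a b c A(1) by auto
  show "(\<Oplus>\<^bsub>V\<^esub>b\<in>B. b \<cdot>\<^bsub>V\<^esub> a b) \<oplus>\<^bsub>V\<^esub> b \<cdot>\<^bsub>V\<^esub> c = (\<Oplus>\<^bsub>V\<^esub>b\<in>B. b \<cdot>\<^bsub>V\<^esub> ?a b)"
    unfolding split[OF a] split[OF a'] sC using bV cl s
    by (simp add: ract_r_distr V.a_ac ract_closed)
qed

context skew_poly_dvr_algebra
begin

interpretation k: field k by (rule field_k)
interpretation A: algebra k R by (rule algebra_R)
interpretation UPk: UP_domain k "UP k" by unfold_locales simp

lemma X_module:
  "right_module S V \<Longrightarrow> skew_division_module S (UP k) XX \<epsilon> sdeg size V"
  by (intro skew_division_module.intro skew_division_X)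

lemma \<theta>_module:
  "right_module S V \<Longrightarrow> normal_section_module S R \<theta> (skew_const R) V"
  by (intro normal_section_module.intro normal_section_var)

text \<open>Otherwise \<open>X\<close> acts bijectively, by simplicity, which Nakayama's lemma excludes for a nonzero module
  that is finitely generated over the local ring \<open>R\<close>.\<close>

lemma simple_finite_dim_killed:
  assumes V: "simple_module S V" and fd: "finite_dim k R V" and u: "u \<in> carrier V"
  shows "u \<cdot>\<^bsub>V\<^esub> XX = \<zero>\<^bsub>V\<^esub>"
proof (rule ccontr)
  assume ux: "u \<cdot>\<^bsub>V\<^esub> XX \<noteq> \<zero>\<^bsub>V\<^esub>"
  have "right_module S V" using V by (simp add: simple_module_def)
  then interpret M: skew_division_module S "UP k" XX \<epsilon> sdeg size V by (rule X_module)
  let ?A = "skew_const R ` carrier R"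
  have "finitely_spanned_over ((\<lambda>c. skew_const R (c \<odot> \<one>)) ` carrier k) V" using fd by (simp add: finite_dim_def)
  hence fs: "finitely_spanned_over ?A V" by (rule finitely_spanned_over_mono) auto
  have "carrier V = {\<zero>\<^bsub>V\<^esub>}"
  proof (rule M.nakayama[OF _ _ _ _ _ _ fs])
    show "?A \<subseteq> carrier S" by auto
    show "\<zero>\<^bsub>S\<^esub> \<in> ?A" by (auto simp: zero_S skew_const_def intro!: image_eqI[of _ _ \<zero>])
    show "XX \<in> ?A" using X_closed by blast
  next
    fix a b assume "a \<in> ?A" "b \<in> ?A"
    then obtain r s where rs: "r \<in> carrier R" "s \<in> carrier R" "a = skew_const R r" "b = skew_const R s" by blast
    show "a \<oplus>\<^bsub>S\<^esub> b \<in> ?A" using rs ring_hom_add[OF const_hom rs(1,2)] by (metis a_closed imageI)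
    show "a \<otimes>\<^bsub>S\<^esub> b \<in> ?A" using rs ring_hom_mult[OF const_hom rs(1,2)] by (metis m_closed imageI)
  next
    fix a assume "a \<in> ?A"
    then obtain r where r: "r \<in> carrier R" "a = skew_const R r" by blast
    have "\<one> \<ominus> r \<otimes> X \<in> Units R"
    proof (rule ccontr)
      assume "\<one> \<ominus> r \<otimes> X \<notin> Units R"
      then obtain q where q: "q \<in> carrier R" "\<one> \<ominus> r \<otimes> X = q \<otimes> X"
        using nonunit_divisible[of "\<one> \<ominus> r \<otimes> X"] r X_closed by auto
      have "\<one> = (\<one> \<ominus> r \<otimes> X) \<oplus> r \<otimes> X" using r X_closed by (simp add: a_minus_def a_assoc l_neg)
      also have "\<dots> = X \<otimes> (q \<oplus> r)" unfolding q(2) using r q X_closed by (simp add: r_distr m_comm[of _ X])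
      finally show False using UnitsI[of X "q \<oplus> r"] X_nonunit X_closed r q by simp
    qed
    then obtain b where b: "b \<in> carrier R" "(\<one> \<ominus> r \<otimes> X) \<otimes> b = \<one>" using Units_r_inv Units_inv_closed by blast
    have "\<one>\<^bsub>S\<^esub> \<ominus>\<^bsub>S\<^esub> a \<otimes>\<^bsub>S\<^esub> XX = skew_const R (\<one> \<ominus> r \<otimes> X)"
    proof
      fix i show "(\<one>\<^bsub>S\<^esub> \<ominus>\<^bsub>S\<^esub> a \<otimes>\<^bsub>S\<^esub> XX) i = skew_const R (\<one> \<ominus> r \<otimes> X) i"
        unfolding r(2) const_monomial one_S_monomial monomial_monomial[OF r(1) X_closed] using r X_closed
        by (simp add: minus_S) (simp add: monomial_def minus_eq_zero_iff)
    qed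
    hence "(\<one>\<^bsub>S\<^esub> \<ominus>\<^bsub>S\<^esub> a \<otimes>\<^bsub>S\<^esub> XX) \<otimes>\<^bsub>S\<^esub> skew_const R b = \<one>\<^bsub>S\<^esub>"
      using ring_hom_mult[OF const_hom, of "\<one> \<ominus> r \<otimes> X" b] ring_hom_one[OF const_hom] b r X_closed by simp
    thus "\<exists>b\<in>?A. (\<one>\<^bsub>S\<^esub> \<ominus>\<^bsub>S\<^esub> a \<otimes>\<^bsub>S\<^esub> XX) \<otimes>\<^bsub>S\<^esub> b = \<one>\<^bsub>S\<^esub>" using b(1) by blast
  next
    fix v assume "v \<in> carrier V"
    thus "\<exists>w\<in>carrier V. v = w \<cdot>\<^bsub>V\<^esub> XX" by (rule M.simple_x_bijective(2)[OF V u ux])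
  qed
  thus False using V by (simp add: simple_module_def)
qed

abbreviation F_ideal where
  "F_ideal f \<equiv> right_ideal_gen S XX <+>\<^bsub>S\<^esub> right_ideal_gen S (\<epsilon> f)"

text \<open>Division by \<open>f\<close> shows that \<open>V\<close> is spanned over \<open>k\<close> by the elements \<open>v\<theta>\<^sup>i\<close> with \<open>i < deg f\<close>; as
  \<open>\<alpha>\<close> fixes \<open>k\<close>, the scalars can be moved to the right of \<open>\<theta>\<^sup>i\<close>.\<close>

lemma finite_dim_of_annihilator:
  assumes V: "right_module S V" and v: "v \<in> carrier V" "carrier V = right_module.cyclic_submodule S V v"
    and f: "f \<in> carrier (UP k)" "f \<noteq> \<zero>\<^bsub>UP k\<^esub>"
    and ann: "\<And>s. s \<in> carrier S \<Longrightarrow> v \<cdot>\<^bsub>V\<^esub> s = \<zero>\<^bsub>V\<^esub> \<longleftrightarrow> s \<in> F_ideal f"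
  shows "finite_dim k R V"
proof -
  interpret M: skew_division_module S "UP k" XX \<epsilon> sdeg size V by (rule X_module[OF V])
  interpret E: euclidean_domain "UP k" "deg k" by (rule euclidean_domain_UP[OF field_k])
  define d where "d = deg k f"
  define B where "B = (\<lambda>i. v \<cdot>\<^bsub>V\<^esub> monomial \<one> i) ` {..<d}"
  let ?A = "(\<lambda>c. skew_const R (c \<odot> \<one>)) ` carrier k"
  have \<epsilon>f: "\<epsilon> f \<in> carrier S" using f emb_closed by simp
  have "XX \<in> F_ideal f"
    unfolding S.mem_sum_gen_iff using XD.x_closed \<epsilon>f
    by (intro bexI[of _ "\<one>\<^bsub>S\<^esub>"] bexI[of _ "\<zero>\<^bsub>S\<^esub>"]) (simp_all del: carrier_S)
  hence vX: "v \<cdot>\<^bsub>V\<^esub> XX = \<zero>\<^bsub>V\<^esub>" using ann XD.x_closed by blast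
  have "\<epsilon> f \<in> F_ideal f"
    unfolding S.mem_sum_gen_iff using XD.x_closed \<epsilon>f
    by (intro bexI[of _ "\<zero>\<^bsub>S\<^esub>"] bexI[of _ "\<one>\<^bsub>S\<^esub>"]) (simp_all del: carrier_S)
  hence vf: "v \<cdot>\<^bsub>V\<^esub> \<epsilon> f = \<zero>\<^bsub>V\<^esub>" using ann \<epsilon>f by blast
  have B: "finite B" "B \<subseteq> carrier V" unfolding B_def using v(1) by (auto intro!: M.ract_closed)
  have A: "?A \<subseteq> carrier S" by auto
  have Aadd: "a \<oplus>\<^bsub>S\<^esub> b \<in> ?A" if ab: "a \<in> ?A" "b \<in> ?A" for a b
  proof -
    obtain c e where ce: "c \<in> carrier k" "e \<in> carrier k" "a = skew_const R (\<kappa> c)" "b = skew_const R (\<kappa> e)"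
      using ab unfolding \<kappa>_def by blast
    hence "a \<oplus>\<^bsub>S\<^esub> b = skew_const R (\<kappa> (c \<oplus>\<^bsub>k\<^esub> e))"
      using ring_hom_add[OF const_hom, of "\<kappa> c" "\<kappa> e"] ring_hom_add[OF \<kappa>_hom ce(1,2)] by simp
    thus ?thesis using ce by (auto simp: \<kappa>_def)
  qed
  have Azero: "\<zero>\<^bsub>S\<^esub> \<in> ?A"
    by (rule image_eqI[of _ _ "\<zero>\<^bsub>k\<^esub>"]) (auto simp: zero_S skew_const_def)
  have span: "\<exists>a\<in>B \<rightarrow> ?A. v \<cdot>\<^bsub>V\<^esub> p = (\<Oplus>\<^bsub>V\<^esub>b\<in>B. b \<cdot>\<^bsub>V\<^esub> a b)"
    if "p \<in> up R" "\<And>i. p i \<in> \<kappa> ` carrier k" "\<And>i. i \<ge> n \<Longrightarrow> p i = \<zero>" "n \<le> d" for p n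
    using that
  proof (induction n arbitrary: p)
    case 0
    have p0: "p = \<zero>\<^bsub>S\<^esub>" using 0(3) by (auto simp: zero_S)
    have "(\<Oplus>\<^bsub>V\<^esub>b\<in>B. b \<cdot>\<^bsub>V\<^esub> \<zero>\<^bsub>S\<^esub>) = \<zero>\<^bsub>V\<^esub>"
      by (rule M.V.add.finprod_one_eqI) (use B(2) in auto)
    thus ?case using p0 v(1) Azero by (intro bexI[of _ "\<lambda>_. \<zero>\<^bsub>S\<^esub>"]) auto
  next
    case (Suc n)
    define q where "q = p(n := \<zero>)"
    have q: "q \<in> up R" by (rule upI[of _ n]) (use Suc.prems in \<open>auto simp: q_def\<close>)
    obtain c where c: "c \<in> carrier k" "p n = \<kappa> c" using Suc.prems(2)[of n] by blast
    obtain a where a: "a \<in> B \<rightarrow> ?A" "v \<cdot>\<^bsub>V\<^esub> q = (\<Oplus>\<^bsub>V\<^esub>b\<in>B. b \<cdot>\<^bsub>V\<^esub> a b)"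
    proof (rule Suc.IH[of q, THEN bexE])
      show "q i \<in> \<kappa> ` carrier k" for i using Suc.prems(2)[of i] \<kappa>_simps(3) k.zero_closed by (auto simp: q_def intro: image_eqI[of _ _ "\<zero>\<^bsub>k\<^esub>"])
      show "q i = \<zero>" if "i \<ge> n" for i using Suc.prems(3)[of i] that by (auto simp: q_def)
    qed (use q Suc.prems(4) in auto)
    have mm: "monomial \<one> n \<otimes>\<^bsub>S\<^esub> skew_const R (\<kappa> c) = monomial (\<kappa> c) n"
      unfolding const_monomial using c by (simp add: monomial_monomial \<kappa>_fixed)
    have "p = q \<oplus>\<^bsub>S\<^esub> monomial \<one> n \<otimes>\<^bsub>S\<^esub> skew_const R (\<kappa> c)"
      unfolding mm by (rule ext) (use q c Suc.prems(1) in \<open>simp add: add_S, simp add: q_def monomial_def\<close>)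
    hence vp: "v \<cdot>\<^bsub>V\<^esub> p = v \<cdot>\<^bsub>V\<^esub> q \<oplus>\<^bsub>V\<^esub> (v \<cdot>\<^bsub>V\<^esub> monomial \<one> n) \<cdot>\<^bsub>V\<^esub> skew_const R (\<kappa> c)"
      using v(1) q c by (simp add: M.ract_r_distr M.ract_assoc S_mult_closed)
    have "v \<cdot>\<^bsub>V\<^esub> monomial \<one> n \<in> B" using Suc.prems(4) by (auto simp: B_def)
    moreover have "skew_const R (\<kappa> c) \<in> ?A" using c by (auto simp: \<kappa>_def)
    ultimately show ?case unfolding vp a(2)
      using M.span_add[of B ?A a "v \<cdot>\<^bsub>V\<^esub> monomial \<one> n" "skew_const R (\<kappa> c)"] B A Aadd a(1) by simp
  qed
  show ?thesis
    unfolding finite_dim_def finitely_spanned_over_def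
  proof (intro exI[of _ B] conjI B ballI)
    fix w assume "w \<in> carrier V"
    then obtain s where s: "s \<in> carrier S" "w = v \<cdot>\<^bsub>V\<^esub> s" using v by (auto simp: M.cyclic_submodule_def)
    obtain g t where g: "g \<in> carrier (UP k)" "t \<in> carrier S" "v \<cdot>\<^bsub>V\<^esub> s = v \<cdot>\<^bsub>V\<^esub> \<epsilon> g \<oplus>\<^bsub>V\<^esub> (v \<cdot>\<^bsub>V\<^esub> XX) \<cdot>\<^bsub>V\<^esub> t"
      using M.act_decomp[OF v(1) s(1)] by blast
    have wg: "w = v \<cdot>\<^bsub>V\<^esub> \<epsilon> g" using s(2) g vX M.ract_closed[OF v(1), of "\<epsilon> g"] emb_closed[OF g(1)] by simp
    have "\<exists>q r. q \<in> carrier (UP k) \<and> r \<in> carrier (UP k) \<and> g = f \<otimes>\<^bsub>UP k\<^esub> q \<oplus>\<^bsub>UP k\<^esub> r \<and> (r = \<zero>\<^bsub>UP k\<^esub> \<or> deg k r < deg k f)"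
    proof (cases "g = \<zero>\<^bsub>UP k\<^esub>")
      case True
      thus ?thesis using f by (intro exI[of _ "\<zero>\<^bsub>UP k\<^esub>"]) simp
    qed (use E.euclidean_function[of g f] f g in auto)
    then obtain q r where qr: "q \<in> carrier (UP k)" "r \<in> carrier (UP k)" "g = f \<otimes>\<^bsub>UP k\<^esub> q \<oplus>\<^bsub>UP k\<^esub> r"
      "r = \<zero>\<^bsub>UP k\<^esub> \<or> deg k r < d" by (auto simp: d_def)
    have cl: "\<epsilon> q \<in> carrier S" "\<epsilon> r \<in> carrier S" using qr(1,2) emb_closed by auto
    have "w = (v \<cdot>\<^bsub>V\<^esub> \<epsilon> f) \<cdot>\<^bsub>V\<^esub> \<epsilon> q \<oplus>\<^bsub>V\<^esub> v \<cdot>\<^bsub>V\<^esub> \<epsilon> r"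
      unfolding wg qr(3) using v(1) f(1) qr(1,2) cl \<epsilon>f
      by (simp add: XD.section_add XD.section_mult M.ract_r_distr M.ract_assoc del: carrier_S)
    hence wr: "w = v \<cdot>\<^bsub>V\<^esub> \<epsilon> r" using vf cl M.ract_closed[OF v(1)] by simp
    have "\<exists>a\<in>B \<rightarrow> ?A. v \<cdot>\<^bsub>V\<^esub> \<epsilon> r = (\<Oplus>\<^bsub>V\<^esub>b\<in>B. b \<cdot>\<^bsub>V\<^esub> a b)"
    proof (rule span[of _ d])
      show "\<epsilon> r \<in> up R" by (rule emb_closed[OF qr(2)])
      show "\<epsilon> r i \<in> \<kappa> ` carrier k" for i using qr(2) UP_closed by (auto simp: emb_apply)
      show "\<epsilon> r i = \<zero>" if "i \<ge> d" for i
      proof -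
        have "r i = \<zero>\<^bsub>k\<^esub>" using qr(4) UPk.deg_aboveD[of r i] qr(2) that by (auto simp: UP_zero UP_coeff)
        thus ?thesis using qr(2) by (simp add: emb_apply)
      qed
    qed simp
    thus "\<exists>a\<in>B \<rightarrow> ?A. w = (\<Oplus>\<^bsub>V\<^esub>b\<in>B. b \<cdot>\<^bsub>V\<^esub> a b)" using wr by simp
  qed
qed

section \<open>The four classes of modules\<close>

lemma cyclic_model:
  assumes I: "right_ideal S I"
  obtains v where "right_module S (cyclic_module S I)" "v \<in> carrier (cyclic_module S I)"
    "carrier (cyclic_module S I) = right_module.cyclic_submodule S (cyclic_module S I) v"
    "\<And>s. s \<in> carrier S \<Longrightarrow> v \<cdot>\<^bsub>cyclic_module S I\<^esub> s = \<zero>\<^bsub>cyclic_module S I\<^esub> \<longleftrightarrow> s \<in> I"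
  using S.cyclic_module_right_module[OF I] S.cyclic_module_generator[OF I] by blast

lemma mod_iso_cyclic_module:
  assumes V: "right_module S V" and v: "v \<in> carrier V" "carrier V = right_module.cyclic_submodule S V v"
    and ann: "\<And>s. s \<in> carrier S \<Longrightarrow> v \<cdot>\<^bsub>V\<^esub> s = \<zero>\<^bsub>V\<^esub> \<longleftrightarrow> s \<in> I" and I: "right_ideal S I"
  shows "mod_iso S V (cyclic_module S I)"
proof -
  obtain w where "right_module S (cyclic_module S I)" "w \<in> carrier (cyclic_module S I)"
    "carrier (cyclic_module S I) = right_module.cyclic_submodule S (cyclic_module S I) w"
    "\<And>s. s \<in> carrier S \<Longrightarrow> w \<cdot>\<^bsub>cyclic_module S I\<^esub> s = \<zero>\<^bsub>cyclic_module S I\<^esub> \<longleftrightarrow> s \<in> I"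
    using cyclic_model[OF I] by blast
  thus ?thesis using V v ann by (intro mod_iso_of_same_annihilator[of S V _ v w]) auto
qed

lemma irreducible_carrier: "c \<in> irreducible_elements S \<Longrightarrow> c \<in> carrier S"
  by (simp add: irreducible_elements_def)

lemma set_F_D:
  assumes "f \<in> set_F k"
  shows "f \<in> irreducible_elements (UP k)" "f \<in> carrier (UP k)" "f \<noteq> \<zero>\<^bsub>UP k\<^esub>" "f \<in> monic_polys k"
  using assms by (auto simp: set_F_def irreducible_elements_def)

lemma F_ideal_right_ideal: "f \<in> carrier (UP k) \<Longrightarrow> right_ideal S (F_ideal f)"
  by (intro S.right_ideal_set_add S.right_ideal_right_ideal_gen) (auto simp: emb_closed X_closed)

lemma F_module:
  assumes "f \<in> set_F k"
  shows "cyclic_module S (F_ideal f) \<in> simple_finite_dim k R S"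
proof -
  note f = set_F_D[OF assms]
  let ?V = "cyclic_module S (F_ideal f)"
  obtain v where v: "right_module S ?V" "v \<in> carrier ?V" "carrier ?V = right_module.cyclic_submodule S ?V v"
    and ann: "\<And>s. s \<in> carrier S \<Longrightarrow> v \<cdot>\<^bsub>?V\<^esub> s = \<zero>\<^bsub>?V\<^esub> \<longleftrightarrow> s \<in> F_ideal f"
    using cyclic_model[OF F_ideal_right_ideal[OF f(2)]] by blast
  interpret M: skew_division_module S "UP k" XX \<epsilon> sdeg size ?V by (rule X_module[OF v(1)])
  show ?thesis
    using M.simple_of_irreducible_annihilator(1)[OF f(1) v(2,3) ann] finite_dim_of_annihilator[OF v f(2,3) ann]
    by (simp add: simple_finite_dim_def)
qed

lemma simple_finite_dim_classified:
  assumes V: "V \<in> simple_finite_dim k R S"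
  shows "\<exists>f\<in>set_F k. mod_iso S V (cyclic_module S (F_ideal f))"
proof -
  have sV: "simple_module S V" and fd: "finite_dim k R V" and mV: "right_module S V"
    using V by (auto simp: simple_finite_dim_def simple_module_def)
  interpret M: skew_division_module S "UP k" XX \<epsilon> sdeg size V by (rule X_module[OF mV])
  obtain v where v: "v \<in> carrier V" "v \<noteq> \<zero>\<^bsub>V\<^esub>"
    using M.nonzero_submodule_obtains[OF M.submodule_carrier] sV by (auto simp: simple_module_def)
  obtain f where f: "f \<in> irreducible_elements (UP k)"
    and ann: "\<And>s. s \<in> carrier S \<Longrightarrow> v \<cdot>\<^bsub>V\<^esub> s = \<zero>\<^bsub>V\<^esub> \<longleftrightarrow> s \<in> F_ideal f"
    using M.killed_simple_annihilator[OF sV v simple_finite_dim_killed[OF sV fd v(1)]] by blast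
  have fc: "f \<in> carrier (UP k)" "f \<noteq> \<zero>\<^bsub>UP k\<^esub>" using f by (auto simp: irreducible_elements_def)
  obtain g where g: "g \<in> Units (UP k)" "f \<otimes>\<^bsub>UP k\<^esub> g \<in> monic_polys k" using monic_associate[OF fc] by blast
  have gc: "g \<in> carrier (UP k)" "g \<noteq> \<zero>\<^bsub>UP k\<^esub>"
    using g(1) by (auto, metis XD.P.Units_r_inv XD.P.Units_inv_closed XD.P.l_null XD.P.one_not_zero)
  have "f \<otimes>\<^bsub>UP k\<^esub> g \<in> irreducible_elements (UP k)"
    using XD.P.irreducible_mult_unit[OF f g(1)] XD.P.integral[OF _ fc(1) gc(1)] fc(2) gc(2) by blast
  hence fg: "f \<otimes>\<^bsub>UP k\<^esub> g \<in> set_F k" using g(2) by (simp add: set_F_def)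
  have "right_ideal_gen S (\<epsilon> (f \<otimes>\<^bsub>UP k\<^esub> g)) = right_ideal_gen S (\<epsilon> f)"
    using XD.section_mult[OF fc(1) gc(1)] XD.right_ideal_gen_unit[of "\<epsilon> f" "\<epsilon> g"] emb_closed[OF fc(1)] emb_unit[OF g(1)]
    by simp
  hence "F_ideal (f \<otimes>\<^bsub>UP k\<^esub> g) = F_ideal f" by simp
  moreover have "mod_iso S V (cyclic_module S (F_ideal f))"
    by (rule mod_iso_cyclic_module[OF mV v(1) M.simple_cyclic[OF sV v] ann F_ideal_right_ideal[OF fc(1)]])
  ultimately show ?thesis using fg by (metis (no_types, lifting))
qed

lemma F_killed:
  assumes "f \<in> set_F k" and V: "right_module S V" "v \<in> carrier V" "carrier V = right_module.cyclic_submodule S V v"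
    and ann: "\<And>s. s \<in> carrier S \<Longrightarrow> v \<cdot>\<^bsub>V\<^esub> s = \<zero>\<^bsub>V\<^esub> \<longleftrightarrow> s \<in> F_ideal f"
  shows "\<forall>u\<in>carrier V. u \<cdot>\<^bsub>V\<^esub> \<epsilon> f = \<zero>\<^bsub>V\<^esub>"
proof
  note f = set_F_D[OF assms(1)]
  interpret M: skew_division_module S "UP k" XX \<epsilon> sdeg size V by (rule X_module[OF V(1)])
  have vX: "v \<cdot>\<^bsub>V\<^esub> XX = \<zero>\<^bsub>V\<^esub>"
    by (rule M.simple_of_irreducible_annihilator(2)[OF f(1) V(2,3) ann])
  fix u assume "u \<in> carrier V"
  hence "u \<in> M.cyclic_submodule v" using V(3) by simp
  then obtain s where s: "s \<in> carrier S" "u = v \<cdot>\<^bsub>V\<^esub> s" unfolding M.cyclic_submodule_def by blast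
  obtain p t where p: "p \<in> carrier (UP k)" "t \<in> carrier S"
    "v \<cdot>\<^bsub>V\<^esub> s = v \<cdot>\<^bsub>V\<^esub> \<epsilon> p \<oplus>\<^bsub>V\<^esub> (v \<cdot>\<^bsub>V\<^esub> XX) \<cdot>\<^bsub>V\<^esub> t" using M.act_decomp[OF V(2) s(1)] by blast
  have pc: "\<epsilon> p \<in> carrier S" using p(1) emb_closed by simp
  have "u = v \<cdot>\<^bsub>V\<^esub> \<epsilon> p"
    unfolding s(2) p(3) vX M.zero_ract[OF p(2)] by (rule M.V.r_zero[OF M.ract_closed[OF V(2) pc]])
  hence "u \<cdot>\<^bsub>V\<^esub> \<epsilon> f = v \<cdot>\<^bsub>V\<^esub> \<epsilon> (p \<otimes>\<^bsub>UP k\<^esub> f)"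
    using M.act_section_mult[OF V(2) p(1) f(2)] by simp
  moreover have "p \<otimes>\<^bsub>UP k\<^esub> f \<in> carrier (UP k)" "p \<otimes>\<^bsub>UP k\<^esub> f \<in> PIdl\<^bsub>UP k\<^esub> f"
    using p(1) f(2) by (auto simp: cgenideal_def)
  ultimately show "u \<cdot>\<^bsub>V\<^esub> \<epsilon> f = \<zero>\<^bsub>V\<^esub>"
    using ann[of "\<epsilon> (p \<otimes>\<^bsub>UP k\<^esub> f)"] XD.section_mem_sum_iff[OF f(2)] emb_closed by simp
qed

text \<open>As \<open>f\<close> kills the first module, it kills the second one, so \<open>g\<close> divides \<open>f\<close>. Both are irreducible and
  monic.\<close>

lemma F_injective:
  assumes f: "f \<in> set_F k" and g: "g \<in> set_F k"
    and iso: "mod_iso S (cyclic_module S (F_ideal f)) (cyclic_module S (F_ideal g))"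
  shows "f = g"
proof -
  note f' = set_F_D[OF f] and g' = set_F_D[OF g]
  let ?V = "cyclic_module S (F_ideal f)" and ?W = "cyclic_module S (F_ideal g)"
  obtain v where v: "right_module S ?V" "v \<in> carrier ?V" "carrier ?V = right_module.cyclic_submodule S ?V v"
    and ann: "\<And>s. s \<in> carrier S \<Longrightarrow> v \<cdot>\<^bsub>?V\<^esub> s = \<zero>\<^bsub>?V\<^esub> \<longleftrightarrow> s \<in> F_ideal f"
    using cyclic_model[OF F_ideal_right_ideal[OF f'(2)]] by blast
  obtain w where w: "right_module S ?W" "w \<in> carrier ?W" "carrier ?W = right_module.cyclic_submodule S ?W w"
    and annw: "\<And>s. s \<in> carrier S \<Longrightarrow> w \<cdot>\<^bsub>?W\<^esub> s = \<zero>\<^bsub>?W\<^esub> \<longleftrightarrow> s \<in> F_ideal g"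
    using cyclic_model[OF F_ideal_right_ideal[OF g'(2)]] by blast
  have \<epsilon>f: "\<epsilon> f \<in> carrier S" using f'(2) emb_closed by simp
  note kill = F_killed[OF f v ann]
  have "w \<cdot>\<^bsub>?W\<^esub> \<epsilon> f = \<zero>\<^bsub>?W\<^esub>" using mod_iso_annihilates[OF v(1) w(1) iso \<epsilon>f kill] w(2) by blast
  hence "f \<in> PIdl\<^bsub>UP k\<^esub> g" using annw[OF \<epsilon>f] XD.section_mem_sum_iff[OF g'(2) f'(2)] by simp
  then obtain c where c: "c \<in> carrier (UP k)" "f = c \<otimes>\<^bsub>UP k\<^esub> g" by (auto simp: cgenideal_def)
  have cU: "c \<in> Units (UP k)" using f'(1) g'(1,2) c by (auto simp: irreducible_elements_def)
  have c0: "c \<noteq> \<zero>\<^bsub>UP k\<^esub>" using c f'(3) g'(2) by auto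
  have dc: "deg k c = 0" using UP_unit_iff[OF field_k c(1) c0] cU by simp
  let ?c = "coeff (UP k) c 0"
  have "f = ?c \<odot>\<^bsub>UP k\<^esub> g"
    using c UPk.deg_zero_impl_monom[OF c(1) dc] UPk.monom_mult_is_smult[of ?c g] g'(2) by simp
  moreover have "deg k f = deg k g" using UPk.deg_mult[OF c0 g'(3) c(1) g'(2)] c(2) dc by simp
  moreover have "coeff (UP k) f (deg k f) = \<one>\<^bsub>k\<^esub>" "coeff (UP k) g (deg k g) = \<one>\<^bsub>k\<^esub>"
    using f'(4) g'(4) by (auto simp: monic_polys_def)
  ultimately have "?c = \<one>\<^bsub>k\<^esub>" using c(1) g'(2) UPk.coeff_smult[of ?c g "deg k g"] by simp
  thus ?thesis using \<open>f = ?c \<odot>\<^bsub>UP k\<^esub> g\<close> g'(2) by simp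
qed

lemma A_module:
  assumes c: "c \<in> set_A R X"
  shows "cyclic_module S (right_ideal_gen S c) \<in> unfaithful_fg_1_critical S"
    "\<forall>v\<in>carrier (cyclic_module S (right_ideal_gen S c)).
      v \<cdot>\<^bsub>cyclic_module S (right_ideal_gen S c)\<^esub> c = \<zero>\<^bsub>cyclic_module S (right_ideal_gen S c)\<^esub>"
proof -
  have cS: "c \<in> carrier S" and c0: "c \<noteq> \<zero>\<^bsub>S\<^esub>"
    using c XD.x_closed TH.x_closed XD.x_nonzero var_irreducible by (auto simp: set_A_def irreducible_elements_def)
  let ?V = "cyclic_module S (right_ideal_gen S c)"
  obtain v where v: "right_module S ?V" "v \<in> carrier ?V" "carrier ?V = right_module.cyclic_submodule S ?V v"
    and ann: "\<And>s. s \<in> carrier S \<Longrightarrow> v \<cdot>\<^bsub>?V\<^esub> s = \<zero>\<^bsub>?V\<^esub> \<longleftrightarrow> s \<in> right_ideal_gen S c"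
    using cyclic_model[OF S.right_ideal_right_ideal_gen[OF cS]] by blast
  interpret M: skew_division_module S "UP k" XX \<epsilon> sdeg size ?V by (rule X_module[OF v(1)])
  interpret N: normal_section_module S R \<theta> "skew_const R" ?V by (rule \<theta>_module[OF v(1)])
  have *: "n_critical 1 S ?V \<and> (\<forall>v\<in>carrier ?V. v \<cdot>\<^bsub>?V\<^esub> c = \<zero>\<^bsub>?V\<^esub>)"
  proof (cases "c = XX")
    case True
    show ?thesis using M.one_critical_of_annihilator_x[OF v(2,3)] ann unfolding True by blast
  next
    case False
    hence \<theta>: "c = \<theta>" using c by (simp add: set_A_def)
    show ?thesis using N.one_critical_of_annihilator_x[OF v(2,3)] ann unfolding \<theta> by blast
  qed
  thus "\<forall>v\<in>carrier ?V. v \<cdot>\<^bsub>?V\<^esub> c = \<zero>\<^bsub>?V\<^esub>" by blast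
  show "?V \<in> unfaithful_fg_1_critical S"
    unfolding unfaithful_fg_1_critical_def faithful_def
    using * M.finitely_generated_cyclic[OF v(2,3)] cS c0 by blast
qed

lemma annihilator_ideal:
  assumes "right_module S V"
  shows "ideal {s \<in> carrier S. \<forall>v\<in>carrier V. v \<cdot>\<^bsub>V\<^esub> s = \<zero>\<^bsub>V\<^esub>} S"
proof -
  interpret V: right_module S V by fact
  show ?thesis
  proof (rule idealI)
    show "ring S" by (rule ring_S)
    show "subgroup {s \<in> carrier S. \<forall>v\<in>carrier V. v \<cdot>\<^bsub>V\<^esub> s = \<zero>\<^bsub>V\<^esub>} (add_monoid S)"
      by (rule S.add.subgroupI)
        (auto simp: V.ract_r_distr V.ract_minus intro: exI[of _ "\<zero>\<^bsub>S\<^esub>"] simp del: carrier_S)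
  qed (auto simp: V.ract_assoc V.ract_closed simp del: carrier_S)
qed

text \<open>The annihilator contains a product \<open>X\<^sup>n\<theta>\<^sup>d\<close>, which would act injectively if both \<open>X\<close> and \<open>\<theta>\<close> did.\<close>

lemma unfaithful_1_critical_killed:
  assumes V: "n_critical 1 S V" and unf: "\<not> faithful S V"
  shows "(\<forall>v\<in>carrier V. v \<cdot>\<^bsub>V\<^esub> XX = \<zero>\<^bsub>V\<^esub>) \<or> (\<forall>v\<in>carrier V. v \<cdot>\<^bsub>V\<^esub> \<theta> = \<zero>\<^bsub>V\<^esub>)"
proof (rule ccontr)
  assume n: "\<not> ?thesis"
  have mV: "right_module S V" and nz: "carrier V \<noteq> {\<zero>\<^bsub>V\<^esub>}" using V by (auto simp: n_critical_def critical_def)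
  interpret V: right_module S V by (rule mV)
  have inj: "v = \<zero>\<^bsub>V\<^esub>" if "v \<in> carrier V" "v \<cdot>\<^bsub>V\<^esub> c = \<zero>\<^bsub>V\<^esub>" "c = XX \<or> c = \<theta>" for v c
    using that n V.one_critical_normal_dichotomy[OF V XD.x_closed XD.normal_left XD.normal_right]
      V.one_critical_normal_dichotomy[OF V TH.x_closed TH.normal_left TH.normal_right] by blast
  have injp: "v = \<zero>\<^bsub>V\<^esub>" if "v \<in> carrier V" "v \<cdot>\<^bsub>V\<^esub> c [^]\<^bsub>S\<^esub> (n::nat) = \<zero>\<^bsub>V\<^esub>" "c = XX \<or> c = \<theta>" for v c n
    using that(2)
  proof (induction n)
    case 0 thus ?case using that(1) by (simp add: V.ract_one)
  next
    case (Suc n)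
    have c: "c \<in> carrier S" using that(3) XD.x_closed TH.x_closed by blast
    have "(v \<cdot>\<^bsub>V\<^esub> c [^]\<^bsub>S\<^esub> n) \<cdot>\<^bsub>V\<^esub> c = \<zero>\<^bsub>V\<^esub>"
      using Suc.prems that(1) c by (simp add: V.ract_assoc del: carrier_S)
    hence "v \<cdot>\<^bsub>V\<^esub> c [^]\<^bsub>S\<^esub> n = \<zero>\<^bsub>V\<^esub>"
      using inj that(3) V.ract_closed[OF that(1) S.nat_pow_closed[OF c]] by blast
    thus ?case by (rule Suc.IH)
  qed
  let ?J = "{s \<in> carrier S. \<forall>v\<in>carrier V. v \<cdot>\<^bsub>V\<^esub> s = \<zero>\<^bsub>V\<^esub>}"
  have J: "ideal ?J S" by (rule annihilator_ideal[OF mV])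
  have "?J \<noteq> {\<zero>\<^bsub>S\<^esub>}" using unf unfolding faithful_def by blast
  then obtain c d where c: "c \<in> carrier R" "c \<noteq> \<zero>" "monomial c d \<in> ?J"
    using two_sided_ideal_contains_monomial[OF \<alpha>_infinite_order J] by blast
  obtain u where u: "u \<in> Units R" "c = u \<otimes> X [^] val c" using valE[OF c(1,2)] .
  have uc: "u \<in> carrier R" "inv u \<in> carrier R" using u(1) by auto
  have "monomial (inv u) 0 \<otimes>\<^bsub>S\<^esub> monomial c d = monomial (inv u \<otimes> c) d" using uc c(1) by (simp add: monomial_monomial)
  also have "inv u \<otimes> c = X [^] val c"
    by (subst u(2)) (use uc u(1) X_closed in \<open>simp add: m_assoc[symmetric]\<close>)
  also have "monomial (X [^] val c) d = XX [^]\<^bsub>S\<^esub> val c \<otimes>\<^bsub>S\<^esub> \<theta> [^]\<^bsub>S\<^esub> d"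
    using X_closed by (simp add: const_pow var_pow) (simp add: const_monomial monomial_monomial)
  finally have "XX [^]\<^bsub>S\<^esub> val c \<otimes>\<^bsub>S\<^esub> \<theta> [^]\<^bsub>S\<^esub> d \<in> ?J"
    using ideal.I_l_closed[OF J c(3), of "monomial (inv u) 0"] uc by simp
  moreover obtain v where v: "v \<in> carrier V" "v \<noteq> \<zero>\<^bsub>V\<^esub>"
    using V.nonzero_submodule_obtains[OF V.submodule_carrier nz] .
  ultimately have "(v \<cdot>\<^bsub>V\<^esub> XX [^]\<^bsub>S\<^esub> val c) \<cdot>\<^bsub>V\<^esub> \<theta> [^]\<^bsub>S\<^esub> d = \<zero>\<^bsub>V\<^esub>"
    using XD.x_closed TH.x_closed V.ract_assoc[of v "XX [^]\<^bsub>S\<^esub> val c" "\<theta> [^]\<^bsub>S\<^esub> d"] by (simp del: carrier_S)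
  thus False using injp v V.ract_closed[OF v(1) S.nat_pow_closed[OF XD.x_closed]] by blast
qed

lemma unfaithful_classified:
  assumes V: "V \<in> unfaithful_fg_1_critical S"
  shows "\<exists>c\<in>set_A R X. mod_iso S V (cyclic_module S (right_ideal_gen S c))"
proof -
  have cV: "n_critical 1 S V" and fg: "finitely_generated S V" and unf: "\<not> faithful S V" and mV: "right_module S V"
    using V by (auto simp: unfaithful_fg_1_critical_def n_critical_def critical_def)
  interpret M: skew_division_module S "UP k" XX \<epsilon> sdeg size V by (rule X_module[OF mV])
  interpret N: normal_section_module S R \<theta> "skew_const R" V by (rule \<theta>_module[OF mV])
  have "\<exists>c\<in>set_A R X. \<exists>u\<in>carrier V. carrier V = M.cyclic_submodule u \<and>
      (\<forall>s\<in>carrier S. u \<cdot>\<^bsub>V\<^esub> s = \<zero>\<^bsub>V\<^esub> \<longleftrightarrow> s \<in> right_ideal_gen S c)"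
    using unfaithful_1_critical_killed[OF cV unf]
  proof
    assume "\<forall>v\<in>carrier V. v \<cdot>\<^bsub>V\<^esub> XX = \<zero>\<^bsub>V\<^esub>"
    then obtain u where "u \<in> carrier V" "carrier V = M.cyclic_submodule u"
      "\<And>s. s \<in> carrier S \<Longrightarrow> u \<cdot>\<^bsub>V\<^esub> s = \<zero>\<^bsub>V\<^esub> \<longleftrightarrow> s \<in> right_ideal_gen S XX"
      using M.killed_one_critical_cyclic[OF cV fg] by blast
    thus ?thesis by (intro bexI[of _ XX] bexI[of _ u]) (auto simp: set_A_def)
  next
    assume "\<forall>v\<in>carrier V. v \<cdot>\<^bsub>V\<^esub> \<theta> = \<zero>\<^bsub>V\<^esub>"
    then obtain u where "u \<in> carrier V" "carrier V = M.cyclic_submodule u"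
      "\<And>s. s \<in> carrier S \<Longrightarrow> u \<cdot>\<^bsub>V\<^esub> s = \<zero>\<^bsub>V\<^esub> \<longleftrightarrow> s \<in> right_ideal_gen S \<theta>"
      using N.killed_one_critical_cyclic[OF cV fg] by blast
    thus ?thesis by (intro bexI[of _ \<theta>] bexI[of _ u]) (auto simp: set_A_def)
  qed
  then obtain c u where c: "c \<in> set_A R X" "u \<in> carrier V" "carrier V = M.cyclic_submodule u"
    "\<And>s. s \<in> carrier S \<Longrightarrow> u \<cdot>\<^bsub>V\<^esub> s = \<zero>\<^bsub>V\<^esub> \<longleftrightarrow> s \<in> right_ideal_gen S c" by blast
  have "c \<in> carrier S" using c(1) XD.x_closed TH.x_closed by (auto simp: set_A_def)
  thus ?thesis using mod_iso_cyclic_module[OF mV c(2-4) S.right_ideal_right_ideal_gen] c(1) by blast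
qed

text \<open>As \<open>c\<close> kills the first module, it kills the second one, so \<open>c \<in> dS\<close>. But \<open>X\<close> and \<open>\<theta>\<close> are irreducible
  and not associates.\<close>

lemma A_injective:
  assumes c: "c \<in> set_A R X" and d: "d \<in> set_A R X"
    and iso: "mod_iso S (cyclic_module S (right_ideal_gen S c)) (cyclic_module S (right_ideal_gen S d))"
  shows "c = d"
proof (rule ccontr)
  assume cd: "c \<noteq> d"
  have cS: "c \<in> carrier S" "d \<in> carrier S" using c d XD.x_closed TH.x_closed by (auto simp: set_A_def)
  let ?V = "cyclic_module S (right_ideal_gen S c)" and ?W = "cyclic_module S (right_ideal_gen S d)"
  have mV: "right_module S ?V" using cS by (intro S.cyclic_module_right_module S.right_ideal_right_ideal_gen)
  obtain w where w: "right_module S ?W" "w \<in> carrier ?W" and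
    annw: "carrier ?W = right_module.cyclic_submodule S ?W w"
      "\<And>s. s \<in> carrier S \<Longrightarrow> w \<cdot>\<^bsub>?W\<^esub> s = \<zero>\<^bsub>?W\<^esub> \<longleftrightarrow> s \<in> right_ideal_gen S d"
    using cyclic_model[OF S.right_ideal_right_ideal_gen[OF cS(2)]] by blast
  have "c \<in> right_ideal_gen S d"
    using mod_iso_annihilates[OF mV w(1) iso cS(1) A_module(2)[OF c]] w(2) annw(2)[OF cS(1)] by blast
  then obtain t where t: "t \<in> carrier S" "c = d \<otimes>\<^bsub>S\<^esub> t" by (auto simp: right_ideal_gen_eq)
  have "t \<in> Units S"
  proof -
    have "c \<in> irreducible_elements S" "d \<notin> Units S"
      using c d X_irreducible var_irreducible by (auto simp: set_A_def irreducible_elements_def)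
    thus ?thesis using cS t by (auto simp: irreducible_elements_def)
  qed
  then obtain r where r: "r \<in> Units R" "t = monomial r 0" using const_unit_apply by blast
  have rR: "r \<in> carrier R" using r(1) by auto
  consider "c = XX" "d = \<theta>" | "c = \<theta>" "d = XX" using c d cd by (auto simp: set_A_def)
  thus False
  proof cases
    case 1
    have "X = c 0" using 1 by (simp add: skew_const_def)
    also have "\<dots> = \<zero>" unfolding t(2) using 1 t(1) by (simp add: var_mult)
    finally show False using X_nonzero by simp
  next
    case 2
    have "\<zero> = c 0" using 2 by (simp add: skew_var_def)
    also have "\<dots> = X \<otimes> r" unfolding t(2) using 2 t(1) r(2) by (simp add: const_X_mult) (simp add: monomial_def)
    finally have "X \<otimes> r = \<zero>" by simp
    hence "r = \<zero>" using X_nonzero X_closed rR integral_iff by blast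
    thus False using r(1) by (metis Units_r_inv Units_inv_closed l_null one_not_zero)
  qed
qed

lemma B_module:
  assumes c: "c \<in> set_B R \<alpha> X"
  shows "cyclic_module S (right_ideal_gen S c) \<in> simple_infinite_dim k R S"
proof -
  obtain f t where z: "c \<in> irreducible_elements S" "c = \<epsilon> f \<oplus>\<^bsub>S\<^esub> XX \<otimes>\<^bsub>S\<^esub> t" "f \<in> Units (UP k)" "t \<in> carrier S"
    using set_B_section[OF c] .
  let ?V = "cyclic_module S (right_ideal_gen S c)"
  obtain v where v: "right_module S ?V" "v \<in> carrier ?V" "carrier ?V = right_module.cyclic_submodule S ?V v"
    and ann: "\<And>s. s \<in> carrier S \<Longrightarrow> v \<cdot>\<^bsub>?V\<^esub> s = \<zero>\<^bsub>?V\<^esub> \<longleftrightarrow> s \<in> right_ideal_gen S c"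
    using cyclic_model[OF S.right_ideal_right_ideal_gen[OF irreducible_carrier[OF z(1)]]] by blast
  interpret M: skew_division_module S "UP k" XX \<epsilon> sdeg size ?V by (rule X_module[OF v(1)])
  note s = M.simple_of_unit_section[OF v(2,3) ann z]
  have "\<not> finite_dim k R ?V" using simple_finite_dim_killed[OF s(1) _ v(2)] s(2) by blast
  thus ?thesis using s(1) by (simp add: simple_infinite_dim_def)
qed

text \<open>If \<open>X\<close> killed \<open>V\<close>, then \<open>V\<close> would be \<open>k[\<theta>]/(f)\<close> for some \<open>f\<close>.\<close>

lemma simple_infinite_dim_classified:
  assumes V: "V \<in> simple_infinite_dim k R S"
  shows "\<exists>c\<in>set_B R \<alpha> X. mod_iso S V (cyclic_module S (right_ideal_gen S c))"
proof -
  have sV: "simple_module S V" and fd: "\<not> finite_dim k R V" and mV: "right_module S V"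
    using V by (auto simp: simple_infinite_dim_def simple_module_def)
  interpret M: skew_division_module S "UP k" XX \<epsilon> sdeg size V by (rule X_module[OF mV])
  have "\<exists>u\<in>carrier V. u \<cdot>\<^bsub>V\<^esub> XX \<noteq> \<zero>\<^bsub>V\<^esub>"
  proof (rule ccontr)
    assume killed: "\<not> (\<exists>u\<in>carrier V. u \<cdot>\<^bsub>V\<^esub> XX \<noteq> \<zero>\<^bsub>V\<^esub>)"
    obtain v where v: "v \<in> carrier V" "v \<noteq> \<zero>\<^bsub>V\<^esub>"
      using M.nonzero_submodule_obtains[OF M.submodule_carrier] sV by (auto simp: simple_module_def)
    obtain f where f: "f \<in> irreducible_elements (UP k)"
      and ann: "\<And>s. s \<in> carrier S \<Longrightarrow> v \<cdot>\<^bsub>V\<^esub> s = \<zero>\<^bsub>V\<^esub> \<longleftrightarrow> s \<in> F_ideal f"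
      using M.killed_simple_annihilator[OF sV v] killed v(1) by blast
    have "finite_dim k R V"
      by (rule finite_dim_of_annihilator[OF mV v(1) M.simple_cyclic[OF sV v] _ _ ann])
        (use f in \<open>auto simp: irreducible_elements_def\<close>)
    thus False using fd by blast
  qed
  then obtain u where u: "u \<in> carrier V" "u \<cdot>\<^bsub>V\<^esub> XX \<noteq> \<zero>\<^bsub>V\<^esub>" by blast
  obtain v z f t where v: "v \<in> carrier V" "carrier V = M.cyclic_submodule v"
    and ann: "\<And>s. s \<in> carrier S \<Longrightarrow> v \<cdot>\<^bsub>V\<^esub> s = \<zero>\<^bsub>V\<^esub> \<longleftrightarrow> s \<in> right_ideal_gen S z"
    and z: "z \<in> irreducible_elements S" "z = \<epsilon> f \<oplus>\<^bsub>S\<^esub> XX \<otimes>\<^bsub>S\<^esub> t" "f \<in> Units (UP k)" "t \<in> carrier S"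
    using M.simple_annihilator[OF sV u] by blast
  obtain w where w: "w \<in> Units S" "z \<otimes>\<^bsub>S\<^esub> w \<in> set_B R \<alpha> X"
    using irreducible_normal_form(2)[OF z] by blast
  note zS = irreducible_carrier[OF z(1)]
  have "right_ideal_gen S (z \<otimes>\<^bsub>S\<^esub> w) = right_ideal_gen S z" by (rule XD.right_ideal_gen_unit[OF zS w(1)])
  moreover have "mod_iso S V (cyclic_module S (right_ideal_gen S z))"
    by (rule mod_iso_cyclic_module[OF mV v ann S.right_ideal_right_ideal_gen[OF zS]])
  ultimately show ?thesis using w(2) by (metis (no_types, lifting))
qed

text \<open>If the module were unfaithful, it would be killed by \<open>X\<close> or \<open>\<theta>\<close>; that element would lie in \<open>cS\<close> and,
  being irreducible, be an associate of \<open>c\<close>.\<close>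

lemma C_module:
  assumes c: "c \<in> set_C k R \<alpha> X"
  shows "cyclic_module S (right_ideal_gen S c) \<in> faithful_fg_1_critical S"
proof -
  obtain f t where z: "c \<in> irreducible_elements S" "c = \<epsilon> f \<oplus>\<^bsub>S\<^esub> XX \<otimes>\<^bsub>S\<^esub> t"
    "f \<in> carrier (UP k)" "f \<noteq> \<zero>\<^bsub>UP k\<^esub>" "f \<notin> Units (UP k)" "t \<in> carrier S"
    and \<theta>: "\<And>u. u \<in> Units S \<Longrightarrow> c \<noteq> \<theta> \<otimes>\<^bsub>S\<^esub> u"
    using set_C_section[OF c] by blast
  note zS = irreducible_carrier[OF z(1)]
  let ?V = "cyclic_module S (right_ideal_gen S c)"
  obtain v where v: "right_module S ?V" "v \<in> carrier ?V" "carrier ?V = right_module.cyclic_submodule S ?V v"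
    and ann: "\<And>s. s \<in> carrier S \<Longrightarrow> v \<cdot>\<^bsub>?V\<^esub> s = \<zero>\<^bsub>?V\<^esub> \<longleftrightarrow> s \<in> right_ideal_gen S c"
    using cyclic_model[OF S.right_ideal_right_ideal_gen[OF zS]] by blast
  interpret M: skew_division_module S "UP k" XX \<epsilon> sdeg size ?V by (rule X_module[OF v(1)])
  have crit: "n_critical 1 S ?V" by (rule M.one_critical_of_nonunit_section[OF v(2,3) ann z])
  have "faithful S ?V"
  proof (rule ccontr)
    assume unf: "\<not> faithful S ?V"
    have "v \<cdot>\<^bsub>?V\<^esub> XX = \<zero>\<^bsub>?V\<^esub> \<or> v \<cdot>\<^bsub>?V\<^esub> \<theta> = \<zero>\<^bsub>?V\<^esub>"
      using unfaithful_1_critical_killed[OF crit unf] v(2) by blast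
    then obtain a where a: "a \<in> set_A R X" "v \<cdot>\<^bsub>?V\<^esub> a = \<zero>\<^bsub>?V\<^esub>" by (auto simp: set_A_def)
    have aI: "a \<in> irreducible_elements S" using a(1) X_irreducible var_irreducible by (auto simp: set_A_def)
    have "a \<in> right_ideal_gen S c" using ann[OF irreducible_carrier[OF aI]] a(2) by blast
    then obtain s where s: "s \<in> carrier S" "a = c \<otimes>\<^bsub>S\<^esub> s" by (auto simp: right_ideal_gen_eq)
    have sU: "s \<in> Units S" using XD.irreducibleD(4)[OF aI zS s] XD.irreducibleD(3)[OF z(1)] by blast
    have "c = a \<otimes>\<^bsub>S\<^esub> inv\<^bsub>S\<^esub> s" unfolding s(2) using zS s(1) sU by (simp add: S.m_assoc del: carrier_S)
    thus False using A_C_separate[OF a(1) c S.Units_inv_Units[OF sU]] by blast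
  qed
  thus ?thesis using crit M.finitely_generated_cyclic[OF v(2,3)] by (simp add: faithful_fg_1_critical_def)
qed

text \<open>The module \<open>V\<close> need not be cyclic; it contains a submodule \<open>vS \<cong> S/zS\<close>. If \<open>z\<close> were an associate of
  \<open>\<theta>\<close>, then \<open>\<theta>\<close> would kill \<open>v\<close> and therefore \<open>V\<close>.\<close>

lemma faithful_classified:
  assumes V: "V \<in> faithful_fg_1_critical S"
  shows "\<exists>c\<in>set_C k R \<alpha> X. hull_similar S V (cyclic_module S (right_ideal_gen S c))"
proof -
  have cV: "n_critical 1 S V" and fa: "faithful S V" and mV: "right_module S V"
    using V by (auto simp: faithful_fg_1_critical_def n_critical_def critical_def)
  interpret M: skew_division_module S "UP k" XX \<epsilon> sdeg size V by (rule X_module[OF mV])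
  obtain u where u: "u \<in> carrier V" "u \<cdot>\<^bsub>V\<^esub> XX \<noteq> \<zero>\<^bsub>V\<^esub>"
    using fa XD.x_closed XD.x_nonzero unfolding faithful_def by blast
  obtain v z f t where v: "v \<in> carrier V" "v \<noteq> \<zero>\<^bsub>V\<^esub>"
    and ann: "\<And>s. s \<in> carrier S \<Longrightarrow> v \<cdot>\<^bsub>V\<^esub> s = \<zero>\<^bsub>V\<^esub> \<longleftrightarrow> s \<in> right_ideal_gen S z"
    and z: "z \<in> irreducible_elements S" "z = \<epsilon> f \<oplus>\<^bsub>S\<^esub> XX \<otimes>\<^bsub>S\<^esub> t"
      "f \<in> carrier (UP k)" "f \<noteq> \<zero>\<^bsub>UP k\<^esub>" "f \<notin> Units (UP k)" "t \<in> carrier S"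
    using M.one_critical_annihilator[OF cV u] by blast
  note zS = irreducible_carrier[OF z(1)]
  have \<theta>0: "\<theta> \<noteq> \<zero>\<^bsub>S\<^esub>" using var_irreducible by (simp add: irreducible_elements_def)
  have "z \<noteq> \<theta> \<otimes>\<^bsub>S\<^esub> w" if w: "w \<in> Units S" for w
  proof
    assume zw: "z = \<theta> \<otimes>\<^bsub>S\<^esub> w"
    have "right_ideal_gen S z = right_ideal_gen S \<theta>" unfolding zw by (rule XD.right_ideal_gen_unit[OF TH.x_closed w])
    hence "v \<cdot>\<^bsub>V\<^esub> \<theta> = \<zero>\<^bsub>V\<^esub>" using ann[OF TH.x_closed] XD.self_mem_gen[OF TH.x_closed] by simp
    hence "\<forall>v\<in>carrier V. v \<cdot>\<^bsub>V\<^esub> \<theta> = \<zero>\<^bsub>V\<^esub>"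
      using M.one_critical_normal_dichotomy[OF cV TH.x_closed TH.normal_left TH.normal_right] v by blast
    thus False using fa \<theta>0 TH.x_closed unfolding faithful_def by blast
  qed
  then obtain w where w: "w \<in> Units S" "z \<otimes>\<^bsub>S\<^esub> w \<in> set_C k R \<alpha> X"
    using irreducible_normal_form(3)[OF z(1,2,3,4,5,6)] by blast
  have gen: "right_ideal_gen S (z \<otimes>\<^bsub>S\<^esub> w) = right_ideal_gen S z" by (rule XD.right_ideal_gen_unit[OF zS w(1)])
  let ?N = "M.cyclic_submodule v" and ?W = "cyclic_module S (right_ideal_gen S z)"
  let ?V' = "V\<lparr>carrier := ?N\<rparr>"
  note N = M.cyclic_submodule_submodule[OF v(1)]
  have mN: "right_module S ?V'" by (rule M.module_of_submodule[OF N])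
  have iso: "mod_iso S ?V' ?W"
  proof (rule mod_iso_cyclic_module[OF mN _ _ _ S.right_ideal_right_ideal_gen[OF zS]])
    show "v \<in> carrier ?V'" using M.self_in_cyclic_submodule[OF v(1)] by simp
    show "carrier ?V' = right_module.cyclic_submodule S ?V' v"
      unfolding right_module.cyclic_submodule_def[OF mN] by (simp add: M.cyclic_submodule_def)
    show "v \<cdot>\<^bsub>?V'\<^esub> s = \<zero>\<^bsub>?V'\<^esub> \<longleftrightarrow> s \<in> right_ideal_gen S z" if "s \<in> carrier S" for s using ann[OF that] by simp
  qed
  have mW: "right_module S ?W" by (intro S.cyclic_module_right_module S.right_ideal_right_ideal_gen zS)
  interpret W: right_module S ?W by (rule mW)
  have "?W \<in> faithful_fg_1_critical S" using C_module[OF w(2)] unfolding gen .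
  hence "carrier ?W \<noteq> {\<zero>\<^bsub>?W\<^esub>}" by (auto simp: faithful_fg_1_critical_def n_critical_def critical_def)
  moreover have "?W\<lparr>carrier := carrier ?W\<rparr> = ?W" by simp
  ultimately have "hull_similar S V ?W"
    unfolding hull_similar_def using N M.cyclic_submodule_nonzero[OF v] W.submodule_carrier iso by metis
  thus ?thesis using w(2) gen by (metis (no_types, lifting))
qed

lemma critical_torsion_iff:
  "{V :: (nat \<Rightarrow> 'a, 'v) right_mod. critical S V \<and> finitely_generated S V \<and> torsion S V} =
       simple_finite_dim k R S \<union> simple_infinite_dim k R S \<union>
       unfaithful_fg_1_critical S \<union> faithful_fg_1_critical S" (is "?L = ?R")
proof (rule Set.set_eqI, rule iffI)
  fix V :: "(nat \<Rightarrow> 'a, 'v) right_mod" assume "V \<in> ?L"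
  hence V: "critical S V" "finitely_generated S V" "torsion S V" by auto
  hence mV: "right_module S V" and nz: "carrier V \<noteq> {\<zero>\<^bsub>V\<^esub>}" by (auto simp: critical_def)
  interpret M: skew_division_module S "UP k" XX \<epsilon> sdeg size V by (rule X_module[OF mV])
  obtain N where "right_submodule S V N" "N \<noteq> {\<zero>\<^bsub>V\<^esub>}" "(N, {\<zero>\<^bsub>V\<^esub>}) \<in> kdim_step S V M.artinian"
    using M.torsion_has_small_submodule[OF V(3) nz] .
  hence "simple_module S V \<or> n_critical 1 S V" by (rule M.critical_simple_or_1_critical[OF V(1)])
  thus "V \<in> ?R" using V(2)
    by (auto simp: simple_finite_dim_def simple_infinite_dim_def unfaithful_fg_1_critical_def faithful_fg_1_critical_def)
next
  fix V :: "(nat \<Rightarrow> 'a, 'v) right_mod" assume "V \<in> ?R"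
  hence "simple_module S V \<or> (n_critical 1 S V \<and> finitely_generated S V)"
    by (auto simp: simple_finite_dim_def simple_infinite_dim_def unfaithful_fg_1_critical_def faithful_fg_1_critical_def)
  thus "V \<in> ?L"
  proof
    assume sV: "simple_module S V"
    hence mV: "right_module S V" by (simp add: simple_module_def)
    interpret M: skew_division_module S "UP k" XX \<epsilon> sdeg size V by (rule X_module[OF mV])
    obtain v where v: "v \<in> carrier V" "v \<noteq> \<zero>\<^bsub>V\<^esub>"
      using M.nonzero_submodule_obtains[OF M.submodule_carrier] sV by (auto simp: simple_module_def)
    show ?thesis using M.simple_critical[OF sV] M.simple_torsion[OF sV]
        M.finitely_generated_cyclic[OF v(1) M.simple_cyclic[OF sV v]] by simp
  next
    assume cV: "n_critical 1 S V \<and> finitely_generated S V"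
    hence mV: "right_module S V" by (auto simp: n_critical_def critical_def)
    interpret M: skew_division_module S "UP k" XX \<epsilon> sdeg size V by (rule X_module[OF mV])
    show ?thesis using cV M.one_critical_torsion by (auto simp: n_critical_def)
  qed
qed

lemma equiv_mod_iso:
  assumes "\<And>V. V \<in> M \<Longrightarrow> right_module S V"
  shows "equiv M (rel_on M (mod_iso S))"
  by (rule equiv_rel_on) (auto intro: mod_iso_refl mod_iso_sym[OF assms] mod_iso_trans)

lemma equiv_hull_similar: "equiv (faithful_fg_1_critical S) (rel_on (faithful_fg_1_critical S) (hull_similar S))"
proof (rule equiv_rel_on)
  have m: "right_module S V" "carrier V \<noteq> {\<zero>\<^bsub>V\<^esub>}" "n_critical 1 S V" if "V \<in> faithful_fg_1_critical S" for V
    using that by (auto simp: faithful_fg_1_critical_def n_critical_def critical_def)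
  show "hull_similar S V V" if "V \<in> faithful_fg_1_critical S" for V
    by (rule hull_similar_refl[OF m(1,2)[OF that]])
  show "hull_similar S W V" if "V \<in> faithful_fg_1_critical S" "hull_similar S V W" for V W
    by (rule hull_similar_sym[OF m(1)[OF that(1)] that(2)])
  show "hull_similar S V U" if "V \<in> faithful_fg_1_critical S" "W \<in> faithful_fg_1_critical S"
    "U \<in> faithful_fg_1_critical S" "hull_similar S V W" "hull_similar S W U" for V W U
    by (rule hull_similar_trans[OF m(1)[OF that(1)] m(1,3)[OF that(2)] m(1)[OF that(3)] that(4,5)])
qed

end

theorem theorem1p2:
  fixes k :: "('k, 'n) ring_scheme"
    and R :: "('k, 'a, 'm) module_scheme"
    and X :: 'a
    and \<alpha> :: "'a \<Rightarrow> 'a"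
    and S :: "(nat \<Rightarrow> 'a) ring"
  assumes "field k"
    and "discrete_valuation_ring R"
    and "algebra k R"
    and "X \<in> carrier R"
    and "maximalideal (PIdl\<^bsub>R\<^esub> X) R"
    and "bij_betw (\<lambda>c. (PIdl\<^bsub>R\<^esub> X) +>\<^bsub>R\<^esub> (c \<odot>\<^bsub>R\<^esub> \<one>\<^bsub>R\<^esub>)) (carrier k) (carrier (R Quot (PIdl\<^bsub>R\<^esub> X)))"
    and "\<alpha> \<in> ring_iso R R"
    and "\<forall>c\<in>carrier k. \<forall>r\<in>carrier R. \<alpha> (c \<odot>\<^bsub>R\<^esub> r) = c \<odot>\<^bsub>R\<^esub> \<alpha> r"
    and "\<forall>n>0. \<exists>r\<in>carrier R. (\<alpha> ^^ n) r \<noteq> r"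
    and "S = skew_poly_ring R \<alpha>"
  shows
    "set_A R X \<union> set_B R \<alpha> X \<union> set_C k R \<alpha> X \<subseteq> irreducible_elements S \<and>
     set_A R X \<inter> set_B R \<alpha> X = {} \<and>
     set_A R X \<inter> set_C k R \<alpha> X = {} \<and>
     set_B R \<alpha> X \<inter> set_C k R \<alpha> X = {} \<and>
     (\<forall>z\<in>irreducible_elements S.
        \<exists>!T. T \<in> {set_A R X, set_B R \<alpha> X, set_C k R \<alpha> X} \<and> (\<exists>u\<in>Units S. z \<otimes>\<^bsub>S\<^esub> u \<in> T)) \<and>

     {V :: (nat \<Rightarrow> 'a, 'v) right_mod. critical S V \<and> finitely_generated S V \<and> torsion S V} =
       simple_finite_dim k R S \<union> simple_infinite_dim k R S \<union>
       unfaithful_fg_1_critical S \<union> faithful_fg_1_critical S \<and>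

     bijection_onto_classes (set_F k)
       (\<lambda>f. cyclic_module S
          (right_ideal_gen S (skew_const R X) <+>\<^bsub>S\<^esub> right_ideal_gen S (emb_poly k R f)))
       (simple_finite_dim k R S) (mod_iso S) \<and>
     bijection_onto_classes (set_A R X)
       (\<lambda>c. cyclic_module S (right_ideal_gen S c))
       (unfaithful_fg_1_critical S) (mod_iso S) \<and>
     bijection_onto_classes_up_to_similarity (set_B R \<alpha> X)
       (\<lambda>c. cyclic_module S (right_ideal_gen S c))
       (simple_infinite_dim k R S) (mod_iso S) \<and>
     bijection_onto_classes_up_to_similarity (set_C k R \<alpha> X)
       (\<lambda>c. cyclic_module S (right_ideal_gen S c))
       (faithful_fg_1_critical S) (hull_similar S) \<and>

     (\<forall>V :: (nat \<Rightarrow> 'a, 'v) right_mod.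
        (V \<in> simple_finite_dim k R S \<longrightarrow>
          (\<exists>f\<in>set_F k. mod_iso S V (cyclic_module S
             (right_ideal_gen S (skew_const R X) <+>\<^bsub>S\<^esub> right_ideal_gen S (emb_poly k R f))))) \<and>
        (V \<in> unfaithful_fg_1_critical S \<longrightarrow>
          (\<exists>c\<in>set_A R X. mod_iso S V (cyclic_module S (right_ideal_gen S c)))) \<and>
        (V \<in> simple_infinite_dim k R S \<longrightarrow>
          (\<exists>c\<in>set_B R \<alpha> X. mod_iso S V (cyclic_module S (right_ideal_gen S c)))) \<and>
        (V \<in> faithful_fg_1_critical S \<longrightarrow>
          (\<exists>c\<in>set_C k R \<alpha> X. hull_similar S V (cyclic_module S (right_ideal_gen S c)))))"
proof -
  have "principal_domain R" using assms(2) by (simp add: discrete_valuation_ring_def)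
  then interpret D: principal_domain R .
  interpret skew_poly_dvr_algebra R \<alpha> X k
    by (intro skew_poly_dvr_algebra.intro skew_poly_dvr.intro skew_poly.intro D.domain_axioms
        skew_poly_axioms.intro skew_poly_dvr_axioms.intro skew_poly_dvr_algebra_axioms.intro assms)
  have irr: "set_A R X \<union> set_B R \<alpha> X \<union> set_C k R \<alpha> X \<subseteq> irreducible_elements (skew_poly_ring R \<alpha>)"
    using X_irreducible var_irreducible by (auto simp: set_A_def set_B_iff set_C_iff)
  have one: "\<one>\<^bsub>skew_poly_ring R \<alpha>\<^esub> \<in> Units (skew_poly_ring R \<alpha>)" by (rule S.Units_one_closed)
  have car: "z \<otimes>\<^bsub>skew_poly_ring R \<alpha>\<^esub> \<one>\<^bsub>skew_poly_ring R \<alpha>\<^esub> = z"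
    if "z \<in> set_A R X \<union> set_B R \<alpha> X \<union> set_C k R \<alpha> X" for z
    using that irr irreducible_carrier by (intro S.r_one) blast
  have disj: "set_A R X \<inter> set_B R \<alpha> X = {}" "set_A R X \<inter> set_C k R \<alpha> X = {}" "set_B R \<alpha> X \<inter> set_C k R \<alpha> X = {}"
  proof -
    have "z \<notin> set_B R \<alpha> X" "z \<notin> set_C k R \<alpha> X" if "z \<in> set_A R X" for z
      using A_B_separate[OF that _ one, of z] A_C_separate[OF that _ one, of z] car[of z] that by auto
    moreover have "z \<notin> set_C k R \<alpha> X" if "z \<in> set_B R \<alpha> X" for z
      using B_C_separate[OF that _ one, of z] car[of z] that by auto
    ultimately show "set_A R X \<inter> set_B R \<alpha> X = {}" "set_A R X \<inter> set_C k R \<alpha> X = {}"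
      "set_B R \<alpha> X \<inter> set_C k R \<alpha> X = {}" by blast+
  qed
  have cls: "\<exists>!T. T \<in> {set_A R X, set_B R \<alpha> X, set_C k R \<alpha> X} \<and>
      (\<exists>u\<in>Units (skew_poly_ring R \<alpha>). z \<otimes>\<^bsub>skew_poly_ring R \<alpha>\<^esub> u \<in> T)"
    if z: "z \<in> irreducible_elements (skew_poly_ring R \<alpha>)" for z
    using irreducible_normal_form(1)[OF z] irreducible_class_unique[OF irreducible_carrier[OF z]] by (metis (no_types, lifting))
  have mods: "right_module (skew_poly_ring R \<alpha>) V"
    if "V \<in> simple_finite_dim k R (skew_poly_ring R \<alpha>) \<union> simple_infinite_dim k R (skew_poly_ring R \<alpha>) \<union>
       unfaithful_fg_1_critical (skew_poly_ring R \<alpha>)" for V :: "(nat \<Rightarrow> 'a, (nat \<Rightarrow> 'a) set) right_mod"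
    using that by (auto simp: simple_finite_dim_def simple_infinite_dim_def unfaithful_fg_1_critical_def
        simple_module_def n_critical_def critical_def)
  show ?thesis
    unfolding assms(10)
  proof (intro conjI allI impI ballI irr disj cls critical_torsion_iff)
    show "bijection_onto_classes (set_F k) (\<lambda>f. cyclic_module (skew_poly_ring R \<alpha>) (F_ideal f))
       (simple_finite_dim k R (skew_poly_ring R \<alpha>)) (mod_iso (skew_poly_ring R \<alpha>))"
      by (rule bijection_onto_classesI)
        (use equiv_mod_iso mods F_module F_injective simple_finite_dim_classified in blast)+
    show "bijection_onto_classes (set_A R X) (\<lambda>c. cyclic_module (skew_poly_ring R \<alpha>) (right_ideal_gen (skew_poly_ring R \<alpha>) c))
       (unfaithful_fg_1_critical (skew_poly_ring R \<alpha>)) (mod_iso (skew_poly_ring R \<alpha>))"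
      by (rule bijection_onto_classesI)
        (use equiv_mod_iso mods A_module(1) A_injective unfaithful_classified in blast)+
    show "bijection_onto_classes_up_to_similarity (set_B R \<alpha> X)
       (\<lambda>c. cyclic_module (skew_poly_ring R \<alpha>) (right_ideal_gen (skew_poly_ring R \<alpha>) c))
       (simple_infinite_dim k R (skew_poly_ring R \<alpha>)) (mod_iso (skew_poly_ring R \<alpha>))"
      by (rule bijection_onto_classes_up_to_similarityI)
        (use equiv_mod_iso mods B_module simple_infinite_dim_classified in blast)+
    show "bijection_onto_classes_up_to_similarity (set_C k R \<alpha> X)
       (\<lambda>c. cyclic_module (skew_poly_ring R \<alpha>) (right_ideal_gen (skew_poly_ring R \<alpha>) c))
       (faithful_fg_1_critical (skew_poly_ring R \<alpha>)) (hull_similar (skew_poly_ring R \<alpha>))"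
      by (rule bijection_onto_classes_up_to_similarityI)
        (use equiv_hull_similar C_module faithful_classified in blast)+
  qed (use simple_finite_dim_classified unfaithful_classified simple_infinite_dim_classified
      faithful_classified in blast)+
qed

end
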